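(* Let $T>0$, $n,\nu\in\mathbb{N}^{\ast}$, and let $\eta:\mathbb{R}_+\to\mathbb{R}_+$ be an increasing function. Let $P$ and $Q=(Q^{\delta_n^l})_{l\in\mathbb{N}}$ be as in the context, and let $\alpha>0$, $\beta\in\mathbb{N}$. Assume that: (1) $P$ propagates regularity and dually propagates regularity; (2) the property $\overline{R}_{n,\nu,\eta}(Q)$ holds; (3) for every $k\in\mathbb{N}^{\ast}$ the short time estimate $E_n(k,\alpha,\beta,P,Q)$ and the dual short time estimate $E_n(k,\alpha,\beta,P,Q)^{\ast}$ hold. Then there is a constant $C$, not depending on $n$ or $f$, such that for every $f\in\mathcal{M}_b(\mathbb{R}^d)$, $$\Vert P_Tf-\hat{Q}^{\nu,\delta_n^0}_{0,T}f\Vert_\infty\leqslant\frac{C}{T(\nu)^{\eta(q_\nu)}}\,\Vert f\Vert_\infty\,\frac{1}{n^\nu},$$ where $P_T:=P_{0,T}$ and $T(\nu)=\inf\left\{t\in\pi^{\delta_n^1}:\ t\geqslant T\frac{n-m(0,\nu)}{n(m(0,\nu)+1)}\right\}$.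
   Context: **Function spaces.** $\mathbb{N}=\{0,1,2,\ldots\}$, $\mathbb{N}^{\ast}=\mathbb{N}\setminus\{0\}$, $d\in\mathbb{N}^{\ast}$. $\mathcal{M}_b(\mathbb{R}^d)$: bounded measurable functions $\mathbb{R}^d\to\mathbb{R}$. $\mathcal{C}_b^q(\mathbb{R}^d)$: functions having bounded derivatives up to order $q$ (order $0$ included). $\mathcal{C}_1^q(\mathbb{R}^d)$: functions having derivatives up to order $q$, all in $L_1(\mathbb{R}^d)$. $\mathcal{C}_c^q(\mathbb{R}^d)$: compactly supported functions having derivatives up to order $q$. $\Vert f\Vert_{r,\infty}=\sum_{|\gamma|\leqslant r}\Vert\partial_\gamma f\Vert_\infty$ and $\Vert f\Vert_{r,1}=\sum_{|\gamma|\leqslant r}\Vert\partial_\gamma f\Vert_{L_1}$. **Grids and discrete semigroups.** For $T>0$, $n\in\mathbb{N}^{\ast}$, $l\in\mathbb{N}$: $\delta_n^l=T/n^l$; for $\delta>0$: $\pi^\delta=\{k\delta:k\in\mathbb{N}\}$. Given finite positive transition measures $(\mu^\delta_t(x,dy))_{t\in\pi^\delta}$ on $\mathbb{R}^d$, measurable in $x$, with $\sup_{t\in\pi^\delta}\sup_x\mu^\delta_t(x,\mathbb{R}^d)<\infty$, write $\mu_t^\delta f(x)=\int f(y)\mu_t^\delta(x,dy)$; the associated discrete semigroup is $(Q^\delta_{s,t})_{s\leqslant t\in\pi^\delta}$ with $Q^\delta_{t,t}f=f$ and $Q^\delta_{t,t+(r+1)\delta}f=Q^\delta_{t,t+r\delta}\,\mu^\delta_{t+r\delta}f$,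 $r\in\mathbb{N}$, $f\in\mathcal{M}_b(\mathbb{R}^d)$. It satisfies $Q_{t,u}=Q_{t,s}Q_{s,u}$ for $t\leqslant s\leqslant u$. $P$ denotes a family of discrete semigroups $((P^\delta_{s,t})_{s\leqslant t\in\pi^\delta})_{\delta>0}$ that is grid independent: $P^\delta_{s,t}=P^{\bar\delta}_{s,t}=:P_{s,t}$ whenever $s,t\in\pi^\delta\cap\pi^{\bar\delta}$. $Q=(Q^{\delta_n^l})_{l\in\mathbb{N}}$ is a family of discrete semigroups, $Q^{\delta_n^l}$ living on $\pi^{\delta_n^l}$. The dual $Q^{\ast}$ of an operator $Q$ is taken with respect to the $L_2(\mathbb{R}^d)$ scalar product: $\int (Qg)f\,dx=\int g\,(Q^{\ast}f)\,dx$. **Constants.** In all hypotheses $C$ is a generic constant which may depend on $d,T,r,q,\nu,\alpha,\beta,\eta$ but not on $n$, $k$, the step of the grid, the times, or $f$. The constant in the conclusion depends only on these parameters and on the constants in the hypotheses. **Hypotheses.** - $P$ propagates regularity: for all $r\in\mathbb{N}$, $f\in\mathcal{C}_b^r(\mathbb{R}^d)$: $P_{s,t}f\in\mathcal{C}_b^r(\mathbb{R}^d)$ and $\sup_{t\geqslant s\geqslant0}\Vert P_{s,t}f\Vert_{r,\infty}\leqslant C\Vert f\Vert_{r,\infty}$. - $P$ dually propagates regularity: for all $r\in\mathbb{N}$, $f\in\mathcal{C}_1^r(\mathbb{R}^d)$: $P^{\ast}_{s,t}f\in\mathcal{C}_1^r(\mathbb{R}^d)$ and $\sup_{t\geqslant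 s\geqslant0}\Vert P^{\ast}_{s,t}f\Vert_{r,1}\leqslant C\Vert f\Vert_{r,1}$. - $E_n(k,\alpha,\beta,P,Q)$: for all $r\in\mathbb{N}$, $f\in\mathcal{C}_b^{\beta+r}(\mathbb{R}^d)$, $t\in\pi^{\delta_n^k}$: $\Vert P_{t,t+\delta_n^k}f-Q^{\delta_n^k}_{t,t+\delta_n^k}f\Vert_{r,\infty}\leqslant C\Vert f\Vert_{\beta+r,\infty}(\delta_n^k)^{\alpha+1}$. - $E_n(k,\alpha,\beta,P,Q)^{\ast}$: for all $r\in\mathbb{N}$, $f\in\mathcal{C}_1^{\beta+r}(\mathbb{R}^d)$, $t\in\pi^{\delta_n^k}$: $\Vert P^{\ast}_{t,t+\delta_n^k}f-Q^{\delta_n^k,\ast}_{t,t+\delta_n^k}f\Vert_{r,1}\leqslant C\Vert f\Vert_{\beta+r,1}(\delta_n^k)^{\alpha+1}$. - $R_{q,\eta}(Q^\delta)$, for a family of operators $(Q^\delta_{s,t})_{s<t\in\pi^\delta}$ (not necessarily a semigroup): (i) $Q^\delta_{s,t}f\in\mathcal{C}_b^\infty(\mathbb{R}^d)$ for all $f\in\mathcal{M}_b(\mathbb{R}^d)$ and $s<t$ in $\pi^\delta$; (ii) for all $r\in\mathbb{N}$ and multi-indices $\gamma$ with $|\gamma|+r\leqslant q$, all $f\in\mathcal{C}_c^\infty(\mathbb{R}^d)$ and $s<t$ in $\pi^\delta$: $\Vert Q^\delta_{s,t}\partial_\gamma f\Vert_{r,\infty}\leqslant\frac{C}{(t-s)^{\eta(q)}}\Vert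 f\Vert_\infty$. - $\overline{R}_{n,\nu,\eta}(Q)$: for every $k\in\mathbb{N}^{\ast}$: (i) for all $r\in\mathbb{N}$ and $s\leqslant t$ in $\pi^{\delta_n^k}$, $Q^{\delta_n^k}_{s,t}$ maps $\mathcal{C}_b^r(\mathbb{R}^d)$ into itself with $\Vert Q^{\delta_n^k}_{s,t}f\Vert_{r,\infty}\leqslant C\Vert f\Vert_{r,\infty}$, and $Q^{\delta_n^k,\ast}_{s,t}$ maps $\mathcal{C}_1^r(\mathbb{R}^d)$ into itself with $\Vert Q^{\delta_n^k,\ast}_{s,t}f\Vert_{r,1}\leqslant C\Vert f\Vert_{r,1}$; (ii) there is a family of operators $\overline{Q}^{\delta_n^k}=(\overline{Q}^{\delta_n^k}_{s,t})_{s<t\in\pi^{\delta_n^k}}$ (not necessarily a semigroup) satisfying $R_{q_\nu,\eta}(\overline{Q}^{\delta_n^k})$ and, for all $f\in\mathcal{M}_b(\mathbb{R}^d)$ and $s<t$ in $\pi^{\delta_n^k}$, $\Vert Q^{\delta_n^k}_{s,t}f-\overline{Q}^{\delta_n^k}_{s,t}f\Vert_\infty\leqslant C(t-s)^{-\eta(q_\nu)}\frac{\Vert f\Vert_\infty}{n^{\nu+m(0,\nu)}}$. **Parameters.** For $l\in\mathbb{N}$: $m(l,\nu)=\left\lceil\frac{\nu}{(1+\alpha)l+\alpha}\right\rceil$, $q_i(l,\nu)=\nu+\lceil i-(1+\alpha)(l+1)(i-1)\rceil$, and recursively $\kappa(l,\nu)=\max\left\{\beta m(l,\nu),\max_{1\leqslant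 i\leqslant m(l,\nu)-1}i\,\kappa(l+1,q_i(l,\nu))\right\}$ (only the first term when $m(l,\nu)=1$). Finally $q_\nu=\max_{i\in\{1,\ldots,m(0,\nu)\}}i\max(\beta,\kappa(1,q_i(0,\nu)))$, where the formula for $q_i$ is also used for $i=m(0,\nu)$. **The approximation $\hat Q$.** For $t\in\pi^{\delta_n^l}$, recursively $$\hat Q^{\nu,\delta_n^l}_{t,t+\delta_n^l}=Q^{\delta_n^{l+1}}_{t,t+\delta_n^l}+\sum_{i=1}^{m(l,\nu)-1}\hat I^{\delta_n^{l+1}}_{t,t+\delta_n^l,i},$$ $$\hat I^{\delta_n^{l+1}}_{t,t+\delta_n^l,i}=\sum_{\substack{t=t_0<t_1<\cdots<t_i\leqslant t+\delta_n^l\\ t_1,\ldots,t_i\in\pi^{\delta_n^{l+1}}}}\ \prod_{j=1}^i\left[Q^{\delta_n^{l+1}}_{t_{j-1},t_j-\delta_n^{l+1}}\left(\hat Q^{q_i(l,\nu),\delta_n^{l+1}}_{t_j-\delta_n^{l+1},t_j}-Q^{\delta_n^{l+1}}_{t_j-\delta_n^{l+1},t_j}\right)\right]Q^{\delta_n^{l+1}}_{t_i,t+\delta_n^l},$$ operator products being ordered from left to right in increasing $j$. The recursion terminates: when $m(l,\nu)=1$, $\hat Q^{\nu,\delta_n^l}_{t,t+\delta_n^l}=Q^{\delta_n^{l+1}}_{t,t+\delta_n^l}$. Since $\delta_n^0=T$, $\hat Q^{\nu,\delta_n^0}_{0,T}$ is defined. **Convention.** When $T(\nu)=0$ the right-hand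 side of the conclusion is understood as $+\infty$. *)

theory Defs
  imports "HOL-Analysis.Analysis"
begin

type_synonym 'd func = "real ^ 'd \<Rightarrow> real"
type_synonym 'd operator = "'d func \<Rightarrow> 'd func"


definition partial :: "'d \<Rightarrow> 'd::finite func \<Rightarrow> 'd func" where
  "partial i f = (\<lambda>x. frechet_derivative f (at x) (axis i 1))"

text \<open>All partial derivatives of order at most \<open>q\<close> exist and are continuous.\<close>

fun C_k :: "nat \<Rightarrow> 'd::finite func \<Rightarrow> bool" where
  "C_k 0 f \<longleftrightarrow> continuous_on UNIV f"
| "C_k (Suc q) f \<longleftrightarrow> (\<forall>x. f differentiable (at x)) \<and> (\<forall>i. C_k q (partial i f))"

text \<open>A multi-index is a map \<open>\<gamma> :: 'd \<Rightarrow> nat\<close>. The order in which the partial derivatives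
  of \<open>\<partial>\<^sub>\<gamma>\<close> are taken is irrelevant for the functions in the spaces below (Schwarz); since
  the index type \<open>'d\<close> carries no order, some enumeration of \<open>\<gamma>\<close> is chosen.\<close>

definition msize :: "('d::finite \<Rightarrow> nat) \<Rightarrow> nat" where
  "msize \<gamma> = (\<Sum>i\<in>UNIV. \<gamma> i)"

definition mpartial :: "('d::finite \<Rightarrow> nat) \<Rightarrow> 'd func \<Rightarrow> 'd func" where
  "mpartial \<gamma> f = foldr partial (SOME is. \<forall>i. count_list is i = \<gamma> i) f"

definition M_b :: "'d::finite func set" where
  "M_b = {f \<in> borel_measurable borel. bounded (range f)}"

definition C_b :: "nat \<Rightarrow> 'd::finite func set" where
  "C_b q = {f. C_k q f \<and> (\<forall>\<gamma>. msize \<gamma> \<le> q \<longrightarrow> bounded (range (mpartial \<gamma> f)))}"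

definition C_b_inf :: "'d::finite func set" where
  "C_b_inf = (\<Inter>q. C_b q)"

definition C_1 :: "nat \<Rightarrow> 'd::finite func set" where
  "C_1 q = {f. C_k q f \<and> (\<forall>\<gamma>. msize \<gamma> \<le> q \<longrightarrow> integrable lborel (mpartial \<gamma> f))}"

definition C_c_inf :: "'d::finite func set" where
  "C_c_inf = {f. (\<forall>q. C_k q f) \<and> compact (closure {x. f x \<noteq> 0})}"

definition sup_norm :: "'d::finite func \<Rightarrow> real" where
  "sup_norm f = (SUP x. \<bar>f x\<bar>)"

definition norm_inf :: "nat \<Rightarrow> 'd::finite func \<Rightarrow> real" where
  "norm_inf r f = (\<Sum>\<gamma> | msize \<gamma> \<le> r. sup_norm (mpartial \<gamma> f))"

definition norm_1 :: "nat \<Rightarrow> 'd::finite func \<Rightarrow> real" where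
  "norm_1 r f = (\<Sum>\<gamma> | msize \<gamma> \<le> r. \<integral>x. \<bar>mpartial \<gamma> f x\<bar> \<partial>lborel)"

text \<open>The two sums above are genuine finite sums.\<close>

lemma finite_msize_le: "finite {\<gamma> :: 'd::finite \<Rightarrow> nat. msize \<gamma> \<le> r}"
proof (rule finite_subset)
  have "\<gamma> i \<le> msize \<gamma>" for \<gamma> :: "'d \<Rightarrow> nat" and i
    unfolding msize_def by (rule member_le_sum) auto
  then show "{\<gamma> :: 'd \<Rightarrow> nat. msize \<gamma> \<le> r} \<subseteq> PiE UNIV (\<lambda>_. {..r})"
    by (auto intro: order_trans)
  show "finite (PiE (UNIV :: 'd set) (\<lambda>_. {..r}))"
    by (rule finite_PiE) auto
qed

definition linear_on_M_b :: "'d::finite operator \<Rightarrow> bool" where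
  "linear_on_M_b A \<longleftrightarrow> (\<forall>f\<in>M_b. \<forall>g\<in>M_b. \<forall>a b.
     A (\<lambda>x. a * f x + b * g x) = (\<lambda>x. a * A f x + b * A g x))"

text \<open>\<open>is_dual A f h\<close> says that \<open>h\<close> is (a version of) \<open>A\<^sup>*f\<close>. It determines \<open>h\<close> almost
  everywhere, hence uniquely among continuous functions.\<close>

definition is_dual :: "'d::finite operator \<Rightarrow> 'd func \<Rightarrow> 'd func \<Rightarrow> bool" where
  "is_dual A f h \<longleftrightarrow> integrable lborel h \<and>
     (\<forall>g\<in>M_b. (\<integral>x. A g x * f x \<partial>lborel) = (\<integral>x. g x * h x \<partial>lborel))"


definition step :: "real \<Rightarrow> nat \<Rightarrow> nat \<Rightarrow> real" where
  "step T n l = T / real n ^ l"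

definition grid :: "real \<Rightarrow> real set" where
  "grid \<delta> = {real k * \<delta> | k. True}"

definition transition_measures :: "real \<Rightarrow> (real \<Rightarrow> real ^ 'd::finite \<Rightarrow> (real ^ 'd) measure) \<Rightarrow> bool"
  where "transition_measures \<delta> \<mu> \<longleftrightarrow>
     (\<forall>t\<in>grid \<delta>. \<forall>x. sets (\<mu> t x) = sets borel \<and> finite_measure (\<mu> t x)) \<and>
     (\<forall>t\<in>grid \<delta>. \<forall>A\<in>sets borel. (\<lambda>x. emeasure (\<mu> t x) A) \<in> borel_measurable borel) \<and>
     (SUP t\<in>grid \<delta>. SUP x. emeasure (\<mu> t x) UNIV) < \<infinity>"

text \<open>Only the values \<open>Q s t f\<close> with \<open>s \<le> t\<close> on the grid and \<open>f \<in> M_b\<close> matter.\<close>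

definition discrete_semigroup :: "real \<Rightarrow> (real \<Rightarrow> real \<Rightarrow> 'd::finite operator) \<Rightarrow> bool" where
  "discrete_semigroup \<delta> Q \<longleftrightarrow> (\<exists>\<mu>. transition_measures \<delta> \<mu> \<and>
     (\<forall>t\<in>grid \<delta>. \<forall>f\<in>M_b. Q t t f = f \<and>
        (\<forall>r::nat. Q t (t + real (Suc r) * \<delta>) f =
           Q t (t + real r * \<delta>) (\<lambda>x. \<integral>y. f y \<partial>\<mu> (t + real r * \<delta>) x))))"

definition grid_independent :: "(real \<Rightarrow> real \<Rightarrow> real \<Rightarrow> 'd::finite operator) \<Rightarrow> bool" where
  "grid_independent P \<longleftrightarrow> (\<forall>\<delta>>0. \<forall>\<delta>'>0. \<forall>s\<in>grid \<delta> \<inter> grid \<delta>'. \<forall>t\<in>grid \<delta> \<inter> grid \<delta>'.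
     s \<le> t \<longrightarrow> (\<forall>f\<in>M_b. P \<delta> s t f = P \<delta>' s t f))"


definition m_par :: "real \<Rightarrow> nat \<Rightarrow> nat \<Rightarrow> nat" where
  "m_par \<alpha> l \<nu> = nat \<lceil>real \<nu> / ((1 + \<alpha>) * real l + \<alpha>)\<rceil>"

text \<open>For \<open>1 \<le> i \<le> m_par \<alpha> l \<nu>\<close> the integer inside \<open>nat\<close> is positive.\<close>

definition q_par :: "real \<Rightarrow> nat \<Rightarrow> nat \<Rightarrow> nat \<Rightarrow> nat" where
  "q_par \<alpha> i l \<nu> = nat (int \<nu> + \<lceil>real i - (1 + \<alpha>) * (real l + 1) * (real i - 1)\<rceil>)"

definition rec_measure :: "real \<Rightarrow> nat \<Rightarrow> nat \<Rightarrow> nat" where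
  "rec_measure \<alpha> l \<nu> = nat \<lceil>(real \<nu> - (1 + \<alpha>) * real l) / \<alpha>\<rceil>"

lemma rec_measure_decreases:
  assumes \<alpha>: "\<alpha> > 0" and m: "m_par \<alpha> l \<nu> > 1" and i: "i \<ge> 1"
  shows "rec_measure \<alpha> (Suc l) (q_par \<alpha> i l \<nu>) < rec_measure \<alpha> l \<nu>"
proof -
  define X where "X = (real \<nu> - (1 + \<alpha>) * real l) / \<alpha>"
  define Y where "Y = (real (q_par \<alpha> i l \<nu>) - (1 + \<alpha>) * real (Suc l)) / \<alpha>"
  have pos: "(1 + \<alpha>) * real l + \<alpha> > 0" using \<alpha> by (simp add: add_nonneg_pos)
  have "\<lceil>real \<nu> / ((1 + \<alpha>) * real l + \<alpha>)\<rceil> > 1" using m unfolding m_par_def by linarith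
  then have "real \<nu> / ((1 + \<alpha>) * real l + \<alpha>) > 1" by linarith
  then have "real \<nu> > (1 + \<alpha>) * real l + \<alpha>" using pos by (simp add: field_simps)
  then have X1: "X > 1" unfolding X_def using \<alpha> by (simp add: field_simps)
  have "(1 + \<alpha>) * (real l + 1) * (real i - 1) \<ge> 1 * (real i - 1)"
  proof (rule mult_right_mono)
    have "(1 + \<alpha>) * (real l + 1) = 1 + (real l + \<alpha> * real l + \<alpha>)" by (simp add: algebra_simps)
    then show "(1 + \<alpha>) * (real l + 1) \<ge> 1" using \<alpha> by simp
  qed (use i in simp)
  then have "\<lceil>real i - (1 + \<alpha>) * (real l + 1) * (real i - 1)\<rceil> \<le> 1" by (simp add: ceiling_le_iff)
  then have "real (q_par \<alpha> i l \<nu>) \<le> real \<nu> + 1" unfolding q_par_def by linarith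
  then have "Y \<le> (real \<nu> + 1 - (1 + \<alpha>) * real (Suc l)) / \<alpha>"
    unfolding Y_def using \<alpha> by (intro divide_right_mono) auto
  also have "\<dots> = X - 1" unfolding X_def using \<alpha> by (simp add: field_simps)
  finally have "\<lceil>Y\<rceil> \<le> \<lceil>X\<rceil> - 1" by linarith
  moreover have "\<lceil>X\<rceil> > 1" using X1 by linarith
  ultimately have "nat \<lceil>Y\<rceil> < nat \<lceil>X\<rceil>" by linarith
  then show ?thesis unfolding rec_measure_def X_def Y_def .
qed

text \<open>The recursions below terminate only for \<open>\<alpha> > 0\<close>, hence the guard \<open>\<alpha> \<le> 0\<close>, which makes
  the functions total.\<close>

function kappa :: "real \<Rightarrow> nat \<Rightarrow> nat \<Rightarrow> nat \<Rightarrow> nat" where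
  "kappa \<alpha> \<beta> l \<nu> =
     (if \<alpha> \<le> 0 \<or> m_par \<alpha> l \<nu> \<le> 1 then \<beta> * m_par \<alpha> l \<nu>
      else max (\<beta> * m_par \<alpha> l \<nu>)
             (Max ((\<lambda>i. i * kappa \<alpha> \<beta> (Suc l) (q_par \<alpha> i l \<nu>)) ` {1..m_par \<alpha> l \<nu> - 1})))"
  by pat_completeness auto
termination
  by (relation "Wellfounded.measure (\<lambda>(\<alpha>, \<beta>, l, \<nu>). rec_measure \<alpha> l \<nu>)")
     (auto intro!: rec_measure_decreases)

declare kappa.simps [simp del]

definition q_nu :: "real \<Rightarrow> nat \<Rightarrow> nat \<Rightarrow> nat" where
  "q_nu \<alpha> \<beta> \<nu> =
     Max ((\<lambda>i. i * max \<beta> (kappa \<alpha> \<beta> 1 (q_par \<alpha> i 0 \<nu>))) ` {1..m_par \<alpha> 0 \<nu>})"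

definition T_nu :: "real \<Rightarrow> nat \<Rightarrow> real \<Rightarrow> nat \<Rightarrow> real" where
  "T_nu T n \<alpha> \<nu> = Inf {t \<in> grid (step T n 1).
     t \<ge> T * (real n - real (m_par \<alpha> 0 \<nu>)) / (real n * (real (m_par \<alpha> 0 \<nu>) + 1))}"


text \<open>With \<open>ts = [t\<^sub>1, \<dots>, t\<^sub>i]\<close> and \<open>s = t\<^sub>0\<close>, \<open>op_chain \<delta> Q D u s ts\<close> is the operator product
  \<open>(Q t\<^sub>0 (t\<^sub>1 - \<delta>) D(t\<^sub>1 - \<delta>)) \<cdots> (Q t\<^sub>i\<^sub>-\<^sub>1 (t\<^sub>i - \<delta>) D(t\<^sub>i - \<delta>)) (Q t\<^sub>i u)\<close>; here \<open>D s\<close> is the one-step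
  difference on \<open>[s, s + \<delta>]\<close>.\<close>

fun op_chain :: "real \<Rightarrow> (real \<Rightarrow> real \<Rightarrow> 'd::finite operator) \<Rightarrow> (real \<Rightarrow> 'd operator) \<Rightarrow>
    real \<Rightarrow> real \<Rightarrow> real list \<Rightarrow> 'd operator" where
  "op_chain \<delta> Q D u s [] = Q s u"
| "op_chain \<delta> Q D u s (t # ts) = Q s (t - \<delta>) \<circ> D (t - \<delta>) \<circ> op_chain \<delta> Q D u t ts"

definition time_chains :: "real \<Rightarrow> real \<Rightarrow> real \<Rightarrow> nat \<Rightarrow> real list set" where
  "time_chains \<delta> t u i =
     {ts. length ts = i \<and> sorted_wrt (<) ts \<and> set ts \<subseteq> {s \<in> grid \<delta>. t < s \<and> s \<le> u}}"

text \<open>\<open>Q l\<close> is the semigroup on the grid of step \<open>T / n\<^sup>l\<close>, and \<open>Qhat T n \<alpha> Q l \<nu> t\<close> is the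
  approximation of order \<open>\<nu>\<close> on the single step from \<open>t\<close> to \<open>t + T / n\<^sup>l\<close>.\<close>

function Qhat :: "real \<Rightarrow> nat \<Rightarrow> real \<Rightarrow> (nat \<Rightarrow> real \<Rightarrow> real \<Rightarrow> 'd::finite operator) \<Rightarrow>
    nat \<Rightarrow> nat \<Rightarrow> real \<Rightarrow> 'd operator" where
  "Qhat T n \<alpha> Q l \<nu> =
     (if \<alpha> \<le> 0 \<or> m_par \<alpha> l \<nu> \<le> 1 then (\<lambda>t. Q (Suc l) t (t + step T n l))
      else (\<lambda>t f x. Q (Suc l) t (t + step T n l) f x +
        (\<Sum>i = 1..m_par \<alpha> l \<nu> - 1. \<Sum>ts\<in>time_chains (step T n (Suc l)) t (t + step T n l) i.
           op_chain (step T n (Suc l)) (Q (Suc l))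
             (\<lambda>s g y. Qhat T n \<alpha> Q (Suc l) (q_par \<alpha> i l \<nu>) s g y
                      - Q (Suc l) s (s + step T n (Suc l)) g y)
             (t + step T n l) t ts f x)))"
  by pat_completeness auto
termination
  by (relation "Wellfounded.measure (\<lambda>(T, n, \<alpha>, Q, l, \<nu>). rec_measure \<alpha> l \<nu>)")
     (auto intro!: rec_measure_decreases)

declare Qhat.simps [simp del]


text \<open>In each property \<open>K r\<close> is the constant for the regularity index \<open>r\<close>.\<close>

definition propagates_regularity ::
    "(nat \<Rightarrow> real) \<Rightarrow> (real \<Rightarrow> real \<Rightarrow> real \<Rightarrow> 'd::finite operator) \<Rightarrow> bool" where
  "propagates_regularity K P \<longleftrightarrow> (\<forall>r. \<forall>f\<in>C_b r. \<forall>\<delta>>0. \<forall>s\<in>grid \<delta>. \<forall>t\<in>grid \<delta>. s \<le> t \<longrightarrow>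
     P \<delta> s t f \<in> C_b r \<and> norm_inf r (P \<delta> s t f) \<le> K r * norm_inf r f)"

definition dually_propagates_regularity ::
    "(nat \<Rightarrow> real) \<Rightarrow> (real \<Rightarrow> real \<Rightarrow> real \<Rightarrow> 'd::finite operator) \<Rightarrow> bool" where
  "dually_propagates_regularity K P \<longleftrightarrow>
     (\<forall>r. \<forall>f\<in>C_1 r. \<forall>\<delta>>0. \<forall>s\<in>grid \<delta>. \<forall>t\<in>grid \<delta>. s \<le> t \<longrightarrow>
       (\<exists>h\<in>C_1 r. is_dual (P \<delta> s t) f h \<and> norm_1 r h \<le> K r * norm_1 r f))"

definition short_time_estimate :: "(nat \<Rightarrow> real) \<Rightarrow> real \<Rightarrow> real \<Rightarrow> nat \<Rightarrow>
    (real \<Rightarrow> real \<Rightarrow> 'd::finite operator) \<Rightarrow> (real \<Rightarrow> real \<Rightarrow> 'd operator) \<Rightarrow> bool" where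
  "short_time_estimate K \<delta> \<alpha> \<beta> P Q \<longleftrightarrow> (\<forall>r. \<forall>f\<in>C_b (\<beta> + r). \<forall>t\<in>grid \<delta>.
     norm_inf r (\<lambda>x. P t (t + \<delta>) f x - Q t (t + \<delta>) f x)
       \<le> K r * norm_inf (\<beta> + r) f * \<delta> powr (\<alpha> + 1))"

definition dual_short_time_estimate :: "(nat \<Rightarrow> real) \<Rightarrow> real \<Rightarrow> real \<Rightarrow> nat \<Rightarrow>
    (real \<Rightarrow> real \<Rightarrow> 'd::finite operator) \<Rightarrow> (real \<Rightarrow> real \<Rightarrow> 'd operator) \<Rightarrow> bool" where
  "dual_short_time_estimate K \<delta> \<alpha> \<beta> P Q \<longleftrightarrow> (\<forall>r. \<forall>f\<in>C_1 (\<beta> + r). \<forall>t\<in>grid \<delta>.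
     \<exists>h\<in>C_1 r. \<exists>h'\<in>C_1 r. is_dual (P t (t + \<delta>)) f h \<and> is_dual (Q t (t + \<delta>)) f h' \<and>
       norm_1 r (\<lambda>x. h x - h' x) \<le> K r * norm_1 (\<beta> + r) f * \<delta> powr (\<alpha> + 1))"

definition regularization :: "(nat \<Rightarrow> real) \<Rightarrow> real \<Rightarrow> nat \<Rightarrow> (real \<Rightarrow> real) \<Rightarrow>
    (real \<Rightarrow> real \<Rightarrow> 'd::finite operator) \<Rightarrow> bool" where
  "regularization K \<delta> q \<eta> Q \<longleftrightarrow> (\<forall>s\<in>grid \<delta>. \<forall>t\<in>grid \<delta>. s < t \<longrightarrow>
     (\<forall>f\<in>M_b. Q s t f \<in> C_b_inf) \<and>
     (\<forall>r \<gamma>. msize \<gamma> + r \<le> q \<longrightarrow> (\<forall>f\<in>C_c_inf.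
        norm_inf r (Q s t (mpartial \<gamma> f)) \<le> K r / (t - s) powr \<eta> (real q) * sup_norm f)))"

text \<open>\<open>\<alpha>\<close> and \<open>\<beta>\<close> enter through \<open>m(0, \<nu>)\<close> and \<open>q\<^sub>\<nu>\<close>; \<open>c\<close> is the constant of the comparison
  of \<open>Q\<close> with the regularizing family. The operators of that family are linear on \<open>M_b\<close>, but
  need not come from measures or form a semigroup.\<close>

definition R_bar :: "(nat \<Rightarrow> real) \<Rightarrow> real \<Rightarrow> real \<Rightarrow> nat \<Rightarrow> nat \<Rightarrow> (real \<Rightarrow> real) \<Rightarrow>
    real \<Rightarrow> nat \<Rightarrow> (nat \<Rightarrow> real \<Rightarrow> real \<Rightarrow> 'd::finite operator) \<Rightarrow> bool" where
  "R_bar K c T n \<nu> \<eta> \<alpha> \<beta> Q \<longleftrightarrow> (\<forall>k\<ge>1. let \<delta> = step T n k; q = q_nu \<alpha> \<beta> \<nu> in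
     (\<forall>r. \<forall>s\<in>grid \<delta>. \<forall>t\<in>grid \<delta>. s \<le> t \<longrightarrow>
        (\<forall>f\<in>C_b r. Q k s t f \<in> C_b r \<and> norm_inf r (Q k s t f) \<le> K r * norm_inf r f) \<and>
        (\<forall>f\<in>C_1 r. \<exists>h\<in>C_1 r. is_dual (Q k s t) f h \<and> norm_1 r h \<le> K r * norm_1 r f)) \<and>
     (\<exists>Qbar. (\<forall>s\<in>grid \<delta>. \<forall>t\<in>grid \<delta>. s < t \<longrightarrow> linear_on_M_b (Qbar s t)) \<and>
        regularization K \<delta> q \<eta> Qbar \<and>
        (\<forall>f\<in>M_b. \<forall>s\<in>grid \<delta>. \<forall>t\<in>grid \<delta>. s < t \<longrightarrow>
           sup_norm (\<lambda>x. Q k s t f x - Qbar s t f x)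
             \<le> c * (t - s) powr (- \<eta> (real q)) * (sup_norm f / real n ^ (\<nu> + m_par \<alpha> 0 \<nu>)))))"

end

theory Submission imports Defs begin

text \<open>With \<open>\<delta>\<close> the step of the next finer grid and \<open>\<Delta>\<^sub>s = P\<^sub>s\<^sub>,\<^sub>s\<^sub>+\<^sub>\<delta> - Q\<^sub>s\<^sub>,\<^sub>s\<^sub>+\<^sub>\<delta>\<close>, the semigroup \<open>P\<close> is a sum over
  chains of times of products of operators \<open>Q\<close> and fewer than \<open>m\<close> differences \<open>\<Delta>\<close>, plus a remainder made of the
  chains with \<open>m\<close> differences, in which the last factor is \<open>P\<close> (\<open>duhamel_expansion\<close>). The approximation is the
  same sum without the remainder, with each \<open>\<Delta>\<close> replaced by its own approximation of order \<open>q\<^sub>i\<close> one level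
  further down. Hence the error is a sum of chains in which some factor is the error of that inner approximation,
  and of the remainder (\<open>Qhat_error_expansion\<close>). A factor \<open>\<Delta>\<close> gains \<open>n\<close> to the power \<open>-(1 + \<alpha>)(l + 1)\<close> and
  costs \<open>\<beta>\<close> derivatives; an inner error gains \<open>n\<close> to the power \<open>-q\<^sub>i\<close> and costs \<open>\<kappa>(l + 1, q\<^sub>i)\<close> derivatives; there
  are at most \<open>n\<^sup>i\<close> chains with \<open>i\<close> times. The parameters are such that each sum is of order \<open>n\<close> to the power
  \<open>-\<nu>\<close> (\<open>powr_chain_exponent\<close>, \<open>powr_remainder_exponent\<close>), and induction along the recursion bounds the error
  by that order at the cost of \<open>\<kappa>(l, \<nu>)\<close> derivatives (\<open>level_bound_exists\<close>).

  At the coarsest level the lost derivatives have to be recovered, because \<open>f\<close> is only bounded. A chain with at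
  most \<open>m\<close> times leaves a gap of length about \<open>T / (2 (m + 1))\<close> in \<open>[0, T]\<close>. What is lost to the left of
  the gap is charged to the functional that evaluates the result (\<open>order_functional\<close>), what is lost to the right of it
  is moved by duality to the test function that the result is paired with (\<open>weak_bounded\<close>). Both
  losses together are at most \<open>q\<^sub>\<nu>\<close> derivatives, and the regularising family absorbs that many on
  the gap (\<open>gchain_regularised\<close>, \<open>gchain_diff_regularised\<close>).

  On the gap \<open>Q\<close> is only close to a regularising operator. The difference of the two meets the rest of
  the chain as an operator on bounded functions, and there the factors that contain the inner
  approximation are merely bounded by some power \<open>n\<^sup>N\<close>, with \<open>N\<close> produced by the recursion. One factor
  of a fixed negative order does not outweigh this. Therefore the gap is cut into \<open>p + 1\<close> pieces. On
  each of them \<open>Q\<close> preceded by a mollification is a smoothing operator up to an error of order \<open>1 / n\<close>,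
  and such errors multiply in a composition (\<open>approx_smoothing_comp\<close>). So the whole gap has an error of order
  \<open>1 / n\<close> to the power \<open>p + 1\<close>, where \<open>p\<close> is free (\<open>gap_regularised\<close>). If the gap is the last one in the remainder, it
  carries \<open>P\<close> in place of \<open>Q\<close>; there \<open>P\<close> is the limit of the operators \<open>Q\<close> on finer and finer
  grids (\<open>Q_tendsto_P\<close>).

  All this concerns smooth \<open>f\<close> with compact support, but with the supremum norm of \<open>f\<close> on the right. Since
  \<open>P\<close>, \<open>Q\<close> and the approximation are built from integrals, they are continuous under bounded pointwise convergence, and
  the bound extends to bounded measurable \<open>f\<close> (\<open>mb_functional_bound_extend_smooth\<close>). Small \<open>n\<close> are covered by
  the crude bound \<open>n\<^sup>N\<close>. Finally \<open>T(\<nu>) \<le> T\<close>, so an error bound by a constant times \<open>1 / n\<^sup>\<nu>\<close> is enough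
  (\<open>error_bound\<close>).\<close>

section \<open>Iterated partial derivatives and the function spaces\<close>

lemma partial_eqI: "(f has_derivative D) (at x) \<Longrightarrow> partial i f x = D (axis i 1)"
  unfolding partial_def by (metis frechet_derivative_at)

lemma has_derivative_partials:
  fixes f :: "'d::finite func"
  assumes "f differentiable (at x)"
  shows "(f has_derivative (\<lambda>h. \<Sum>i\<in>UNIV. h $ i * partial i f x)) (at x)"
proof -
  let ?D = "frechet_derivative f (at x)"
  have D: "(f has_derivative ?D) (at x)"
    using assms frechet_derivative_works by blast
  then have lin: "linear ?D"
    using has_derivative_linear by blast
  have "?D h = (\<Sum>i\<in>UNIV. h $ i * partial i f x)" for h
  proof -
    have "?D h = ?D (\<Sum>i\<in>UNIV. h $ i *\<^sub>R axis i 1)"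
      using basis_expansion[of h] by (simp add: scalar_mult_eq_scaleR)
    also have "\<dots> = (\<Sum>i\<in>UNIV. h $ i * ?D (axis i 1))"
      by (simp add: linear_sum[OF lin] linear_scale[OF lin])
    finally show ?thesis by (simp add: partial_def)
  qed
  then have "?D = (\<lambda>h. \<Sum>i\<in>UNIV. h $ i * partial i f x)" by blast
  with D show ?thesis by simp
qed

lemma partial_lincomb:
  fixes f g :: "'d::finite func"
  assumes "\<And>x. f differentiable (at x)" "\<And>x. g differentiable (at x)"
  shows "partial i (\<lambda>x. a * f x + b * g x) = (\<lambda>x. a * partial i f x + b * partial i g x)"
proof
  fix x
  have "((\<lambda>x. a * f x + b * g x) has_derivative
      (\<lambda>h. a * frechet_derivative f (at x) h + b * frechet_derivative g (at x) h)) (at x)"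
    using assms[of x] unfolding frechet_derivative_works
    by (auto intro!: derivative_eq_intros)
  from partial_eqI[OF this]
  show "partial i (\<lambda>x. a * f x + b * g x) x = a * partial i f x + b * partial i g x"
    by (simp add: partial_def)
qed

lemma C_k_lincomb:
  assumes "C_k q f" "C_k q g"
  shows "C_k q (\<lambda>x. a * f x + b * g x)"
  using assms
proof (induction q arbitrary: f g)
  case 0
  then show ?case by (auto intro!: continuous_intros)
next
  case (Suc q)
  then show ?case
    using partial_lincomb[of f g _ a b] by (auto intro!: derivative_intros)
qed

lemma C_k_zero: "C_k q (\<lambda>x. 0)"
proof (induction q)
  case (Suc q)
  have "partial i (\<lambda>x. 0 :: real) = (\<lambda>x. 0)" for i :: 'a
    by (intro ext partial_eqI[where D = "\<lambda>_. 0", simplified]) simp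
  with Suc show ?case by simp
qed auto

lemma C_k_SucD: "C_k (Suc q) f \<Longrightarrow> C_k q f"
proof (induction q arbitrary: f)
  case 0
  then show ?case
    by (auto intro!: continuous_at_imp_continuous_on differentiable_imp_continuous_within)
qed auto

lemma C_k_mono: "C_k q f \<Longrightarrow> p \<le> q \<Longrightarrow> C_k p f"
proof (induction "q - p" arbitrary: q)
  case (Suc d)
  then obtain q' where q: "q = Suc q'" by (cases q) auto
  with Suc have "C_k q' f" using C_k_SucD by blast
  with Suc q show ?case by (metis diff_Suc_Suc Suc_diff_le diff_Suc_1 le_SucE diff_self_eq_0 old.nat.distinct(1))
qed auto

lemma C_k_continuous: "C_k q f \<Longrightarrow> continuous_on UNIV f"
  using C_k_mono[of q f 0] by simp

lemma C_k_foldr_partial: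
  "C_k q f \<Longrightarrow> length is \<le> q \<Longrightarrow> C_k (q - length is) (foldr partial is f)"
proof (induction "is")
  case (Cons i "is")
  then have "C_k (q - length is) (foldr partial is f)" by simp
  moreover have "q - length is = Suc (q - length (i # is))" using Cons.prems by simp
  ultimately show ?case by (metis C_k.simps(2) comp_apply foldr_Cons)
qed auto

lemma foldr_partial_lincomb:
  assumes "C_k q f" "C_k q g" "length is \<le> q"
  shows "foldr partial is (\<lambda>x. a * f x + b * g x)
    = (\<lambda>x. a * foldr partial is f x + b * foldr partial is g x)"
  using assms(3)
proof (induction "is")
  case (Cons i "is")
  have "length is \<le> q" using Cons.prems by simp
  then have "C_k (q - length is) (foldr partial is f)" "C_k (q - length is) (foldr partial is g)"
    using C_k_foldr_partial assms(1,2) by blast+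
  moreover have "q - length is = Suc (q - length (i # is))" using Cons.prems by simp
  ultimately have "\<And>x. foldr partial is f differentiable (at x)"
    "\<And>x. foldr partial is g differentiable (at x)" by (metis C_k.simps(2))+
  from partial_lincomb[OF this] Cons show ?case by simp
qed auto

text \<open>One and the same enumeration of \<open>\<gamma>\<close> serves all functions, so that properties of iterated partial derivatives pass to
  \<open>mpartial \<gamma>\<close> by induction over lists.\<close>

lemma mpartial_obtain:
  fixes \<gamma> :: "'d::finite \<Rightarrow> nat"
  obtains "is" where "length is = msize \<gamma>" "\<And>f. mpartial \<gamma> f = foldr partial is f"
proof -
  define xs where "xs = (SOME is. \<forall>i. count_list is i = \<gamma> i)"
  obtain ys where ys: "mset ys = (\<Sum>i\<in>UNIV. replicate_mset (\<gamma> i) i)"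
    using ex_mset by blast
  have "count_list ys i = \<gamma> i" for i
  proof -
    have "count_list ys i = count (mset ys) i" by (simp add: count_mset)
    also have "\<dots> = (\<Sum>j\<in>UNIV. if j = i then \<gamma> j else 0)"
      unfolding ys by (simp add: count_sum if_distrib)
    finally show ?thesis by simp
  qed
  then have "\<exists>is. \<forall>i. count_list is i = \<gamma> i" by blast
  then have xs: "\<forall>i. count_list xs i = \<gamma> i" unfolding xs_def by (rule someI_ex)
  have "msize \<gamma> = sum (count_list xs) UNIV" using xs by (simp add: msize_def)
  also have "\<dots> = length xs" by (rule sum_count_set) auto
  finally show thesis using that[of xs] by (simp add: mpartial_def xs_def)
qed

lemma mpartial_msize_0: "msize \<gamma> = 0 \<Longrightarrow> mpartial \<gamma> f = f"
proof -
  assume z: "msize \<gamma> = 0"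
  obtain "is" where "length is = msize \<gamma>" "mpartial \<gamma> f = foldr partial is f"
    using mpartial_obtain[of \<gamma>] by blast
  with z show ?thesis by simp
qed

lemma msize_le_0: "{\<gamma> :: 'd::finite \<Rightarrow> nat. msize \<gamma> \<le> 0} = {\<lambda>_. 0}"
  by (auto simp: msize_def)

lemma mpartial_lincomb:
  assumes "C_k q f" "C_k q g" "msize \<gamma> \<le> q"
  shows "mpartial \<gamma> (\<lambda>x. a * f x + b * g x) = (\<lambda>x. a * mpartial \<gamma> f x + b * mpartial \<gamma> g x)"
proof -
  obtain "is" where "length is = msize \<gamma>" "\<And>f. mpartial \<gamma> f = foldr partial is f"
    using mpartial_obtain[of \<gamma>] by blast
  with assms show ?thesis by (simp add: foldr_partial_lincomb)
qed

lemma C_k_mpartial: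
  assumes "C_k q f" "msize \<gamma> \<le> q"
  shows "C_k (q - msize \<gamma>) (mpartial \<gamma> f)"
proof -
  obtain "is" where "length is = msize \<gamma>" "\<And>f. mpartial \<gamma> f = foldr partial is f"
    using mpartial_obtain[of \<gamma>] by blast
  with assms show ?thesis using C_k_foldr_partial[of q f "is"] by simp
qed

lemma continuous_mpartial:
  "C_k q f \<Longrightarrow> msize \<gamma> \<le> q \<Longrightarrow> continuous_on UNIV (mpartial \<gamma> f)"
  using C_k_mpartial C_k_continuous by blast

subsection \<open>The supremum norm and the scale of bounded functions\<close>

lemma bounded_range_iff: "bounded (range (f :: 'a \<Rightarrow> real)) \<longleftrightarrow> (\<exists>B. \<forall>x. \<bar>f x\<bar> \<le> B)"
  by (auto simp: bounded_iff)

lemma abs_le_sup_norm: "bounded (range f) \<Longrightarrow> \<bar>f x\<bar> \<le> sup_norm f"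
  unfolding sup_norm_def bounded_range_iff
  by (rule cSUP_upper) (auto simp: bdd_above_def)

lemma sup_norm_le: "(\<And>x. \<bar>f x\<bar> \<le> B) \<Longrightarrow> sup_norm f \<le> B"
  unfolding sup_norm_def by (rule cSUP_least) auto

lemma sup_norm_nonneg: "bounded (range f) \<Longrightarrow> 0 \<le> sup_norm f"
  using abs_le_sup_norm[of f undefined] by linarith

lemma bounded_lincomb:
  assumes "bounded (range f)" "bounded (range g)"
  shows "bounded (range (\<lambda>x. a * f x + b * g x :: real))"
proof -
  obtain A B where "\<And>x. \<bar>f x\<bar> \<le> A" "\<And>x. \<bar>g x\<bar> \<le> B" using assms unfolding bounded_range_iff by auto
  then have "\<bar>a\<bar> * \<bar>f x\<bar> + \<bar>b\<bar> * \<bar>g x\<bar> \<le> \<bar>a\<bar> * A + \<bar>b\<bar> * B" for x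
    by (intro add_mono mult_left_mono) auto
  then have "\<bar>a * f x + b * g x\<bar> \<le> \<bar>a\<bar> * A + \<bar>b\<bar> * B" for x
    using abs_triangle_ineq[of "a * f x" "b * g x"] unfolding abs_mult
    by (meson order_trans)
  then show ?thesis unfolding bounded_range_iff by blast
qed

lemma sup_norm_lincomb:
  assumes "bounded (range f)" "bounded (range g)"
  shows "sup_norm (\<lambda>x. a * f x + b * g x) \<le> \<bar>a\<bar> * sup_norm f + \<bar>b\<bar> * sup_norm g"
proof (rule sup_norm_le)
  fix x
  have "\<bar>a * f x + b * g x\<bar> \<le> \<bar>a\<bar> * \<bar>f x\<bar> + \<bar>b\<bar> * \<bar>g x\<bar>"
    by (metis abs_mult abs_triangle_ineq)
  also have "\<dots> \<le> \<bar>a\<bar> * sup_norm f + \<bar>b\<bar> * sup_norm g"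
    using assms abs_le_sup_norm by (intro add_mono mult_left_mono) auto
  finally show "\<bar>a * f x + b * g x\<bar> \<le> \<bar>a\<bar> * sup_norm f + \<bar>b\<bar> * sup_norm g" .
qed

lemma M_b_D: "f \<in> M_b \<Longrightarrow> f \<in> borel_measurable borel" "f \<in> M_b \<Longrightarrow> bounded (range f)"
  by (auto simp: M_b_def)

lemma M_b_I: "f \<in> borel_measurable borel \<Longrightarrow> (\<And>x. \<bar>f x\<bar> \<le> B) \<Longrightarrow> f \<in> M_b"
  by (auto simp: M_b_def bounded_range_iff)

lemma M_b_abs_le: "f \<in> M_b \<Longrightarrow> \<bar>f x\<bar> \<le> sup_norm f"
  using M_b_D abs_le_sup_norm by blast

lemma M_b_sup_norm_nonneg: "f \<in> M_b \<Longrightarrow> 0 \<le> sup_norm f"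
  using M_b_D sup_norm_nonneg by blast

lemma M_b_lincomb: "f \<in> M_b \<Longrightarrow> g \<in> M_b \<Longrightarrow> (\<lambda>x. a * f x + b * g x) \<in> M_b"
  using bounded_lincomb unfolding M_b_def by (auto intro!: borel_measurable_add borel_measurable_times)

lemma M_b_add: "f \<in> M_b \<Longrightarrow> g \<in> M_b \<Longrightarrow> (\<lambda>x. f x + g x) \<in> M_b"
  using M_b_lincomb[of f g 1 1] by simp

lemma M_b_diff: "f \<in> M_b \<Longrightarrow> g \<in> M_b \<Longrightarrow> (\<lambda>x. f x - g x) \<in> M_b"
  using M_b_lincomb[of f g 1 "-1"] by simp

lemma M_b_zero: "(\<lambda>x. 0) \<in> M_b"
  by (rule M_b_I[where B = 0]) auto

lemma M_b_continuousI: "continuous_on UNIV f \<Longrightarrow> (\<And>x. \<bar>f x\<bar> \<le> B) \<Longrightarrow> f \<in> M_b"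
  by (rule M_b_I) (auto intro: borel_measurable_continuous_onI)

lemma C_b_0_iff: "f \<in> C_b 0 \<longleftrightarrow> continuous_on UNIV f \<and> bounded (range f)"
proof -
  have "msize \<gamma> \<le> 0 \<Longrightarrow> mpartial \<gamma> f = f" for \<gamma> using mpartial_msize_0 by auto
  moreover have "msize (\<lambda>_ :: 'a. 0) = 0" by (simp add: msize_def)
  ultimately show ?thesis unfolding C_b_def by (auto simp: mpartial_msize_0)
qed

lemma mpartial_zero: "mpartial (\<lambda>_. 0) f = f"
  by (rule mpartial_msize_0) (simp add: msize_def)

lemma norm_inf_0: "norm_inf 0 f = sup_norm f"
  unfolding norm_inf_def msize_le_0 by (simp only: sum.insert finite.emptyI empty_iff
      not_False_eq_True sum.empty mpartial_zero add_0_right simp_thms)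

lemma norm_inf_nonneg: "f \<in> C_b q \<Longrightarrow> 0 \<le> norm_inf q f"
  unfolding norm_inf_def C_b_def by (rule sum_nonneg, rule sup_norm_nonneg) blast

lemma C_b_mono: "f \<in> C_b q \<Longrightarrow> p \<le> q \<Longrightarrow> f \<in> C_b p"
  using C_k_mono le_trans unfolding C_b_def by blast

lemma C_b_subset_M_b: "f \<in> C_b q \<Longrightarrow> f \<in> M_b"
  using C_b_mono[of f q 0] unfolding C_b_0_iff M_b_def
  by (auto intro: borel_measurable_continuous_onI)

lemma norm_inf_mono:
  assumes "f \<in> C_b q" "p \<le> q"
  shows "norm_inf p f \<le> norm_inf q f"
  unfolding norm_inf_def using assms
  by (intro sum_mono2 finite_msize_le) (auto simp: C_b_def intro!: sup_norm_nonneg)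

lemma C_b_lincomb:
  assumes "f \<in> C_b q" "g \<in> C_b q"
  shows "(\<lambda>x. a * f x + b * g x) \<in> C_b q"
  using assms C_k_lincomb[of q f g]
  by (auto simp: C_b_def mpartial_lincomb intro!: bounded_lincomb)

lemma norm_inf_lincomb:
  assumes "f \<in> C_b q" "g \<in> C_b q"
  shows "norm_inf q (\<lambda>x. a * f x + b * g x) \<le> \<bar>a\<bar> * norm_inf q f + \<bar>b\<bar> * norm_inf q g"
proof -
  have "norm_inf q (\<lambda>x. a * f x + b * g x)
      = (\<Sum>\<gamma> | msize \<gamma> \<le> q. sup_norm (\<lambda>x. a * mpartial \<gamma> f x + b * mpartial \<gamma> g x))"
    unfolding norm_inf_def using assms by (intro sum.cong) (auto simp: C_b_def mpartial_lincomb)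
  also have "\<dots> \<le> (\<Sum>\<gamma> | msize \<gamma> \<le> q. \<bar>a\<bar> * sup_norm (mpartial \<gamma> f) + \<bar>b\<bar> * sup_norm (mpartial \<gamma> g))"
    using assms by (intro sum_mono sup_norm_lincomb) (auto simp: C_b_def)
  finally show ?thesis by (simp add: norm_inf_def sum.distrib sum_distrib_left)
qed

subsection \<open>The scale of integrable functions\<close>

lemma C_1_integrable: "f \<in> C_1 q \<Longrightarrow> integrable lborel f"
proof -
  assume "f \<in> C_1 q"
  then have "integrable lborel (mpartial (\<lambda>_. 0) f)" by (auto simp: C_1_def msize_def)
  then show ?thesis by (simp only: mpartial_zero)
qed

lemma norm_1_nonneg: "0 \<le> norm_1 q f"
  unfolding norm_1_def by (auto intro!: sum_nonneg)

lemma C_1_mono: "f \<in> C_1 q \<Longrightarrow> p \<le> q \<Longrightarrow> f \<in> C_1 p"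
  using C_k_mono le_trans unfolding C_1_def by blast

lemma norm_1_mono: "p \<le> q \<Longrightarrow> norm_1 p f \<le> norm_1 q f"
  unfolding norm_1_def by (intro sum_mono2 finite_msize_le) auto

lemma norm_1_0: "norm_1 0 f = (\<integral>x. \<bar>f x\<bar> \<partial>lborel)"
  unfolding norm_1_def msize_le_0 by (simp only: sum.insert finite.emptyI empty_iff
      not_False_eq_True sum.empty mpartial_zero add_0_right simp_thms)

lemma C_1_lincomb:
  assumes "f \<in> C_1 q" "g \<in> C_1 q"
  shows "(\<lambda>x. a * f x + b * g x) \<in> C_1 q"
  using assms C_k_lincomb by (auto simp: C_1_def mpartial_lincomb)

lemma norm_1_lincomb:
  assumes "f \<in> C_1 q" "g \<in> C_1 q"
  shows "norm_1 q (\<lambda>x. a * f x + b * g x) \<le> \<bar>a\<bar> * norm_1 q f + \<bar>b\<bar> * norm_1 q g"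
proof -
  have "norm_1 q (\<lambda>x. a * f x + b * g x)
      = (\<Sum>\<gamma> | msize \<gamma> \<le> q. \<integral>x. \<bar>a * mpartial \<gamma> f x + b * mpartial \<gamma> g x\<bar> \<partial>lborel)"
    unfolding norm_1_def using assms by (intro sum.cong) (auto simp: C_1_def mpartial_lincomb)
  also have "\<dots> \<le> (\<Sum>\<gamma> | msize \<gamma> \<le> q.
      \<integral>x. \<bar>a\<bar> * \<bar>mpartial \<gamma> f x\<bar> + \<bar>b\<bar> * \<bar>mpartial \<gamma> g x\<bar> \<partial>lborel)"
    using assms
    by (intro sum_mono integral_mono integrable_abs Bochner_Integration.integrable_add
        integrable_mult_right) (auto simp: C_1_def abs_mult[symmetric] intro: abs_triangle_ineq)
  also have "\<dots> = (\<Sum>\<gamma> | msize \<gamma> \<le> q. \<bar>a\<bar> * (\<integral>x. \<bar>mpartial \<gamma> f x\<bar> \<partial>lborel)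
      + \<bar>b\<bar> * (\<integral>x. \<bar>mpartial \<gamma> g x\<bar> \<partial>lborel))"
    using assms by (intro sum.cong) (auto simp: C_1_def integrable_abs)
  finally show ?thesis by (simp add: norm_1_def sum.distrib sum_distrib_left)
qed

subsection \<open>Smooth functions of compact support\<close>

lemma C_c_inf_C_k: "f \<in> C_c_inf \<Longrightarrow> C_k q f"
  by (simp add: C_c_inf_def)

lemma C_c_inf_differentiable: "f \<in> C_c_inf \<Longrightarrow> f differentiable (at x)"
  using C_c_inf_C_k[of f "Suc 0"] by simp

lemma C_c_infI:
  assumes "\<And>q. C_k q f" "compact K" "\<And>x. x \<notin> K \<Longrightarrow> f x = 0"
  shows "f \<in> C_c_inf"
proof -
  have "{x. f x \<noteq> 0} \<subseteq> K" using assms(3) by blast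
  then have "compact (closure {x. f x \<noteq> 0})"
    using assms(2) by (meson bounded_subset compact_closure compact_imp_bounded)
  with assms(1) show ?thesis by (simp add: C_c_inf_def)
qed

lemma C_c_infE:
  assumes "f \<in> C_c_inf"
  obtains K where "compact K" "\<And>x. x \<notin> K \<Longrightarrow> f x = 0"
  using assms closure_subset unfolding C_c_inf_def
  by (smt (verit, best) mem_Collect_eq subset_iff)

lemma C_c_inf_lincomb:
  assumes "f \<in> C_c_inf" "g \<in> C_c_inf"
  shows "(\<lambda>x. a * f x + b * g x) \<in> C_c_inf"
proof -
  obtain K L where "compact K" "\<And>x. x \<notin> K \<Longrightarrow> f x = 0" "compact L" "\<And>x. x \<notin> L \<Longrightarrow> g x = 0"
    using assms C_c_infE by metis
  then show ?thesis
    using assms by (intro C_c_infI[of _ "K \<union> L"] C_k_lincomb) (auto simp: C_c_inf_def)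
qed

lemma C_c_inf_zero: "(\<lambda>x. 0) \<in> C_c_inf"
  using C_k_zero by (intro C_c_infI[of _ "{}"]) auto

lemma C_c_inf_sum:
  "finite S \<Longrightarrow> (\<And>s. s \<in> S \<Longrightarrow> F s \<in> C_c_inf) \<Longrightarrow> (\<lambda>x. \<Sum>s\<in>S. c s * F s x) \<in> C_c_inf"
proof (induction S rule: finite_induct)
  case (insert s S)
  then show ?case using C_c_inf_lincomb[of "F s" "\<lambda>x. \<Sum>s\<in>S. c s * F s x" "c s" 1] by simp
qed (auto intro: C_c_inf_zero)

lemma C_c_inf_partial:
  assumes "f \<in> C_c_inf"
  shows "partial i f \<in> C_c_inf"
proof -
  let ?K = "closure {x. f x \<noteq> 0}"
  have "partial i f x = 0" if "x \<notin> ?K" for x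
  proof -
    have "((\<lambda>_. 0) has_derivative (\<lambda>_. 0)) (at x)" by simp
    then have "(f has_derivative (\<lambda>_. 0)) (at x)"
    proof (rule has_derivative_transform_within_open)
      show "open (- ?K)" "x \<in> - ?K" using that by auto
      fix y assume "y \<in> - ?K"
      then show "0 = f y" using closure_subset[of "{x. f x \<noteq> 0}"] by auto
    qed
    then show ?thesis by (rule partial_eqI)
  qed
  moreover have "C_k q (partial i f)" for q using C_c_inf_C_k[OF assms, of "Suc q"] by simp
  ultimately show ?thesis using assms C_c_infI[of "partial i f" ?K] by (auto simp: C_c_inf_def)
qed

lemma C_c_inf_foldr_partial: "f \<in> C_c_inf \<Longrightarrow> foldr partial is f \<in> C_c_inf"
  by (induction "is") (auto intro: C_c_inf_partial)

lemma C_c_inf_mpartial: "f \<in> C_c_inf \<Longrightarrow> mpartial \<gamma> f \<in> C_c_inf"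
proof -
  assume f: "f \<in> C_c_inf"
  obtain "is" where "\<And>f. mpartial \<gamma> f = foldr partial is f"
    using mpartial_obtain[of \<gamma>] by blast
  with f show ?thesis by (simp add: C_c_inf_foldr_partial)
qed

lemma C_c_inf_bounded:
  assumes "f \<in> C_c_inf"
  shows "bounded (range f)"
proof -
  let ?K = "closure {x. f x \<noteq> 0}"
  have "compact (f ` ?K)"
    using assms C_k_continuous[OF C_c_inf_C_k[OF assms, of 0]]
    by (intro compact_continuous_image) (auto simp: C_c_inf_def intro: continuous_on_subset)
  then obtain B where "\<And>x. x \<in> ?K \<Longrightarrow> \<bar>f x\<bar> \<le> B"
    using compact_imp_bounded by (fastforce simp: bounded_iff)
  then have "\<bar>f x\<bar> \<le> \<bar>B\<bar>" for x
    using closure_subset[of "{x. f x \<noteq> 0}"] by (cases "f x = 0") fastforce+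
  then show ?thesis unfolding bounded_range_iff by blast
qed

lemma C_c_inf_subset_C_b: "f \<in> C_c_inf \<Longrightarrow> f \<in> C_b q"
  by (auto simp: C_b_def intro!: C_c_inf_C_k C_c_inf_mpartial C_c_inf_bounded)

lemma C_c_inf_subset_M_b: "f \<in> C_c_inf \<Longrightarrow> f \<in> M_b"
  using C_c_inf_subset_C_b C_b_subset_M_b by blast

lemma C_c_inf_continuous: "f \<in> C_c_inf \<Longrightarrow> continuous_on UNIV f"
  using C_c_inf_C_k C_k_continuous by blast

lemma partial_reflect:
  fixes f :: "'d::finite func"
  assumes "\<And>x. f differentiable (at x)"
  shows "partial i (\<lambda>z. f (y - z)) = (\<lambda>z. - partial i f (y - z))"
proof
  fix z
  have "(f has_derivative frechet_derivative f (at (y - z))) (at (y - z))"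
    using assms frechet_derivative_works by blast
  then have D: "((\<lambda>z. f (y - z)) has_derivative (\<lambda>h. frechet_derivative f (at (y - z)) (- h))) (at z)"
    by (rule has_derivative_compose[of "\<lambda>z. y - z" uminus z UNIV f, rotated])
      (auto intro!: derivative_eq_intros)
  have "linear (frechet_derivative f (at (y - z)))"
    using assms linear_frechet_derivative by blast
  then show "partial i (\<lambda>z. f (y - z)) z = - partial i f (y - z)"
    using partial_eqI[OF D, of i] by (simp add: partial_def linear_neg)
qed

lemma differentiable_reflect:
  fixes f :: "'d::finite func"
  assumes "\<And>x. f differentiable (at x)"
  shows "(\<lambda>z. f (y - z)) differentiable (at z)"
proof -
  have "(f \<circ> (\<lambda>z. y - z)) differentiable (at z)"
    using assms by (intro differentiable_chain_at) (auto intro!: derivative_intros)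
  then show ?thesis by (simp add: o_def)
qed

lemma C_k_reflect: "C_k q f \<Longrightarrow> C_k q (\<lambda>z. f (y - z))"
proof (induction q arbitrary: f)
  case 0
  then show ?case
    by (auto intro!: continuous_on_compose2[of UNIV f] continuous_intros)
next
  case (Suc q)
  then have "C_k q (\<lambda>z. (-1) * partial i f (y - z) + 0 * 0)" for i
    by (intro C_k_lincomb C_k_zero) auto
  with Suc show ?case by (simp add: partial_reflect differentiable_reflect)
qed

lemma C_c_inf_reflect:
  assumes "f \<in> C_c_inf"
  shows "(\<lambda>z. f (y - z)) \<in> C_c_inf"
proof -
  obtain K where K: "compact K" "\<And>x. x \<notin> K \<Longrightarrow> f x = 0" using assms C_c_infE by metis
  have "compact ((\<lambda>x. y - x) ` K)"
    using K by (intro compact_continuous_image) (auto intro!: continuous_intros)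
  moreover have "f (y - z) = 0" if "z \<notin> (\<lambda>x. y - x) ` K" for z
    using that K(2)[of "y - z"] by (metis diff_diff_eq2 add_diff_cancel_left' image_eqI)
  ultimately show ?thesis by (intro C_c_infI C_k_reflect C_c_inf_C_k[OF assms])
qed

lemma foldr_partial_reflect:
  assumes "f \<in> C_c_inf"
  shows "foldr partial is (\<lambda>z. f (y - z)) = (\<lambda>z. (-1) ^ length is * foldr partial is f (y - z))"
proof (induction "is")
  case (Cons i "is")
  let ?g = "foldr partial is f"
  have g: "?g \<in> C_c_inf" using assms C_c_inf_foldr_partial by blast
  then have d: "\<And>x. ?g differentiable (at x)" using C_c_inf_differentiable by blast
  have "foldr partial (i # is) (\<lambda>z. f (y - z)) = partial i (\<lambda>z. (-1) ^ length is * ?g (y - z) + 0 * 0)"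
    using Cons by simp
  also have "\<dots> = (\<lambda>z. (-1) ^ length is * partial i (\<lambda>z. ?g (y - z)) z
      + 0 * partial i (\<lambda>z. 0) z)"
    by (subst partial_lincomb) (auto intro: differentiable_reflect d)
  also have "\<dots> = (\<lambda>z. (-1) ^ length (i # is) * foldr partial (i # is) f (y - z))"
    by (subst partial_reflect[OF d]) (auto simp: algebra_simps)
  finally show ?case .
qed auto

lemma mpartial_reflect:
  assumes "f \<in> C_c_inf"
  shows "mpartial \<gamma> (\<lambda>z. f (y - z)) = (\<lambda>z. (-1) ^ msize \<gamma> * mpartial \<gamma> f (y - z))"
proof -
  obtain "is" where "length is = msize \<gamma>" "\<And>f. mpartial \<gamma> f = foldr partial is f"
    using mpartial_obtain[of \<gamma>] by blast
  with assms show ?thesis by (simp add: foldr_partial_reflect)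
qed

lemma compact_unit_neighbourhood:
  fixes K :: "('a::euclidean_space) set"
  assumes "compact K"
  shows "compact {x + h |x h. x \<in> K \<and> h \<in> cball 0 1}"
  by (rule compact_sums[OF assms compact_cball])

text \<open>The derivative of the remainder of the first order Taylor expansion at \<open>u\<close> is small near \<open>u\<close>, uniformly in
  \<open>u\<close>, because the partial derivatives are uniformly continuous on a compact neighbourhood.\<close>

lemma C_k_uniform_taylor:
  fixes f :: "'d::finite func"
  assumes f: "C_k (Suc 0) f" and K: "compact K" and e: "e > 0"
  obtains d where "d > 0" "\<And>(u :: real ^ 'd) h. u \<in> K \<Longrightarrow> norm h < d \<Longrightarrow>
    \<bar>f (u + h) - f u - (\<Sum>i\<in>UNIV. h $ i * partial i f u)\<bar> \<le> e * norm h"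
proof -
  define N where "N = real (CARD('d))"
  have N: "N > 0" by (simp add: N_def)
  define K' where "K' = {x + h |x h. x \<in> K \<and> h \<in> cball 0 (1 :: real)}"
  have K': "compact K'" unfolding K'_def using compact_unit_neighbourhood[OF K] .
  have "\<exists>d>0. \<forall>x\<in>K'. \<forall>y\<in>K'. dist y x < d \<longrightarrow> dist (partial i f y) (partial i f x) < e / N" for i
  proof -
    have "continuous_on K' (partial i f)"
      using f C_k_continuous[of 0 "partial i f"] by (auto intro: continuous_on_subset)
    then show ?thesis
      using compact_uniformly_continuous[OF _ K', of "partial i f"] e N
      unfolding uniformly_continuous_on_def by simp
  qed
  then obtain d where d: "\<And>i. d i > 0"
    "\<And>i x y. x \<in> K' \<Longrightarrow> y \<in> K' \<Longrightarrow> dist y x < d i \<Longrightarrow> dist (partial i f y) (partial i f x) < e / N"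
    by metis
  define d0 where "d0 = min 1 (Min (range d))"
  have d0: "d0 > 0" "d0 \<le> 1" "d0 \<le> d i" for i
    using d(1) by (auto simp: d0_def min_le_iff_disj)
  show thesis
  proof (rule that[of d0])
    fix u h :: "real ^ 'd" assume u: "u \<in> K" and h: "norm h < d0"
    define D where "D = (\<lambda>v h. \<Sum>i\<in>UNIV. h $ i * partial i f v)"
    have D: "(f has_derivative D v) (at v within S)" for v S
      unfolding D_def using f has_derivative_partials has_derivative_at_withinI by fastforce
    have "norm (f (u + h) - f u - D u (u + h - u)) \<le> norm (u + h - u) * e"
    proof (rule differentiable_bound_linearization[where S = "ball u d0"])
      show "u + t *\<^sub>R (u + h - u) \<in> ball u d0" if "t \<in> {0..1}" for t
      proof -
        have "norm (t *\<^sub>R h) \<le> norm h" using that by (auto intro: mult_left_le_one_le)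
        with h show ?thesis by (simp add: dist_norm)
      qed
      show "u \<in> ball u d0" using d0 by simp
      fix v assume v: "v \<in> ball u d0"
      have "u + 0 \<in> K'" unfolding K'_def using u by (intro CollectI exI[of _ u] exI[of _ 0]) simp
      then have uK: "u \<in> K'" by simp
      have "u + (v - u) \<in> K'" unfolding K'_def using u v d0(2)
        by (intro CollectI exI[of _ u] exI[of _ "v - u"]) (simp add: dist_norm norm_minus_commute)
      then have vK: "v \<in> K'" by simp
      show "onorm (D v - D u) \<le> e"
      proof (rule onorm_le)
        fix h
        have "norm ((D v - D u) h) = \<bar>\<Sum>i\<in>UNIV. h $ i * (partial i f v - partial i f u)\<bar>"
          by (simp add: D_def sum_subtractf right_diff_distrib)
        also have "\<dots> \<le> (\<Sum>i\<in>(UNIV :: 'd set). norm h * (e / N))"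
        proof (rule order_trans[OF sum_abs sum_mono])
          fix i
          have "dist v u < d i" using v d0(3)[of i] by (simp add: dist_commute)
          then have "\<bar>partial i f v - partial i f u\<bar> \<le> e / N"
            using d(2)[OF uK vK] by (auto simp: dist_real_def less_imp_le)
          then show "\<bar>h $ i * (partial i f v - partial i f u)\<bar> \<le> norm h * (e / N)"
            unfolding abs_mult by (intro mult_mono component_le_norm_cart) auto
        qed
        also have "\<dots> = e * norm h" using N by (simp add: N_def)
        finally show "norm ((D v - D u) h) \<le> e * norm h" .
      qed
    qed (use D in auto)
    then show "\<bar>f (u + h) - f u - (\<Sum>i\<in>UNIV. h $ i * partial i f u)\<bar> \<le> e * norm h"
      by (simp add: D_def mult.commute)
  qed (use d0 in auto)
qed

lemma uniform_continuity_near_compact: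
  fixes f :: "'d::finite func"
  assumes f: "continuous_on UNIV f" and K: "compact K" and e: "e > 0"
  obtains d where "d > 0" "\<And>(u :: real ^ 'd) h. u \<in> K \<Longrightarrow> norm h < d \<Longrightarrow> \<bar>f (u + h) - f u\<bar> \<le> e"
proof -
  define K' where "K' = {x + h |x h. x \<in> K \<and> h \<in> cball 0 (1 :: real)}"
  have K': "compact K'" unfolding K'_def using compact_unit_neighbourhood[OF K] .
  then obtain d where d: "d > 0" "\<And>x y. x \<in> K' \<Longrightarrow> y \<in> K' \<Longrightarrow> dist y x < d \<Longrightarrow> dist (f y) (f x) < e"
    using compact_uniformly_continuous[OF continuous_on_subset[OF f] K'] e
    unfolding uniformly_continuous_on_def by (metis UNIV_I subsetI)
  show thesis
  proof (rule that[of "min d 1"])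
    fix u h :: "real ^ 'd" assume u: "u \<in> K" and h: "norm h < min d 1"
    have "u + 0 \<in> K'" unfolding K'_def using u
      by (intro CollectI exI[of _ u] exI[of _ 0]) simp
    then have "u \<in> K'" by simp
    moreover have "u + h \<in> K'" unfolding K'_def using u h
      by (intro CollectI exI[of _ u] exI[of _ h]) simp
    ultimately have "dist (f (u + h)) (f u) < e" using d(2) h by (simp add: dist_norm)
    then show "\<bar>f (u + h) - f u\<bar> \<le> e" by (simp add: dist_real_def)
  qed (use d in auto)
qed

text \<open>Compact support makes the expansion uniform on the whole space: away from a neighbourhood of the support
  the left side vanishes.\<close>

lemma C_c_inf_uniform_taylor:
  fixes f :: "'d::finite func"
  assumes f: "f \<in> C_c_inf" and e: "e > 0"
  obtains d where "d > 0" "\<And>(u :: real ^ 'd) h. norm h < d \<Longrightarrow>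
    \<bar>f (u + h) - f u - (\<Sum>i\<in>UNIV. h $ i * partial i f u)\<bar> \<le> e * norm h"
proof -
  let ?K = "closure {x. f x \<noteq> 0}"
  define K' where "K' = {x + h |x h. x \<in> ?K \<and> h \<in> cball 0 (1 :: real)}"
  have "compact ?K" using f by (simp add: C_c_inf_def)
  then have K': "compact K'" unfolding K'_def by (rule compact_unit_neighbourhood)
  obtain d where d: "d > 0" "\<And>(u :: real ^ 'd) h. u \<in> K' \<Longrightarrow> norm h < d \<Longrightarrow>
    \<bar>f (u + h) - f u - (\<Sum>i\<in>UNIV. h $ i * partial i f u)\<bar> \<le> e * norm h"
    using C_k_uniform_taylor[OF C_c_inf_C_k[OF f] K' e] by blast
  have supp: "f v = 0" "partial i f v = 0" if "v \<notin> ?K" for v i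
  proof -
    show "f v = 0" using that closure_subset[of "{x. f x \<noteq> 0}"] by auto
    have "((\<lambda>_. 0) has_derivative (\<lambda>_. 0)) (at v)" by simp
    then have "(f has_derivative (\<lambda>_. 0)) (at v)"
    proof (rule has_derivative_transform_within_open)
      show "open (- ?K)" "v \<in> - ?K" using that by auto
      fix y assume "y \<in> - ?K"
      then show "0 = f y" using closure_subset[of "{x. f x \<noteq> 0}"] by auto
    qed
    then show "partial i f v = 0" by (rule partial_eqI)
  qed
  show thesis
  proof (rule that[of "min d 1"])
    fix u h :: "real ^ 'd" assume h: "norm h < min d 1"
    show "\<bar>f (u + h) - f u - (\<Sum>i\<in>UNIV. h $ i * partial i f u)\<bar> \<le> e * norm h"
    proof (cases "u \<in> K'")
      case True
      then show ?thesis using d(2)[OF True, of h] h by simp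
    next
      case False
      have u: "u \<notin> ?K"
      proof
        assume "u \<in> ?K"
        then have "u + 0 \<in> K'" unfolding K'_def by (intro CollectI exI[of _ u] exI[of _ 0]) simp
        with False show False by simp
      qed
      have uh: "u + h \<notin> ?K"
      proof
        assume "u + h \<in> ?K"
        then have "(u + h) + (- h) \<in> K'" unfolding K'_def using h
          by (intro CollectI exI[of _ "u + h"] exI[of _ "- h"]) simp
        with False show False by simp
      qed
      show ?thesis unfolding supp(1)[OF u] supp(1)[OF uh] supp(2)[OF u] using e by simp
    qed
  qed (use d in auto)
qed

section \<open>Mollifiers\<close>

text \<open>The functions \<open>p(x) (1 - x\<^sup>2)\<^sup>-\<^sup>k exp (- 1 / (1 - x\<^sup>2))\<close> on \<open>(-1, 1)\<close>, extended by zero. This family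
  contains a standard bump function and is closed under differentiation, which makes all its
  members smooth.\<close>

definition bump :: "real poly \<Rightarrow> nat \<Rightarrow> real \<Rightarrow> real" where
  "bump p k x = (if \<bar>x\<bar> < 1 then poly p x / (1 - x\<^sup>2) ^ k * exp (- 1 / (1 - x\<^sup>2)) else 0)"

lemma power_le_fact_exp:
  fixes y :: real
  assumes "y \<ge> 0"
  shows "y ^ k \<le> fact k * exp y"
proof -
  have s: "summable (\<lambda>n. y ^ n /\<^sub>R fact n)" by (rule summable_exp_generic)
  have "(\<Sum>n\<in>{k}. y ^ n /\<^sub>R fact n) \<le> (\<Sum>n. y ^ n /\<^sub>R fact n)"
    using assms by (intro sum_le_suminf[OF s]) auto
  then show ?thesis by (simp add: exp_def field_simps)
qed

text \<open>At the end points \<open>exp (- 1 / (1 - x\<^sup>2))\<close> beats every negative power of \<open>1 - x\<^sup>2\<close>. A quadratic bound is what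
  makes the derivative there exist and vanish.\<close>

lemma bump_quadratic_bound:
  assumes "\<bar>x\<bar> = 1"
  obtains C where "\<And>y. \<bar>bump p k y\<bar> \<le> C * \<bar>y - x\<bar> ^ 2"
proof -
  have "continuous_on {-1..1} (poly p)" by (intro continuous_intros)
  then have "compact (poly p ` {-1..1})" using compact_continuous_image by blast
  then have "bounded (poly p ` {-1..1})" by (rule compact_imp_bounded)
  then obtain P where "\<forall>z\<in>poly p ` {-1..1}. norm z \<le> P" unfolding bounded_iff by blast
  then have P: "\<bar>poly p y\<bar> \<le> P" if "\<bar>y\<bar> \<le> 1" for y using that by (simp add: abs_le_iff)
  have P0: "P \<ge> 0" using P[of 0] by simp
  show thesis
  proof (rule that[of "4 * P * fact (k + 2)"])
    fix y
    show "\<bar>bump p k y\<bar> \<le> 4 * P * fact (k + 2) * \<bar>y - x\<bar> ^ 2"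
    proof (cases "\<bar>y\<bar> < 1")
      case True
      define s where "s = 1 - y\<^sup>2"
      have s: "s > 0" using True by (simp add: s_def abs_square_less_1)
      have "(1 / s) ^ (k + 2) \<le> fact (k + 2) * exp (1 / s)"
        using s by (intro power_le_fact_exp) simp
      then have "1 / s ^ k * exp (- 1 / s) \<le> fact (k + 2) * s ^ 2"
        using s by (simp add: field_simps exp_minus power_add power2_eq_square)
      moreover have "s \<le> 2 * \<bar>y - x\<bar>"
      proof -
        have "s = (1 - \<bar>y\<bar>) * (1 + \<bar>y\<bar>)" by (simp add: s_def algebra_simps power2_eq_square)
        also have "\<dots> \<le> (1 - \<bar>y\<bar>) * 2" using True by (intro mult_left_mono) auto
        also have "\<dots> \<le> 2 * \<bar>y - x\<bar>"
          using assms abs_triangle_ineq2_sym[of x y] by simp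
        finally show ?thesis .
      qed
      then have "s ^ 2 \<le> (2 * \<bar>y - x\<bar>) ^ 2" using s by (intro power_mono) auto
      ultimately have "1 / s ^ k * exp (- 1 / s) \<le> fact (k + 2) * (2 * \<bar>y - x\<bar>) ^ 2"
        by (meson fact_ge_zero mult_left_mono order_trans)
      then have "\<bar>poly p y\<bar> * (1 / s ^ k * exp (- 1 / s)) \<le> P * (fact (k + 2) * (2 * \<bar>y - x\<bar>) ^ 2)"
        using P[of y] True P0 s by (rule_tac mult_mono) auto
      moreover have "\<bar>bump p k y\<bar> = \<bar>poly p y\<bar> * (1 / s ^ k * exp (- 1 / s))"
        using True s by (simp add: bump_def s_def[symmetric] abs_mult)
      moreover have "P * (F * (2 * t) ^ 2) = 4 * P * F * t ^ 2" for F t :: real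
        by (simp add: power_mult_distrib)
      ultimately show ?thesis by metis
    qed (use P0 in \<open>simp add: bump_def\<close>)
  qed
qed

lemma bump_has_derivative:
  "(bump p k has_real_derivative
     bump (pderiv p * [:1, 0, -1:] ^ 2 + smult (2 * real k) ([:0, 1:] * p * [:1, 0, -1:])
       - [:0, 2:] * p) (k + 2) x) (at x)" (is "(_ has_real_derivative bump ?q _ _) _")
proof -
  consider "\<bar>x\<bar> < 1" | "\<bar>x\<bar> > 1" | "\<bar>x\<bar> = 1" by linarith
  then show ?thesis
  proof cases
    case 1
    define s where "s = 1 - x\<^sup>2"
    have s: "s > 0" using 1 by (simp add: s_def abs_square_less_1)
    have ds: "((\<lambda>y. 1 - y\<^sup>2) has_real_derivative (- 2 * x)) (at x)"
      by (auto intro!: derivative_eq_intros)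
    have dk: "((\<lambda>y. (1 - y\<^sup>2) ^ k) has_real_derivative real k * s ^ (k - 1) * (- 2 * x)) (at x)"
      unfolding s_def by (rule DERIV_cong[OF DERIV_power[OF ds]]) simp
    have "((\<lambda>y. - 1 / (1 - y\<^sup>2)) has_real_derivative (- 2 * x) / s ^ 2) (at x)"
      using s unfolding s_def
      by (intro DERIV_cong[OF DERIV_divide[OF DERIV_const ds]]) (auto simp: power2_eq_square)
    from DERIV_chain2[OF DERIV_exp this]
    have de: "((\<lambda>y. exp (- 1 / (1 - y\<^sup>2))) has_real_derivative
        exp (- 1 / s) * ((- 2 * x) / s ^ 2)) (at x)" by (simp add: s_def)
    have "((\<lambda>y. poly p y / (1 - y\<^sup>2) ^ k * exp (- 1 / (1 - y\<^sup>2))) has_real_derivative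
        (poly (pderiv p) x * s ^ k - poly p x * (real k * s ^ (k - 1) * (- 2 * x))) / (s ^ k) ^ 2
          * exp (- 1 / s) + poly p x / s ^ k * (exp (- 1 / s) * ((- 2 * x) / s ^ 2))) (at x)"
      using s
      by (intro DERIV_cong[OF DERIV_mult[OF DERIV_divide[OF poly_DERIV dk] de]])
        (auto simp: s_def[symmetric] power2_eq_square[of "s ^ k"] algebra_simps)
    also have "(poly (pderiv p) x * s ^ k - poly p x * (real k * s ^ (k - 1) * (- 2 * x))) / (s ^ k) ^ 2
          * exp (- 1 / s) + poly p x / s ^ k * (exp (- 1 / s) * ((- 2 * x) / s ^ 2))
        = poly ?q x / s ^ (k + 2) * exp (- 1 / s)"
    proof -
      have p: "poly [:1, 0, -1:] x = s" "poly [:0, 1:] x = x" "poly [:0, 2:] x = 2 * x"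
        by (simp_all add: s_def power2_eq_square)
      have q: "poly ?q x = poly (pderiv p) x * s ^ 2 + 2 * real k * (x * poly p x * s) - 2 * x * poly p x"
        unfolding poly_add poly_diff poly_mult poly_power poly_smult p by simp
      show ?thesis unfolding q using s
        by (cases k) (simp_all add: field_simps power2_eq_square)
    qed
    also have "\<dots> = bump ?q (k + 2) x" using 1 by (simp add: bump_def s_def)
    finally have "((\<lambda>y. poly p y / (1 - y\<^sup>2) ^ k * exp (- 1 / (1 - y\<^sup>2))) has_real_derivative
        bump ?q (k + 2) x) (at x)" .
    then show ?thesis
    proof (rule has_field_derivative_transform_within_open)
      show "open {-1<..<1 :: real}" "x \<in> {-1<..<1}" using 1 by auto
    qed (auto simp: bump_def)
  next
    case 2
    have "((\<lambda>_. 0) has_real_derivative 0) (at x)" by simp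
    then have "(bump p k has_real_derivative 0) (at x)"
    proof (rule has_field_derivative_transform_within_open)
      show "open (- {-1..1 :: real})" "x \<in> - {-1..1}" using 2 by auto
    qed (auto simp: bump_def)
    then show ?thesis using 2 by (simp add: bump_def)
  next
    case 3
    obtain C where C: "\<And>y. \<bar>bump p k y\<bar> \<le> C * \<bar>y - x\<bar> ^ 2" using bump_quadratic_bound[OF 3] by blast
    have "((\<lambda>y. (bump p k y - bump p k x) / (y - x)) \<longlongrightarrow> 0) (at x)"
    proof (rule Lim_null_comparison)
      show "\<forall>\<^sub>F y in at x. norm ((bump p k y - bump p k x) / (y - x)) \<le> C * \<bar>y - x\<bar>"
        using C 3 by (auto simp: eventually_at_filter bump_def[of p k x] power2_eq_square
            divide_le_eq mult.assoc)
      show "((\<lambda>y. C * \<bar>y - x\<bar>) \<longlongrightarrow> 0) (at x)"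
        by (auto intro!: tendsto_eq_intros)
    qed
    then have "(bump p k has_real_derivative 0) (at x)" by (simp add: has_field_derivative_iff)
    moreover have "bump ?q (k + 2) x = 0" using 3 by (simp add: bump_def)
    ultimately show ?thesis by metis
  qed
qed

text \<open>A class of functions that is closed under differentiation gives smooth products in separated variables: a partial
  derivative replaces one factor by its derivative. Smoothness of the product then needs no count of derivatives of
  the factors.\<close>

lemma C_k_product:
  fixes us :: "'d::finite \<Rightarrow> real \<Rightarrow> real"
  assumes S: "\<And>u. u \<in> S \<Longrightarrow> \<exists>u'\<in>S. \<forall>x. (u has_real_derivative u' x) (at x)"
    and us: "\<And>i. us i \<in> S"
  shows "C_k q (\<lambda>x. \<Prod>i\<in>UNIV. us i (x $ i))"
  using us
proof (induction q arbitrary: us)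
  case 0
  have "\<forall>i. \<exists>u'\<in>S. \<forall>x. (us i has_real_derivative u' x) (at x)" using S 0 by blast
  then have c: "continuous_on UNIV (us i)" for i
    by (meson DERIV_isCont continuous_at_imp_continuous_on)
  have "continuous_on UNIV (\<lambda>x. \<Prod>i\<in>UNIV. us i (x $ i))"
    by (intro continuous_on_prod continuous_on_compose2[OF c] continuous_intros) auto
  then show ?case by simp
next
  case (Suc q)
  have "\<forall>i. \<exists>u'. u' \<in> S \<and> (\<forall>x. (us i has_real_derivative u' x) (at x))"
    using S Suc.prems by blast
  then obtain us' where "\<forall>i. us' i \<in> S \<and> (\<forall>x. (us i has_real_derivative us' i x) (at x))"
    by (rule choice[THEN exE])
  then have us': "\<And>i. us' i \<in> S" "\<And>i x. (us i has_real_derivative us' i x) (at x)" by auto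
  have D: "((\<lambda>x. \<Prod>i\<in>UNIV. us i (x $ i)) has_derivative
      (\<lambda>h. \<Sum>i\<in>UNIV. (h $ i * us' i (x $ i)) * (\<Prod>j\<in>UNIV - {i}. us j (x $ j)))) (at x)" for x
  proof (rule has_derivative_prod)
    fix i
    have "((\<lambda>x. x $ i) has_derivative (\<lambda>h. h $ i)) (at x)"
      by (rule bounded_linear_imp_has_derivative) (rule bounded_linear_vec_nth)
    from has_derivative_compose[OF this us'(2)[unfolded has_field_derivative_def]]
    show "((\<lambda>x. us i (x $ i)) has_derivative (\<lambda>h. h $ i * us' i (x $ i))) (at x)"
      by (simp add: mult.commute)
  qed
  have "C_k q (partial k (\<lambda>x. \<Prod>i\<in>UNIV. us i (x $ i)))" for k
  proof -
    have "partial k (\<lambda>x. \<Prod>i\<in>UNIV. us i (x $ i)) x = (\<Prod>i\<in>UNIV. (us(k := us' k)) i (x $ i))" for x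
    proof -
      have "partial k (\<lambda>x. \<Prod>i\<in>UNIV. us i (x $ i)) x
          = (\<Sum>i\<in>UNIV. if i = k then us' k (x $ k) * (\<Prod>j\<in>UNIV - {k}. us j (x $ j)) else 0)"
        unfolding partial_eqI[OF D] by (intro sum.cong) (auto simp: axis_def)
      also have "\<dots> = us' k (x $ k) * (\<Prod>j\<in>UNIV - {k}. us j (x $ j))" by simp
      also have "\<dots> = (\<Prod>i\<in>UNIV. (us(k := us' k)) i (x $ i))"
        by (subst (2) prod.remove[of _ k]) auto
      finally show ?thesis .
    qed
    then have "partial k (\<lambda>x. \<Prod>i\<in>UNIV. us i (x $ i)) = (\<lambda>x. \<Prod>i\<in>UNIV. (us(k := us' k)) i (x $ i))"
      by blast
    moreover have "C_k q (\<lambda>x. \<Prod>i\<in>UNIV. (us(k := us' k)) i (x $ i))"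
      using us'(1) Suc.prems by (intro Suc.IH) auto
    ultimately show ?thesis by simp
  qed
  moreover have "(\<lambda>x. \<Prod>i\<in>UNIV. us i (x $ i)) differentiable (at x)" for x
    using D differentiable_def by blast
  ultimately show ?case by simp
qed

lemma continuous_compact_support_integrable:
  fixes f :: "'a::euclidean_space \<Rightarrow> real"
  assumes "continuous_on UNIV f" "compact K" "\<And>x. x \<notin> K \<Longrightarrow> f x = 0"
  shows "integrable lborel f"
proof -
  have "integrable lborel (\<lambda>x. indicator K x *\<^sub>R f x)"
    using assms by (intro borel_integrable_compact) (auto intro: continuous_on_subset)
  moreover have "(\<lambda>x. indicator K x *\<^sub>R f x) = f"
  proof
    show "indicator K x *\<^sub>R f x = f x" for x using assms(3)[of x] by (cases "x \<in> K") auto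
  qed
  ultimately show ?thesis by simp
qed

lemma C_c_inf_integrable: "f \<in> C_c_inf \<Longrightarrow> integrable lborel f"
  using C_c_infE C_c_inf_continuous continuous_compact_support_integrable by metis

text \<open>The symmetry makes mollification its own dual.\<close>

definition mollifier :: "real \<Rightarrow> 'd::finite func \<Rightarrow> bool" where
  "mollifier \<epsilon> \<rho> \<longleftrightarrow> \<rho> \<in> C_c_inf \<and> (\<forall>x. 0 \<le> \<rho> x) \<and> (\<forall>x. \<rho> (- x) = \<rho> x) \<and>
     (\<integral>x. \<rho> x \<partial>lborel) = 1 \<and> (\<forall>x. \<epsilon> \<le> norm x \<longrightarrow> \<rho> x = 0)"

lemma mollifier_exists:
  assumes "\<epsilon> > 0"
  shows "\<exists>\<rho> :: 'd::finite func. mollifier \<epsilon> \<rho>"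
proof -
  \<comment> \<open>The cube of half side \<open>s\<close> lies in the ball of radius \<open>\<epsilon>\<close>, by comparison with the sum norm.\<close>
  define s where "s = \<epsilon> / real (CARD('d))"
  have s: "s > 0" using assms by (simp add: s_def)
  define S where "S = {\<lambda>x. c * bump p k (x / s) |c p k. True}"
  have S: "\<exists>u'\<in>S. \<forall>x. (u has_real_derivative u' x) (at x)" if "u \<in> S" for u
  proof -
    obtain c p k where u: "u = (\<lambda>x. c * bump p k (x / s))" using \<open>u \<in> S\<close> unfolding S_def by blast
    obtain q where q: "\<And>x. (bump p k has_real_derivative bump q (k + 2) x) (at x)"
      using bump_has_derivative by blast
    have "(u has_real_derivative (c / s) * bump q (k + 2) (x / s)) (at x)" for x
      unfolding u using s by (auto intro!: derivative_eq_intros DERIV_chain2[OF q])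
    moreover have "(\<lambda>x. (c / s) * bump q (k + 2) (x / s)) \<in> S" unfolding S_def by blast
    ultimately show ?thesis by (intro bexI allI)
  qed
  define r :: "'d func" where "r = (\<lambda>x. \<Prod>i\<in>UNIV. 1 * bump 1 0 (x $ i / s))"
  have "(\<lambda>x. 1 * bump 1 0 (x / s)) \<in> S" unfolding S_def by blast
  then have smooth: "C_k q r" for q
    unfolding r_def using C_k_product[of S "\<lambda>_ x. 1 * bump 1 0 (x / s)", OF S] by blast
  have supp: "r x = 0" if "\<epsilon> \<le> norm x" for x
  proof (rule ccontr)
    assume "r x \<noteq> 0"
    then have "bump 1 0 (x $ i / s) \<noteq> 0" for i by (simp add: r_def)
    then have "\<bar>x $ i / s\<bar> < 1" for i unfolding bump_def by (meson)
    then have "\<bar>x $ i\<bar> < s" for i using s by simp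
    then have "(\<Sum>i\<in>UNIV. \<bar>x $ i\<bar>) < (\<Sum>i\<in>(UNIV :: 'd set). s)" by (intro sum_strict_mono) auto
    then show False using norm_le_l1_cart[of x] that by (simp add: s_def)
  qed
  have r: "r \<in> C_c_inf" using smooth supp
    by (intro C_c_infI[of _ "cball 0 \<epsilon>"]) auto
  have "bump 1 0 (- t) = bump 1 0 t" for t by (simp add: bump_def)
  then have even: "r (- x) = r x" for x by (simp add: r_def)
  have pos: "0 \<le> r x" for x by (auto simp: r_def bump_def intro!: prod_nonneg)
  have "r 0 > 0" by (auto simp: r_def bump_def intro!: prod_pos)
  have "integral\<^sup>L lborel r \<noteq> 0"
  proof
    assume "integral\<^sup>L lborel r = 0"
    then have "AE x in lborel. r x = 0"
      using integral_nonneg_eq_0_iff_AE[OF C_c_inf_integrable[OF r]] pos by auto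
    then have "{x. r x \<noteq> 0} \<in> null_sets lborel"
      using AE_iff_null[of lborel "\<lambda>x. r x = 0"] C_c_inf_subset_M_b[OF r] by (auto simp: M_b_def)
    then have "negligible {x. r x \<noteq> 0}"
      using negligible_iff_null_sets null_sets_completionI by blast
    moreover have "open {x. r x \<noteq> 0}"
      using C_c_inf_continuous[OF r] by (intro open_Collect_neq) auto
    ultimately show False using open_not_negligible \<open>r 0 > 0\<close> by fastforce
  qed
  then have I: "integral\<^sup>L lborel r > 0"
    using Bochner_Integration.integral_nonneg[of lborel r] pos by (simp add: order_less_le)
  \<comment> \<open>The summand \<open>0 * r x\<close> gives \<open>\<rho>\<close> the shape of a linear combination.\<close>
  define \<rho> where "\<rho> = (\<lambda>x. (1 / integral\<^sup>L lborel r) * r x + 0 * r x)"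
  have "mollifier \<epsilon> \<rho>" unfolding mollifier_def
  proof (intro conjI allI impI)
    show "\<rho> \<in> C_c_inf" unfolding \<rho>_def by (rule C_c_inf_lincomb[OF r r])
    show "integral\<^sup>L lborel \<rho> = 1" unfolding \<rho>_def using I by simp
  qed (use pos I supp even in \<open>auto simp: \<rho>_def\<close>)
  then show ?thesis by blast
qed

lemma lborel_reflect:
  fixes z :: "'a::euclidean_space"
  shows "distr lborel borel (\<lambda>y. z - y) = lborel"
proof -
  have "(lborel :: 'a measure)
      = density (distr lborel borel (\<lambda>x. z + (-1) *\<^sub>R x)) (\<lambda>_. \<bar>-1 :: real\<bar> ^ DIM('a))"
    by (rule lborel_affine) simp
  then show ?thesis by (simp add: density_1)
qed

lemma integral_reflect:
  fixes f :: "'a::euclidean_space \<Rightarrow> real"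
  assumes "f \<in> borel_measurable borel"
  shows "(\<integral>y. f (z - y) \<partial>lborel) = (\<integral>y. f y \<partial>lborel)"
proof -
  have "(\<integral>y. f y \<partial>lborel) = (\<integral>y. f y \<partial>distr lborel borel (\<lambda>y. z - y))" by (simp add: lborel_reflect)
  also have "\<dots> = (\<integral>y. f (z - y) \<partial>lborel)" using assms by (intro integral_distr) auto
  finally show ?thesis by simp
qed

lemma integrable_reflect:
  fixes f :: "'a::euclidean_space \<Rightarrow> real"
  assumes "integrable lborel f"
  shows "integrable lborel (\<lambda>y. f (z - y))"
proof -
  have "integrable (distr lborel borel (\<lambda>y. z - y)) f" using assms by (simp add: lborel_reflect)
  then show ?thesis by (rule integrable_distr[rotated]) auto
qed

section \<open>Functionals on smooth functions of compact support\<close>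

text \<open>The composition of a functional with an operator of the regularising family is of this kind. Such operators are
  only linear and bounded, so that pointwise limits cannot be taken.\<close>

definition test_functional :: "real \<Rightarrow> ('d::finite func \<Rightarrow> real) \<Rightarrow> bool" where
  "test_functional M L \<longleftrightarrow>
     (\<forall>f\<in>C_c_inf. \<forall>g\<in>C_c_inf. \<forall>a b. L (\<lambda>x. a * f x + b * g x) = a * L f + b * L g) \<and>
     (\<forall>f\<in>C_c_inf. \<bar>L f\<bar> \<le> M * sup_norm f)"

lemma test_functional_lincomb:
  "test_functional M L \<Longrightarrow> f \<in> C_c_inf \<Longrightarrow> g \<in> C_c_inf \<Longrightarrow>
    L (\<lambda>x. a * f x + b * g x) = a * L f + b * L g"
  by (simp add: test_functional_def)

lemma test_functional_diff:
  "test_functional M L \<Longrightarrow> f \<in> C_c_inf \<Longrightarrow> g \<in> C_c_inf \<Longrightarrow> L (\<lambda>x. f x - g x) = L f - L g"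
  using test_functional_lincomb[of M L f g 1 "-1"] by simp

lemma test_functional_sum:
  assumes "test_functional M L" "finite S" "\<And>s. s \<in> S \<Longrightarrow> F s \<in> C_c_inf"
  shows "L (\<lambda>x. \<Sum>s\<in>S. c s * F s x) = (\<Sum>s\<in>S. c s * L (F s))"
  using assms(2,3)
proof (induction S rule: finite_induct)
  case empty
  show ?case using test_functional_lincomb[OF assms(1) C_c_inf_zero C_c_inf_zero, of 0 0] by simp
next
  case (insert s S)
  then show ?case
    using test_functional_lincomb[OF assms(1), of "F s" "\<lambda>x. \<Sum>s\<in>S. c s * F s x" "c s" 1]
      C_c_inf_sum[of S F c] by simp
qed

lemma test_functional_le:
  assumes "test_functional M L" "f \<in> C_c_inf" "\<And>x. \<bar>f x\<bar> \<le> e"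
  shows "\<bar>L f\<bar> \<le> \<bar>M\<bar> * e"
proof -
  have "0 \<le> sup_norm f" using assms(2) C_c_inf_bounded sup_norm_nonneg by blast
  have "\<bar>L f\<bar> \<le> M * sup_norm f" using assms by (simp add: test_functional_def)
  also have "\<dots> \<le> \<bar>M\<bar> * e"
    using sup_norm_le[of f e] assms(3) \<open>0 \<le> sup_norm f\<close> by (intro mult_mono) auto
  finally show ?thesis .
qed

lemma C_c_inf_uniformly_continuous:
  fixes f :: "'d::finite func"
  assumes f: "f \<in> C_c_inf" and e: "e > 0"
  obtains d where "d > 0" "\<And>(u :: real ^ 'd) v. norm (u - v) < d \<Longrightarrow> \<bar>f u - f v\<bar> \<le> e"
proof -
  obtain d where d: "d > 0" "\<And>(u :: real ^ 'd) h. norm h < d \<Longrightarrow>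
    \<bar>f (u + h) - f u - (\<Sum>i\<in>UNIV. h $ i * partial i f u)\<bar> \<le> 1 * norm h"
    using C_c_inf_uniform_taylor[OF f zero_less_one] by blast
  define C where "C = (\<Sum>i\<in>UNIV. sup_norm (partial i f)) + 1"
  have b: "\<bar>partial i f u\<bar> \<le> sup_norm (partial i f)" for i u
    using C_c_inf_bounded[OF C_c_inf_partial[OF f]] abs_le_sup_norm by blast
  have C: "C > 0" unfolding C_def
    using b by (intro add_nonneg_pos sum_nonneg) (auto intro: order_trans[OF abs_ge_zero])
  have lip: "\<bar>f (u + h) - f u\<bar> \<le> C * norm h" if "norm h < d" for u h
  proof -
    have "\<bar>\<Sum>i\<in>UNIV. h $ i * partial i f u\<bar> \<le> (\<Sum>i\<in>UNIV. norm h * sup_norm (partial i f))"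
      using b by (intro order_trans[OF sum_abs sum_mono])
        (auto simp: abs_mult intro!: mult_mono component_le_norm_cart)
    also have "\<dots> = norm h * (\<Sum>i\<in>UNIV. sup_norm (partial i f))" by (simp add: sum_distrib_left)
    finally show ?thesis using d(2)[OF that, of u] unfolding C_def distrib_right
      by (simp add: mult.commute abs_le_iff)
  qed
  show thesis
  proof (rule that[of "min d (e / C)"])
    fix u v :: "real ^ 'd" assume h: "norm (u - v) < min d (e / C)"
    then have "\<bar>f (v + (u - v)) - f v\<bar> \<le> C * norm (u - v)" by (intro lip) simp
    also have "\<dots> \<le> e" using h C by (simp add: field_simps)
    finally show "\<bar>f u - f v\<bar> \<le> e" by simp
  qed (use d e C in auto)
qed

text \<open>Differentiating \<open>y \<mapsto> \<Lambda>(F(y - \<cdot>))\<close> under the functional \<open>\<Lambda>\<close>. The functional lives on some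
  space \<open>X\<close> of functions and is controlled by the values on \<open>W\<close>; so all that is needed is
  a Taylor expansion of \<open>F\<close> that is uniform on \<open>y - W\<close>. This is used with \<open>W = UNIV\<close> for functionals on
  test functions and with compact \<open>W\<close> for integration against a mollifier.\<close>

lemma has_derivative_functional_translate:
  fixes F :: "'d::finite func"
  assumes lin: "\<And>f g a b. f \<in> X \<Longrightarrow> g \<in> X \<Longrightarrow> \<Lambda> (\<lambda>x. a * f x + b * g x) = a * \<Lambda> f + b * \<Lambda> g"
    and closed: "\<And>f g a b. f \<in> X \<Longrightarrow> g \<in> X \<Longrightarrow> (\<lambda>x. a * f x + b * g x) \<in> X"
    and bound: "\<And>f e. f \<in> X \<Longrightarrow> (\<And>w. w \<in> W \<Longrightarrow> \<bar>f w\<bar> \<le> e) \<Longrightarrow> \<bar>\<Lambda> f\<bar> \<le> M * e"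
    and F: "\<And>y. (\<lambda>z. F (y - z)) \<in> X" "\<And>y i. (\<lambda>z. partial i F (y - z)) \<in> X"
    and taylor: "\<And>e. e > 0 \<Longrightarrow> \<exists>d>0. \<forall>h w. w \<in> W \<longrightarrow> norm h < d \<longrightarrow>
      \<bar>F (y - w + h) - F (y - w) - (\<Sum>i\<in>UNIV. h $ i * partial i F (y - w))\<bar> \<le> e * norm h"
    and M: "M \<ge> 0"
  shows "((\<lambda>y. \<Lambda> (\<lambda>z. F (y - z))) has_derivative
    (\<lambda>h. \<Sum>i\<in>UNIV. h $ i * \<Lambda> (\<lambda>z. partial i F (y - z)))) (at y)"
proof -
  have zero: "(\<lambda>_. 0) \<in> X" using closed[OF F(1) F(1), of 0 _ 0] by simp
  have sum: "(\<lambda>z. \<Sum>i\<in>I. h $ i * partial i F (y - z)) \<in> X \<and>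
      \<Lambda> (\<lambda>z. \<Sum>i\<in>I. h $ i * partial i F (y - z)) = (\<Sum>i\<in>I. h $ i * \<Lambda> (\<lambda>z. partial i F (y - z)))"
    if "finite I" for I and h :: "real ^ 'd" using that
  proof (induction I rule: finite_induct)
    case empty
    then show ?case using zero lin[OF zero zero, of 0 0] by simp
  next
    case (insert i I)
    let ?G = "\<lambda>z. \<Sum>i\<in>I. h $ i * partial i F (y - z)"
    have "?G \<in> X" using insert by simp
    from closed[OF F(2)[of i y] this, of "h $ i" 1] lin[OF F(2)[of i y] this, of "h $ i" 1] insert
    show ?case by simp
  qed
  show ?thesis unfolding has_derivative_at_alt
  proof (intro conjI allI impI)
    show "bounded_linear (\<lambda>h. \<Sum>i\<in>UNIV. h $ i * \<Lambda> (\<lambda>z. partial i F (y - z)))"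
      by (intro bounded_linear_sum bounded_linear_mult_const bounded_linear_vec_nth)
    fix e :: real assume "e > 0"
    then have "e / (M + 1) > 0" using M by simp
    then obtain d where d: "d > 0" "\<And>h w. w \<in> W \<Longrightarrow> norm h < d \<Longrightarrow>
      \<bar>F (y - w + h) - F (y - w) - (\<Sum>i\<in>UNIV. h $ i * partial i F (y - w))\<bar> \<le> e / (M + 1) * norm h"
      using taylor by blast
    have "norm (\<Lambda> (\<lambda>z. F (y' - z)) - \<Lambda> (\<lambda>z. F (y - z))
        - (\<Sum>i\<in>UNIV. (y' - y) $ i * \<Lambda> (\<lambda>z. partial i F (y - z)))) \<le> e * norm (y' - y)"
      if "norm (y' - y) < d" for y'
    proof -
      let ?h = "y' - y"
      let ?P = "\<lambda>z. \<Sum>i\<in>UNIV. ?h $ i * partial i F (y - z)"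
      let ?D = "\<lambda>z. 1 * F (y' - z) + (-1) * F (y - z)"
      have P: "?P \<in> X" "\<Lambda> ?P = (\<Sum>i\<in>UNIV. ?h $ i * \<Lambda> (\<lambda>z. partial i F (y - z)))"
        using sum[of UNIV ?h] by auto
      have D: "?D \<in> X" "\<Lambda> ?D = \<Lambda> (\<lambda>z. F (y' - z)) - \<Lambda> (\<lambda>z. F (y - z))"
        using closed[OF F(1)[of y'] F(1)[of y], of 1 "-1"] lin[OF F(1)[of y'] F(1)[of y], of 1 "-1"] by auto
      have DP: "(\<lambda>z. 1 * ?D z + (-1) * ?P z) \<in> X"
        "\<Lambda> (\<lambda>z. 1 * ?D z + (-1) * ?P z) = \<Lambda> ?D - \<Lambda> ?P"
        using closed[OF D(1) P(1), of 1 "-1"] lin[OF D(1) P(1), of 1 "-1"] by auto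
      have "\<bar>\<Lambda> (\<lambda>z. 1 * ?D z + (-1) * ?P z)\<bar> \<le> M * (e / (M + 1) * norm ?h)"
      proof (rule bound[OF DP(1)])
        fix w assume "w \<in> W"
        \<comment> \<open>The Taylor expansion is used at \<open>y - w\<close>, for all \<open>w \<in> W\<close> at once.\<close>
        from d(2)[OF this that]
        show "\<bar>1 * ?D w + (-1) * ?P w\<bar> \<le> e / (M + 1) * norm ?h"
          by (simp add: algebra_simps)
      qed
      also have "\<dots> = M / (M + 1) * (e * norm ?h)" using M by (simp add: field_simps)
      also have "\<dots> \<le> 1 * (e * norm ?h)"
        using M \<open>e > 0\<close> by (intro mult_right_mono) (auto simp: field_simps)
      finally show ?thesis unfolding DP(2) D(2) P(2) by simp
    qed
    then show "\<exists>d>0. \<forall>y'. norm (y' - y) < d \<longrightarrow>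
        norm (\<Lambda> (\<lambda>z. F (y' - z)) - \<Lambda> (\<lambda>z. F (y - z))
        - (\<Sum>i\<in>UNIV. (y' - y) $ i * \<Lambda> (\<lambda>z. partial i F (y - z)))) \<le> e * norm (y' - y)"
      using d(1) by blast
  qed
qed

lemma has_derivative_test_functional:
  fixes F :: "'d::finite func"
  assumes L: "test_functional M L" and F: "F \<in> C_c_inf"
  shows "((\<lambda>y. L (\<lambda>z. F (y - z))) has_derivative
    (\<lambda>h. \<Sum>i\<in>UNIV. h $ i * L (\<lambda>z. partial i F (y - z)))) (at y)"
proof (rule has_derivative_functional_translate[where X = C_c_inf and W = UNIV and M = "\<bar>M\<bar>"])
  show "\<And>f g a b. f \<in> C_c_inf \<Longrightarrow> g \<in> C_c_inf \<Longrightarrow> L (\<lambda>x. a * f x + b * g x) = a * L f + b * L g"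
    using test_functional_lincomb[OF L] .
  show "\<And>f e. f \<in> C_c_inf \<Longrightarrow> (\<And>w. w \<in> UNIV \<Longrightarrow> \<bar>f w\<bar> \<le> e) \<Longrightarrow> \<bar>L f\<bar> \<le> \<bar>M\<bar> * e"
    using test_functional_le[OF L] by simp
  fix e :: real assume "e > 0"
  from C_c_inf_uniform_taylor[OF F this] obtain d where "d > 0" "\<And>(u :: real ^ 'd) h. norm h < d \<Longrightarrow>
    \<bar>F (u + h) - F u - (\<Sum>i\<in>UNIV. h $ i * partial i F u)\<bar> \<le> e * norm h" by blast
  then show "\<exists>d>0. \<forall>h w. w \<in> UNIV \<longrightarrow> norm h < d \<longrightarrow>
    \<bar>F (y - w + h) - F (y - w) - (\<Sum>i\<in>UNIV. h $ i * partial i F (y - w))\<bar> \<le> e * norm h" by blast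
qed (auto intro: C_c_inf_lincomb C_c_inf_reflect C_c_inf_partial F)

lemma partial_test_functional:
  assumes L: "test_functional M L" and F: "F \<in> C_c_inf"
  shows "partial i (\<lambda>y. L (\<lambda>z. F (y - z))) = (\<lambda>y. L (\<lambda>z. partial i F (y - z)))"
proof
  fix y
  have "partial i (\<lambda>y. L (\<lambda>z. F (y - z))) y
      = (\<Sum>j\<in>UNIV. axis i 1 $ j * L (\<lambda>z. partial j F (y - z)))"
    by (rule partial_eqI[OF has_derivative_test_functional[OF L F]])
  also have "\<dots> = (\<Sum>j\<in>UNIV. if j = i then L (\<lambda>z. partial j F (y - z)) else 0)"
    by (intro sum.cong) (auto simp: axis_def)
  finally show "partial i (\<lambda>y. L (\<lambda>z. F (y - z))) y = L (\<lambda>z. partial i F (y - z))" by simp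
qed

lemma C_k_test_functional:
  assumes L: "test_functional M L" and F: "F \<in> C_c_inf"
  shows "C_k q (\<lambda>y. L (\<lambda>z. F (y - z)))"
  using F
proof (induction q arbitrary: F)
  case 0
  have "isCont (\<lambda>y. L (\<lambda>z. F (y - z))) y" for y
    using has_derivative_continuous[OF has_derivative_test_functional[OF L 0]] .
  then show ?case by (simp add: continuous_at_imp_continuous_on)
next
  case (Suc q)
  note partial_test_functional[OF L Suc.prems]
  moreover have "(\<lambda>y. L (\<lambda>z. F (y - z))) differentiable (at y)" for y
    using has_derivative_test_functional[OF L Suc.prems] differentiable_def by blast
  ultimately show ?case by (simp add: Suc.IH[OF C_c_inf_partial[OF Suc.prems]])
qed

lemma foldr_partial_test_functional:
  assumes L: "test_functional M L" and F: "F \<in> C_c_inf"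
  shows "foldr partial is (\<lambda>y. L (\<lambda>z. F (y - z))) = (\<lambda>y. L (\<lambda>z. foldr partial is F (y - z)))"
proof (induction "is")
  case (Cons i "is")
  let ?G = "foldr partial is F"
  have G: "?G \<in> C_c_inf" using F C_c_inf_foldr_partial by blast
  show ?case using Cons partial_test_functional[OF L G] by simp
qed auto

lemma mpartial_test_functional:
  assumes "test_functional M L" "F \<in> C_c_inf"
  shows "mpartial \<gamma> (\<lambda>y. L (\<lambda>z. F (y - z))) = (\<lambda>y. L (\<lambda>z. mpartial \<gamma> F (y - z)))"
proof -
  obtain "is" where "\<And>f. mpartial \<gamma> f = foldr partial is f" using mpartial_obtain[of \<gamma>] by blast
  with foldr_partial_test_functional[OF assms] show ?thesis by simp
qed

subsection \<open>Convolution\<close>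

definition conv :: "'d::finite func \<Rightarrow> 'd operator" where
  "conv \<rho> g = (\<lambda>z. \<integral>y. g y * \<rho> (z - y) \<partial>lborel)"

lemma M_b_compact_integrable:
  fixes g :: "'d::finite func"
  assumes "g \<in> M_b" "compact K" "\<forall>x. x \<notin> K \<longrightarrow> g x = 0"
  shows "integrable lborel g"
proof (rule integrableI_bounded_set[of K _ _ "sup_norm g"])
  show "emeasure lborel K < \<infinity>" using assms(2) emeasure_compact_finite by blast
qed (use assms M_b_abs_le M_b_D in \<open>auto intro: borel_compact\<close>)

lemma integrable_times_M_b:
  fixes f g :: "'d::finite func"
  assumes "integrable lborel f" "g \<in> M_b"
  shows "integrable lborel (\<lambda>x. f x * g x)"
proof (rule Bochner_Integration.integrable_bound[of _ "\<lambda>x. sup_norm g * \<bar>f x\<bar>"])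
  show "integrable lborel (\<lambda>x. sup_norm g * \<bar>f x\<bar>)"
    using assms(1) by (intro integrable_mult_right integrable_abs)
  show "(\<lambda>x. f x * g x) \<in> borel_measurable lborel"
    using assms M_b_D by (auto intro!: borel_measurable_times)
  show "AE x in lborel. norm (f x * g x) \<le> norm (sup_norm g * \<bar>f x\<bar>)"
    using M_b_abs_le[OF assms(2)] M_b_sup_norm_nonneg[OF assms(2)]
    by (auto simp: abs_mult mult.commute[of "\<bar>f _\<bar>"] intro!: mult_right_mono)
qed

lemma integral_abs_bound_M_b:
  fixes f g :: "'d::finite func"
  assumes "integrable lborel f" "g \<in> M_b"
  shows "\<bar>\<integral>x. f x * g x \<partial>lborel\<bar> \<le> sup_norm g * (\<integral>x. \<bar>f x\<bar> \<partial>lborel)"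
proof -
  have "\<bar>\<integral>x. f x * g x \<partial>lborel\<bar> \<le> (\<integral>x. sup_norm g * \<bar>f x\<bar> \<partial>lborel)"
  proof (intro order_trans[OF integral_abs_bound] integral_mono)
    show "integrable lborel (\<lambda>x. \<bar>f x * g x\<bar>)"
      using integrable_times_M_b[OF assms] by (rule integrable_abs)
    show "integrable lborel (\<lambda>x. sup_norm g * \<bar>f x\<bar>)"
      using assms(1) by (intro integrable_mult_right integrable_abs)
    show "\<bar>f x * g x\<bar> \<le> sup_norm g * \<bar>f x\<bar>" for x
      using M_b_abs_le[OF assms(2), of x]
      by (auto simp: abs_mult mult.commute[of "\<bar>f _\<bar>"] intro!: mult_right_mono)
  qed
  then show ?thesis by simp
qed

lemma test_functional_integral:
  fixes g :: "'d::finite func"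
  assumes "integrable lborel g"
  shows "test_functional (\<integral>x. \<bar>g x\<bar> \<partial>lborel) (\<lambda>h. \<integral>y. g y * h y \<partial>lborel)"
  unfolding test_functional_def
proof (intro conjI ballI allI)
  fix f h :: "'d func" and a b :: real
  assume "f \<in> C_c_inf" "h \<in> C_c_inf"
  then have "integrable lborel (\<lambda>y. g y * f y)" "integrable lborel (\<lambda>y. g y * h y)"
    using integrable_times_M_b[OF assms] C_c_inf_subset_M_b by blast+
  then have "(\<integral>y. a * (g y * f y) + b * (g y * h y) \<partial>lborel)
      = a * (\<integral>y. g y * f y \<partial>lborel) + b * (\<integral>y. g y * h y \<partial>lborel)" by simp
  then show "(\<integral>y. g y * (a * f y + b * h y) \<partial>lborel)
      = a * (\<integral>y. g y * f y \<partial>lborel) + b * (\<integral>y. g y * h y \<partial>lborel)"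
    by (simp add: algebra_simps)
next
  fix f :: "'d func" assume "f \<in> C_c_inf"
  then show "\<bar>\<integral>y. g y * f y \<partial>lborel\<bar> \<le> (\<integral>x. \<bar>g x\<bar> \<partial>lborel) * sup_norm f"
    using integral_abs_bound_M_b[OF assms C_c_inf_subset_M_b] by (simp add: mult.commute)
qed

lemma conv_C_c_inf:
  fixes g :: "'d::finite func"
  assumes g: "g \<in> M_b" "compact K" "\<forall>x. x \<notin> K \<longrightarrow> g x = 0" and F: "F \<in> C_c_inf"
  shows "conv F g \<in> C_c_inf" and "mpartial \<gamma> (conv F g) = conv (mpartial \<gamma> F) g"
proof -
  let ?L = "\<lambda>h. \<integral>y. g y * h y \<partial>lborel"
  have L: "test_functional (\<integral>x. \<bar>g x\<bar> \<partial>lborel) ?L"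
    using test_functional_integral M_b_compact_integrable g by blast
  have eq: "conv F g = (\<lambda>z. ?L (\<lambda>y. F (z - y)))" for F by (simp add: conv_def)
  obtain K' where K': "compact K'" "\<And>x. x \<notin> K' \<Longrightarrow> F x = 0" using F C_c_infE by metis
  show "conv F g \<in> C_c_inf"
  proof (rule C_c_infI)
    show "C_k q (conv F g)" for q unfolding eq by (rule C_k_test_functional[OF L F])
    show "compact {x + y |x y. x \<in> K \<and> y \<in> K'}" using g(2) K'(1) by (rule compact_sums)
    fix z assume z: "z \<notin> {x + y |x y. x \<in> K \<and> y \<in> K'}"
    have "g y * F (z - y) = 0" for y
    proof (rule ccontr)
      assume "g y * F (z - y) \<noteq> 0"
      then have "y \<in> K" "z - y \<in> K'" using g(3) K'(2) by force+
      then have "y + (z - y) \<in> {x + y |x y. x \<in> K \<and> y \<in> K'}" by blast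
      then have "z \<in> {x + y |x y. x \<in> K \<and> y \<in> K'}" by (simp only: add_diff_cancel_left' add_diff_eq)
      with z show False by contradiction
    qed
    then show "conv F g z = 0" by (simp only: conv_def Bochner_Integration.integral_zero)
  qed
  show "mpartial \<gamma> (conv F g) = conv (mpartial \<gamma> F) g"
    unfolding eq by (rule mpartial_test_functional[OF L F])
qed

subsection \<open>The density of a regularising functional\<close>

text \<open>A measurable map close to the identity that takes finitely many values on a bounded set; integrals of functions of
  \<open>lattice_round \<eta> y\<close> over such a set are finite sums.\<close>

definition lattice_round :: "real \<Rightarrow> real ^ 'd::finite \<Rightarrow> real ^ 'd" where
  "lattice_round \<eta> y = (\<chi> i. \<eta> * real_of_int \<lfloor>y $ i / \<eta>\<rfloor>)"

lemma lattice_round_measurable: "lattice_round \<eta> \<in> borel_measurable borel"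
  unfolding lattice_round_def
proof (subst borel_measurable_euclidean_space, intro ballI)
  fix b :: "real ^ 'a" assume "b \<in> Basis"
  then obtain i where b: "b = axis i 1" by (auto simp: Basis_vec_def)
  have [measurable]: "(\<lambda>x :: real ^ 'a. x $ i) \<in> borel_measurable borel"
    by (intro borel_measurable_continuous_onI continuous_intros)
  have "(\<lambda>x. \<eta> * real_of_int \<lfloor>x $ i / \<eta>\<rfloor>) \<in> borel_measurable (borel :: (real ^ 'a) measure)"
    by measurable
  then show "(\<lambda>x. (\<chi> i. \<eta> * real_of_int \<lfloor>x $ i / \<eta>\<rfloor>) \<bullet> b) \<in> borel_measurable borel"
    by (simp add: b inner_axis)
qed

lemma lattice_round_near:
  fixes y :: "real ^ 'd::finite"
  assumes "\<eta> > 0"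
  shows "norm (lattice_round \<eta> y - y) \<le> real (CARD('d)) * \<eta>"
proof -
  have "\<bar>(lattice_round \<eta> y - y) $ i\<bar> \<le> \<eta>" for i
  proof -
    have "(lattice_round \<eta> y - y) $ i = \<eta> * (real_of_int \<lfloor>y $ i / \<eta>\<rfloor> - y $ i / \<eta>)"
      using assms by (simp add: lattice_round_def right_diff_distrib)
    moreover have "\<bar>real_of_int \<lfloor>y $ i / \<eta>\<rfloor> - y $ i / \<eta>\<bar> \<le> 1" by linarith
    ultimately show ?thesis using assms by (simp add: abs_mult mult_left_le)
  qed
  then have "(\<Sum>i\<in>UNIV. \<bar>(lattice_round \<eta> y - y) $ i\<bar>) \<le> (\<Sum>i\<in>(UNIV :: 'd set). \<eta>)"
    by (intro sum_mono)
  then show ?thesis using norm_le_l1_cart[of "lattice_round \<eta> y - y"] by simp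
qed

lemma finite_lattice_round:
  fixes K :: "(real ^ 'd::finite) set"
  assumes "\<eta> > 0" "bounded K"
  shows "finite (lattice_round \<eta> ` K)"
proof -
  obtain B where B: "\<And>x. x \<in> K \<Longrightarrow> norm x \<le> B" using assms(2) unfolding bounded_iff by blast
  define S where "S = (\<lambda>k :: 'd \<Rightarrow> int. (\<chi> i. \<eta> * real_of_int (k i)) :: real ^ 'd) `
    PiE UNIV (\<lambda>_. {\<lfloor>- B / \<eta>\<rfloor>..\<lfloor>B / \<eta>\<rfloor>})"
  have "lattice_round \<eta> x \<in> S" if "x \<in> K" for x
  proof -
    have "\<bar>x $ i\<bar> \<le> B" for i using component_le_norm_cart[of x i] B[OF that] by linarith
    then have "- B \<le> x $ i \<and> x $ i \<le> B" for i by (simp add: abs_le_iff minus_le_iff)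
    then have "- B / \<eta> \<le> x $ i / \<eta> \<and> x $ i / \<eta> \<le> B / \<eta>" for i
      using assms(1) divide_right_mono less_imp_le by metis
    then have "(\<lambda>i. \<lfloor>x $ i / \<eta>\<rfloor>) \<in> PiE UNIV (\<lambda>_. {\<lfloor>- B / \<eta>\<rfloor>..\<lfloor>B / \<eta>\<rfloor>})"
      by (auto intro!: floor_mono)
    then show ?thesis unfolding S_def lattice_round_def
      by (rule image_eqI[where x = "\<lambda>i. \<lfloor>x $ i / \<eta>\<rfloor>", rotated]) simp
  qed
  moreover have "finite S" unfolding S_def by (intro finite_imageI finite_PiE) auto
  ultimately show ?thesis by (meson finite_subset image_subsetI)
qed

text \<open>A sup-norm continuous functional commutes with the integral over translates: the integral is a
  uniform limit of finite sums, obtained by rounding the integration variable to a lattice. No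
  continuity in any weaker sense is available here.\<close>

lemma test_functional_integral_swap:
  fixes g :: "'d::finite func"
  assumes L: "test_functional M L" and F: "F \<in> C_c_inf"
    and g: "g \<in> M_b" "compact K" "\<forall>x. x \<notin> K \<longrightarrow> g x = 0"
  shows "L (\<lambda>z. \<integral>y. g y * F (y - z) \<partial>lborel) = (\<integral>y. g y * L (\<lambda>z. F (y - z)) \<partial>lborel)"
proof -
  define \<psi> where "\<psi> = (\<lambda>y. L (\<lambda>z. F (y - z)))"
  define A where "A = (\<integral>y. \<bar>g y\<bar> \<partial>lborel)"
  have gi: "integrable lborel g" using M_b_compact_integrable[OF g] .
  have A: "A \<ge> 0" by (simp add: A_def)
  have F': "(\<lambda>z. F (0 - z)) \<in> C_c_inf" using F by (rule C_c_inf_reflect)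
  let ?H = "\<lambda>z. \<integral>y. g y * F (y - z) \<partial>lborel"
  have "?H = conv (\<lambda>z. F (0 - z)) g" by (simp add: conv_def)
  then have H: "?H \<in> C_c_inf" using conv_C_c_inf(1)[OF g F'] by simp
  have \<psi>_cont: "continuous_on UNIV \<psi>"
    unfolding \<psi>_def using C_k_test_functional[OF L F, of 0] by simp
  have "\<bar>\<psi> y\<bar> \<le> \<bar>M\<bar> * sup_norm F" for y
    unfolding \<psi>_def using C_c_inf_reflect[OF F] C_c_inf_bounded[OF F] abs_le_sup_norm
    by (intro test_functional_le[OF L]) blast+
  then have \<psi>: "\<psi> \<in> M_b" using M_b_continuousI[OF \<psi>_cont] by blast
  have "\<bar>L ?H - (\<integral>y. g y * \<psi> y \<partial>lborel)\<bar> \<le> (2 * \<bar>M\<bar> * A) * e" if e: "e > 0" for e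
  proof -
    obtain d where d: "d > 0" "\<And>(u :: real ^ 'd) v. norm (u - v) < d \<Longrightarrow> \<bar>F u - F v\<bar> \<le> e"
      using C_c_inf_uniformly_continuous[OF F e] by blast
    define \<eta> where "\<eta> = d / (2 * real (CARD('d)))"
    have \<eta>: "\<eta> > 0" using d by (simp add: \<eta>_def)
    define s where "s = (lattice_round \<eta> :: real ^ 'd \<Rightarrow> real ^ 'd)"
    have s_near: "norm (s y - y) < d" for y
      using lattice_round_near[OF \<eta>, of y] d by (simp add: s_def \<eta>_def)
    have [measurable]: "s \<in> borel_measurable borel" unfolding s_def by (rule lattice_round_measurable)
    define V where "V = s ` K"
    have V: "finite V" unfolding V_def s_def
      using g(2) \<eta> by (intro finite_lattice_round compact_imp_bounded)
    have gs: "g y * \<phi> (s y) = (\<Sum>v\<in>V. \<phi> v * (g y * indicator (s -` {v}) y))" for y and \<phi> :: "'d func"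
    proof (cases "y \<in> K")
      case True
      then have "s y \<in> V" by (simp add: V_def)
      have "(\<Sum>v\<in>V. \<phi> v * (g y * indicator (s -` {v}) y)) = (\<Sum>v\<in>V. if v = s y then \<phi> v * g y else 0)"
        by (intro sum.cong) (auto simp: indicator_def)
      also have "\<dots> = \<phi> (s y) * g y" using \<open>s y \<in> V\<close> V by simp
      finally show ?thesis by simp
    qed (simp add: g(3))
    have gv: "integrable lborel (\<lambda>y. g y * indicator (s -` {v}) y)" for v
      using gi by (intro integrable_times_M_b M_b_I[where B = 1])
        (auto simp: indicator_def intro!: borel_measurable_indicator measurable_sets_borel)
    define c where "c v = (\<integral>y. g y * indicator (s -` {v}) y \<partial>lborel)" for v
    have sum_int: "integrable lborel (\<lambda>y. g y * \<phi> (s y))"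
      "(\<integral>y. g y * \<phi> (s y) \<partial>lborel) = (\<Sum>v\<in>V. c v * \<phi> v)" for \<phi> :: "'d func"
    proof -
      show "integrable lborel (\<lambda>y. g y * \<phi> (s y))"
        unfolding gs using gv by (intro Bochner_Integration.integrable_sum integrable_mult_right)
      show "(\<integral>y. g y * \<phi> (s y) \<partial>lborel) = (\<Sum>v\<in>V. c v * \<phi> v)"
        unfolding gs c_def using gv
        by (subst Bochner_Integration.integral_sum) (auto simp: mult.commute)
    qed
    have close: "\<bar>(\<integral>y. g y * \<phi> y \<partial>lborel) - (\<Sum>v\<in>V. c v * \<phi> v)\<bar> \<le> A * e'"
      if "\<phi> \<in> M_b" "\<And>y. \<bar>\<phi> y - \<phi> (s y)\<bar> \<le> e'" for \<phi> :: "'d func" and e'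
    proof -
      have "(\<integral>y. g y * \<phi> y \<partial>lborel) - (\<Sum>v\<in>V. c v * \<phi> v)
          = (\<integral>y. g y * \<phi> y - g y * \<phi> (s y) \<partial>lborel)"
        using integrable_times_M_b[OF gi that(1)] sum_int[of \<phi>] by simp
      also have "\<bar>\<dots>\<bar> \<le> (\<integral>y. \<bar>g y\<bar> * e' \<partial>lborel)"
      proof (intro order_trans[OF integral_abs_bound] integral_mono)
        show "integrable lborel (\<lambda>y. \<bar>g y * \<phi> y - g y * \<phi> (s y)\<bar>)"
          using integrable_times_M_b[OF gi that(1)] sum_int(1)[of \<phi>]
          by (intro integrable_abs Bochner_Integration.integrable_diff)
        show "integrable lborel (\<lambda>y. \<bar>g y\<bar> * e')"
          using gi by (intro integrable_mult_left integrable_abs)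
        show "\<bar>g y * \<phi> y - g y * \<phi> (s y)\<bar> \<le> \<bar>g y\<bar> * e'" for y
          using that(2)[of y] by (simp add: right_diff_distrib[symmetric] abs_mult mult_left_mono)
      qed
      finally show ?thesis by (simp add: A_def)
    qed
    have 1: "\<bar>(\<integral>y. g y * \<psi> y \<partial>lborel) - (\<Sum>v\<in>V. c v * \<psi> v)\<bar> \<le> A * (\<bar>M\<bar> * e)"
    proof (rule close[OF \<psi>])
      fix y
      have "\<psi> y - \<psi> (s y) = L (\<lambda>z. F (y - z) - F (s y - z))"
        unfolding \<psi>_def by (rule test_functional_diff[OF L C_c_inf_reflect[OF F] C_c_inf_reflect[OF F], symmetric])
      also have "\<bar>\<dots>\<bar> \<le> \<bar>M\<bar> * e"
      proof (rule test_functional_le[OF L])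
        show "(\<lambda>z. F (y - z) - F (s y - z)) \<in> C_c_inf"
          using C_c_inf_lincomb[OF C_c_inf_reflect[OF F, of y] C_c_inf_reflect[OF F, of "s y"], of 1 "-1"]
          by simp
        show "\<bar>F (y - z) - F (s y - z)\<bar> \<le> e" for z
          using s_near[of y] by (intro d(2)) (simp add: norm_minus_commute)
      qed
      finally show "\<bar>\<psi> y - \<psi> (s y)\<bar> \<le> \<bar>M\<bar> * e" .
    qed
    have fin: "(\<lambda>z. \<Sum>v\<in>V. c v * F (v - z)) \<in> C_c_inf"
      using V C_c_inf_reflect[OF F] by (intro C_c_inf_sum[of V "\<lambda>v z. F (v - z)"]) auto
    have "(\<Sum>v\<in>V. c v * \<psi> v) = L (\<lambda>z. \<Sum>v\<in>V. c v * F (v - z))"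
      unfolding \<psi>_def using test_functional_sum[OF L V, of "\<lambda>v z. F (v - z)" c] C_c_inf_reflect[OF F] by simp
    then have "L ?H - (\<Sum>v\<in>V. c v * \<psi> v) = L (\<lambda>z. ?H z - (\<Sum>v\<in>V. c v * F (v - z)))"
      using test_functional_diff[OF L H fin] by simp
    also have "\<bar>\<dots>\<bar> \<le> \<bar>M\<bar> * (A * e)"
    proof (rule test_functional_le[OF L])
      show "(\<lambda>z. ?H z - (\<Sum>v\<in>V. c v * F (v - z))) \<in> C_c_inf"
        using C_c_inf_lincomb[OF H fin, of 1 "-1"] by simp
      fix z
      have Fz: "(\<lambda>y. F (y - z)) \<in> M_b"
        using C_c_inf_subset_M_b[OF C_c_inf_reflect[OF F', of z]] by simp
      show "\<bar>?H z - (\<Sum>v\<in>V. c v * F (v - z))\<bar> \<le> A * e"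
        using s_near by (intro close[OF Fz] d(2)) (simp add: norm_minus_commute)
    qed
    finally show ?thesis using 1 by (simp add: abs_le_iff algebra_simps)
  qed
  moreover have "((\<lambda>e. (2 * \<bar>M\<bar> * A) * e) \<longlongrightarrow> (2 * \<bar>M\<bar> * A) * 0) (at_right 0)"
    by (intro tendsto_intros)
  ultimately have "\<bar>L ?H - (\<integral>y. g y * \<psi> y \<partial>lborel)\<bar> \<le> (2 * \<bar>M\<bar> * A) * 0"
    by (intro tendsto_lowerbound[of "\<lambda>e. (2 * \<bar>M\<bar> * A) * e" _ "at_right 0"])
      (auto simp: eventually_at_right_less eventually_at_filter)
  then show ?thesis by (simp add: \<psi>_def)
qed

text \<open>If \<open>L\<close> absorbs up to \<open>\<kappa>\<close> derivatives, then its density after mollification is bounded in the norm of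
  order \<open>\<kappa>\<close> of the integrable scale. The \<open>L\<^sub>1\<close> norm of a derivative is computed by testing against
  its sign, which turns it into \<open>L\<close> applied to the same derivative of a convolution.\<close>

lemma regularising_functional_density:
  fixes L :: "'d::finite func \<Rightarrow> real"
  assumes L: "test_functional M L" and M: "M \<ge> 0" and \<rho>: "mollifier \<epsilon> \<rho>"
    and reg: "\<And>\<gamma> h. msize \<gamma> \<le> \<kappa> \<Longrightarrow> h \<in> C_c_inf \<Longrightarrow> \<bar>L (mpartial \<gamma> h)\<bar> \<le> M * sup_norm h"
  defines "\<psi> \<equiv> \<lambda>y. L (\<lambda>z. \<rho> (y - z))"
  shows "\<psi> \<in> C_1 \<kappa>"
    and "norm_1 \<kappa> \<psi> \<le> real (card {\<gamma> :: 'd \<Rightarrow> nat. msize \<gamma> \<le> \<kappa>}) * M"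
    and "\<And>g K. g \<in> M_b \<Longrightarrow> compact K \<Longrightarrow> \<forall>x. x \<notin> K \<longrightarrow> g x = 0 \<Longrightarrow>
      L (conv \<rho> g) = (\<integral>y. g y * \<psi> y \<partial>lborel)"
proof -
  have \<rho>C: "\<rho> \<in> C_c_inf" and \<rho>0: "\<And>x. 0 \<le> \<rho> x" and \<rho>1: "(\<integral>x. \<rho> x \<partial>lborel) = 1"
    and even: "\<And>x. \<rho> (- x) = \<rho> x" using \<rho> by (auto simp: mollifier_def)
  \<comment> \<open>The density involves \<open>\<rho> (y - z)\<close>, the convolution \<open>\<rho> (z - y)\<close>. Since \<open>\<rho>\<close> is even, their derivatives differ by a sign.\<close>
  have parity: "mpartial \<gamma> \<rho> (z - y) = (-1) ^ msize \<gamma> * mpartial \<gamma> \<rho> (y - z)" for \<gamma> z y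
  proof -
    have "(\<lambda>z. \<rho> (0 - z)) = \<rho>" using even by simp
    then have "mpartial \<gamma> \<rho> (z - y) = mpartial \<gamma> (\<lambda>z. \<rho> (0 - z)) (z - y)" by simp
    also have "\<dots> = (-1) ^ msize \<gamma> * mpartial \<gamma> \<rho> (0 - (z - y))"
      unfolding mpartial_reflect[OF \<rho>C] ..
    finally show ?thesis by simp
  qed
  have m: "mpartial \<gamma> \<psi> = (\<lambda>y. L (\<lambda>z. mpartial \<gamma> \<rho> (y - z)))" for \<gamma>
    unfolding \<psi>_def by (rule mpartial_test_functional[OF L \<rho>C])
  have swap: "(\<integral>y. g y * mpartial \<gamma> \<psi> y \<partial>lborel) = (-1) ^ msize \<gamma> * L (mpartial \<gamma> (conv \<rho> g))"
    if g: "g \<in> M_b" "compact K" "\<forall>x. x \<notin> K \<longrightarrow> g x = 0" for g K \<gamma>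
  proof -
    have c: "mpartial \<gamma> (conv \<rho> g) \<in> C_c_inf" using conv_C_c_inf(1)[OF g \<rho>C] C_c_inf_mpartial by blast
    have "(\<integral>y. g y * mpartial \<gamma> \<psi> y \<partial>lborel) = L (\<lambda>z. \<integral>y. g y * mpartial \<gamma> \<rho> (y - z) \<partial>lborel)"
      unfolding m by (rule test_functional_integral_swap[OF L C_c_inf_mpartial[OF \<rho>C] g, symmetric])
    also have "(\<lambda>z. \<integral>y. g y * mpartial \<gamma> \<rho> (y - z) \<partial>lborel)
        = (\<lambda>z. (-1) ^ msize \<gamma> * mpartial \<gamma> (conv \<rho> g) z + 0 * mpartial \<gamma> (conv \<rho> g) z)"
    proof
      fix z
      have "(\<integral>y. g y * mpartial \<gamma> \<rho> (y - z) \<partial>lborel)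
          = (\<integral>y. (-1) ^ msize \<gamma> * (g y * mpartial \<gamma> \<rho> (z - y)) \<partial>lborel)"
        by (intro Bochner_Integration.integral_cong refl) (subst parity, rule mult.left_commute)
      then show "(\<integral>y. g y * mpartial \<gamma> \<rho> (y - z) \<partial>lborel)
          = (-1) ^ msize \<gamma> * mpartial \<gamma> (conv \<rho> g) z + 0 * mpartial \<gamma> (conv \<rho> g) z"
        using fun_cong[OF conv_C_c_inf(2)[OF g \<rho>C, of \<gamma>], of z] by (simp add: conv_def)
    qed
    also have "L \<dots> = (-1) ^ msize \<gamma> * L (mpartial \<gamma> (conv \<rho> g))"
      unfolding test_functional_lincomb[OF L c c] by simp
    finally show ?thesis .
  qed
  show "L (conv \<rho> g) = (\<integral>y. g y * \<psi> y \<partial>lborel)"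
    if g: "g \<in> M_b" "compact K" "\<forall>x. x \<notin> K \<longrightarrow> g x = 0" for g K
    using swap[OF g, of "\<lambda>_. 0"] by (simp add: mpartial_zero msize_def)
  have bound: "integrable lborel (mpartial \<gamma> \<psi>) \<and> (\<integral>y. \<bar>mpartial \<gamma> \<psi> y\<bar> \<partial>lborel) \<le> M"
    if \<gamma>: "msize \<gamma> \<le> \<kappa>" for \<gamma>
  proof -
    define u where "u = mpartial \<gamma> \<psi>"
    have u_cont: "continuous_on UNIV u" unfolding u_def m
      using C_k_test_functional[OF L C_c_inf_mpartial[OF \<rho>C], of 0] by simp
    then have [measurable]: "u \<in> borel_measurable borel" by (rule borel_measurable_continuous_onI)
    have int_le: "(\<integral>\<^sup>+ y. ennreal \<bar>u y\<bar> * indicator (cball 0 (real k)) y \<partial>lborel) \<le> ennreal M" for k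
    proof -
      let ?B = "cball 0 (real k) :: (real ^ 'd) set"
      \<comment> \<open>The truncated sign of \<open>u\<close> turns the pairing with \<open>u\<close> into the integral of \<open>|u|\<close> over a ball.\<close>
      define g where "g y = indicator ?B y * sgn (u y)" for y
      have g: "g \<in> M_b" "\<forall>x. x \<notin> ?B \<longrightarrow> g x = 0" "\<And>x. \<bar>g x\<bar> \<le> 1"
        by (auto intro!: M_b_I[where B = 1] simp: g_def[abs_def] indicator_def sgn_if)
      have c: "conv \<rho> g \<in> C_c_inf" using conv_C_c_inf(1)[OF g(1) compact_cball g(2) \<rho>C] .
      have "\<bar>conv \<rho> g z\<bar> \<le> 1" for z
      proof -
        have i: "integrable lborel (\<lambda>y. \<rho> (z - y))"
          using integrable_reflect[OF C_c_inf_integrable[OF \<rho>C]] .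
        have "\<bar>conv \<rho> g z\<bar> \<le> (\<integral>y. \<rho> (z - y) \<partial>lborel)" unfolding conv_def
        proof (intro order_trans[OF integral_abs_bound] integral_mono)
          show "integrable lborel (\<lambda>y. \<bar>g y * \<rho> (z - y)\<bar>)"
            using integrable_times_M_b[OF i g(1)] by (intro integrable_abs) (simp add: mult.commute)
          show "\<bar>g y * \<rho> (z - y)\<bar> \<le> \<rho> (z - y)" for y
            using g(3)[of y] \<rho>0[of "z - y"] by (simp add: abs_mult mult_left_le_one_le)
        qed (rule i)
        also have "\<dots> = 1" using integral_reflect[of \<rho> z] \<rho>1 C_c_inf_subset_M_b[OF \<rho>C] by (simp add: M_b_def)
        finally show ?thesis .
      qed
      then have "sup_norm (conv \<rho> g) \<le> 1" by (rule sup_norm_le)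
      then have "\<bar>L (mpartial \<gamma> (conv \<rho> g))\<bar> \<le> M"
        using order_trans[OF reg[OF \<gamma> c] mult_left_mono[OF _ M]] by fastforce
      then have "\<bar>\<integral>y. g y * u y \<partial>lborel\<bar> \<le> M"
        unfolding u_def swap[OF g(1) compact_cball g(2)] by (simp add: abs_mult power_abs)
      moreover have gu: "g y * u y = indicator ?B y *\<^sub>R \<bar>u y\<bar>" for y
        by (simp add: g_def abs_sgn mult.commute)
      moreover have "integrable lborel (\<lambda>y. indicator ?B y *\<^sub>R \<bar>u y\<bar>)"
        using u_cont by (intro borel_integrable_compact continuous_on_rabs) (auto intro: continuous_on_subset)
      ultimately have "(\<integral>\<^sup>+ y. ennreal (indicator ?B y *\<^sub>R \<bar>u y\<bar>) \<partial>lborel) \<le> ennreal M"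
        by (subst nn_integral_eq_integral) (auto intro!: ennreal_leI)
      then show ?thesis by (simp add: ennreal_mult'' ennreal_indicator mult.commute)
    qed
    have "(\<integral>\<^sup>+ y. ennreal \<bar>u y\<bar> \<partial>lborel)
        = (SUP k. \<integral>\<^sup>+ y. ennreal \<bar>u y\<bar> * indicator (cball 0 (real k)) y \<partial>lborel)"
    proof (subst nn_integral_monotone_convergence_SUP[symmetric])
      show "incseq (\<lambda>k y. ennreal \<bar>u y\<bar> * indicator (cball 0 (real k)) y)"
        by (auto simp: incseq_def le_fun_def indicator_def)
      have "(SUP k. ennreal \<bar>u y\<bar> * indicator (cball 0 (real k)) y) = ennreal \<bar>u y\<bar>" for y
      proof (rule antisym)
        obtain k :: nat where "norm y \<le> real k" using real_arch_simple by blast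
        then show "ennreal \<bar>u y\<bar> \<le> (SUP k. ennreal \<bar>u y\<bar> * indicator (cball 0 (real k)) y)"
          by (intro SUP_upper2[of k]) auto
      qed (auto intro!: SUP_least simp: indicator_def)
      then show "(\<integral>\<^sup>+ y. ennreal \<bar>u y\<bar> \<partial>lborel)
          = (\<integral>\<^sup>+ y. (SUP k. ennreal \<bar>u y\<bar> * indicator (cball 0 (real k)) y) \<partial>lborel)" by simp
      have "indicator (cball 0 (real k) :: (real ^ 'd) set) \<in> borel_measurable lborel" for k
        by (intro borel_measurable_indicator) auto
      then show "(\<lambda>y. ennreal \<bar>u y\<bar> * indicator (cball 0 (real k)) y) \<in> borel_measurable lborel" for k
        by (intro borel_measurable_times_ennreal) auto
    qed
    also have "\<dots> \<le> ennreal M" using int_le by (rule SUP_least)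
    finally have fin: "(\<integral>\<^sup>+ y. ennreal \<bar>u y\<bar> \<partial>lborel) \<le> ennreal M" .
    have i: "integrable lborel u"
      using fin by (intro integrableI_bounded) (auto simp: le_less_trans)
    have "ennreal (\<integral>y. \<bar>u y\<bar> \<partial>lborel) \<le> ennreal M"
      using fin nn_integral_eq_integral[OF integrable_abs[OF i]] by simp
    then show ?thesis using i M unfolding u_def by (simp add: ennreal_le_iff)
  qed
  have "C_k \<kappa> \<psi>" unfolding \<psi>_def by (rule C_k_test_functional[OF L \<rho>C])
  then show "\<psi> \<in> C_1 \<kappa>" using bound by (simp add: C_1_def)
  show "norm_1 \<kappa> \<psi> \<le> real (card {\<gamma> :: 'd \<Rightarrow> nat. msize \<gamma> \<le> \<kappa>}) * M"
    unfolding norm_1_def using bound by (intro sum_bounded_above) auto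
qed

section \<open>Operators on bounded measurable functions\<close>

text \<open>Continuity under bounded pointwise convergence expresses that a functional is given by a measure. Unlike a
  representation by kernels it passes to compositions at once, and it is what all limits below rest on.\<close>

definition mb_functional :: "('d::finite func \<Rightarrow> real) \<Rightarrow> bool" where
  "mb_functional \<Lambda> \<longleftrightarrow>
     (\<forall>f\<in>M_b. \<forall>g\<in>M_b. \<forall>a b. \<Lambda> (\<lambda>x. a * f x + b * g x) = a * \<Lambda> f + b * \<Lambda> g) \<and>
     (\<forall>F f B. (\<forall>k. F k \<in> M_b) \<longrightarrow> (\<forall>k x. \<bar>F k x\<bar> \<le> B) \<longrightarrow>
        (\<forall>x. (\<lambda>k :: nat. F k x) \<longlonglongrightarrow> f x) \<longrightarrow> (\<lambda>k. \<Lambda> (F k)) \<longlonglongrightarrow> \<Lambda> f)"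

definition mb_operator :: "real \<Rightarrow> 'd::finite operator \<Rightarrow> bool" where
  "mb_operator b A \<longleftrightarrow> 0 \<le> b \<and> (\<forall>f\<in>M_b. A f \<in> M_b \<and> sup_norm (A f) \<le> b * sup_norm f) \<and>
     (\<forall>x. mb_functional (\<lambda>f. A f x))"

lemma mb_functional_lincomb:
  "mb_functional \<Lambda> \<Longrightarrow> f \<in> M_b \<Longrightarrow> g \<in> M_b \<Longrightarrow>
    \<Lambda> (\<lambda>x. a * f x + b * g x) = a * \<Lambda> f + b * \<Lambda> g"
  unfolding mb_functional_def by blast

lemma mb_functional_add:
  "mb_functional \<Lambda> \<Longrightarrow> f \<in> M_b \<Longrightarrow> g \<in> M_b \<Longrightarrow> \<Lambda> (\<lambda>x. f x + g x) = \<Lambda> f + \<Lambda> g"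
  using mb_functional_lincomb[of \<Lambda> f g 1 1] by simp

lemma mb_functional_diff:
  "mb_functional \<Lambda> \<Longrightarrow> f \<in> M_b \<Longrightarrow> g \<in> M_b \<Longrightarrow> \<Lambda> (\<lambda>x. f x - g x) = \<Lambda> f - \<Lambda> g"
  using mb_functional_lincomb[of \<Lambda> f g 1 "-1"] by simp

lemma mb_functional_tendsto:
  "mb_functional \<Lambda> \<Longrightarrow> (\<And>k. F k \<in> M_b) \<Longrightarrow> (\<And>k x. \<bar>F k x\<bar> \<le> B) \<Longrightarrow>
    (\<And>x. (\<lambda>k :: nat. F k x) \<longlonglongrightarrow> f x) \<Longrightarrow> (\<lambda>k. \<Lambda> (F k)) \<longlonglongrightarrow> \<Lambda> f"
  unfolding mb_functional_def by blast

lemma M_b_limit: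
  assumes "\<And>k. F k \<in> M_b" "\<And>k x. \<bar>F k x\<bar> \<le> B" "\<And>x. (\<lambda>k :: nat. F k x) \<longlonglongrightarrow> f x"
  shows "f \<in> M_b" and "\<bar>f x\<bar> \<le> B"
proof -
  show *: "\<bar>f x\<bar> \<le> B" for x
    using assms by (intro tendsto_upperbound[OF tendsto_rabs[OF assms(3)]]) auto
  have "f \<in> borel_measurable borel"
    using assms(3) M_b_D(1)[OF assms(1)] by (rule borel_measurable_LIMSEQ_real)
  then show "f \<in> M_b" using * by (rule M_b_I)
qed

lemma mb_functional_eval: "mb_functional (\<lambda>f. f x)"
  unfolding mb_functional_def by simp

lemma mb_operatorD:
  assumes "mb_operator b A"
  shows "f \<in> M_b \<Longrightarrow> A f \<in> M_b" "f \<in> M_b \<Longrightarrow> sup_norm (A f) \<le> b * sup_norm f"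
    "mb_functional (\<lambda>f. A f x)" "0 \<le> b"
  using assms unfolding mb_operator_def by blast+

lemma mb_operator_abs_le: "mb_operator b A \<Longrightarrow> f \<in> M_b \<Longrightarrow> \<bar>A f x\<bar> \<le> b * sup_norm f"
proof -
  assume A: "mb_operator b A" and f: "f \<in> M_b"
  show ?thesis using M_b_abs_le[OF mb_operatorD(1)[OF A f]] mb_operatorD(2)[OF A f] by (rule order_trans)
qed

lemma mb_operator_lincomb_apply:
  assumes "mb_operator b A" "f \<in> M_b" "g \<in> M_b"
  shows "A (\<lambda>x. a * f x + c * g x) = (\<lambda>x. a * A f x + c * A g x)"
  using mb_functional_lincomb[OF mb_operatorD(3)[OF assms(1)] assms(2,3)] by blast

lemma mb_operator_diff_apply:
  assumes "mb_operator b A" "f \<in> M_b" "g \<in> M_b"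
  shows "A (\<lambda>x. f x - g x) = (\<lambda>x. A f x - A g x)"
  using mb_operator_lincomb_apply[OF assms, of 1 "-1"] by simp

lemma mb_operatorI:
  assumes "0 \<le> b" "\<And>f. f \<in> M_b \<Longrightarrow> A f \<in> borel_measurable borel"
    "\<And>f x. f \<in> M_b \<Longrightarrow> \<bar>A f x\<bar> \<le> b * sup_norm f" "\<And>x. mb_functional (\<lambda>f. A f x)"
  shows "mb_operator b A"
  unfolding mb_operator_def
proof (intro conjI ballI allI)
  show "A f \<in> M_b" if "f \<in> M_b" for f by (rule M_b_I[OF assms(2,3)]) (use that in auto)
  show "sup_norm (A f) \<le> b * sup_norm f" if "f \<in> M_b" for f
    by (rule sup_norm_le) (rule assms(3)[OF that])
qed (use assms(1,4) in auto)

lemma mb_functional_cong: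
  fixes \<Lambda> \<Lambda>' :: "'d::finite func \<Rightarrow> real"
  assumes "mb_functional \<Lambda>" "\<And>f. f \<in> M_b \<Longrightarrow> \<Lambda>' f = \<Lambda> f"
  shows "mb_functional \<Lambda>'"
  unfolding mb_functional_def
proof (intro conjI ballI allI impI)
  fix f g :: "'d func" and a b assume "f \<in> M_b" "g \<in> M_b"
  then show "\<Lambda>' (\<lambda>x. a * f x + b * g x) = a * \<Lambda>' f + b * \<Lambda>' g"
    using mb_functional_lincomb[OF assms(1)] assms(2) by (simp add: M_b_lincomb)
next
  fix F :: "nat \<Rightarrow> 'd func" and f B
  assume F: "\<forall>k. F k \<in> M_b" "\<forall>k x. \<bar>F k x\<bar> \<le> B" "\<forall>x. (\<lambda>k :: nat. F k x) \<longlonglongrightarrow> f x"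
  then have "f \<in> M_b" using M_b_limit(1)[of F B f] by blast
  then show "(\<lambda>k. \<Lambda>' (F k)) \<longlonglongrightarrow> \<Lambda>' f"
    using mb_functional_tendsto[OF assms(1), of F B f] F assms(2) by simp
qed

lemma mb_operator_cong:
  assumes "mb_operator b A" "\<And>f. f \<in> M_b \<Longrightarrow> A' f = A f"
  shows "mb_operator b A'"
proof -
  have "mb_functional (\<lambda>f. A' f x)" for x
    by (rule mb_functional_cong[OF mb_operatorD(3)[OF assms(1)]]) (simp add: assms(2))
  with assms show ?thesis unfolding mb_operator_def by auto
qed

lemma mb_functional_comp:
  fixes \<Lambda> :: "'d::finite func \<Rightarrow> real"
  assumes \<Lambda>: "mb_functional \<Lambda>" and A: "mb_operator b A"
  shows "mb_functional (\<lambda>f. \<Lambda> (A f))"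
  unfolding mb_functional_def
proof (intro conjI ballI allI impI)
  fix f g :: "'d func" and a c assume "f \<in> M_b" "g \<in> M_b"
  then show "\<Lambda> (A (\<lambda>x. a * f x + c * g x)) = a * \<Lambda> (A f) + c * \<Lambda> (A g)"
    using mb_functional_lincomb[OF \<Lambda>] mb_operatorD(1)[OF A] mb_operator_lincomb_apply[OF A] by simp
next
  fix F :: "nat \<Rightarrow> 'd func" and f B
  assume F: "\<forall>k. F k \<in> M_b" "\<forall>k x. \<bar>F k x\<bar> \<le> B" "\<forall>x. (\<lambda>k :: nat. F k x) \<longlonglongrightarrow> f x"
  show "(\<lambda>k. \<Lambda> (A (F k))) \<longlonglongrightarrow> \<Lambda> (A f)"
  proof (rule mb_functional_tendsto[OF \<Lambda>])
    show "A (F k) \<in> M_b" for k using mb_operatorD(1)[OF A] F by blast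
    have "sup_norm (F k) \<le> B" for k using F by (intro sup_norm_le) auto
    then show "\<bar>A (F k) x\<bar> \<le> b * B" for k x
      using mb_operator_abs_le[OF A, of "F k" x] F(1) mb_operatorD(4)[OF A]
      by (meson mult_left_mono order_trans)
    show "(\<lambda>k. A (F k) x) \<longlonglongrightarrow> A f x" for x
      using mb_functional_tendsto[OF mb_operatorD(3)[OF A]] F by blast
  qed
qed

lemma mb_operator_comp:
  fixes A B :: "'d::finite operator"
  assumes A: "mb_operator a A" and B: "mb_operator b B"
  shows "mb_operator (a * b) (\<lambda>f. A (B f))"
  unfolding mb_operator_def
proof (intro conjI ballI allI)
  fix f :: "'d func" assume f: "f \<in> M_b"
  then show "A (B f) \<in> M_b" using mb_operatorD(1)[OF A] mb_operatorD(1)[OF B] by blast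
  have "sup_norm (A (B f)) \<le> a * sup_norm (B f)"
    using mb_operatorD(2)[OF A] mb_operatorD(1)[OF B f] by blast
  also have "\<dots> \<le> a * (b * sup_norm f)"
    using mb_operatorD(2)[OF B f] mb_operatorD(4)[OF A] by (rule mult_left_mono)
  finally show "sup_norm (A (B f)) \<le> a * b * sup_norm f" by (simp add: mult.assoc)
next
  show "0 \<le> a * b" using mb_operatorD(4)[OF A] mb_operatorD(4)[OF B] by simp
  show "mb_functional (\<lambda>f. A (B f) x)" for x
    by (rule mb_functional_comp[OF mb_operatorD(3)[OF A] B])
qed

lemma mb_operator_id: "mb_operator 1 (\<lambda>f. f)"
  unfolding mb_operator_def by (simp add: mb_functional_eval)

lemma mb_operator_mono: "mb_operator b A \<Longrightarrow> b \<le> b' \<Longrightarrow> mb_operator b' A"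
proof -
  assume A: "mb_operator b A" and b: "b \<le> b'"
  have "sup_norm (A f) \<le> b' * sup_norm f" if "f \<in> M_b" for f
    using mb_operatorD(2)[OF A that] mult_right_mono[OF b M_b_sup_norm_nonneg[OF that]] by linarith
  then show ?thesis using A b unfolding mb_operator_def by auto
qed

lemma mb_operator_lincomb:
  fixes A B :: "'d::finite operator"
  assumes A: "mb_operator b1 A" and B: "mb_operator b2 B"
  shows "mb_operator (\<bar>a\<bar> * b1 + \<bar>c\<bar> * b2) (\<lambda>f x. a * A f x + c * B f x)"
proof (rule mb_operatorI)
  show "0 \<le> \<bar>a\<bar> * b1 + \<bar>c\<bar> * b2"
    using mb_operatorD(4)[OF A] mb_operatorD(4)[OF B] by simp
  fix f :: "'d func" assume f: "f \<in> M_b"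
  show "(\<lambda>x. a * A f x + c * B f x) \<in> borel_measurable borel"
    using f M_b_lincomb[OF mb_operatorD(1)[OF A f] mb_operatorD(1)[OF B f]] M_b_D(1) by blast
  fix x
  have "\<bar>a * A f x + c * B f x\<bar> \<le> \<bar>a\<bar> * \<bar>A f x\<bar> + \<bar>c\<bar> * \<bar>B f x\<bar>"
    by (metis abs_mult abs_triangle_ineq)
  also have "\<dots> \<le> \<bar>a\<bar> * (b1 * sup_norm f) + \<bar>c\<bar> * (b2 * sup_norm f)"
    using mb_operator_abs_le[OF A f] mb_operator_abs_le[OF B f] by (intro add_mono mult_left_mono) auto
  finally show "\<bar>a * A f x + c * B f x\<bar> \<le> (\<bar>a\<bar> * b1 + \<bar>c\<bar> * b2) * sup_norm f"
    by (simp add: algebra_simps)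
next
  fix x
  have lA: "A (\<lambda>x. a' * f x + c' * g x) = (\<lambda>x. a' * A f x + c' * A g x)"
    if "f \<in> M_b" "g \<in> M_b" for f g a' c' using mb_operator_lincomb_apply[OF A that] .
  have lB: "B (\<lambda>x. a' * f x + c' * g x) = (\<lambda>x. a' * B f x + c' * B g x)"
    if "f \<in> M_b" "g \<in> M_b" for f g a' c' using mb_operator_lincomb_apply[OF B that] .
  show "mb_functional (\<lambda>f. a * A f x + c * B f x)"
    unfolding mb_functional_def
  proof (intro conjI ballI allI impI)
    fix f g :: "'d func" and a' c' assume "f \<in> M_b" "g \<in> M_b"
    then show "a * A (\<lambda>x. a' * f x + c' * g x) x + c * B (\<lambda>x. a' * f x + c' * g x) x
        = a' * (a * A f x + c * B f x) + c' * (a * A g x + c * B g x)"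
      by (simp add: lA lB algebra_simps)
  next
    fix F :: "nat \<Rightarrow> 'd func" and f C
    assume "\<forall>k. F k \<in> M_b" "\<forall>k x. \<bar>F k x\<bar> \<le> C" "\<forall>x. (\<lambda>k. F k x) \<longlonglongrightarrow> f x"
    then show "(\<lambda>k. a * A (F k) x + c * B (F k) x) \<longlonglongrightarrow> a * A f x + c * B f x"
      using mb_functional_tendsto[OF mb_operatorD(3)[OF A]] mb_functional_tendsto[OF mb_operatorD(3)[OF B]]
      by (intro tendsto_intros) blast+
  qed
qed

subsection \<open>From continuous to measurable functions\<close>

text \<open>The functions of all Baire classes. On a metric space these include the Borel functions, which reduces
  statements that are stable under limits to continuous functions.\<close>

inductive baire :: "('a::metric_space \<Rightarrow> real) \<Rightarrow> bool" where
  cont: "continuous_on UNIV f \<Longrightarrow> baire f"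
| lim: "(\<And>k :: nat. baire (F k)) \<Longrightarrow> (\<And>x. (\<lambda>k. F k x) \<longlonglongrightarrow> f x) \<Longrightarrow> baire f"

lemma baire_cont_lincomb:
  "baire g \<Longrightarrow> continuous_on UNIV f \<Longrightarrow> baire (\<lambda>x. a * f x + b * g x)"
proof (induction rule: baire.induct)
  case (cont g)
  show ?case by (rule baire.cont) (intro continuous_intros cont)
next
  case (lim F g)
  show ?case
  proof (rule baire.lim)
    show "baire (\<lambda>x. a * f x + b * F k x)" for k by (rule lim.IH[OF lim.prems])
    show "(\<lambda>k. a * f x + b * F k x) \<longlonglongrightarrow> a * f x + b * g x" for x
      by (intro tendsto_intros lim.hyps)
  qed
qed

lemma baire_lincomb: "baire f \<Longrightarrow> baire g \<Longrightarrow> baire (\<lambda>x. a * f x + b * g x)"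
proof (induction rule: baire.induct)
  case (cont f)
  then show ?case by (intro baire_cont_lincomb)
next
  case (lim F f)
  show ?case
  proof (rule baire.lim)
    show "baire (\<lambda>x. a * F k x + b * g x)" for k by (rule lim.IH[OF lim.prems])
    show "(\<lambda>k. a * F k x + b * g x) \<longlonglongrightarrow> a * f x + b * g x" for x
      by (intro tendsto_intros lim.hyps)
  qed
qed

text \<open>The indicator is the limit of the continuous functions \<open>(1 - k d(x, C))\<^sup>+\<close>.\<close>

lemma baire_indicator_closed:
  fixes C :: "'a::metric_space set"
  assumes "closed C"
  shows "baire (indicator C)"
proof (cases "C = {}")
  case True
  then show ?thesis by (auto intro!: baire.cont)
next
  case False
  show ?thesis
  proof (rule baire.lim)
    show "baire (\<lambda>x. max 0 (1 - real k * infdist x C))" for k :: nat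
      by (intro baire.cont continuous_intros)
    fix x
    show "(\<lambda>k. max 0 (1 - real k * infdist x C)) \<longlonglongrightarrow> indicator C x"
    proof (cases "x \<in> C")
      case False
      then have d: "infdist x C > 0"
        using assms \<open>C \<noteq> {}\<close> in_closed_iff_infdist_zero infdist_nonneg by (metis order_less_le)
      obtain n :: nat where n: "real n > 1 / infdist x C" using reals_Archimedean2 by blast
      have "\<forall>\<^sub>F k in sequentially. max 0 (1 - real k * infdist x C) = indicator C x"
      proof (rule eventually_sequentiallyI)
        fix k assume "n \<le> k"
        then have "real k * infdist x C \<ge> real n * infdist x C" using d by simp
        then show "max 0 (1 - real k * infdist x C) = indicator C x"
        proof -
          have "1 < real n * infdist x C" using n d by (simp add: field_simps)
          then have "1 - real k * infdist x C \<le> 0"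
            using \<open>real k * infdist x C \<ge> real n * infdist x C\<close> by linarith
          then show ?thesis using False by simp
        qed
      qed
      then show ?thesis by (rule tendsto_eventually)
    qed simp
  qed
qed

text \<open>The sets with a Baire indicator contain the closed sets and form a Dynkin system.\<close>

lemma baire_indicator:
  fixes A :: "'a::metric_space set"
  assumes "A \<in> sets borel"
  shows "baire (indicator A)"
proof -
  have "A \<in> sigma_sets UNIV (Collect closed)"
    using assms by (simp add: borel_eq_closed)
  have "Int_stable (Collect closed :: 'a set set)" by (auto simp: Int_stable_def)
  moreover have "Collect closed \<subseteq> Pow (UNIV :: 'a set)" by simp
  moreover note \<open>A \<in> sigma_sets UNIV (Collect closed)\<close>
  ultimately show ?thesis
  proof (induction rule: sigma_sets_induct_disjoint)
    case (compl A)
    have "indicator (UNIV - A) = (\<lambda>x :: 'a. 1 * 1 + (-1) * indicator A x :: real)"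
      by (auto simp: indicator_def fun_eq_iff)
    moreover have "baire (\<lambda>x. 1 * 1 + (-1) * indicator A x)"
      by (rule baire_lincomb[OF baire.cont[OF continuous_on_const] compl(2)])
    ultimately show ?case by (simp only:)
  next
    case (union A)
    have fin: "baire (\<lambda>x. \<Sum>i<n. indicator (A i) x)" for n :: nat
    proof (induction n)
      case (Suc n)
      then show ?case
        using baire_lincomb[OF Suc union(3)[of n], of 1 1] by (simp only: sum.lessThan_Suc mult_1)
    qed (simp add: baire.cont)
    show ?case
    proof (rule baire.lim[OF fin])
      show "(\<lambda>k. \<Sum>i<k. indicator (A i) x :: real) \<longlonglongrightarrow> indicator (\<Union> (range A)) x" for x
        using indicator_sums[of A x] union(1) by (simp add: sums_def disjoint_family_on_def)
    qed
  qed (auto intro: baire_indicator_closed baire.cont)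
qed

lemma baire_borel_measurable:
  fixes f :: "'a::metric_space \<Rightarrow> real"
  assumes "f \<in> borel_measurable borel"
  shows "baire f"
proof -
  obtain F where F: "\<And>i :: nat. simple_function borel (F i)" "\<And>x. (\<lambda>i. F i x) \<longlonglongrightarrow> f x"
    using borel_measurable_implies_sequence_metric[OF assms, of 0] by auto
  have "baire (F i)" for i
  proof -
    let ?R = "range (F i)"
    have fin: "finite ?R" using simple_functionD(1)[OF F(1)[of i]] by simp
    have "baire (\<lambda>x. \<Sum>y\<in>S. y * indicator (F i -` {y}) x)" if "finite S" for S using that
    proof (induction S rule: finite_induct)
      case (insert y S)
      have "baire (indicator (F i -` {y}))"
        using simple_functionD(2)[OF F(1)[of i], of "{y}"] by (intro baire_indicator) simp
      from baire_lincomb[OF this insert(3), of y 1]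
      show ?case by (simp only: sum.insert[OF insert(1,2)] mult_1)
    qed (simp add: baire.cont)
    from this[OF fin] have "baire (\<lambda>x. \<Sum>y\<in>?R. y * indicator (F i -` {y}) x)" .
    moreover have "(\<Sum>y\<in>?R. y * indicator (F i -` {y}) x) = F i x" for x
    proof -
      have "(\<Sum>y\<in>?R. y * indicator (F i -` {y}) x) = (\<Sum>y\<in>?R. if y = F i x then y else 0)"
        by (intro sum.cong) (auto simp: indicator_def)
      then show ?thesis using fin by simp
    qed
    ultimately show ?thesis by simp
  qed
  then show ?thesis using F(2) by (rule baire.lim)
qed

text \<open>A sup-norm bound on continuous functions extends to all bounded measurable functions: the truncations
  of a Baire function at a fixed level satisfy the bound, by induction over the Baire hierarchy.\<close>

lemma mb_functional_bound_extend:
  assumes \<Lambda>: "mb_functional \<Lambda>" and bound: "\<And>f. f \<in> C_b 0 \<Longrightarrow> \<bar>\<Lambda> f\<bar> \<le> C * sup_norm f"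
    and f: "f \<in> M_b" and C: "C \<ge> 0"
  shows "\<bar>\<Lambda> f\<bar> \<le> C * sup_norm f"
proof -
  define m where "m = sup_norm f"
  have m: "m \<ge> 0" using M_b_sup_norm_nonneg[OF f] by (simp add: m_def)
  have "(\<lambda>x. max (- m) (min m (g x))) \<in> M_b \<and> \<bar>\<Lambda> (\<lambda>x. max (- m) (min m (g x)))\<bar> \<le> C * m"
    if "baire g" for g using that
  proof (induction rule: baire.induct)
    case (cont g)
    let ?h = "\<lambda>x. max (- m) (min m (g x))"
    have h: "\<bar>?h x\<bar> \<le> m" for x using m by auto
    have c: "continuous_on UNIV ?h" using cont by (intro continuous_intros)
    then have "?h \<in> C_b 0" using h unfolding C_b_0_iff bounded_range_iff by blast
    moreover from this have "\<bar>\<Lambda> ?h\<bar> \<le> C * m"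
      using bound order_trans mult_left_mono[OF sup_norm_le[of ?h m] C] h by blast
    ultimately show ?case using C_b_subset_M_b by blast
  next
    case (lim F g)
    let ?h = "\<lambda>g x. max (- m) (min m (g x))"
    have 1: "\<bar>?h (F k) x\<bar> \<le> m" for k x using m by auto
    have 2: "(\<lambda>k. ?h (F k) x) \<longlonglongrightarrow> ?h g x" for x
      using lim(2) by (intro tendsto_intros) auto
    have "?h g \<in> M_b"
      by (rule M_b_limit(1)[of "\<lambda>k. ?h (F k)" m, OF _ 1 2]) (use lim(3) in blast)
    moreover have "(\<lambda>k. \<Lambda> (?h (F k))) \<longlonglongrightarrow> \<Lambda> (?h g)"
      by (rule mb_functional_tendsto[OF \<Lambda>, of "\<lambda>k. ?h (F k)" m, OF _ 1 2]) (use lim(3) in blast)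
    then have "\<bar>\<Lambda> (?h g)\<bar> \<le> C * m"
      by (rule tendsto_upperbound[OF tendsto_rabs]) (use lim(3) in auto)
    ultimately show ?case by blast
  qed
  from this[OF baire_borel_measurable[OF M_b_D(1)[OF f]]]
  have "\<bar>\<Lambda> (\<lambda>x. max (- m) (min m (f x)))\<bar> \<le> C * m" by blast
  moreover have "max (- m) (min m (f x)) = f x" for x
    using M_b_abs_le[OF f, of x] by (auto simp: m_def)
  ultimately show ?thesis by (simp add: m_def)
qed

subsection \<open>Discrete semigroups\<close>

lemma transition_nn_integral_measurable:
  fixes \<mu> :: "'a::topological_space \<Rightarrow> 'b::topological_space measure"
  assumes s: "\<And>x. sets (\<mu> x) = sets borel"
    and m: "\<And>A. A \<in> sets borel \<Longrightarrow> (\<lambda>x. emeasure (\<mu> x) A) \<in> borel_measurable borel"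
    and f: "f \<in> borel_measurable borel"
  shows "(\<lambda>x. \<integral>\<^sup>+ y. f y \<partial>\<mu> x) \<in> borel_measurable borel"
  using f
proof (induction rule: borel_measurable_induct)
  case (cong f g)
  then show ?case by simp
next
  case (set A)
  then show ?case using m s by simp
next
  case (mult u c)
  then have "u \<in> borel_measurable (\<mu> x)" for x using s by (simp cong: measurable_cong_sets)
  then show ?case using mult by (simp add: nn_integral_cmult)
next
  case (add u v)
  then have "u \<in> borel_measurable (\<mu> x)" "v \<in> borel_measurable (\<mu> x)" for x
    using s by (simp_all cong: measurable_cong_sets)
  then show ?case using add by (simp add: nn_integral_add)
next
  case (seq U)
  then have "U i \<in> borel_measurable (\<mu> x)" for i x using s by (simp cong: measurable_cong_sets)
  then have "(\<integral>\<^sup>+ y. (SUP i. U i y) \<partial>\<mu> x) = (SUP i. \<integral>\<^sup>+ y. U i y \<partial>\<mu> x)" for x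
    using seq by (intro nn_integral_monotone_convergence_SUP) auto
  then show ?case using seq by (simp add: image_comp)
qed

lemma mb_operator_transition:
  fixes \<mu> :: "real ^ 'd::finite \<Rightarrow> (real ^ 'd) measure"
  assumes s: "\<And>x. sets (\<mu> x) = sets borel" and fin: "\<And>x. finite_measure (\<mu> x)"
    and m: "\<And>A. A \<in> sets borel \<Longrightarrow> (\<lambda>x. emeasure (\<mu> x) A) \<in> borel_measurable borel"
    and b: "\<And>x. emeasure (\<mu> x) UNIV \<le> ennreal b" "b \<ge> 0"
  shows "mb_operator b (\<lambda>f x. \<integral>y. f y \<partial>\<mu> x)"
proof (rule mb_operatorI[OF b(2)])
  have space: "space (\<mu> x) = UNIV" for x using sets_eq_imp_space_eq[OF s] by simp
  have meas: "f \<in> borel_measurable (\<mu> x)" if "f \<in> M_b" for f x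
    using M_b_D(1)[OF that] s by (simp cong: measurable_cong_sets)
  have mass: "measure (\<mu> x) UNIV \<le> b" for x
    using b finite_measure.emeasure_eq_measure[OF fin] by (metis ennreal_le_iff)
  have int: "integrable (\<mu> x) f" if "f \<in> M_b" for f x
    using M_b_abs_le[OF that] meas[OF that]
    by (intro finite_measure.integrable_const_bound[OF fin, where B = "sup_norm f"]) auto
  fix f :: "'d func" and x assume f: "f \<in> M_b"
  show "(\<lambda>x. \<integral>y. f y \<partial>\<mu> x) \<in> borel_measurable borel"
  proof -
    let ?M = "sup_norm f"
    have "(\<integral>y. f y \<partial>\<mu> x) = enn2real (\<integral>\<^sup>+ y. ennreal (f y + ?M) \<partial>\<mu> x) - ?M * enn2real (emeasure (\<mu> x) UNIV)" for x
    proof -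
      have "(\<integral>y. f y + ?M \<partial>\<mu> x) = enn2real (\<integral>\<^sup>+ y. ennreal (f y + ?M) \<partial>\<mu> x)"
      proof (rule integral_eq_nn_integral)
        have "0 \<le> f y + ?M" for y using M_b_abs_le[OF f, of y] by linarith
        then show "AE y in \<mu> x. 0 \<le> f y + ?M" by simp
      qed (use meas[OF f] in simp)
      moreover have "(\<integral>y. f y + ?M \<partial>\<mu> x) = (\<integral>y. f y \<partial>\<mu> x) + ?M * measure (\<mu> x) UNIV"
        using Bochner_Integration.integral_add[OF int[OF f, of x] finite_measure.integrable_const[OF fin, of x ?M]]
          space by simp
      ultimately show ?thesis by (simp add: measure_def)
    qed
    moreover have "(\<lambda>x. enn2real (\<integral>\<^sup>+ y. ennreal (f y + ?M) \<partial>\<mu> x) - ?M * enn2real (emeasure (\<mu> x) UNIV))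
        \<in> borel_measurable borel"
    proof -
      have "(\<lambda>x. \<integral>\<^sup>+ y. ennreal (f y + ?M) \<partial>\<mu> x) \<in> borel_measurable borel"
        using M_b_D(1)[OF f] by (intro transition_nn_integral_measurable s m) auto
      moreover have "(\<lambda>x. emeasure (\<mu> x) UNIV) \<in> borel_measurable borel" by (intro m) simp
      ultimately show ?thesis by (intro borel_measurable_diff borel_measurable_times) auto
    qed
    ultimately show ?thesis by presburger
  qed
  have "\<bar>\<integral>y. f y \<partial>\<mu> x\<bar> \<le> (\<integral>y. sup_norm f \<partial>\<mu> x)"
    using M_b_abs_le[OF f] int[OF f] finite_measure.integrable_const[OF fin]
    by (intro order_trans[OF integral_abs_bound] integral_mono integrable_abs) auto
  also have "\<dots> = measure (\<mu> x) UNIV * sup_norm f" using space by simp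
  also have "\<dots> \<le> b * sup_norm f" using mass M_b_sup_norm_nonneg[OF f] by (intro mult_right_mono) auto
  finally show "\<bar>\<integral>y. f y \<partial>\<mu> x\<bar> \<le> b * sup_norm f" .
next
  fix x
  have meas: "f \<in> borel_measurable (\<mu> x)" if "f \<in> M_b" for f
    using M_b_D(1)[OF that] s by (simp cong: measurable_cong_sets)
  have int: "integrable (\<mu> x) f" if "f \<in> M_b" for f
    using M_b_abs_le[OF that] meas[OF that]
    by (intro finite_measure.integrable_const_bound[OF fin, where B = "sup_norm f"]) auto
  show "mb_functional (\<lambda>f. \<integral>y. f y \<partial>\<mu> x)"
    unfolding mb_functional_def
  proof (intro conjI ballI allI impI)
    fix F :: "nat \<Rightarrow> 'd func" and f B
    assume F: "\<forall>k. F k \<in> M_b" "\<forall>k x. \<bar>F k x\<bar> \<le> B" "\<forall>x. (\<lambda>k. F k x) \<longlonglongrightarrow> f x"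
    then have "f \<in> M_b" using M_b_limit(1)[of F B f] by blast
    then show "(\<lambda>k. \<integral>y. F k y \<partial>\<mu> x) \<longlonglongrightarrow> (\<integral>y. f y \<partial>\<mu> x)"
      using F meas finite_measure.integrable_const[OF fin]
      by (intro integral_dominated_convergence[where w = "\<lambda>_. B"]) auto
  qed (use int in simp)
qed

lemma grid_obtain:
  assumes "s \<in> grid \<delta>" "t \<in> grid \<delta>" "s \<le> t" "\<delta> > 0"
  obtains r :: nat where "t = s + real r * \<delta>"
proof -
  obtain j k :: nat where jk: "s = real j * \<delta>" "t = real k * \<delta>" using assms unfolding grid_def by blast
  then have "j \<le> k" using assms by simp
  then have "t = s + real (k - j) * \<delta>" using jk by (simp add: of_nat_diff algebra_simps)
  then show thesis by (rule that)
qed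

lemma zero_mem_grid: "0 \<in> grid \<delta>"
  unfolding grid_def by (rule CollectI, rule exI[of _ 0]) simp

lemma grid_add: "s \<in> grid \<delta> \<Longrightarrow> s + real r * \<delta> \<in> grid \<delta>"
proof -
  assume "s \<in> grid \<delta>"
  then obtain j :: nat where "s = real j * \<delta>" unfolding grid_def by blast
  then have "s + real r * \<delta> = real (j + r) * \<delta>" by (simp add: algebra_simps)
  then show ?thesis unfolding grid_def by blast
qed

lemma grid_Suc: "s \<in> grid \<delta> \<Longrightarrow> s + \<delta> \<in> grid \<delta>"
  using grid_add[of s \<delta> 1] by simp

lemma discrete_semigroup_id: "discrete_semigroup \<delta> Q \<Longrightarrow> t \<in> grid \<delta> \<Longrightarrow> f \<in> M_b \<Longrightarrow> Q t t f = f"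
  unfolding discrete_semigroup_def by blast

text \<open>What the transition measures provide: each step of the semigroup is a composition with an operator that is
  continuous under bounded pointwise convergence.\<close>

lemma discrete_semigroup_structure:
  fixes Q :: "real \<Rightarrow> real \<Rightarrow> 'd::finite operator"
  assumes "discrete_semigroup \<delta> Q"
  obtains N b where "\<And>t. t \<in> grid \<delta> \<Longrightarrow> mb_operator b (N t)"
    "\<And>t r f. t \<in> grid \<delta> \<Longrightarrow> f \<in> M_b \<Longrightarrow>
      Q t (t + real (Suc r) * \<delta>) f = Q t (t + real r * \<delta>) (N (t + real r * \<delta>) f)"
proof -
  obtain \<mu> where \<mu>: "transition_measures \<delta> \<mu>"
    "\<And>t f r. t \<in> grid \<delta> \<Longrightarrow> f \<in> M_b \<Longrightarrow> Q t (t + real (Suc r) * \<delta>) f =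
           Q t (t + real r * \<delta>) (\<lambda>x. \<integral>y. f y \<partial>\<mu> (t + real r * \<delta>) x)"
    using assms unfolding discrete_semigroup_def by blast
  define S where "S = (SUP t\<in>grid \<delta>. SUP x. emeasure (\<mu> t x) UNIV)"
  have "S < \<infinity>" using \<mu>(1) by (simp add: transition_measures_def S_def)
  then have S: "S = ennreal (enn2real S)" by (simp add: ennreal_enn2real_if)
  have "mb_operator (enn2real S) (\<lambda>f x. \<integral>y. f y \<partial>\<mu> t x)" if t: "t \<in> grid \<delta>" for t
  proof (rule mb_operator_transition)
    have "emeasure (\<mu> t x) UNIV \<le> S" for x
      unfolding S_def using t
      by (intro order_trans[OF SUP_upper[of x UNIV] SUP_upper[of t "grid \<delta>"]]) auto
    then show "emeasure (\<mu> t x) UNIV \<le> ennreal (enn2real S)" for x using S by simp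
  qed (use \<mu>(1) t in \<open>auto simp: transition_measures_def\<close>)
  from that[OF this \<mu>(2)] show thesis by blast
qed

lemma discrete_semigroup_mb_operator:
  fixes Q :: "real \<Rightarrow> real \<Rightarrow> 'd::finite operator"
  assumes Q: "discrete_semigroup \<delta> Q" and st: "s \<in> grid \<delta>" "t \<in> grid \<delta>" "s \<le> t" and \<delta>: "\<delta> > 0"
  shows "\<exists>b. mb_operator b (Q s t)"
proof -
  obtain N b where N: "\<And>t. t \<in> grid \<delta> \<Longrightarrow> mb_operator b (N t)"
    "\<And>t r f. t \<in> grid \<delta> \<Longrightarrow> f \<in> M_b \<Longrightarrow>
      Q t (t + real (Suc r) * \<delta>) f = Q t (t + real r * \<delta>) (N (t + real r * \<delta>) f)"
    by (rule discrete_semigroup_structure[OF Q]) blast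
  obtain r :: nat where r: "t = s + real r * \<delta>" using grid_obtain[OF st \<delta>] by blast
  have "\<exists>b. mb_operator b (Q s (s + real r * \<delta>))"
  proof (induction r)
    case 0
    show ?case using mb_operator_cong[OF mb_operator_id] discrete_semigroup_id[OF Q st(1)] by auto
  next
    case (Suc r)
    then obtain b' where "mb_operator b' (Q s (s + real r * \<delta>))" by blast
    from mb_operator_cong[OF mb_operator_comp[OF this N(1)[OF grid_add[OF st(1)]]] N(2)[OF st(1)]]
    show ?case by blast
  qed
  then show ?thesis by (simp add: r)
qed

lemma discrete_semigroup_comp:
  fixes Q :: "real \<Rightarrow> real \<Rightarrow> 'd::finite operator"
  assumes Q: "discrete_semigroup \<delta> Q" and g: "s \<in> grid \<delta>" "t \<in> grid \<delta>" "u \<in> grid \<delta>"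
    and le: "s \<le> t" "t \<le> u" and \<delta>: "\<delta> > 0" and f: "f \<in> M_b"
  shows "Q s u f = Q s t (Q t u f)"
proof -
  obtain N b where N: "\<And>t. t \<in> grid \<delta> \<Longrightarrow> mb_operator b (N t)"
    "\<And>t r f. t \<in> grid \<delta> \<Longrightarrow> f \<in> M_b \<Longrightarrow>
      Q t (t + real (Suc r) * \<delta>) f = Q t (t + real r * \<delta>) (N (t + real r * \<delta>) f)"
    by (rule discrete_semigroup_structure[OF Q]) blast
  obtain r :: nat where r: "t = s + real r * \<delta>" using grid_obtain[OF g(1,2) le(1) \<delta>] by blast
  obtain k :: nat where k: "u = t + real k * \<delta>" using grid_obtain[OF g(2,3) le(2) \<delta>] by blast
  have "Q s (t + real k * \<delta>) f = Q s t (Q t (t + real k * \<delta>) f)" using f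
  proof (induction k arbitrary: f)
    case 0
    then show ?case using discrete_semigroup_id[OF Q g(2)] by simp
  next
    case (Suc k)
    have eq: "s + real (Suc (r + k)) * \<delta> = t + real (Suc k) * \<delta>" "s + real (r + k) * \<delta> = t + real k * \<delta>"
      by (simp_all add: r algebra_simps)
    have "N (t + real k * \<delta>) f \<in> M_b" using mb_operatorD(1)[OF N(1)[OF grid_add[OF g(2)]]] Suc.prems .
    moreover have "Q s (t + real (Suc k) * \<delta>) f = Q s (t + real k * \<delta>) (N (t + real k * \<delta>) f)"
      using N(2)[OF g(1) Suc.prems, of "r + k"] unfolding eq .
    ultimately show ?case using Suc.IH N(2)[OF g(2) Suc.prems, of k] by simp
  qed
  then show ?thesis by (simp add: k)
qed

subsection \<open>Operators of finite order\<close>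

text \<open>An operator of order \<open>\<kappa>\<close> loses \<open>\<kappa>\<close> derivatives, both in the supremum scale and, for its dual, in the
  \<open>L\<^sub>1\<close> scale, with the common constant \<open>e\<close>; \<open>b\<close> bounds it on \<open>M_b\<close> without any loss of derivatives.
  Capping the order of all derivatives at \<open>q\<close> lets one constant serve for every \<open>r\<close>, so that the constants of
  compositions are plain products.\<close>

definition order_bounded :: "nat \<Rightarrow> nat \<Rightarrow> real \<Rightarrow> real \<Rightarrow> 'd::finite operator \<Rightarrow> bool" where
  "order_bounded q \<kappa> e b A \<longleftrightarrow> mb_operator b A \<and> 0 \<le> e \<and> (\<forall>r. r + \<kappa> \<le> q \<longrightarrow>
     (\<forall>f\<in>C_b (\<kappa> + r). A f \<in> C_b r \<and> norm_inf r (A f) \<le> e * norm_inf (\<kappa> + r) f) \<and>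
     (\<forall>f\<in>C_1 (\<kappa> + r). \<exists>h\<in>C_1 r. is_dual A f h \<and> norm_1 r h \<le> e * norm_1 (\<kappa> + r) f))"

lemma order_boundedD:
  assumes "order_bounded q \<kappa> e b A"
  shows "mb_operator b A" "0 \<le> e"
    "r + \<kappa> \<le> q \<Longrightarrow> f \<in> C_b (\<kappa> + r) \<Longrightarrow> A f \<in> C_b r"
    "r + \<kappa> \<le> q \<Longrightarrow> f \<in> C_b (\<kappa> + r) \<Longrightarrow> norm_inf r (A f) \<le> e * norm_inf (\<kappa> + r) f"
    "r + \<kappa> \<le> q \<Longrightarrow> g \<in> C_1 (\<kappa> + r) \<Longrightarrow>
      \<exists>h\<in>C_1 r. is_dual A g h \<and> norm_1 r h \<le> e * norm_1 (\<kappa> + r) g"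
  using assms unfolding order_bounded_def by blast+

lemma is_dual_cong:
  assumes "\<And>f. f \<in> M_b \<Longrightarrow> A' f = A f" "is_dual A f h"
  shows "is_dual A' f h"
  using assms unfolding is_dual_def by simp

lemma is_dual_comp:
  fixes A B :: "'d::finite operator"
  assumes A: "is_dual A f h" and B: "is_dual B h k" and b: "mb_operator b B"
  shows "is_dual (\<lambda>f. A (B f)) f k"
  using A B mb_operatorD(1)[OF b] unfolding is_dual_def by simp

lemma is_dual_lincomb:
  fixes A B :: "'d::finite operator"
  assumes A: "is_dual A f h" "mb_operator b1 A" and B: "is_dual B f k" "mb_operator b2 B"
    and f: "integrable lborel f"
  shows "is_dual (\<lambda>g x. a * A g x + c * B g x) f (\<lambda>x. a * h x + c * k x)"
  unfolding is_dual_def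
proof (intro conjI ballI)
  have hk: "integrable lborel h" "integrable lborel k" using A B unfolding is_dual_def by auto
  then show "integrable lborel (\<lambda>x. a * h x + c * k x)" by simp
  fix g :: "'d func" assume g: "g \<in> M_b"
  have i: "integrable lborel (\<lambda>x. A g x * f x)" "integrable lborel (\<lambda>x. B g x * f x)"
    "integrable lborel (\<lambda>x. g x * h x)" "integrable lborel (\<lambda>x. g x * k x)"
    using integrable_times_M_b[OF f mb_operatorD(1)[OF A(2) g]]
      integrable_times_M_b[OF f mb_operatorD(1)[OF B(2) g]]
      integrable_times_M_b[OF hk(1) g] integrable_times_M_b[OF hk(2) g]
    by (simp_all add: mult.commute)
  have "(\<integral>x. (a * A g x + c * B g x) * f x \<partial>lborel) = (\<integral>x. a * (A g x * f x) + c * (B g x * f x) \<partial>lborel)"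
    by (simp add: algebra_simps)
  also have "\<dots> = a * (\<integral>x. A g x * f x \<partial>lborel) + c * (\<integral>x. B g x * f x \<partial>lborel)"
    using i by simp
  also have "\<dots> = a * (\<integral>x. g x * h x \<partial>lborel) + c * (\<integral>x. g x * k x \<partial>lborel)"
    using A(1) B(1) g unfolding is_dual_def by simp
  also have "\<dots> = (\<integral>x. a * (g x * h x) + c * (g x * k x) \<partial>lborel)" using i by simp
  finally show "(\<integral>x. (a * A g x + c * B g x) * f x \<partial>lborel) = (\<integral>x. g x * (a * h x + c * k x) \<partial>lborel)"
    by (simp add: algebra_simps)
qed

lemma order_bounded_cong:
  fixes A A' :: "'d::finite operator"
  assumes A: "order_bounded q \<kappa> e b A" and eq: "\<And>f. f \<in> M_b \<Longrightarrow> A' f = A f"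
  shows "order_bounded q \<kappa> e b A'"
  unfolding order_bounded_def
proof (intro conjI allI impI ballI)
  show "mb_operator b A'" by (rule mb_operator_cong[OF order_boundedD(1)[OF A] eq])
  show "0 \<le> e" by (rule order_boundedD(2)[OF A])
  fix r assume r: "r + \<kappa> \<le> q"
  fix f :: "'d func"
  show "A' f \<in> C_b r" "norm_inf r (A' f) \<le> e * norm_inf (\<kappa> + r) f" if "f \<in> C_b (\<kappa> + r)"
    using order_boundedD(3,4)[OF A r that] eq[OF C_b_subset_M_b[OF that]] by simp_all
  show "\<exists>h\<in>C_1 r. is_dual A' f h \<and> norm_1 r h \<le> e * norm_1 (\<kappa> + r) f" if f1: "f \<in> C_1 (\<kappa> + r)"
  proof -
    obtain h where h: "h \<in> C_1 r" "is_dual A f h" "norm_1 r h \<le> e * norm_1 (\<kappa> + r) f"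
      using order_boundedD(5)[OF A r f1] by blast
    have "is_dual A' f h" by (rule is_dual_cong[OF eq h(2)])
    with h show ?thesis by blast
  qed
qed

lemma order_bounded_comp:
  fixes A B :: "'d::finite operator"
  assumes A: "order_bounded q \<kappa>1 e1 b1 A" and B: "order_bounded q \<kappa>2 e2 b2 B"
  shows "order_bounded q (\<kappa>1 + \<kappa>2) (e1 * e2) (b1 * b2) (\<lambda>f. A (B f))"
  unfolding order_bounded_def
proof (intro conjI allI impI ballI)
  show "mb_operator (b1 * b2) (\<lambda>f. A (B f))"
    by (rule mb_operator_comp[OF order_boundedD(1)[OF A] order_boundedD(1)[OF B]])
  show "0 \<le> e1 * e2" using order_boundedD(2)[OF A] order_boundedD(2)[OF B] by simp
  fix r assume r: "r + (\<kappa>1 + \<kappa>2) \<le> q"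
  fix f :: "'d func"
  {
    assume f: "f \<in> C_b (\<kappa>1 + \<kappa>2 + r)"
    have B': "B f \<in> C_b (\<kappa>1 + r)" "norm_inf (\<kappa>1 + r) (B f) \<le> e2 * norm_inf (\<kappa>1 + \<kappa>2 + r) f"
      using order_boundedD(3,4)[OF B, of "\<kappa>1 + r" f] r f by (simp_all add: ac_simps)
    show "A (B f) \<in> C_b r" using order_boundedD(3)[OF A _ B'(1)] r by simp
    have "norm_inf r (A (B f)) \<le> e1 * norm_inf (\<kappa>1 + r) (B f)"
      using order_boundedD(4)[OF A _ B'(1)] r by simp
    also have "\<dots> \<le> e1 * (e2 * norm_inf (\<kappa>1 + \<kappa>2 + r) f)"
      using B'(2) order_boundedD(2)[OF A] by (rule mult_left_mono)
    finally show "norm_inf r (A (B f)) \<le> e1 * e2 * norm_inf (\<kappa>1 + \<kappa>2 + r) f" by (simp add: mult.assoc)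
  }
  assume f: "f \<in> C_1 (\<kappa>1 + \<kappa>2 + r)"
  then obtain h where h: "h \<in> C_1 (\<kappa>2 + r)" "is_dual A f h"
    "norm_1 (\<kappa>2 + r) h \<le> e1 * norm_1 (\<kappa>1 + \<kappa>2 + r) f"
    using order_boundedD(5)[OF A, of "\<kappa>2 + r" f] r by (auto simp: ac_simps)
  obtain k where k: "k \<in> C_1 r" "is_dual B h k" "norm_1 r k \<le> e2 * norm_1 (\<kappa>2 + r) h"
    using order_boundedD(5)[OF B, of r h] r h(1) by auto
  have "e2 * norm_1 (\<kappa>2 + r) h \<le> e2 * (e1 * norm_1 (\<kappa>1 + \<kappa>2 + r) f)"
    using h(3) order_boundedD(2)[OF B] by (rule mult_left_mono)
  then have "norm_1 r k \<le> e1 * e2 * norm_1 (\<kappa>1 + \<kappa>2 + r) f" using k(3) by (simp add: ac_simps)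
  then show "\<exists>h\<in>C_1 r. is_dual (\<lambda>f. A (B f)) f h \<and> norm_1 r h \<le> e1 * e2 * norm_1 (\<kappa>1 + \<kappa>2 + r) f"
    using k is_dual_comp[OF h(2) k(2) order_boundedD(1)[OF B]] by blast
qed

lemma order_bounded_lincomb:
  fixes A B :: "'d::finite operator"
  assumes A: "order_bounded q \<kappa> e1 b1 A" and B: "order_bounded q \<kappa> e2 b2 B"
  shows "order_bounded q \<kappa> (\<bar>a\<bar> * e1 + \<bar>c\<bar> * e2) (\<bar>a\<bar> * b1 + \<bar>c\<bar> * b2) (\<lambda>f x. a * A f x + c * B f x)"
  unfolding order_bounded_def
proof (intro conjI allI impI ballI)
  have mA: "mb_operator b1 A" and mB: "mb_operator b2 B"
    using order_boundedD(1)[OF A] order_boundedD(1)[OF B] by auto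
  show "mb_operator (\<bar>a\<bar> * b1 + \<bar>c\<bar> * b2) (\<lambda>f x. a * A f x + c * B f x)"
    by (rule mb_operator_lincomb[OF mA mB])
  have e: "0 \<le> e1" "0 \<le> e2" using order_boundedD(2)[OF A] order_boundedD(2)[OF B] by auto
  then show "0 \<le> \<bar>a\<bar> * e1 + \<bar>c\<bar> * e2" by simp
  have combine: "\<bar>a\<bar> * x + \<bar>c\<bar> * y \<le> (\<bar>a\<bar> * e1 + \<bar>c\<bar> * e2) * z"
    if "x \<le> e1 * z" "y \<le> e2 * z" for x y z
    using mult_left_mono[OF that(1), of "\<bar>a\<bar>"] mult_left_mono[OF that(2), of "\<bar>c\<bar>"]
    by (simp add: algebra_simps)
  fix r assume r: "r + \<kappa> \<le> q"
  fix f :: "'d func"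
  {
    assume f: "f \<in> C_b (\<kappa> + r)"
    note A' = order_boundedD(3,4)[OF A r f] and B' = order_boundedD(3,4)[OF B r f]
    show "(\<lambda>x. a * A f x + c * B f x) \<in> C_b r" using A' B' by (intro C_b_lincomb)
    show "norm_inf r (\<lambda>x. a * A f x + c * B f x) \<le> (\<bar>a\<bar> * e1 + \<bar>c\<bar> * e2) * norm_inf (\<kappa> + r) f"
      using norm_inf_lincomb[OF A'(1) B'(1)] combine[OF A'(2) B'(2)] by (rule order_trans)
  }
  assume f: "f \<in> C_1 (\<kappa> + r)"
  obtain h where h: "h \<in> C_1 r" "is_dual A f h" "norm_1 r h \<le> e1 * norm_1 (\<kappa> + r) f"
    using order_boundedD(5)[OF A r f] by blast
  obtain k where k: "k \<in> C_1 r" "is_dual B f k" "norm_1 r k \<le> e2 * norm_1 (\<kappa> + r) f"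
    using order_boundedD(5)[OF B r f] by blast
  have "norm_1 r (\<lambda>x. a * h x + c * k x) \<le> (\<bar>a\<bar> * e1 + \<bar>c\<bar> * e2) * norm_1 (\<kappa> + r) f"
    using norm_1_lincomb[OF h(1) k(1)] combine[OF h(3) k(3)] by (rule order_trans)
  moreover have "is_dual (\<lambda>f x. a * A f x + c * B f x) f (\<lambda>x. a * h x + c * k x)"
    by (rule is_dual_lincomb[OF h(2) mA k(2) mB C_1_integrable[OF f]])
  ultimately show "\<exists>h\<in>C_1 r. is_dual (\<lambda>f x. a * A f x + c * B f x) f h \<and>
      norm_1 r h \<le> (\<bar>a\<bar> * e1 + \<bar>c\<bar> * e2) * norm_1 (\<kappa> + r) f"
    using C_1_lincomb[OF h(1) k(1)] by blast
qed

lemma order_bounded_add: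
  "order_bounded q \<kappa> e1 b1 A \<Longrightarrow> order_bounded q \<kappa> e2 b2 B \<Longrightarrow>
    order_bounded q \<kappa> (e1 + e2) (b1 + b2) (\<lambda>f x. A f x + B f x)"
  using order_bounded_lincomb[of q \<kappa> e1 b1 A e2 b2 B 1 1] by simp

lemma order_bounded_diff:
  "order_bounded q \<kappa> e1 b1 A \<Longrightarrow> order_bounded q \<kappa> e2 b2 B \<Longrightarrow>
    order_bounded q \<kappa> (e1 + e2) (b1 + b2) (\<lambda>f x. A f x - B f x)"
  using order_bounded_lincomb[of q \<kappa> e1 b1 A e2 b2 B 1 "-1"] by simp

lemma order_bounded_mono:
  fixes A :: "'d::finite operator"
  assumes A: "order_bounded q \<kappa> e b A" and le: "\<kappa> \<le> \<kappa>'" "e \<le> e'" "b \<le> b'"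
  shows "order_bounded q \<kappa>' e' b' A"
  unfolding order_bounded_def
proof (intro conjI allI impI ballI)
  show "mb_operator b' A" by (rule mb_operator_mono[OF order_boundedD(1)[OF A] le(3)])
  have e: "0 \<le> e" by (rule order_boundedD(2)[OF A])
  with le show "0 \<le> e'" by simp
  fix r assume r: "r + \<kappa>' \<le> q"
  with le have r': "r + \<kappa> \<le> q" by simp
  have kr: "\<kappa> + r \<le> \<kappa>' + r" using le by simp
  fix f :: "'d func"
  {
    assume f: "f \<in> C_b (\<kappa>' + r)"
    have f': "f \<in> C_b (\<kappa> + r)" by (rule C_b_mono[OF f kr])
    show "A f \<in> C_b r" by (rule order_boundedD(3)[OF A r' f'])
    have "norm_inf r (A f) \<le> e * norm_inf (\<kappa> + r) f" by (rule order_boundedD(4)[OF A r' f'])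
    also have "\<dots> \<le> e' * norm_inf (\<kappa>' + r) f"
      using norm_inf_mono[OF f kr] e le(2) norm_inf_nonneg[OF f'] by (intro mult_mono) auto
    finally show "norm_inf r (A f) \<le> e' * norm_inf (\<kappa>' + r) f" .
  }
  assume f: "f \<in> C_1 (\<kappa>' + r)"
  have f': "f \<in> C_1 (\<kappa> + r)" by (rule C_1_mono[OF f kr])
  have "e * norm_1 (\<kappa> + r) f \<le> e' * norm_1 (\<kappa>' + r) f"
    using norm_1_mono[OF kr, of f] e le(2) norm_1_nonneg[of "\<kappa> + r" f] by (intro mult_mono) auto
  with order_boundedD(5)[OF A r' f']
  show "\<exists>h\<in>C_1 r. is_dual A f h \<and> norm_1 r h \<le> e' * norm_1 (\<kappa>' + r) f" by (meson order_trans)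
qed

lemma order_bounded_id: "order_bounded q 0 1 1 (\<lambda>f. f)"
  unfolding order_bounded_def is_dual_def
  using mb_operator_id by (auto intro: C_1_integrable)

lemma order_bounded_zero: "order_bounded q \<kappa> 0 0 (\<lambda>f x. 0)"
proof -
  have "order_bounded q 0 0 0 (\<lambda>f x. 0)"
    using order_bounded_lincomb[OF order_bounded_id order_bounded_id, of q 0 0] by simp
  then show ?thesis by (rule order_bounded_mono) auto
qed

lemma order_bounded_sum:
  assumes "finite S" "\<And>s. s \<in> S \<Longrightarrow> order_bounded q \<kappa> e b (A s)"
  shows "order_bounded q \<kappa> (real (card S) * e) (real (card S) * b) (\<lambda>f x. \<Sum>s\<in>S. A s f x)"
  using assms
proof (induction S rule: finite_induct)
  case empty
  then show ?case using order_bounded_zero by simp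
next
  case (insert s S)
  then have "order_bounded q \<kappa> (e + real (card S) * e) (b + real (card S) * b)
      (\<lambda>f x. A s f x + (\<Sum>s\<in>S. A s f x))"
    by (intro order_bounded_add) auto
  then show ?case using insert(1,2) by (simp add: algebra_simps)
qed

subsection \<open>Mollification as an operator\<close>

lemma mollifierD:
  assumes "mollifier \<epsilon> \<rho>"
  shows "\<rho> \<in> C_c_inf" "0 \<le> \<rho> x" "\<rho> (- x) = \<rho> x" "(\<integral>x. \<rho> x \<partial>lborel) = 1" "\<epsilon> \<le> norm x \<Longrightarrow> \<rho> x = 0"
    "integrable lborel \<rho>" "\<rho> \<in> borel_measurable borel" "\<rho> (y - x) = \<rho> (x - y)"
proof -
  show \<rho>: "\<rho> \<in> C_c_inf" "0 \<le> \<rho> x" "(\<integral>x. \<rho> x \<partial>lborel) = 1" "\<epsilon> \<le> norm x \<Longrightarrow> \<rho> x = 0"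
    and even: "\<rho> (- x) = \<rho> x" for x
    using assms unfolding mollifier_def by auto
  show "integrable lborel \<rho>" by (rule C_c_inf_integrable[OF \<rho>(1)])
  show "\<rho> \<in> borel_measurable borel" by (rule M_b_D(1)[OF C_c_inf_subset_M_b[OF \<rho>(1)]])
  show "\<rho> (y - x) = \<rho> (x - y)" using even[of "x - y"] by simp
qed

lemma integrable_mollifier_translate:
  assumes "mollifier \<epsilon> \<rho>"
  shows "integrable lborel (\<lambda>y. \<rho> (z - y))" "(\<integral>y. \<rho> (z - y) \<partial>lborel) = 1"
  using integrable_reflect[OF mollifierD(6)[OF assms], of z]
    integral_reflect[OF mollifierD(7)[OF assms], of z] mollifierD(4)[OF assms] by auto

lemma integrable_conv_kernel:
  fixes u :: "'d::finite func"
  assumes \<rho>: "mollifier \<epsilon> \<rho>" and u: "integrable lborel u"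
  shows "integrable (lborel \<Otimes>\<^sub>M lborel) (\<lambda>(y, z). u y * \<rho> (z - y))"
proof (rule lborel_pair.Fubini_integrable)
  have [measurable]: "u \<in> borel_measurable borel" "\<rho> \<in> borel_measurable borel"
    using u mollifierD(7)[OF \<rho>] by auto
  show "(\<lambda>(y, z). u y * \<rho> (z - y)) \<in> borel_measurable (lborel \<Otimes>\<^sub>M lborel)" by measurable
  have r: "integrable lborel (\<lambda>z. \<rho> (z - y))" "(\<integral>z. \<rho> (z - y) \<partial>lborel) = 1" for y
    using integrable_mollifier_translate[OF \<rho>, of y] by (simp_all add: mollifierD(8)[OF \<rho>])
  have "(\<integral>z. norm (u y * \<rho> (z - y)) \<partial>lborel) = \<bar>u y\<bar>" for y
    using r(2) mollifierD(2)[OF \<rho>] by (simp add: abs_mult)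
  then show "integrable lborel (\<lambda>y. \<integral>z. norm (case (y, z) of (y, z) \<Rightarrow> u y * \<rho> (z - y)) \<partial>lborel)"
    using u by (simp add: integrable_abs)
  show "AE y in lborel. integrable lborel (\<lambda>z. case (y, z) of (y, z) \<Rightarrow> u y * \<rho> (z - y))"
    using r(1) by simp
qed

lemma conv_integrable:
  fixes u :: "'d::finite func"
  assumes \<rho>: "mollifier \<epsilon> \<rho>" and u: "integrable lborel u"
  shows "integrable lborel (conv \<rho> u)" "(\<integral>z. \<bar>conv \<rho> u z\<bar> \<partial>lborel) \<le> (\<integral>z. \<bar>u z\<bar> \<partial>lborel)"
proof -
  have i: "integrable lborel (conv \<rho> u)"
    "(\<integral>z. conv \<rho> u z \<partial>lborel) = (\<integral>y. \<integral>z. u y * \<rho> (z - y) \<partial>lborel \<partial>lborel)"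
    if "integrable lborel u" for u :: "'d func"
    using lborel_pair.integrable_snd[OF integrable_conv_kernel[OF \<rho> that]]
      lborel_pair.Fubini_integral[OF integrable_conv_kernel[OF \<rho> that]]
    by (simp_all add: conv_def[abs_def])
  show "integrable lborel (conv \<rho> u)" by (rule i[OF u])
  have "(\<integral>z. \<bar>conv \<rho> u z\<bar> \<partial>lborel) \<le> (\<integral>z. conv \<rho> (\<lambda>y. \<bar>u y\<bar>) z \<partial>lborel)"
  proof (rule integral_mono)
    show "integrable lborel (\<lambda>z. \<bar>conv \<rho> u z\<bar>)" by (rule integrable_abs[OF i(1)[OF u]])
    show "integrable lborel (conv \<rho> (\<lambda>y. \<bar>u y\<bar>))" by (rule i(1)[OF integrable_abs[OF u]])
    show "\<bar>conv \<rho> u z\<bar> \<le> conv \<rho> (\<lambda>y. \<bar>u y\<bar>) z" for z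
      unfolding conv_def using mollifierD(2)[OF \<rho>]
      by (intro order_trans[OF integral_abs_bound]) (simp add: abs_mult)
  qed
  also have "\<dots> = (\<integral>y. \<integral>z. \<bar>u y\<bar> * \<rho> (z - y) \<partial>lborel \<partial>lborel)" by (rule i(2)[OF integrable_abs[OF u]])
  also have "\<dots> = (\<integral>y. \<bar>u y\<bar> \<partial>lborel)"
    using integrable_mollifier_translate(2)[OF \<rho>] by (simp add: mollifierD(8)[OF \<rho>])
  finally show "(\<integral>z. \<bar>conv \<rho> u z\<bar> \<partial>lborel) \<le> (\<integral>z. \<bar>u z\<bar> \<partial>lborel)" .
qed

lemma conv_abs_le:
  fixes g :: "'d::finite func"
  assumes \<rho>: "mollifier \<epsilon> \<rho>" and g: "g \<in> M_b" "\<And>x. \<bar>g x\<bar> \<le> B"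
  shows "\<bar>conv \<rho> g z\<bar> \<le> B"
proof -
  have i: "integrable lborel (\<lambda>y. \<rho> (z - y) * g y)"
    by (rule integrable_times_M_b[OF integrable_mollifier_translate(1)[OF \<rho>] g(1)])
  have "\<bar>conv \<rho> g z\<bar> \<le> (\<integral>y. B * \<rho> (z - y) \<partial>lborel)" unfolding conv_def
  proof (intro order_trans[OF integral_abs_bound] integral_mono)
    show "integrable lborel (\<lambda>y. \<bar>g y * \<rho> (z - y)\<bar>)" using integrable_abs[OF i] by (simp add: mult.commute)
    show "integrable lborel (\<lambda>y. B * \<rho> (z - y))"
      by (rule integrable_mult_right[OF integrable_mollifier_translate(1)[OF \<rho>]])
    show "\<bar>g y * \<rho> (z - y)\<bar> \<le> B * \<rho> (z - y)" for y
      using g(2)[of y] mollifierD(2)[OF \<rho>, of "z - y"] by (simp add: abs_mult mult_right_mono)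
  qed
  then show ?thesis using integrable_mollifier_translate(2)[OF \<rho>] by simp
qed

lemma mb_operator_conv:
  fixes \<rho> :: "'d::finite func"
  assumes \<rho>: "mollifier \<epsilon> \<rho>"
  shows "mb_operator 1 (conv \<rho>)"
proof (rule mb_operatorI)
  fix f :: "'d func" assume f: "f \<in> M_b"
  have [measurable]: "f \<in> borel_measurable borel" "\<rho> \<in> borel_measurable borel"
    using M_b_D(1)[OF f] mollifierD(7)[OF \<rho>] by auto
  have "(\<lambda>(z, y). f y * \<rho> (z - y)) \<in> borel_measurable (borel \<Otimes>\<^sub>M lborel)" by measurable
  then show "conv \<rho> f \<in> borel_measurable borel"
    unfolding conv_def by (intro lborel.borel_measurable_lebesgue_integral) simp
  show "\<bar>conv \<rho> f x\<bar> \<le> 1 * sup_norm f" for x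
    using conv_abs_le[OF \<rho> f, of "sup_norm f" x] M_b_abs_le[OF f] by simp
next
  fix z
  have i: "integrable lborel (\<lambda>y. f y * \<rho> (z - y))" if "f \<in> M_b" for f
    using integrable_times_M_b[OF integrable_mollifier_translate(1)[OF \<rho>] that, of z] by (simp add: mult.commute)
  show "mb_functional (\<lambda>f. conv \<rho> f z)"
    unfolding mb_functional_def
  proof (intro conjI ballI allI impI)
    fix f g :: "'d func" and a b assume "f \<in> M_b" "g \<in> M_b"
    then have "(\<integral>y. a * (f y * \<rho> (z - y)) + b * (g y * \<rho> (z - y)) \<partial>lborel)
        = a * (\<integral>y. f y * \<rho> (z - y) \<partial>lborel) + b * (\<integral>y. g y * \<rho> (z - y) \<partial>lborel)"
      using i by simp
    then show "conv \<rho> (\<lambda>x. a * f x + b * g x) z = a * conv \<rho> f z + b * conv \<rho> g z"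
      by (simp add: conv_def algebra_simps)
  next
    fix F :: "nat \<Rightarrow> 'd func" and f B
    assume F: "\<forall>k. F k \<in> M_b" "\<forall>k x. \<bar>F k x\<bar> \<le> B" "\<forall>x. (\<lambda>k. F k x) \<longlonglongrightarrow> f x"
    then have f: "f \<in> M_b" using M_b_limit(1)[of F B f] by blast
    show "(\<lambda>k. conv \<rho> (F k) z) \<longlonglongrightarrow> conv \<rho> f z" unfolding conv_def
    proof (rule integral_dominated_convergence[where w = "\<lambda>y. B * \<rho> (z - y)"])
      show "(\<lambda>y. f y * \<rho> (z - y)) \<in> borel_measurable lborel" using i[OF f] by auto
      show "(\<lambda>y. F k y * \<rho> (z - y)) \<in> borel_measurable lborel" for k using i F by blast
      show "integrable lborel (\<lambda>y. B * \<rho> (z - y))"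
        by (rule integrable_mult_right[OF integrable_mollifier_translate(1)[OF \<rho>]])
      show "AE y in lborel. (\<lambda>k. F k y * \<rho> (z - y)) \<longlonglongrightarrow> f y * \<rho> (z - y)"
        using F(3) by (intro AE_I2 tendsto_intros) auto
      show "AE y in lborel. norm (F k y * \<rho> (z - y)) \<le> B * \<rho> (z - y)" for k
        using F(2) mollifierD(2)[OF \<rho>] by (intro AE_I2) (simp add: abs_mult mult_right_mono)
    qed
  qed
qed simp

lemma conv_shift:
  fixes f :: "'d::finite func"
  assumes \<rho>: "mollifier \<epsilon> \<rho>" and f: "f \<in> borel_measurable borel"
  shows "conv \<rho> f = (\<lambda>z. \<integral>w. f (z - w) * \<rho> w \<partial>lborel)"
proof
  fix z
  have [measurable]: "f \<in> borel_measurable borel" "\<rho> \<in> borel_measurable borel"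
    using f mollifierD(7)[OF \<rho>] by auto
  have "(\<lambda>w. f (z - w) * \<rho> w) \<in> borel_measurable borel" by measurable
  from integral_reflect[OF this, of z] show "conv \<rho> f z = (\<integral>w. f (z - w) * \<rho> w \<partial>lborel)"
    by (simp add: conv_def)
qed

text \<open>Both scales are preserved by mollification because the derivatives may be put on the function instead of on
  the mollifier; the function is merely \<open>C\<^sup>r\<close>, so this uses the locally uniform Taylor expansion.\<close>

lemma conv_C_k:
  fixes f :: "'d::finite func"
  assumes \<rho>: "mollifier \<epsilon> \<rho>"
  shows "C_k r f \<Longrightarrow> C_k r (conv \<rho> f)"
    and "C_k (Suc r) f \<Longrightarrow> partial i (conv \<rho> f) = conv \<rho> (partial i f)"
proof -
  let ?W = "cball 0 \<bar>\<epsilon>\<bar> :: (real ^ 'd) set"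
  let ?X = "{h :: 'd func. continuous_on UNIV h}"
  let ?L = "\<lambda>h :: 'd func. \<integral>w. h w * \<rho> w \<partial>lborel"
  have zero: "\<rho> w = 0" if "w \<notin> ?W" for w using that mollifierD(5)[OF \<rho>, of w] by auto
  have int: "integrable lborel (\<lambda>w. h w * \<rho> w)" if "h \<in> ?X" for h
    using that zero C_c_inf_continuous[OF mollifierD(1)[OF \<rho>]]
    by (intro continuous_compact_support_integrable[of _ ?W]) (auto intro!: continuous_intros)
  have bound: "\<bar>?L h\<bar> \<le> 1 * e" if "h \<in> ?X" "\<And>w. w \<in> ?W \<Longrightarrow> \<bar>h w\<bar> \<le> e" for h e
  proof -
    have "\<bar>?L h\<bar> \<le> (\<integral>w. e * \<rho> w \<partial>lborel)"
    proof (intro order_trans[OF integral_abs_bound] integral_mono)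
      show "integrable lborel (\<lambda>w. \<bar>h w * \<rho> w\<bar>)" by (rule integrable_abs[OF int[OF that(1)]])
      show "integrable lborel (\<lambda>w. e * \<rho> w)" by (rule integrable_mult_right[OF mollifierD(6)[OF \<rho>]])
      show "\<bar>h w * \<rho> w\<bar> \<le> e * \<rho> w" for w
        using that(2)[of w] zero[of w] mollifierD(2)[OF \<rho>, of w]
        by (cases "w \<in> ?W") (auto simp: abs_mult intro!: mult_right_mono)
    qed
    then show ?thesis using mollifierD(4)[OF \<rho>] by simp
  qed
  have reflect: "(\<lambda>w. h (z - w)) \<in> ?X" if "continuous_on UNIV h" for h z
    using that by (auto intro!: continuous_on_compose2[of UNIV h] continuous_intros)
  have lin: "?L (\<lambda>x. a * f x + b * g x) = a * ?L f + b * ?L g" if "f \<in> ?X" "g \<in> ?X" for f g a b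
  proof -
    have "(\<integral>x. a * (f x * \<rho> x) + b * (g x * \<rho> x) \<partial>lborel) = a * ?L f + b * ?L g"
      using int[OF that(1)] int[OF that(2)] by simp
    then show ?thesis by (simp add: algebra_simps)
  qed
  have eq: "conv \<rho> f = (\<lambda>z. ?L (\<lambda>w. f (z - w)))" if "continuous_on UNIV f" for f
    using conv_shift[OF \<rho>] borel_measurable_continuous_onI[OF that] by blast
  have Wc: "compact ((\<lambda>w. y - w) ` ?W)" for y
    by (intro compact_continuous_image continuous_intros) auto
  have cont: "continuous_on UNIV (conv \<rho> f)" if f: "continuous_on UNIV f" for f
    unfolding continuous_on_iff
  proof (intro ballI allI impI)
    fix y :: "real ^ 'd" and e :: real assume "e > 0"
    then have "e / 2 > 0" by simp
    from uniform_continuity_near_compact[OF f Wc this] obtain d where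
      d: "d > 0" "\<And>(u :: real ^ 'd) h. u \<in> (\<lambda>w. y - w) ` ?W \<Longrightarrow> norm h < d \<Longrightarrow> \<bar>f (u + h) - f u\<bar> \<le> e / 2"
      by blast
    have "dist (conv \<rho> f y') (conv \<rho> f y) < e" if "dist y' y < d" for y'
    proof -
      have "conv \<rho> f y' - conv \<rho> f y = ?L (\<lambda>w. 1 * f (y' - w) + (-1) * f (y - w))"
        unfolding eq[OF f] lin[OF reflect[OF f] reflect[OF f]] by simp
      also have "\<bar>\<dots>\<bar> \<le> 1 * (e / 2)"
      proof (rule bound)
        show "(\<lambda>w. 1 * f (y' - w) + (-1) * f (y - w)) \<in> ?X"
          using reflect[OF f, of y'] reflect[OF f, of y] by (auto intro!: continuous_intros)
        fix w assume "w \<in> ?W"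
        then have "\<bar>f (y - w + (y' - y)) - f (y - w)\<bar> \<le> e / 2"
          using that by (intro d(2)) (auto simp: dist_norm)
        then show "\<bar>1 * f (y' - w) + (-1) * f (y - w)\<bar> \<le> e / 2" by simp
      qed
      finally show ?thesis using \<open>e > 0\<close> by (simp add: dist_real_def)
    qed
    then show "\<exists>d>0. \<forall>x'\<in>UNIV. dist x' y < d \<longrightarrow> dist (conv \<rho> f x') (conv \<rho> f y) < e"
      using d(1) by blast
  qed
  have deriv: "(conv \<rho> f has_derivative (\<lambda>h. \<Sum>i\<in>UNIV. h $ i * conv \<rho> (partial i f) y)) (at y)"
    if f: "C_k (Suc 0) f" for f y
  proof -
    have fc: "continuous_on UNIV f" "\<And>i. continuous_on UNIV (partial i f)"
      using C_k_continuous[OF f] f by auto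
    show ?thesis unfolding eq[OF fc(1)] eq[OF fc(2)]
    proof (rule has_derivative_functional_translate[where X = ?X and W = ?W and M = 1])
      show "?L (\<lambda>x. a * f x + b * g x) = a * ?L f + b * ?L g" if "f \<in> ?X" "g \<in> ?X" for f g a b
        by (rule lin[OF that])
      show "(\<lambda>x. a * f x + b * g x) \<in> ?X" if "f \<in> ?X" "g \<in> ?X" for f g a b
        using that by (auto intro!: continuous_intros)
      show "\<bar>?L h\<bar> \<le> 1 * e" if "h \<in> ?X" "\<And>w. w \<in> ?W \<Longrightarrow> \<bar>h w\<bar> \<le> e" for h e by (rule bound[OF that])
      show "(\<lambda>z. f (y - z)) \<in> ?X" for y by (rule reflect[OF fc(1)])
      show "(\<lambda>z. partial i f (y - z)) \<in> ?X" for y i by (rule reflect[OF fc(2)])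
      fix e :: real assume "e > 0"
      from C_k_uniform_taylor[OF f Wc[of y] this] obtain d where d: "d > 0"
        "\<And>(u :: real ^ 'd) h. u \<in> (\<lambda>w. y - w) ` ?W \<Longrightarrow> norm h < d \<Longrightarrow>
          \<bar>f (u + h) - f u - (\<Sum>i\<in>UNIV. h $ i * partial i f u)\<bar> \<le> e * norm h" by blast
      show "\<exists>d>0. \<forall>h w. w \<in> ?W \<longrightarrow> norm h < d \<longrightarrow>
          \<bar>f (y - w + h) - f (y - w) - (\<Sum>i\<in>UNIV. h $ i * partial i f (y - w))\<bar> \<le> e * norm h"
        using d by blast
    qed simp
  qed
  have part: "partial i (conv \<rho> f) = conv \<rho> (partial i f)" if f: "C_k (Suc 0) f" for f i
  proof
    fix y
    have "partial i (conv \<rho> f) y = (\<Sum>j\<in>UNIV. if j = i then conv \<rho> (partial j f) y else 0)"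
      unfolding partial_eqI[OF deriv[OF f]] by (intro sum.cong) (auto simp: axis_def)
    then show "partial i (conv \<rho> f) y = conv \<rho> (partial i f) y" by simp
  qed
  show "partial i (conv \<rho> f) = conv \<rho> (partial i f)" if "C_k (Suc r) f"
    by (rule part) (use C_k_mono[OF that] in blast)
  show "C_k r (conv \<rho> f)" if "C_k r f" using that
  proof (induction r arbitrary: f)
    case 0
    then show ?case using cont by simp
  next
    case (Suc r)
    then have f: "C_k (Suc 0) f" using C_k_mono by blast
    have "conv \<rho> f differentiable (at y)" for y using deriv[OF f] differentiable_def by blast
    then show ?case using Suc part[OF f] by simp
  qed
qed

lemma mpartial_conv:
  fixes f :: "'d::finite func"
  assumes \<rho>: "mollifier \<epsilon> \<rho>" and f: "C_k r f" and \<gamma>: "msize \<gamma> \<le> r"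
  shows "mpartial \<gamma> (conv \<rho> f) = conv \<rho> (mpartial \<gamma> f)"
proof -
  have "foldr partial is (conv \<rho> f) = conv \<rho> (foldr partial is f)" if "length is \<le> r" for "is"
    using that
  proof (induction "is")
    case (Cons i "is")
    then have "C_k (r - length is) (foldr partial is f)" using C_k_foldr_partial[OF f] by simp
    moreover have "r - length is = Suc (r - length (i # is))" using Cons.prems by simp
    ultimately have "C_k (Suc (r - length (i # is))) (foldr partial is f)" by simp
    from conv_C_k(2)[OF \<rho> this, of i] Cons show ?case by simp
  qed simp
  moreover obtain "is" where "length is = msize \<gamma>" "\<And>f. mpartial \<gamma> f = foldr partial is f"
    using mpartial_obtain[of \<gamma>] by blast
  ultimately show ?thesis using \<gamma> by simp
qed

lemma order_bounded_conv:
  fixes \<rho> :: "'d::finite func"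
  assumes \<rho>: "mollifier \<epsilon> \<rho>"
  shows "order_bounded q 0 1 1 (conv \<rho>)"
  unfolding order_bounded_def
proof (intro conjI allI impI ballI)
  show "mb_operator 1 (conv \<rho>)" by (rule mb_operator_conv[OF \<rho>])
  fix r and f :: "'d func"
  {
    assume "f \<in> C_b (0 + r)"
    then have f: "f \<in> C_b r" "C_k r f" by (auto simp: C_b_def)
    have m: "mpartial \<gamma> f \<in> M_b" if "msize \<gamma> \<le> r" for \<gamma>
      using f(1) continuous_mpartial[OF f(2) that] that unfolding C_b_def M_b_def
      by (auto intro: borel_measurable_continuous_onI)
    have s: "bounded (range (mpartial \<gamma> (conv \<rho> f))) \<and> sup_norm (mpartial \<gamma> (conv \<rho> f)) \<le> sup_norm (mpartial \<gamma> f)"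
      if "msize \<gamma> \<le> r" for \<gamma>
      unfolding mpartial_conv[OF \<rho> f(2) that]
      using mb_operatorD(1,2)[OF mb_operator_conv[OF \<rho>] m[OF that]] M_b_D(2) by simp
    then show "conv \<rho> f \<in> C_b r" using conv_C_k(1)[OF \<rho> f(2)] by (simp add: C_b_def)
    show "norm_inf r (conv \<rho> f) \<le> 1 * norm_inf (0 + r) f"
      unfolding norm_inf_def using s by (auto intro!: sum_mono)
  }
  assume "f \<in> C_1 (0 + r)"
  then have f: "f \<in> C_1 r" "C_k r f" by (auto simp: C_1_def)
  have s: "integrable lborel (mpartial \<gamma> (conv \<rho> f)) \<and>
      (\<integral>x. \<bar>mpartial \<gamma> (conv \<rho> f) x\<bar> \<partial>lborel) \<le> (\<integral>x. \<bar>mpartial \<gamma> f x\<bar> \<partial>lborel)"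
    if "msize \<gamma> \<le> r" for \<gamma>
    unfolding mpartial_conv[OF \<rho> f(2) that]
    using f(1) that by (auto simp: C_1_def intro!: conv_integrable[OF \<rho>])
  have "conv \<rho> f \<in> C_1 r" using s conv_C_k(1)[OF \<rho> f(2)] by (simp add: C_1_def)
  moreover have "norm_1 r (conv \<rho> f) \<le> 1 * norm_1 (0 + r) f"
    unfolding norm_1_def using s by (auto intro!: sum_mono)
  moreover have "is_dual (conv \<rho>) f (conv \<rho> f)"
    unfolding is_dual_def
  proof (intro conjI ballI)
    have fi: "integrable lborel f" by (rule C_1_integrable[OF f(1)])
    show "integrable lborel (conv \<rho> f)" by (rule conv_integrable(1)[OF \<rho> fi])
    fix g :: "'d func" assume g: "g \<in> M_b"
    have "(\<lambda>(x, y). g y) \<in> borel_measurable (lborel \<Otimes>\<^sub>M lborel)"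
      using M_b_D(1)[OF g] by measurable
    then have "integrable (lborel \<Otimes>\<^sub>M lborel) (\<lambda>p. (case p of (x, y) \<Rightarrow> f x * \<rho> (y - x)) * (case p of (x, y) \<Rightarrow> g y))"
      using M_b_abs_le[OF g] M_b_sup_norm_nonneg[OF g]
      by (intro Bochner_Integration.integrable_bound[OF integrable_mult_right[OF integrable_conv_kernel[OF \<rho> fi], of "sup_norm g"]])
        (auto simp: abs_mult mult.commute[of "sup_norm g"] intro!: borel_measurable_times mult_left_mono
          borel_measurable_integrable[OF integrable_conv_kernel[OF \<rho> fi]] AE_I2)
    then have i: "integrable (lborel \<Otimes>\<^sub>M lborel) (\<lambda>(x, y). g y * \<rho> (x - y) * f x)"
      by (simp add: case_prod_beta' mollifierD(8)[OF \<rho>] ac_simps)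
    have "(\<integral>x. conv \<rho> g x * f x \<partial>lborel) = (\<integral>x. \<integral>y. g y * \<rho> (x - y) * f x \<partial>lborel \<partial>lborel)"
      by (simp add: conv_def)
    also have "\<dots> = (\<integral>y. \<integral>x. g y * \<rho> (x - y) * f x \<partial>lborel \<partial>lborel)"
      by (rule lborel_pair.Fubini_integral[OF i, symmetric])
    also have "\<dots> = (\<integral>y. g y * conv \<rho> f y \<partial>lborel)"
      by (simp add: conv_def mollifierD(8)[OF \<rho>] mult.assoc mult.commute[of "f _"])
    finally show "(\<integral>x. conv \<rho> g x * f x \<partial>lborel) = (\<integral>x. g x * conv \<rho> f x \<partial>lborel)" .
  qed
  ultimately show "\<exists>h\<in>C_1 r. is_dual (conv \<rho>) f h \<and> norm_1 r h \<le> 1 * norm_1 (0 + r) f" by blast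
qed simp

definition mollifiers :: "(nat \<Rightarrow> 'd::finite func) \<Rightarrow> bool" where
  "mollifiers \<rho> \<longleftrightarrow> (\<forall>k. mollifier (1 / real (Suc k)) (\<rho> k))"

lemma mollifiers_exist: "\<exists>\<rho> :: nat \<Rightarrow> 'd::finite func. mollifiers \<rho>"
  unfolding mollifiers_def by (intro choice allI mollifier_exists) simp

lemma conv_tendsto:
  fixes g :: "'d::finite func"
  assumes \<rho>: "mollifiers \<rho>" and g: "g \<in> C_b 0"
  shows "(\<lambda>k. conv (\<rho> k) g z) \<longlonglongrightarrow> g z"
proof (rule LIMSEQ_I)
  fix e :: real assume "e > 0"
  then have "e / 2 > 0" by simp
  have gM: "g \<in> M_b" by (rule C_b_subset_M_b[OF g])
  have gc: "continuous_on UNIV g" using g by (simp add: C_b_0_iff)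
  obtain d where d: "d > 0" "\<And>(u :: real ^ 'd) h. u \<in> {z} \<Longrightarrow> norm h < d \<Longrightarrow> \<bar>g (u + h) - g u\<bar> \<le> e / 2"
    using uniform_continuity_near_compact[OF gc compact_sing \<open>e / 2 > 0\<close>] by blast
  obtain n where n: "1 / real (Suc n) < d" using nat_approx_posE[OF d(1)] by blast
  have "norm (conv (\<rho> k) g z - g z) < e" if "n \<le> k" for k
  proof -
    have \<rho>k: "mollifier (1 / real (Suc k)) (\<rho> k)" using \<rho> by (simp add: mollifiers_def)
    have i: "integrable lborel (\<lambda>y. g y * \<rho> k (z - y))"
      using integrable_times_M_b[OF integrable_mollifier_translate(1)[OF \<rho>k] gM, of z] by (simp add: mult.commute)
    note r = integrable_mollifier_translate[OF \<rho>k, of z]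
    have "conv (\<rho> k) g z - g z = (\<integral>y. (g y - g z) * \<rho> k (z - y) \<partial>lborel)"
      using i r by (simp add: conv_def left_diff_distrib)
    also have "\<bar>\<dots>\<bar> \<le> (\<integral>y. e / 2 * \<rho> k (z - y) \<partial>lborel)"
    proof (intro order_trans[OF integral_abs_bound] integral_mono)
      show "integrable lborel (\<lambda>y. \<bar>(g y - g z) * \<rho> k (z - y)\<bar>)"
        using i r by (intro integrable_abs) (simp add: left_diff_distrib)
      show "integrable lborel (\<lambda>y. e / 2 * \<rho> k (z - y))" using r(1) by simp
      fix y
      show "\<bar>(g y - g z) * \<rho> k (z - y)\<bar> \<le> e / 2 * \<rho> k (z - y)"
      proof (cases "1 / real (Suc k) \<le> norm (z - y)")
        case False
        have "1 / real (Suc k) \<le> 1 / real (Suc n)" using that by (simp add: frac_le)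
        with False n have "norm (y - z) < d" by (simp add: norm_minus_commute)
        then have "\<bar>g y - g z\<bar> \<le> e / 2" using d(2)[of z "y - z"] by simp
        then show ?thesis using mollifierD(2)[OF \<rho>k, of "z - y"] unfolding abs_mult
          using \<open>e > 0\<close> by (intro mult_mono) auto
      qed (simp add: mollifierD(5)[OF \<rho>k])
    qed
    also have "\<dots> = e / 2" using r(2) by simp
    finally show ?thesis using \<open>e > 0\<close> by simp
  qed
  then show "\<exists>n. \<forall>k\<ge>n. norm (conv (\<rho> k) g z - g z) < e" by blast
qed

text \<open>Mollified cut-offs approximate \<open>\<rho> * g\<close> by test functions, boundedly and pointwise.\<close>

lemma conv_cutoff_tendsto:
  fixes g :: "'d::finite func"
  assumes \<rho>: "mollifier \<epsilon> \<rho>" and g: "g \<in> M_b"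
  defines "h \<equiv> \<lambda>k. conv \<rho> (\<lambda>y. indicator (cball 0 (real k)) y * g y)"
  shows "h k \<in> C_c_inf" "\<bar>h k z\<bar> \<le> sup_norm g" "(\<lambda>k. h k z) \<longlonglongrightarrow> conv \<rho> g z"
proof -
  let ?g = "\<lambda>k y. indicator (cball 0 (real k)) y * g y"
  have b: "\<bar>?g k y\<bar> \<le> sup_norm g" for k y
    using M_b_abs_le[OF g, of y] M_b_sup_norm_nonneg[OF g] by (auto simp: indicator_def)
  have m: "?g k \<in> M_b" for k
    using M_b_D(1)[OF g] b
    by (intro M_b_I[where B = "sup_norm g"] borel_measurable_times borel_measurable_indicator) auto
  show "h k \<in> C_c_inf" unfolding h_def
    by (rule conv_C_c_inf(1)[OF m compact_cball[of 0 "real k"] _ mollifierD(1)[OF \<rho>]]) simp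
  show "\<bar>h k z\<bar> \<le> sup_norm g" unfolding h_def by (rule conv_abs_le[OF \<rho> m b])
  show "(\<lambda>k. h k z) \<longlonglongrightarrow> conv \<rho> g z" unfolding h_def
  proof (rule mb_functional_tendsto[OF mb_operatorD(3)[OF mb_operator_conv[OF \<rho>]] m b])
    fix x :: "real ^ 'd"
    obtain n :: nat where n: "norm x \<le> real n" using real_arch_simple by blast
    have "\<forall>\<^sub>F k in sequentially. ?g k x = g x"
      by (rule eventually_sequentiallyI[of n]) (use n in simp)
    then show "(\<lambda>k. ?g k x) \<longlonglongrightarrow> g x" by (rule tendsto_eventually)
  qed
qed

text \<open>From test functions to \<open>\<rho> * g\<close> by exhausting the space, to continuous \<open>g\<close> by letting the mollifiers concentrate,
  and to measurable functions through the Baire classes.\<close>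

lemma mb_functional_bound_extend_smooth:
  fixes \<Lambda> :: "'d::finite func \<Rightarrow> real"
  assumes \<Lambda>: "mb_functional \<Lambda>" and bound: "\<And>f. f \<in> C_c_inf \<Longrightarrow> \<bar>\<Lambda> f\<bar> \<le> C * sup_norm f"
    and f: "f \<in> M_b" and C: "C \<ge> 0"
  shows "\<bar>\<Lambda> f\<bar> \<le> C * sup_norm f"
proof (rule mb_functional_bound_extend[OF \<Lambda> _ f C])
  fix g :: "'d func" assume g: "g \<in> C_b 0"
  then have gM: "g \<in> M_b" by (rule C_b_subset_M_b)
  obtain \<rho> :: "nat \<Rightarrow> 'd func" where \<rho>: "mollifiers \<rho>" using mollifiers_exist by blast
  have 1: "\<bar>\<Lambda> (conv (\<rho> j) g)\<bar> \<le> C * sup_norm g" for j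
  proof -
    have \<rho>j: "mollifier (1 / real (Suc j)) (\<rho> j)" using \<rho> by (simp add: mollifiers_def)
    let ?h = "\<lambda>k. conv (\<rho> j) (\<lambda>y. indicator (cball 0 (real k)) y * g y)"
    note h = conv_cutoff_tendsto[OF \<rho>j gM]
    have "(\<lambda>k. \<Lambda> (?h k)) \<longlonglongrightarrow> \<Lambda> (conv (\<rho> j) g)"
      by (rule mb_functional_tendsto[OF \<Lambda> C_c_inf_subset_M_b[OF h(1)] h(2,3)])
    moreover have "\<bar>\<Lambda> (?h k)\<bar> \<le> C * sup_norm g" for k
      using bound[OF h(1)] mult_left_mono[OF sup_norm_le[OF h(2)] C] by (rule order_trans)
    ultimately show ?thesis by (intro tendsto_upperbound[OF tendsto_rabs]) auto
  qed
  have "(\<lambda>j. \<Lambda> (conv (\<rho> j) g)) \<longlonglongrightarrow> \<Lambda> g"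
  proof (rule mb_functional_tendsto[OF \<Lambda> _ _ conv_tendsto[OF \<rho> g]])
    fix j
    have \<rho>j: "mollifier (1 / real (Suc j)) (\<rho> j)" using \<rho> by (simp add: mollifiers_def)
    show "conv (\<rho> j) g \<in> M_b" by (rule mb_operatorD(1)[OF mb_operator_conv[OF \<rho>j] gM])
    show "\<bar>conv (\<rho> j) g x\<bar> \<le> sup_norm g" for x by (rule conv_abs_le[OF \<rho>j gM M_b_abs_le[OF gM]])
  qed
  with 1 show "\<bar>\<Lambda> g\<bar> \<le> C * sup_norm g" by (intro tendsto_upperbound[OF tendsto_rabs]) auto
qed

section \<open>Regularisation\<close>

text \<open>A functional that has lost \<open>r\<close> derivatives. Precomposing it with an operator of order \<open>\<kappa>\<close> costs \<open>\<kappa>\<close> more, which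
  is how the factors to the left of a gap are accounted for.\<close>

definition order_functional :: "nat \<Rightarrow> real \<Rightarrow> real \<Rightarrow> ('d::finite func \<Rightarrow> real) \<Rightarrow> bool" where
  "order_functional r a A \<Lambda> \<longleftrightarrow> mb_functional \<Lambda> \<and> 0 \<le> a \<and> 0 \<le> A \<and>
     (\<forall>f\<in>C_b r. \<bar>\<Lambda> f\<bar> \<le> a * norm_inf r f) \<and> (\<forall>f\<in>M_b. \<bar>\<Lambda> f\<bar> \<le> A * sup_norm f)"

text \<open>A bound of \<open>g\<close> in a negative norm of order \<open>\<kappa>\<close>. Applying an operator of order \<open>\<kappa>'\<close> raises the order by \<open>\<kappa>'\<close>
  through its dual, which is how the factors to the right of a gap are accounted for.\<close>

definition weak_bounded :: "nat \<Rightarrow> real \<Rightarrow> 'd::finite func \<Rightarrow> bool" where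
  "weak_bounded \<kappa> v g \<longleftrightarrow> g \<in> M_b \<and> 0 \<le> v \<and>
     (\<forall>\<phi>\<in>C_1 \<kappa>. \<bar>\<integral>x. g x * \<phi> x \<partial>lborel\<bar> \<le> v * norm_1 \<kappa> \<phi>)"

text \<open>A smoothing operator repairs any combination of losses on its two sides, as long as their sum is at most
  \<open>q\<close>. The estimate is free of the supremum norm of \<open>g\<close> and of the bound \<open>A\<close> of \<open>\<Lambda>\<close> on \<open>M_b\<close>, which may
  be large.\<close>

definition smoothing :: "nat \<Rightarrow> real \<Rightarrow> 'd::finite operator \<Rightarrow> bool" where
  "smoothing q M S \<longleftrightarrow> 0 \<le> M \<and> (\<forall>f\<in>M_b. S f \<in> M_b) \<and>
     (\<forall>f\<in>M_b. \<forall>g\<in>M_b. \<forall>a b. S (\<lambda>x. a * f x + b * g x) = (\<lambda>x. a * S f x + b * S g x)) \<and>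
     (\<forall>r \<kappa> a A \<Lambda> v g. r + \<kappa> \<le> q \<longrightarrow> order_functional r a A \<Lambda> \<longrightarrow> weak_bounded \<kappa> v g \<longrightarrow>
        \<bar>\<Lambda> (S g)\<bar> \<le> M * a * v)"

definition approx_smoothing :: "nat \<Rightarrow> real \<Rightarrow> real \<Rightarrow> 'd::finite operator \<Rightarrow> bool" where
  "approx_smoothing q M \<epsilon> G \<longleftrightarrow> 0 \<le> \<epsilon> \<and>
     (\<exists>S. smoothing q M S \<and> (\<forall>g\<in>M_b. \<forall>x. \<bar>G g x - S g x\<bar> \<le> \<epsilon> * sup_norm g))"

lemma order_functionalD:
  assumes "order_functional r a A \<Lambda>"
  shows "mb_functional \<Lambda>" "0 \<le> a" "0 \<le> A" "f \<in> C_b r \<Longrightarrow> \<bar>\<Lambda> f\<bar> \<le> a * norm_inf r f"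
    "f \<in> M_b \<Longrightarrow> \<bar>\<Lambda> f\<bar> \<le> A * sup_norm f"
  using assms unfolding order_functional_def by blast+

lemma weak_boundedD:
  assumes "weak_bounded \<kappa> v g"
  shows "g \<in> M_b" "0 \<le> v" "\<phi> \<in> C_1 \<kappa> \<Longrightarrow> \<bar>\<integral>x. g x * \<phi> x \<partial>lborel\<bar> \<le> v * norm_1 \<kappa> \<phi>"
  using assms unfolding weak_bounded_def by blast+

lemma smoothingD:
  assumes "smoothing q M S"
  shows "0 \<le> M" "f \<in> M_b \<Longrightarrow> S f \<in> M_b"
    "f \<in> M_b \<Longrightarrow> g \<in> M_b \<Longrightarrow> S (\<lambda>x. a * f x + b * g x) = (\<lambda>x. a * S f x + b * S g x)"
    "r + \<kappa> \<le> q \<Longrightarrow> order_functional r a' A \<Lambda> \<Longrightarrow> weak_bounded \<kappa> v h \<Longrightarrow> \<bar>\<Lambda> (S h)\<bar> \<le> M * a' * v"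
  using assms unfolding smoothing_def by blast+

lemma order_functional_eval: "order_functional 0 1 1 (\<lambda>f. f x)"
  unfolding order_functional_def norm_inf_0
  by (auto intro: mb_functional_eval M_b_abs_le C_b_subset_M_b)

lemma order_functional_comp:
  fixes \<Lambda> :: "'d::finite func \<Rightarrow> real"
  assumes \<Lambda>: "order_functional r a A \<Lambda>" and X: "order_bounded q \<kappa> e b X" and r: "r + \<kappa> \<le> q"
  shows "order_functional (\<kappa> + r) (a * e) (A * b) (\<lambda>f. \<Lambda> (X f))"
  unfolding order_functional_def
proof (intro conjI ballI)
  have m: "mb_operator b X" by (rule order_boundedD(1)[OF X])
  show "mb_functional (\<lambda>f. \<Lambda> (X f))" by (rule mb_functional_comp[OF order_functionalD(1)[OF \<Lambda>] m])
  show "0 \<le> a * e" "0 \<le> A * b"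
    using order_functionalD(2,3)[OF \<Lambda>] order_boundedD(2)[OF X] mb_operatorD(4)[OF m] by auto
  fix f :: "'d func"
  show "\<bar>\<Lambda> (X f)\<bar> \<le> a * e * norm_inf (\<kappa> + r) f" if "f \<in> C_b (\<kappa> + r)"
    using order_functionalD(4)[OF \<Lambda> order_boundedD(3)[OF X r that]]
      mult_left_mono[OF order_boundedD(4)[OF X r that] order_functionalD(2)[OF \<Lambda>]] by (simp add: mult.assoc)
  show "\<bar>\<Lambda> (X f)\<bar> \<le> A * b * sup_norm f" if "f \<in> M_b"
    using order_functionalD(5)[OF \<Lambda> mb_operatorD(1)[OF m that]]
      mult_left_mono[OF mb_operatorD(2)[OF m that] order_functionalD(3)[OF \<Lambda>]] by (simp add: mult.assoc)
qed

lemma weak_bounded_sup_norm: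
  fixes g :: "'d::finite func"
  assumes "g \<in> M_b" "\<And>x. \<bar>g x\<bar> \<le> B"
  shows "weak_bounded 0 B g"
  unfolding weak_bounded_def
proof (intro conjI ballI)
  show B: "0 \<le> B" using order_trans[OF abs_ge_zero assms(2)] .
  fix \<phi> :: "'d func" assume "\<phi> \<in> C_1 0"
  then have "\<bar>\<integral>x. \<phi> x * g x \<partial>lborel\<bar> \<le> sup_norm g * norm_1 0 \<phi>"
    unfolding norm_1_0 by (rule integral_abs_bound_M_b[OF C_1_integrable assms(1)])
  also have "\<dots> \<le> B * norm_1 0 \<phi>"
    using sup_norm_le[of g B] assms(2) norm_1_nonneg by (intro mult_right_mono) auto
  finally show "\<bar>\<integral>x. g x * \<phi> x \<partial>lborel\<bar> \<le> B * norm_1 0 \<phi>" by (simp add: mult.commute)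
qed (rule assms(1))

lemma weak_bounded_apply:
  fixes g :: "'d::finite func"
  assumes g: "weak_bounded \<kappa> v g" and X: "order_bounded q \<kappa>' e b X" and le: "\<kappa> + \<kappa>' \<le> q"
  shows "weak_bounded (\<kappa>' + \<kappa>) (e * v) (X g)"
  unfolding weak_bounded_def
proof (intro conjI ballI)
  show "X g \<in> M_b" by (rule mb_operatorD(1)[OF order_boundedD(1)[OF X] weak_boundedD(1)[OF g]])
  show "0 \<le> e * v" using weak_boundedD(2)[OF g] order_boundedD(2)[OF X] by simp
  fix \<phi> :: "'d func" assume "\<phi> \<in> C_1 (\<kappa>' + \<kappa>)"
  then obtain h where h: "h \<in> C_1 \<kappa>" "is_dual X \<phi> h" "norm_1 \<kappa> h \<le> e * norm_1 (\<kappa>' + \<kappa>) \<phi>"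
    using order_boundedD(5)[OF X, of \<kappa> \<phi>] le by blast
  have "\<bar>\<integral>x. X g x * \<phi> x \<partial>lborel\<bar> = \<bar>\<integral>x. g x * h x \<partial>lborel\<bar>"
    using h(2) weak_boundedD(1)[OF g] by (simp add: is_dual_def)
  also have "\<dots> \<le> v * norm_1 \<kappa> h" by (rule weak_boundedD(3)[OF g h(1)])
  also have "\<dots> \<le> v * (e * norm_1 (\<kappa>' + \<kappa>) \<phi>)" using h(3) weak_boundedD(2)[OF g] by (rule mult_left_mono)
  finally show "\<bar>\<integral>x. X g x * \<phi> x \<partial>lborel\<bar> \<le> e * v * norm_1 (\<kappa>' + \<kappa>) \<phi>" by (simp add: ac_simps)
qed

lemma smoothing_comp_left:
  fixes S X :: "'d::finite operator"
  assumes S: "smoothing q M S" and X: "order_bounded q 0 e b X"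
  shows "smoothing q (e * M) (\<lambda>f. X (S f))"
  unfolding smoothing_def
proof (intro conjI ballI allI impI)
  have m: "mb_operator b X" by (rule order_boundedD(1)[OF X])
  show "0 \<le> e * M" using smoothingD(1)[OF S] order_boundedD(2)[OF X] by simp
  show "X (S f) \<in> M_b" if "f \<in> M_b" for f by (rule mb_operatorD(1)[OF m smoothingD(2)[OF S that]])
  show "X (S (\<lambda>x. a * f x + b * g x)) = (\<lambda>x. a * X (S f) x + b * X (S g) x)" if "f \<in> M_b" "g \<in> M_b" for f g a b
    unfolding smoothingD(3)[OF S that]
    by (rule mb_operator_lincomb_apply[OF m smoothingD(2)[OF S that(1)] smoothingD(2)[OF S that(2)]])
  fix r \<kappa> a A v and \<Lambda> :: "'d func \<Rightarrow> real" and g :: "'d func"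
  assume r: "r + \<kappa> \<le> q" and \<Lambda>: "order_functional r a A \<Lambda>" and g: "weak_bounded \<kappa> v g"
  have "order_functional (0 + r) (a * e) (A * b) (\<lambda>f. \<Lambda> (X f))"
    using order_functional_comp[OF \<Lambda> X] r by simp
  from smoothingD(4)[OF S _ this g] r show "\<bar>\<Lambda> (X (S g))\<bar> \<le> e * M * a * v" by (simp add: ac_simps)
qed

lemma smoothing_comp_right:
  fixes S X :: "'d::finite operator"
  assumes S: "smoothing q M S" and X: "order_bounded q 0 e b X"
  shows "smoothing q (M * e) (\<lambda>f. S (X f))"
  unfolding smoothing_def
proof (intro conjI ballI allI impI)
  have m: "mb_operator b X" by (rule order_boundedD(1)[OF X])
  show "0 \<le> M * e" using smoothingD(1)[OF S] order_boundedD(2)[OF X] by simp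
  show "S (X f) \<in> M_b" if "f \<in> M_b" for f by (rule smoothingD(2)[OF S mb_operatorD(1)[OF m that]])
  show "S (X (\<lambda>x. a * f x + b * g x)) = (\<lambda>x. a * S (X f) x + b * S (X g) x)" if "f \<in> M_b" "g \<in> M_b" for f g a b
    unfolding mb_operator_lincomb_apply[OF m that]
    by (rule smoothingD(3)[OF S mb_operatorD(1)[OF m that(1)] mb_operatorD(1)[OF m that(2)]])
  fix r \<kappa> a A v and \<Lambda> :: "'d func \<Rightarrow> real" and g :: "'d func"
  assume r: "r + \<kappa> \<le> q" and \<Lambda>: "order_functional r a A \<Lambda>" and g: "weak_bounded \<kappa> v g"
  have "weak_bounded (0 + \<kappa>) (e * v) (X g)" using weak_bounded_apply[OF g X] r by simp
  from smoothingD(4)[OF S _ \<Lambda> this] r show "\<bar>\<Lambda> (S (X g))\<bar> \<le> M * e * a * v" by (simp add: ac_simps)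
qed

text \<open>The right factor repairs the loss of \<open>g\<close> and the left one that of \<open>\<Lambda>\<close>; in between, a supremum bound is enough.\<close>

lemma smoothing_comp:
  fixes S S' :: "'d::finite operator"
  assumes S: "smoothing q M S" and S': "smoothing q M' S'"
  shows "smoothing q (M * M') (\<lambda>f. S (S' f))"
  unfolding smoothing_def
proof (intro conjI ballI allI impI)
  show "0 \<le> M * M'" using smoothingD(1)[OF S] smoothingD(1)[OF S'] by simp
  show "S (S' f) \<in> M_b" if "f \<in> M_b" for f by (rule smoothingD(2)[OF S smoothingD(2)[OF S' that]])
  show "S (S' (\<lambda>x. a * f x + b * g x)) = (\<lambda>x. a * S (S' f) x + b * S (S' g) x)" if "f \<in> M_b" "g \<in> M_b" for f g a b
    unfolding smoothingD(3)[OF S' that]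
    by (rule smoothingD(3)[OF S smoothingD(2)[OF S' that(1)] smoothingD(2)[OF S' that(2)]])
  fix r \<kappa> a A v and \<Lambda> :: "'d func \<Rightarrow> real" and g :: "'d func"
  assume r: "r + \<kappa> \<le> q" and \<Lambda>: "order_functional r a A \<Lambda>" and g: "weak_bounded \<kappa> v g"
  have "\<bar>S' g x\<bar> \<le> M' * v" for x
    using smoothingD(4)[OF S' _ order_functional_eval g, of x] r by simp
  then have "weak_bounded 0 (M' * v) (S' g)"
    by (rule weak_bounded_sup_norm[OF smoothingD(2)[OF S' weak_boundedD(1)[OF g]]])
  from smoothingD(4)[OF S _ \<Lambda> this] r show "\<bar>\<Lambda> (S (S' g))\<bar> \<le> M * M' * a * v" by (simp add: ac_simps)
qed

lemma smoothing_lincomb: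
  fixes S S' :: "'d::finite operator"
  assumes S: "smoothing q M S" and S': "smoothing q M' S'"
  shows "smoothing q (\<bar>a\<bar> * M + \<bar>c\<bar> * M') (\<lambda>f x. a * S f x + c * S' f x)"
  unfolding smoothing_def
proof (intro conjI ballI allI impI)
  show "0 \<le> \<bar>a\<bar> * M + \<bar>c\<bar> * M'" using smoothingD(1)[OF S] smoothingD(1)[OF S'] by simp
  show "(\<lambda>x. a * S f x + c * S' f x) \<in> M_b" if "f \<in> M_b" for f
    by (rule M_b_lincomb[OF smoothingD(2)[OF S that] smoothingD(2)[OF S' that]])
  show "(\<lambda>x. a * S (\<lambda>x. a' * f x + b * g x) x + c * S' (\<lambda>x. a' * f x + b * g x) x)
      = (\<lambda>x. a' * (a * S f x + c * S' f x) + b * (a * S g x + c * S' g x))"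
    if "f \<in> M_b" "g \<in> M_b" for f g a' b
    unfolding smoothingD(3)[OF S that] smoothingD(3)[OF S' that] by (simp add: algebra_simps)
  fix r \<kappa> a' A v and \<Lambda> :: "'d func \<Rightarrow> real" and g :: "'d func"
  assume r: "r + \<kappa> \<le> q" and \<Lambda>: "order_functional r a' A \<Lambda>" and g: "weak_bounded \<kappa> v g"
  have "\<Lambda> (\<lambda>x. a * S g x + c * S' g x) = a * \<Lambda> (S g) + c * \<Lambda> (S' g)"
    using mb_functional_lincomb[OF order_functionalD(1)[OF \<Lambda>]] smoothingD(2)[OF S] smoothingD(2)[OF S']
      weak_boundedD(1)[OF g] by blast
  also have "\<bar>\<dots>\<bar> \<le> \<bar>a\<bar> * \<bar>\<Lambda> (S g)\<bar> + \<bar>c\<bar> * \<bar>\<Lambda> (S' g)\<bar>" by (metis abs_mult abs_triangle_ineq)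
  also have "\<dots> \<le> \<bar>a\<bar> * (M * a' * v) + \<bar>c\<bar> * (M' * a' * v)"
    using smoothingD(4)[OF S r \<Lambda> g] smoothingD(4)[OF S' r \<Lambda> g] by (intro add_mono mult_left_mono) auto
  finally show "\<bar>\<Lambda> (\<lambda>x. a * S g x + c * S' g x)\<bar> \<le> (\<bar>a\<bar> * M + \<bar>c\<bar> * M') * a' * v"
    by (simp add: algebra_simps)
qed

text \<open>The zero operator approximates the identity with error one. This starts the induction over
  the factors of a composition.\<close>

lemma approx_smoothing_id: "approx_smoothing q 0 1 (\<lambda>f. f)"
proof -
  have "\<Lambda> (\<lambda>x. 0) = 0" if "mb_functional \<Lambda>" for \<Lambda> :: "'a func \<Rightarrow> real"
    using mb_functional_lincomb[OF that M_b_zero M_b_zero, of 0 0] by simp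
  then have "smoothing q 0 (\<lambda>f :: 'a func. \<lambda>x. 0)"
    unfolding smoothing_def using M_b_zero order_functionalD(1) by fastforce
  then show ?thesis unfolding approx_smoothing_def using M_b_abs_le by fastforce
qed

text \<open>The errors of approximations by smoothing operators multiply under composition:
  \<open>G\<^sub>1 G\<^sub>2 - S = (G\<^sub>1 - S\<^sub>1) (G\<^sub>2 - S\<^sub>2)\<close> for \<open>S = S\<^sub>1 G\<^sub>2 + G\<^sub>1 S\<^sub>2 - S\<^sub>1 S\<^sub>2\<close>, and \<open>S\<close> is smoothing because
  each of its terms contains a smoothing factor.\<close>

lemma approx_smoothing_comp:
  fixes G1 G2 :: "'d::finite operator"
  assumes G1: "order_bounded q 0 k1 b1 G1" "approx_smoothing q M1 \<epsilon>1 G1"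
    and G2: "order_bounded q 0 k2 b2 G2" "approx_smoothing q M2 \<epsilon>2 G2"
  shows "approx_smoothing q (M1 * k2 + k1 * M2 + M1 * M2) (\<epsilon>1 * \<epsilon>2) (\<lambda>f. G1 (G2 f))"
proof -
  obtain S1 where S1: "smoothing q M1 S1" "\<And>g x. g \<in> M_b \<Longrightarrow> \<bar>G1 g x - S1 g x\<bar> \<le> \<epsilon>1 * sup_norm g"
    and e1: "0 \<le> \<epsilon>1" using G1(2) unfolding approx_smoothing_def by blast
  obtain S2 where S2: "smoothing q M2 S2" "\<And>g x. g \<in> M_b \<Longrightarrow> \<bar>G2 g x - S2 g x\<bar> \<le> \<epsilon>2 * sup_norm g"
    and e2: "0 \<le> \<epsilon>2" using G2(2) unfolding approx_smoothing_def by blast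
  define S where "S = (\<lambda>f x. 1 * (1 * S1 (G2 f) x + 1 * G1 (S2 f) x) + (-1) * S1 (S2 f) x)"
  have "smoothing q (\<bar>1\<bar> * (\<bar>1\<bar> * (M1 * k2) + \<bar>1\<bar> * (k1 * M2)) + \<bar>-1\<bar> * (M1 * M2)) S"
    unfolding S_def
    by (intro smoothing_lincomb[of q "\<bar>1\<bar> * (M1 * k2) + \<bar>1\<bar> * (k1 * M2)" "\<lambda>f x. 1 * S1 (G2 f) x + 1 * G1 (S2 f) x"]
        smoothing_lincomb smoothing_comp_right[OF S1(1) G2(1)] smoothing_comp_left[OF S2(1) G1(1)]
        smoothing_comp[OF S1(1) S2(1)])
  then have S: "smoothing q (M1 * k2 + k1 * M2 + M1 * M2) S" by simp
  have "\<bar>G1 (G2 g) x - S g x\<bar> \<le> \<epsilon>1 * \<epsilon>2 * sup_norm g" if g: "g \<in> M_b" for g x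
  proof -
    let ?h = "\<lambda>x. 1 * G2 g x + (-1) * S2 g x"
    have m: "G2 g \<in> M_b" "S2 g \<in> M_b" using mb_operatorD(1)[OF order_boundedD(1)[OF G2(1)] g] smoothingD(2)[OF S2(1) g] by auto
    then have h: "?h \<in> M_b" by (rule M_b_lincomb)
    have "G1 (G2 g) x - S g x = G1 ?h x - S1 ?h x"
      unfolding mb_operator_lincomb_apply[OF order_boundedD(1)[OF G1(1)] m] smoothingD(3)[OF S1(1) m] S_def by simp
    also have "\<bar>\<dots>\<bar> \<le> \<epsilon>1 * sup_norm ?h" by (rule S1(2)[OF h])
    also have "\<dots> \<le> \<epsilon>1 * (\<epsilon>2 * sup_norm g)"
      using S2(2)[OF g] e1 by (intro mult_left_mono sup_norm_le) auto
    finally show ?thesis by (simp add: mult.assoc)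
  qed
  then show ?thesis unfolding approx_smoothing_def using S e1 e2 by (intro conjI exI[of _ S]) auto
qed

subsection \<open>The kernel of a regularising operator\<close>

lemma linear_on_M_bD:
  "linear_on_M_b A \<Longrightarrow> f \<in> M_b \<Longrightarrow> g \<in> M_b \<Longrightarrow> A (\<lambda>x. a * f x + b * g x) = (\<lambda>x. a * A f x + b * A g x)"
  unfolding linear_on_M_b_def by blast

lemma card_msize_mono:
  "\<kappa> \<le> q \<Longrightarrow> card {\<gamma> :: 'd::finite \<Rightarrow> nat. msize \<gamma> \<le> \<kappa>} \<le> card {\<gamma> :: 'd \<Rightarrow> nat. msize \<gamma> \<le> q}"
  by (intro card_mono finite_msize_le) auto

text \<open>The bounds of the regularising family concern test functions only, and nothing is known about it under bounded
  pointwise limits. Its values on the mollified cut-offs \<open>\<rho> * (1\<^sub>B g)\<close> are integrals of \<open>g\<close> against integrable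
  kernels, so that they converge as \<open>B\<close> exhausts the space, and the limit defines a smoothing operator.\<close>

lemma regularisation_approx_smoothing:
  fixes Q Qbar :: "'d::finite operator"
  assumes Q: "mb_operator b Q" and lin: "linear_on_M_b Qbar" and smooth: "\<And>f. f \<in> M_b \<Longrightarrow> Qbar f \<in> C_b_inf"
    and reg: "\<And>r \<gamma> f. msize \<gamma> + r \<le> q \<Longrightarrow> f \<in> C_c_inf \<Longrightarrow> norm_inf r (Qbar (mpartial \<gamma> f)) \<le> M * sup_norm f"
    and close: "\<And>f. f \<in> M_b \<Longrightarrow> sup_norm (\<lambda>x. Q f x - Qbar f x) \<le> \<epsilon> * sup_norm f"
    and M: "M \<ge> 0" and \<epsilon>: "\<epsilon> \<ge> 0" and \<rho>: "mollifier \<delta> \<rho>"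
  shows "approx_smoothing q (real (card {\<gamma> :: 'd \<Rightarrow> nat. msize \<gamma> \<le> q}) * M) \<epsilon> (\<lambda>f. Q (conv \<rho> f))"
proof -
  define N where "N = real (card {\<gamma> :: 'd \<Rightarrow> nat. msize \<gamma> \<le> q})"
  let ?cut = "\<lambda>k g y. indicator (cball 0 (real k)) y * g y"
  \<comment> \<open>The mollified cut-offs \<open>h g k\<close> are test functions, so that the regularising bounds apply to them.\<close>
  define h where "h = (\<lambda>g k. conv \<rho> (?cut k g))"
  have h: "h g k \<in> C_c_inf" "\<bar>h g k z\<bar> \<le> sup_norm g" "(\<lambda>k. h g k z) \<longlonglongrightarrow> conv \<rho> g z"
    if "g \<in> M_b" for g k z
    unfolding h_def by (rule conv_cutoff_tendsto[OF \<rho> that])+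
  have QbarC: "Qbar f \<in> C_b r" if "f \<in> M_b" for f r using smooth[OF that] by (simp add: C_b_inf_def)
  have QbarM: "Qbar f \<in> M_b" if "f \<in> M_b" for f using QbarC[OF that, of 0] C_b_subset_M_b by blast
  \<comment> \<open>The density depends on \<open>\<Lambda>\<close> but neither on \<open>g\<close> nor on the cut-off \<open>k\<close>. This is the reason why the limit below exists.\<close>
  have dens: "\<exists>\<psi>\<in>C_1 \<kappa>. norm_1 \<kappa> \<psi> \<le> N * (a * M) \<and>
      (\<forall>g\<in>M_b. \<forall>k. \<Lambda> (Qbar (h g k)) = (\<integral>y. ?cut k g y * \<psi> y \<partial>lborel))"
    if r: "r + \<kappa> \<le> q" and \<Lambda>: "order_functional r a A \<Lambda>" for r \<kappa> a A \<Lambda>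
  proof -
    let ?L = "\<lambda>f. \<Lambda> (Qbar f)"
    have bd: "\<bar>?L (mpartial \<gamma> f)\<bar> \<le> a * M * sup_norm f" if "msize \<gamma> \<le> \<kappa>" "f \<in> C_c_inf" for \<gamma> f
    proof -
      have "\<bar>?L (mpartial \<gamma> f)\<bar> \<le> a * norm_inf r (Qbar (mpartial \<gamma> f))"
        by (rule order_functionalD(4)[OF \<Lambda> QbarC[OF C_c_inf_subset_M_b[OF C_c_inf_mpartial[OF that(2)]]]])
      also have "\<dots> \<le> a * (M * sup_norm f)"
        using reg[of \<gamma> r f] that r order_functionalD(2)[OF \<Lambda>] by (intro mult_left_mono) auto
      finally show ?thesis by (simp add: mult.assoc)
    qed
    have L: "test_functional (a * M) ?L" unfolding test_functional_def
    proof (intro conjI ballI allI)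
      fix f g :: "'d func" and c d assume "f \<in> C_c_inf" "g \<in> C_c_inf"
      then have "f \<in> M_b" "g \<in> M_b" using C_c_inf_subset_M_b by auto
      then show "?L (\<lambda>x. c * f x + d * g x) = c * ?L f + d * ?L g"
        using linear_on_M_bD[OF lin] mb_functional_lincomb[OF order_functionalD(1)[OF \<Lambda>] QbarM QbarM] by simp
    next
      fix f :: "'d func" assume "f \<in> C_c_inf"
      then show "\<bar>?L f\<bar> \<le> a * M * sup_norm f"
        using bd[of "\<lambda>_. 0" f] by (simp add: mpartial_zero msize_def)
    qed
    have aM: "0 \<le> a * M" using order_functionalD(2)[OF \<Lambda>] M by simp
    note \<psi> = regularising_functional_density[OF L aM \<rho> bd]
    let ?\<psi> = "\<lambda>y. ?L (\<lambda>z. \<rho> (y - z))"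
    have "?\<psi> \<in> C_1 \<kappa>" by (rule \<psi>(1))
    moreover have "norm_1 \<kappa> ?\<psi> \<le> N * (a * M)"
    proof (rule order_trans[OF \<psi>(2)])
      show "real (card {\<gamma> :: 'd \<Rightarrow> nat. msize \<gamma> \<le> \<kappa>}) * (a * M) \<le> N * (a * M)"
        unfolding N_def using card_msize_mono[of \<kappa> q, where 'd = 'd] r aM by (intro mult_right_mono) auto
    qed
    moreover have "\<Lambda> (Qbar (h g k)) = (\<integral>y. ?cut k g y * ?\<psi> y \<partial>lborel)" if "g \<in> M_b" for g k
      unfolding h_def
    proof (rule \<psi>(3))
      show "?cut k g \<in> M_b"
        using M_b_D(1)[OF that] M_b_abs_le[OF that] M_b_sup_norm_nonneg[OF that]
        by (intro M_b_I[where B = "sup_norm g"] borel_measurable_times borel_measurable_indicator)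
          (auto simp: indicator_def)
      show "compact (cball 0 (real k) :: (real ^ 'd) set)" by simp
    qed auto
    ultimately show ?thesis by blast
  qed
  have lim: "(\<lambda>k. \<integral>y. ?cut k g y * \<psi> y \<partial>lborel) \<longlonglongrightarrow> (\<integral>y. g y * \<psi> y \<partial>lborel)"
    if g: "g \<in> M_b" and \<psi>: "integrable lborel \<psi>" for g \<psi> :: "'d func"
  proof (rule integral_dominated_convergence[where w = "\<lambda>y. sup_norm g * \<bar>\<psi> y\<bar>"])
    have [measurable]: "g \<in> borel_measurable borel" "\<psi> \<in> borel_measurable borel"
      using M_b_D(1)[OF g] \<psi> by auto
    show "(\<lambda>y. g y * \<psi> y) \<in> borel_measurable lborel" by simp
    have "(indicator (cball 0 (real k)) :: 'd func) \<in> borel_measurable lborel" for k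
      by (intro borel_measurable_indicator) auto
    then show "(\<lambda>y. ?cut k g y * \<psi> y) \<in> borel_measurable lborel" for k
      by (intro borel_measurable_times) auto
    show "integrable lborel (\<lambda>y. sup_norm g * \<bar>\<psi> y\<bar>)" using \<psi> by (intro integrable_mult_right integrable_abs)
    show "AE y in lborel. (\<lambda>k. ?cut k g y * \<psi> y) \<longlonglongrightarrow> g y * \<psi> y"
    proof (rule AE_I2)
      fix y :: "real ^ 'd"
      obtain n :: nat where n: "norm y \<le> real n" using real_arch_simple by blast
      have "\<forall>\<^sub>F k in sequentially. ?cut k g y * \<psi> y = g y * \<psi> y"
        by (rule eventually_sequentiallyI[of n]) (use n in simp)
      then show "(\<lambda>k. ?cut k g y * \<psi> y) \<longlonglongrightarrow> g y * \<psi> y" by (rule tendsto_eventually)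
    qed
    show "AE y in lborel. norm (?cut k g y * \<psi> y) \<le> sup_norm g * \<bar>\<psi> y\<bar>" for k
      using M_b_abs_le[OF g] M_b_sup_norm_nonneg[OF g]
      by (intro AE_I2) (auto simp: abs_mult indicator_def intro!: mult_right_mono)
  qed
  \<comment> \<open>On functions with compact support \<open>S\<close> is \<open>Qbar\<close> composed with the mollification; elsewhere the two may differ.\<close>
  define S where "S = (\<lambda>g x. lim (\<lambda>k. Qbar (h g k) x))"
  have S: "(\<lambda>k. Qbar (h g k) x) \<longlonglongrightarrow> S g x" if g: "g \<in> M_b" for g x
  proof -
    obtain \<psi> where \<psi>: "\<psi> \<in> C_1 0" "\<forall>g\<in>M_b. \<forall>k. Qbar (h g k) x = (\<integral>y. ?cut k g y * \<psi> y \<partial>lborel)"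
      using dens[OF _ order_functional_eval[of x], of 0] by auto
    then have "convergent (\<lambda>k. Qbar (h g k) x)"
      using lim[OF g C_1_integrable[OF \<psi>(1)]] g by (auto simp: convergent_def)
    then show ?thesis unfolding S_def by (rule convergent_LIMSEQ_iff[THEN iffD1])
  qed
  have hM: "h g k \<in> M_b" if "g \<in> M_b" for g k by (rule C_c_inf_subset_M_b[OF h(1)[OF that]])
  have Qh: "\<bar>Qbar (h g k) x\<bar> \<le> M * sup_norm g" if g: "g \<in> M_b" for g k x
  proof -
    have "\<bar>Qbar (h g k) x\<bar> \<le> norm_inf 0 (Qbar (h g k))"
      unfolding norm_inf_0 by (rule M_b_abs_le[OF QbarM[OF hM[OF g]]])
    also have "\<dots> \<le> M * sup_norm (h g k)"
      using reg[of "\<lambda>_. 0" 0 "h g k"] h(1)[OF g] by (simp add: mpartial_zero msize_def)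
    also have "\<dots> \<le> M * sup_norm g" using h(2)[OF g] M by (intro mult_left_mono sup_norm_le)
    finally show ?thesis .
  qed
  have SM: "S g \<in> M_b" if g: "g \<in> M_b" for g
    by (rule M_b_limit(1)[OF QbarM[OF hM[OF g]] Qh[OF g] S[OF g]])
  have "smoothing q (N * M) S" unfolding smoothing_def
  proof (intro conjI ballI allI impI)
    show "0 \<le> N * M" using M by (simp add: N_def)
    show "S g \<in> M_b" if "g \<in> M_b" for g by (rule SM[OF that])
    show "S (\<lambda>x. c * f x + d * g x) = (\<lambda>x. c * S f x + d * S g x)" if f: "f \<in> M_b" and g: "g \<in> M_b" for f g c d
    proof
      fix x
      have cut: "?cut k f \<in> M_b" if "f \<in> M_b" for f k
        using M_b_D(1)[OF that] M_b_abs_le[OF that] M_b_sup_norm_nonneg[OF that]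
        by (intro M_b_I[where B = "sup_norm f"] borel_measurable_times borel_measurable_indicator)
          (auto simp: indicator_def)
      have "h (\<lambda>x. c * f x + d * g x) k = (\<lambda>x. c * h f k x + d * h g k x)" for k
      proof -
        have "?cut k (\<lambda>x. c * f x + d * g x) = (\<lambda>y. c * ?cut k f y + d * ?cut k g y)"
          by (simp add: algebra_simps)
        then show ?thesis unfolding h_def
          using mb_operator_lincomb_apply[OF mb_operator_conv[OF \<rho>] cut[OF f] cut[OF g]] by simp
      qed
      then have "(\<lambda>k. Qbar (h (\<lambda>x. c * f x + d * g x) k) x) = (\<lambda>k. c * Qbar (h f k) x + d * Qbar (h g k) x)"
        using linear_on_M_bD[OF lin hM[OF f] hM[OF g]] by simp
      then have "(\<lambda>k. Qbar (h (\<lambda>x. c * f x + d * g x) k) x) \<longlonglongrightarrow> c * S f x + d * S g x"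
        by (simp only:) (intro tendsto_intros S f g)
      then show "S (\<lambda>x. c * f x + d * g x) x = c * S f x + d * S g x"
        by (rule LIMSEQ_unique[OF S[OF M_b_lincomb[OF f g]]])
    qed
    fix r \<kappa> a A v and \<Lambda> :: "'d func \<Rightarrow> real" and g :: "'d func"
    assume r: "r + \<kappa> \<le> q" and \<Lambda>: "order_functional r a A \<Lambda>" and g: "weak_bounded \<kappa> v g"
    have gM: "g \<in> M_b" by (rule weak_boundedD(1)[OF g])
    obtain \<psi> where \<psi>: "\<psi> \<in> C_1 \<kappa>" "norm_1 \<kappa> \<psi> \<le> N * (a * M)"
      "\<And>k. \<Lambda> (Qbar (h g k)) = (\<integral>y. ?cut k g y * \<psi> y \<partial>lborel)"
      using dens[OF r \<Lambda>] gM by blast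
    have "(\<lambda>k. \<Lambda> (Qbar (h g k))) \<longlonglongrightarrow> \<Lambda> (S g)"
      by (rule mb_functional_tendsto[OF order_functionalD(1)[OF \<Lambda>] QbarM[OF hM[OF gM]] Qh[OF gM] S[OF gM]])
    moreover have "(\<lambda>k. \<Lambda> (Qbar (h g k))) \<longlonglongrightarrow> (\<integral>y. g y * \<psi> y \<partial>lborel)"
      unfolding \<psi>(3) by (rule lim[OF gM C_1_integrable[OF \<psi>(1)]])
    ultimately have "\<Lambda> (S g) = (\<integral>y. g y * \<psi> y \<partial>lborel)" by (rule LIMSEQ_unique)
    then have "\<bar>\<Lambda> (S g)\<bar> \<le> v * norm_1 \<kappa> \<psi>" using weak_boundedD(3)[OF g \<psi>(1)] by simp
    also have "\<dots> \<le> v * (N * (a * M))" using \<psi>(2) weak_boundedD(2)[OF g] by (rule mult_left_mono)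
    finally show "\<bar>\<Lambda> (S g)\<bar> \<le> N * M * a * v" by (simp add: ac_simps)
  qed
  moreover have "\<bar>Q (conv \<rho> g) x - S g x\<bar> \<le> \<epsilon> * sup_norm g" if g: "g \<in> M_b" for g x
  proof -
    have "(\<lambda>k. Q (h g k) x) \<longlonglongrightarrow> Q (conv \<rho> g) x"
      by (rule mb_functional_tendsto[OF mb_operatorD(3)[OF Q] hM[OF g] h(2,3)[OF g]])
    then have "(\<lambda>k. Q (h g k) x - Qbar (h g k) x) \<longlonglongrightarrow> Q (conv \<rho> g) x - S g x"
      by (intro tendsto_diff S[OF g])
    moreover have "\<bar>Q (h g k) x - Qbar (h g k) x\<bar> \<le> \<epsilon> * sup_norm g" for k
    proof -
      have "(\<lambda>x. Q (h g k) x - Qbar (h g k) x) \<in> M_b"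
        by (rule M_b_diff[OF mb_operatorD(1)[OF Q hM[OF g]] QbarM[OF hM[OF g]]])
      from M_b_abs_le[OF this, of x] close[OF hM[OF g, of k]]
      have "\<bar>Q (h g k) x - Qbar (h g k) x\<bar> \<le> \<epsilon> * sup_norm (h g k)" by (rule order_trans)
      also have "\<dots> \<le> \<epsilon> * sup_norm g" using h(2)[OF g] \<epsilon> by (intro mult_left_mono sup_norm_le)
      finally show ?thesis .
    qed
    ultimately show ?thesis by (intro tendsto_upperbound[OF tendsto_rabs]) auto
  qed
  ultimately show ?thesis unfolding approx_smoothing_def N_def[symmetric] using \<epsilon> by blast
qed

subsection \<open>Compositions of regularising operators\<close>

definition comp_list :: "'d::finite operator list \<Rightarrow> 'd operator" where
  "comp_list As = foldr (\<lambda>A B f. A (B f)) As (\<lambda>f. f)"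

lemma comp_list_simps: "comp_list [] f = f" "comp_list (A # As) f = A (comp_list As f)"
  by (simp_all add: comp_list_def)

lemma order_bounded_comp_list:
  assumes "\<And>A. A \<in> set As \<Longrightarrow> order_bounded q 0 k k A"
  shows "order_bounded q 0 (k ^ length As) (k ^ length As) (comp_list As)"
  using assms
proof (induction As)
  case Nil
  show ?case using order_bounded_id by (simp add: comp_list_def)
next
  case (Cons A As)
  then have "order_bounded q (0 + 0) (k * k ^ length As) (k * k ^ length As) (\<lambda>f. A (comp_list As f))"
    by (intro order_bounded_comp) auto
  then show ?case by (simp add: comp_list_def)
qed

text \<open>The recursion of \<open>approx_smoothing_comp\<close> when one more factor is put in front of \<open>p\<close> factors, whose composition
  has the bound \<open>k\<^sup>p\<close>.\<close>

primrec smoothing_const :: "real \<Rightarrow> real \<Rightarrow> nat \<Rightarrow> real" where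
  "smoothing_const M k 0 = 0"
| "smoothing_const M k (Suc p)
     = M * k ^ p + k * smoothing_const M k p + M * smoothing_const M k p"

lemma smoothing_const_nonneg: "0 \<le> M \<Longrightarrow> 0 \<le> k \<Longrightarrow> 0 \<le> smoothing_const M k p"
  by (induction p) auto

lemma approx_smoothing_comp_list:
  assumes "\<And>A. A \<in> set As \<Longrightarrow> order_bounded q 0 k k A \<and> approx_smoothing q M \<epsilon> A"
  shows "approx_smoothing q (smoothing_const M k (length As)) (\<epsilon> ^ length As) (comp_list As)"
  using assms
proof (induction As)
  case Nil
  show ?case using approx_smoothing_id by (simp add: comp_list_def)
next
  case (Cons A As)
  have "approx_smoothing q (smoothing_const M k (length As)) (\<epsilon> ^ length As) (comp_list As)"
    using Cons by simp
  moreover have "order_bounded q 0 (k ^ length As) (k ^ length As) (comp_list As)"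
    using Cons.prems by (intro order_bounded_comp_list) auto
  ultimately have "approx_smoothing q (M * k ^ length As + k * smoothing_const M k (length As)
      + M * smoothing_const M k (length As)) (\<epsilon> * \<epsilon> ^ length As) (\<lambda>f. A (comp_list As f))"
    using Cons.prems by (intro approx_smoothing_comp) auto
  then show ?case by (simp add: comp_list_def)
qed

text \<open>A bound that is uniform in the mollifications holds without them. They are removed one at a time, beginning with
  the last factor: what stands to the right of a mollification then yields a continuous function, and the
  convolutions converge to it pointwise.\<close>

lemma comp_list_unmollify:
  fixes Qs :: "'d::finite operator list"
  assumes "\<And>Q. Q \<in> set Qs \<Longrightarrow> order_bounded q 0 k k Q" "mb_functional \<Lambda>" "g \<in> C_b 0"
    and "\<And>\<rho>s. length \<rho>s = length Qs \<Longrightarrow> (\<And>\<rho>. \<rho> \<in> set \<rho>s \<Longrightarrow> \<exists>\<delta>. mollifier \<delta> \<rho>) \<Longrightarrow>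
      \<bar>\<Lambda> (comp_list (map2 (\<lambda>Q \<rho> f. Q (conv \<rho> f)) Qs \<rho>s) g)\<bar> \<le> X"
  shows "\<bar>\<Lambda> (comp_list Qs g)\<bar> \<le> X"
  using assms
proof (induction Qs arbitrary: \<Lambda>)
  case Nil
  show ?case using Nil(4)[of "[]"] by (simp add: comp_list_def)
next
  case (Cons Q Qs)
  let ?g = "comp_list Qs g"
  have Q: "order_bounded q 0 k k Q" using Cons.prems(1) by simp
  have mQ: "mb_operator k Q" by (rule order_boundedD(1)[OF Q])
  have "?g \<in> C_b 0"
    using order_boundedD(3)[OF order_bounded_comp_list[of Qs q k], of 0 g] Cons.prems(1,3) by simp
  then have gM: "?g \<in> M_b" by (rule C_b_subset_M_b)
  obtain \<rho> :: "nat \<Rightarrow> 'd func" where \<rho>: "mollifiers \<rho>" using mollifiers_exist by blast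
  have \<rho>j: "mollifier (1 / real (Suc j)) (\<rho> j)" for j using \<rho> by (simp add: mollifiers_def)
  have b: "\<bar>\<Lambda> (Q (conv (\<rho> j) ?g))\<bar> \<le> X" for j
  proof (rule Cons.IH[of "\<lambda>f. \<Lambda> (Q (conv (\<rho> j) f))"])
    show "order_bounded q 0 k k Q" if "Q \<in> set Qs" for Q using Cons.prems(1) that by simp
    show "mb_functional (\<lambda>f. \<Lambda> (Q (conv (\<rho> j) f)))"
      by (rule mb_functional_comp[OF Cons.prems(2) mb_operator_comp[OF mQ mb_operator_conv[OF \<rho>j]]])
    fix \<rho>s :: "'d func list"
    assume l: "length \<rho>s = length Qs" and m: "\<And>\<rho>. \<rho> \<in> set \<rho>s \<Longrightarrow> \<exists>\<delta>. mollifier \<delta> \<rho>"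
    have "\<bar>\<Lambda> (comp_list (map2 (\<lambda>Q \<rho> f. Q (conv \<rho> f)) (Q # Qs) (\<rho> j # \<rho>s)) g)\<bar> \<le> X"
      by (rule Cons.prems(4)) (use l m \<rho>j in auto)
    then show "\<bar>\<Lambda> (Q (conv (\<rho> j) (comp_list (map2 (\<lambda>Q \<rho> f. Q (conv \<rho> f)) Qs \<rho>s) g)))\<bar> \<le> X"
      by (simp add: comp_list_def)
  qed (rule Cons.prems(3))
  have "(\<lambda>j. \<Lambda> (Q (conv (\<rho> j) ?g))) \<longlonglongrightarrow> \<Lambda> (Q ?g)"
  proof (rule mb_functional_tendsto[OF mb_functional_comp[OF Cons.prems(2) mQ]])
    show "conv (\<rho> j) ?g \<in> M_b" for j by (rule mb_operatorD(1)[OF mb_operator_conv[OF \<rho>j] gM])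
    show "\<bar>conv (\<rho> j) ?g x\<bar> \<le> sup_norm ?g" for j x by (rule conv_abs_le[OF \<rho>j gM M_b_abs_le[OF gM]])
    show "(\<lambda>j. conv (\<rho> j) ?g x) \<longlonglongrightarrow> ?g x" for x by (rule conv_tendsto[OF \<rho> \<open>?g \<in> C_b 0\<close>])
  qed
  with b have "\<bar>\<Lambda> (Q ?g)\<bar> \<le> X" by (intro tendsto_upperbound[OF tendsto_rabs]) auto
  then show ?case by (simp add: comp_list_def)
qed

text \<open>The form in which long gaps are used: the first term needs no power of \<open>n\<close>, the second one carries as many factors
  \<open>\<epsilon>\<close> as there are pieces and is multiplied by crude bounds only.\<close>

lemma comp_list_regularises:
  fixes Qs :: "'d::finite operator list"
  assumes Qs: "\<And>Q. Q \<in> set Qs \<Longrightarrow> order_bounded q 0 k k Q"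
    "\<And>Q \<delta> \<rho>. Q \<in> set Qs \<Longrightarrow> mollifier \<delta> \<rho> \<Longrightarrow> approx_smoothing q M \<epsilon> (\<lambda>f. Q (conv \<rho> f))"
    and r: "r + \<kappa> \<le> q" and \<Lambda>: "order_functional r a A \<Lambda>" and g: "weak_bounded \<kappa> v g" "g \<in> C_b 0"
  shows "\<bar>\<Lambda> (comp_list Qs g)\<bar> \<le> smoothing_const M k (length Qs) * a * v + \<epsilon> ^ length Qs * A * sup_norm g"
proof (rule comp_list_unmollify[OF Qs(1) order_functionalD(1)[OF \<Lambda>] g(2)])
  fix \<rho>s :: "'d func list"
  assume l: "length \<rho>s = length Qs" and m: "\<And>\<rho>. \<rho> \<in> set \<rho>s \<Longrightarrow> \<exists>\<delta>. mollifier \<delta> \<rho>"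
  let ?As = "map2 (\<lambda>Q \<rho> f. Q (conv \<rho> f)) Qs \<rho>s"
  have A: "order_bounded q 0 k k A' \<and> approx_smoothing q M \<epsilon> A'" if "A' \<in> set ?As" for A'
  proof -
    obtain Q \<rho> where Q: "Q \<in> set Qs" "\<rho> \<in> set \<rho>s" "A' = (\<lambda>f. Q (conv \<rho> f))"
    proof -
      obtain p where p: "p \<in> set (zip Qs \<rho>s)" "A' = (\<lambda>f. fst p (conv (snd p) f))"
        using \<open>A' \<in> set ?As\<close> by (auto simp: case_prod_beta')
      then have "fst p \<in> set Qs" "snd p \<in> set \<rho>s"
        by (metis prod.collapse set_zip_leftD, metis prod.collapse set_zip_rightD p(1))
      with p(2) that show ?thesis by blast
    qed
    then obtain \<delta> where \<delta>: "mollifier \<delta> \<rho>" using m by blast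
    show ?thesis using order_bounded_comp[OF Qs(1)[OF Q(1)] order_bounded_conv[OF \<delta>]] Qs(2)[OF Q(1) \<delta>] Q(3) by simp
  qed
  have len: "length ?As = length Qs" using l by simp
  obtain S where S: "smoothing q (smoothing_const M k (length Qs)) S"
    "\<And>g x. g \<in> M_b \<Longrightarrow> \<bar>comp_list ?As g x - S g x\<bar> \<le> \<epsilon> ^ length Qs * sup_norm g"
    using approx_smoothing_comp_list[of ?As q k M \<epsilon>, OF A] unfolding len approx_smoothing_def by blast
  have gM: "g \<in> M_b" by (rule weak_boundedD(1)[OF g(1)])
  have "order_bounded q 0 (k ^ length ?As) (k ^ length ?As) (comp_list ?As)"
    by (rule order_bounded_comp_list) (use A in blast)
  then have cM: "comp_list ?As g \<in> M_b" by (rule mb_operatorD(1)[OF order_boundedD(1) gM])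
  have SM: "S g \<in> M_b" by (rule smoothingD(2)[OF S(1) gM])
  have "\<Lambda> (comp_list ?As g) = \<Lambda> (S g) + \<Lambda> (\<lambda>x. comp_list ?As g x - S g x)"
    using mb_functional_diff[OF order_functionalD(1)[OF \<Lambda>] cM SM] by simp
  moreover have "\<bar>\<Lambda> (S g)\<bar> \<le> smoothing_const M k (length Qs) * a * v"
    by (rule smoothingD(4)[OF S(1) r \<Lambda> g(1)])
  moreover have "\<bar>\<Lambda> (\<lambda>x. comp_list ?As g x - S g x)\<bar> \<le> A * (\<epsilon> ^ length Qs * sup_norm g)"
    using order_functionalD(5)[OF \<Lambda> M_b_diff[OF cM SM]]
      mult_left_mono[OF sup_norm_le[OF S(2)[OF gM]] order_functionalD(3)[OF \<Lambda>]] by (rule order_trans)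
  ultimately show "\<bar>\<Lambda> (comp_list ?As g)\<bar> \<le> smoothing_const M k (length Qs) * a * v + \<epsilon> ^ length Qs * A * sup_norm g"
    by (simp add: ac_simps)
qed

section \<open>Chains of one-step differences\<close>

text \<open>The operator product of a chain with a free last factor \<open>Z\<close>: it is \<open>Q\<close> in the terms of the expansion and \<open>P\<close> in its
  remainder.\<close>

fun gchain :: "real \<Rightarrow> (real \<Rightarrow> real \<Rightarrow> 'd::finite operator) \<Rightarrow> (real \<Rightarrow> 'd operator) \<Rightarrow>
    (real \<Rightarrow> 'd operator) \<Rightarrow> real \<Rightarrow> real list \<Rightarrow> 'd operator" where
  "gchain \<delta> Q D Z s [] = Z s"
| "gchain \<delta> Q D Z s (t # ts) = (\<lambda>f. Q s (t - \<delta>) (D (t - \<delta>) (gchain \<delta> Q D Z t ts f)))"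

lemma op_chain_eq_gchain: "op_chain \<delta> Q D u s ts = gchain \<delta> Q D (\<lambda>s. Q s u) s ts"
  by (induction ts arbitrary: s) (auto simp: comp_def)

definition steps :: "real \<Rightarrow> real \<Rightarrow> real \<Rightarrow> real set" where
  "steps \<delta> s u = {t \<in> grid \<delta>. s < t \<and> t \<le> u}"

lemma grid_pred:
  assumes "s \<in> grid \<delta>" "t \<in> grid \<delta>" "s < t" "\<delta> > 0"
  shows "t - \<delta> \<in> grid \<delta>" "s \<le> t - \<delta>"
proof -
  obtain j k :: nat where jk: "s = real j * \<delta>" "t = real k * \<delta>" using assms unfolding grid_def by blast
  then have "j < k" using assms by simp
  then have t: "t - \<delta> = real (k - 1) * \<delta>" using jk by (simp add: of_nat_diff algebra_simps)
  then show "t - \<delta> \<in> grid \<delta>" unfolding grid_def by blast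
  have "j \<le> k - 1" using \<open>j < k\<close> by simp
  then show "s \<le> t - \<delta>" unfolding t jk(1) using assms(4) by (intro mult_right_mono) auto
qed

lemma time_chains_0: "time_chains \<delta> s u 0 = {[]}"
  by (auto simp: time_chains_def)

lemma time_chains_Cons:
  "t # ts \<in> time_chains \<delta> s u (Suc i) \<longleftrightarrow> t \<in> steps \<delta> s u \<and> ts \<in> time_chains \<delta> t u i"
  by (auto simp: time_chains_def steps_def)

lemma time_chains_Suc:
  "time_chains \<delta> s u (Suc i) = (\<Union>t\<in>steps \<delta> s u. (#) t ` time_chains \<delta> t u i)"
proof (intro equalityI subsetI)
  fix xs assume xs: "xs \<in> time_chains \<delta> s u (Suc i)"
  then obtain t ts where "xs = t # ts" by (auto simp: time_chains_def length_Suc_conv)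
  with xs show "xs \<in> (\<Union>t\<in>steps \<delta> s u. (#) t ` time_chains \<delta> t u i)" by (auto simp: time_chains_Cons)
qed (auto simp: time_chains_Cons)

lemma steps_eq:
  assumes "s \<in> grid \<delta>" "\<delta> > 0"
  shows "steps \<delta> s (s + real n * \<delta>) = (\<lambda>k. s + real (Suc k) * \<delta>) ` {..<n}"
proof (intro equalityI subsetI)
  fix t assume "t \<in> steps \<delta> s (s + real n * \<delta>)"
  then have t: "t \<in> grid \<delta>" "s < t" "t \<le> s + real n * \<delta>" by (auto simp: steps_def)
  obtain r :: nat where r: "t = s + real r * \<delta>" using grid_obtain[OF assms(1) t(1) _ assms(2)] t(2) by force
  with t assms(2) have "0 < r" "r \<le> n" by (auto simp: zero_less_mult_iff)
  then show "t \<in> (\<lambda>k. s + real (Suc k) * \<delta>) ` {..<n}"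
    by (intro image_eqI[of _ _ "r - 1"]) (auto simp: r)
next
  fix t assume "t \<in> (\<lambda>k. s + real (Suc k) * \<delta>) ` {..<n}"
  then obtain k where k: "k < n" "t = s + real (Suc k) * \<delta>" by blast
  then have "real (Suc k) * \<delta> \<le> real n * \<delta>" using assms(2) by (intro mult_right_mono) auto
  then show "t \<in> steps \<delta> s (s + real n * \<delta>)"
    using k assms(2) grid_add[OF assms(1), of "Suc k"] by (auto simp: steps_def)
qed

lemma finite_steps:
  assumes "s \<in> grid \<delta>" "u \<in> grid \<delta>" "s \<le> u" "\<delta> > 0"
  shows "finite (steps \<delta> s u)"
proof -
  obtain n :: nat where "u = s + real n * \<delta>" using grid_obtain[OF assms] by blast
  then show ?thesis using steps_eq[OF assms(1,4)] by simp
qed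

lemma finite_time_chains:
  assumes "s \<in> grid \<delta>" "u \<in> grid \<delta>" "s \<le> u" "\<delta> > 0"
  shows "finite (time_chains \<delta> s u i)"
  using assms(1,3)
proof (induction i arbitrary: s)
  case (Suc i)
  then show ?case unfolding time_chains_Suc
    using finite_steps[OF Suc.prems(1) assms(2) Suc.prems(2) assms(4)]
    by (intro finite_UN_I finite_imageI Suc.IH) (auto simp: steps_def)
qed (simp add: time_chains_0)

lemma sum_time_chains_Suc:
  assumes "s \<in> grid \<delta>" "u \<in> grid \<delta>" "s \<le> u" "\<delta> > 0"
  shows "(\<Sum>ts\<in>time_chains \<delta> s u (Suc i). F ts) = (\<Sum>t\<in>steps \<delta> s u. \<Sum>ts\<in>time_chains \<delta> t u i. F (t # ts))"
proof -
  have "(\<Sum>ts\<in>time_chains \<delta> s u (Suc i). F ts)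
      = (\<Sum>t\<in>steps \<delta> s u. sum F ((#) t ` time_chains \<delta> t u i))"
    unfolding time_chains_Suc
    by (rule sum.UNION_disjoint[OF finite_steps[OF assms]])
      (auto simp: steps_def intro!: finite_time_chains assms)
  also have "\<dots> = (\<Sum>t\<in>steps \<delta> s u. \<Sum>ts\<in>time_chains \<delta> t u i. F (t # ts))"
  proof (rule sum.cong[OF refl])
    fix t
    show "sum F ((#) t ` time_chains \<delta> t u i) = (\<Sum>ts\<in>time_chains \<delta> t u i. F (t # ts))"
      by (simp add: sum.reindex)
  qed
  finally show ?thesis .
qed

lemma card_time_chains:
  assumes "s \<in> grid \<delta>" "u \<in> grid \<delta>" "s \<le> u" "\<delta> > 0" "u \<le> s + real n * \<delta>"
  shows "card (time_chains \<delta> s u i) \<le> n ^ i"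
  using assms(1,3,5)
proof (induction i arbitrary: s)
  case (Suc i)
  have g: "s \<in> grid \<delta>" "u \<in> grid \<delta>" "s \<le> u" "\<delta> > 0" using Suc.prems assms by auto
  have "steps \<delta> s u \<subseteq> steps \<delta> s (s + real n * \<delta>)" using Suc.prems(3) by (auto simp: steps_def)
  then have "card (steps \<delta> s u) \<le> card {..<n}"
    unfolding steps_eq[OF g(1,4)] by (meson card_image_le card_mono finite_imageI finite_lessThan order_trans)
  then have c: "card (steps \<delta> s u) \<le> n" by simp
  have "card (time_chains \<delta> s u (Suc i)) = (\<Sum>t\<in>steps \<delta> s u. card (time_chains \<delta> t u i))"
    using sum_time_chains_Suc[OF g, of "\<lambda>_. 1 :: nat" i] by simp
  also have "\<dots> \<le> (\<Sum>t\<in>steps \<delta> s u. n ^ i)"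
    using Suc.prems(3) by (intro sum_mono Suc.IH) (auto simp: steps_def)
  also have "\<dots> \<le> n * n ^ i" using c by simp
  finally show ?case by simp
qed (simp add: time_chains_0)

lemma mb_operator_sum_apply:
  assumes A: "mb_operator b A" and S: "finite S" "\<And>s. s \<in> S \<Longrightarrow> F s \<in> M_b"
  shows "A (\<lambda>x. \<Sum>s\<in>S. F s x) = (\<lambda>x. \<Sum>s\<in>S. A (F s) x)" "(\<lambda>x. \<Sum>s\<in>S. F s x) \<in> M_b"
proof -
  have "A (\<lambda>x. \<Sum>s\<in>S. F s x) = (\<lambda>x. \<Sum>s\<in>S. A (F s) x) \<and> (\<lambda>x. \<Sum>s\<in>S. F s x) \<in> M_b"
    using S
  proof (induction S rule: finite_induct)
    case empty
    then show ?case using mb_operator_lincomb_apply[OF A M_b_zero M_b_zero, of 0 0] M_b_zero by simp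
  next
    case (insert s S)
    then show ?case
      using mb_operator_lincomb_apply[OF A, of "F s" "\<lambda>x. \<Sum>s\<in>S. F s x" 1 1]
        M_b_add[of "F s" "\<lambda>x. \<Sum>s\<in>S. F s x"] by simp
  qed
  then show "A (\<lambda>x. \<Sum>s\<in>S. F s x) = (\<lambda>x. \<Sum>s\<in>S. A (F s) x)" "(\<lambda>x. \<Sum>s\<in>S. F s x) \<in> M_b" by auto
qed

subsection \<open>Duhamel expansion\<close>

definition one_step_diff ::
    "real \<Rightarrow> (real \<Rightarrow> real \<Rightarrow> 'd::finite operator) \<Rightarrow> (real \<Rightarrow> real \<Rightarrow> 'd operator) \<Rightarrow> real \<Rightarrow> 'd operator" where
  "one_step_diff \<delta> P Q s = (\<lambda>f x. P s (s + \<delta>) f x - Q s (s + \<delta>) f x)"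

lemma mb_operator_one_step_diff:
  fixes P Q :: "real \<Rightarrow> real \<Rightarrow> 'd::finite operator"
  assumes "discrete_semigroup \<delta> P" "discrete_semigroup \<delta> Q" "\<delta> > 0" "s \<in> grid \<delta>"
  shows "\<exists>b. mb_operator b (one_step_diff \<delta> P Q s)"
proof -
  have g: "s \<in> grid \<delta>" "s + \<delta> \<in> grid \<delta>" "s \<le> s + \<delta>" using assms grid_Suc by auto
  obtain b1 b2 where "mb_operator b1 (P s (s + \<delta>))" "mb_operator b2 (Q s (s + \<delta>))"
    using discrete_semigroup_mb_operator[OF assms(1) g assms(3)]
      discrete_semigroup_mb_operator[OF assms(2) g assms(3)] by blast
  from mb_operator_lincomb[OF this, of 1 "-1"] show ?thesis by (auto simp: one_step_diff_def)
qed

text \<open>The sum telescopes, since \<open>Q\<^sub>s\<^sub>,\<^sub>t\<^sub>-\<^sub>\<delta> (P - Q)\<^sub>t\<^sub>-\<^sub>\<delta>\<^sub>,\<^sub>t P\<^sub>t\<^sub>,\<^sub>u\<close> is the difference of \<open>Q\<^sub>s\<^sub>,\<^sub>t\<^sub>-\<^sub>\<delta> P\<^sub>t\<^sub>-\<^sub>\<delta>\<^sub>,\<^sub>u\<close> and \<open>Q\<^sub>s\<^sub>,\<^sub>t P\<^sub>t\<^sub>,\<^sub>u\<close>.\<close>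

lemma duhamel:
  fixes P Q :: "real \<Rightarrow> real \<Rightarrow> 'd::finite operator"
  assumes P: "discrete_semigroup \<delta> P" and Q: "discrete_semigroup \<delta> Q" and \<delta>: "\<delta> > 0"
    and g: "s \<in> grid \<delta>" "u \<in> grid \<delta>" "s \<le> u" and f: "f \<in> M_b"
  shows "P s u f x = Q s u f x
    + (\<Sum>t\<in>steps \<delta> s u. Q s (t - \<delta>) (one_step_diff \<delta> P Q (t - \<delta>) (P t u f)) x)"
proof -
  obtain n :: nat where n: "u = s + real n * \<delta>" using grid_obtain[OF g \<delta>] by blast
  define t where "t k = s + real k * \<delta>" for k
  have tg: "t k \<in> grid \<delta>" "s \<le> t k" "t k \<le> t (Suc k)" "t (Suc k) - \<delta> = t k" "t k + \<delta> = t (Suc k)" for k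
    using grid_add[OF g(1)] \<delta> by (auto simp: t_def algebra_simps)
  have tu: "t k \<le> u" if "k \<le> n" for k
    using that \<delta> by (simp add: t_def n mult_right_mono)
  have PM: "P (t k) u f \<in> M_b" if "k \<le> n" for k
    using discrete_semigroup_mb_operator[OF P tg(1) g(2) tu[OF that] \<delta>] mb_operatorD(1) f by blast
  have "Q s (t (Suc k) - \<delta>) (one_step_diff \<delta> P Q (t (Suc k) - \<delta>) (P (t (Suc k)) u f)) x
      = Q s (t k) (P (t k) u f) x - Q s (t (Suc k)) (P (t (Suc k)) u f) x" if k: "k < n" for k
  proof -
    let ?h = "P (t (Suc k)) u f"
    have h: "?h \<in> M_b" using PM k by simp
    obtain b where b: "mb_operator b (Q s (t k))"
      using discrete_semigroup_mb_operator[OF Q g(1) tg(1,2) \<delta>] by blast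
    have Pk: "P (t k) (t (Suc k)) ?h = P (t k) u f"
      using discrete_semigroup_comp[OF P tg(1)[of k] tg(1)[of "Suc k"] g(2) tg(3) _ \<delta> f] tu[of "Suc k"] k by simp
    have Qk: "Q s (t k) (Q (t k) (t (Suc k)) ?h) = Q s (t (Suc k)) ?h"
      using discrete_semigroup_comp[OF Q g(1) tg(1)[of k] tg(1)[of "Suc k"] tg(2,3) \<delta> h] by simp
    have QM: "Q (t k) (t (Suc k)) ?h \<in> M_b"
      using discrete_semigroup_mb_operator[OF Q tg(1)[of k] tg(1)[of "Suc k"] tg(3) \<delta>] mb_operatorD(1) h by blast
    have "one_step_diff \<delta> P Q (t (Suc k) - \<delta>) ?h = (\<lambda>x. P (t k) u f x - Q (t k) (t (Suc k)) ?h x)"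
      unfolding one_step_diff_def tg(4,5) Pk ..
    then show ?thesis
      using mb_operator_diff_apply[OF b PM QM] k Qk tg(4) by simp
  qed
  then have "(\<Sum>k<n. Q s (t (Suc k) - \<delta>) (one_step_diff \<delta> P Q (t (Suc k) - \<delta>) (P (t (Suc k)) u f)) x)
      = (\<Sum>k<n. Q s (t k) (P (t k) u f) x - Q s (t (Suc k)) (P (t (Suc k)) u f) x)"
    by (intro sum.cong) auto
  also have "\<dots> = Q s (t 0) (P (t 0) u f) x - Q s (t n) (P (t n) u f) x"
    by (rule sum_lessThan_telescope')
  also have "\<dots> = P s u f x - Q s u f x"
    using discrete_semigroup_id[OF Q g(1)] discrete_semigroup_id[OF P g(2) f] PM[of 0] by (simp add: t_def n)
  finally have "P s u f x - Q s u f x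
      = (\<Sum>k<n. Q s (t (Suc k) - \<delta>) (one_step_diff \<delta> P Q (t (Suc k) - \<delta>) (P (t (Suc k)) u f)) x)" by simp
  also have "\<dots> = (\<Sum>t\<in>steps \<delta> s u. Q s (t - \<delta>) (one_step_diff \<delta> P Q (t - \<delta>) (P t u f)) x)"
  proof -
    have "inj_on (\<lambda>k. t (Suc k)) {..<n}" using \<delta> by (auto simp: inj_on_def t_def)
    moreover have "steps \<delta> s u = (\<lambda>k. t (Suc k)) ` {..<n}"
      unfolding n steps_eq[OF g(1) \<delta>] t_def ..
    ultimately show ?thesis by (simp add: sum.reindex)
  qed
  finally show ?thesis by simp
qed

lemma gchain_M_b:
  fixes Q :: "real \<Rightarrow> real \<Rightarrow> 'd::finite operator"
  assumes \<delta>: "\<delta> > 0" and s: "s \<in> grid \<delta>" and ts: "ts \<in> time_chains \<delta> s u i"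
    and Q: "\<And>s t. s \<in> grid \<delta> \<Longrightarrow> t \<in> grid \<delta> \<Longrightarrow> s \<le> t \<Longrightarrow> \<exists>b. mb_operator b (Q s t)"
    and D: "\<And>s. s \<in> grid \<delta> \<Longrightarrow> \<exists>b. mb_operator b (D s)"
    and Z: "\<And>s. s \<in> grid \<delta> \<Longrightarrow> s \<le> u \<Longrightarrow> \<exists>b. mb_operator b (Z s)" and su: "s \<le> u"
  shows "\<exists>b. mb_operator b (gchain \<delta> Q D Z s ts)"
  using s ts su
proof (induction ts arbitrary: s i)
  case Nil
  then show ?case using Z by simp
next
  case (Cons t ts)
  then obtain j where j: "i = Suc j" by (auto simp: time_chains_def)
  have t: "t \<in> grid \<delta>" "s < t" "t \<le> u" "ts \<in> time_chains \<delta> t u j"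
    using Cons.prems(2) unfolding j time_chains_Cons by (auto simp: steps_def)
  note p = grid_pred[OF Cons.prems(1) t(1,2) \<delta>]
  obtain b1 b2 b3 where "mb_operator b1 (Q s (t - \<delta>))" "mb_operator b2 (D (t - \<delta>))"
    "mb_operator b3 (gchain \<delta> Q D Z t ts)"
    using Q[OF Cons.prems(1) p] D[OF p(1)] Cons.IH[OF t(1,4,3)] by blast
  from mb_operator_comp[OF this(1) mb_operator_comp[OF this(2,3)]] show ?case by auto
qed

text \<open>\<open>duhamel\<close> applied to its own last factor \<open>P\<close>, \<open>m\<close> times.\<close>

lemma duhamel_expansion:
  fixes P Q :: "real \<Rightarrow> real \<Rightarrow> 'd::finite operator"
  assumes P: "discrete_semigroup \<delta> P" and Q: "discrete_semigroup \<delta> Q" and \<delta>: "\<delta> > 0"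
    and g: "s \<in> grid \<delta>" "u \<in> grid \<delta>" "s \<le> u" and f: "f \<in> M_b"
  defines "D \<equiv> one_step_diff \<delta> P Q"
  shows "P s u f x = (\<Sum>i<m. \<Sum>ts\<in>time_chains \<delta> s u i. gchain \<delta> Q D (\<lambda>s. Q s u) s ts f x)
    + (\<Sum>ts\<in>time_chains \<delta> s u m. gchain \<delta> Q D (\<lambda>s. P s u) s ts f x)"
proof -
  have Qm: "\<exists>b. mb_operator b (Q s t)" if "s \<in> grid \<delta>" "t \<in> grid \<delta>" "s \<le> t" for s t
    by (rule discrete_semigroup_mb_operator[OF Q that \<delta>])
  have Pm: "\<exists>b. mb_operator b (P s t)" if "s \<in> grid \<delta>" "t \<in> grid \<delta>" "s \<le> t" for s t
    by (rule discrete_semigroup_mb_operator[OF P that \<delta>])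
  have Dm: "\<exists>b. mb_operator b (D s)" if "s \<in> grid \<delta>" for s
    unfolding D_def by (rule mb_operator_one_step_diff[OF P Q \<delta> that])
  define V where "V i s = (\<lambda>x. \<Sum>ts\<in>time_chains \<delta> s u i. gchain \<delta> Q D (\<lambda>s. Q s u) s ts f x)" for i s
  define R where "R i s = (\<lambda>x. \<Sum>ts\<in>time_chains \<delta> s u i. gchain \<delta> Q D (\<lambda>s. P s u) s ts f x)" for i s
  have GM: "gchain \<delta> Q D Z s ts f \<in> M_b"
    if "s \<in> grid \<delta>" "s \<le> u" "ts \<in> time_chains \<delta> s u i"
      "\<And>s. s \<in> grid \<delta> \<Longrightarrow> s \<le> u \<Longrightarrow> \<exists>b. mb_operator b (Z s)" for s ts i Z
  proof -
    have "\<exists>b. mb_operator b (gchain \<delta> Q D Z s ts)"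
      by (rule gchain_M_b[OF \<delta> that(1,3) Qm Dm that(4,2)])
    then show ?thesis using mb_operatorD(1) f by blast
  qed
  have VM: "V i s \<in> M_b" and RM: "R i s \<in> M_b" if s: "s \<in> grid \<delta>" "s \<le> u" for i s
    unfolding V_def R_def
    using GM[OF s] Qm[OF _ g(2)] Pm[OF _ g(2)]
    by (auto intro!: mb_operator_sum_apply(2)[OF mb_operator_id] finite_time_chains[OF s(1) g(2) s(2) \<delta>])
  have chain_Suc: "(\<Sum>ts\<in>time_chains \<delta> s u (Suc i). gchain \<delta> Q D Z s ts f x)
      = (\<Sum>t\<in>steps \<delta> s u. Q s (t - \<delta>) (D (t - \<delta>) (\<lambda>x. \<Sum>ts\<in>time_chains \<delta> t u i. gchain \<delta> Q D Z t ts f x)) x)"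
    if s: "s \<in> grid \<delta>" "s \<le> u" and Z: "\<And>s. s \<in> grid \<delta> \<Longrightarrow> s \<le> u \<Longrightarrow> \<exists>b. mb_operator b (Z s)" for s i Z x
    unfolding sum_time_chains_Suc[OF s(1) g(2) s(2) \<delta>]
  proof (intro sum.cong refl)
    fix t assume "t \<in> steps \<delta> s u"
    then have t: "t \<in> grid \<delta>" "s < t" "t \<le> u" by (auto simp: steps_def)
    note p = grid_pred[OF s(1) t(1,2) \<delta>]
    obtain b1 b2 where "mb_operator b1 (Q s (t - \<delta>))" "mb_operator b2 (D (t - \<delta>))"
      using Qm[OF s(1) p] Dm[OF p(1)] by blast
    moreover have "gchain \<delta> Q D Z t ts f \<in> M_b" if "ts \<in> time_chains \<delta> t u i" for ts
      by (rule GM[OF t(1,3) that Z])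
    ultimately have "Q s (t - \<delta>) (D (t - \<delta>) (\<lambda>x. \<Sum>ts\<in>time_chains \<delta> t u i. gchain \<delta> Q D Z t ts f x)) =
      (\<lambda>x. \<Sum>ts\<in>time_chains \<delta> t u i. Q s (t - \<delta>) (D (t - \<delta>) (gchain \<delta> Q D Z t ts f)) x)"
      using mb_operator_sum_apply(1)[OF mb_operator_comp finite_time_chains[OF t(1) g(2) t(3) \<delta>, of i],
        where F = "\<lambda>ts. gchain \<delta> Q D Z t ts f"] by blast
    then show "(\<Sum>ts\<in>time_chains \<delta> t u i. gchain \<delta> Q D Z s (t # ts) f x)
      = Q s (t - \<delta>) (D (t - \<delta>) (\<lambda>x. \<Sum>ts\<in>time_chains \<delta> t u i. gchain \<delta> Q D Z t ts f x)) x" by simp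
  qed
  have R_Suc: "R (Suc i) s x = (\<Sum>t\<in>steps \<delta> s u. Q s (t - \<delta>) (D (t - \<delta>) (R i t)) x)"
    if s: "s \<in> grid \<delta>" "s \<le> u" for i s x
    unfolding R_def by (rule chain_Suc[OF s, of "\<lambda>s. P s u"]) (rule Pm[OF _ g(2)])
  have V_Suc: "V (Suc i) s x = (\<Sum>t\<in>steps \<delta> s u. Q s (t - \<delta>) (D (t - \<delta>) (V i t)) x)"
    if s: "s \<in> grid \<delta>" "s \<le> u" for i s x
    unfolding V_def by (rule chain_Suc[OF s, of "\<lambda>s. Q s u"]) (rule Qm[OF _ g(2)])
  \<comment> \<open>The remainder with \<open>i\<close> differences is the \<open>i\<close>-th term plus the remainder with \<open>i + 1\<close> differences.\<close>
  have step: "R i s x = V i s x + R (Suc i) s x" if s: "s \<in> grid \<delta>" "s \<le> u" for i s x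
    using s
  proof (induction i arbitrary: s x)
    case 0
    have "R (Suc 0) s x = (\<Sum>t\<in>steps \<delta> s u. Q s (t - \<delta>) (D (t - \<delta>) (P t u f)) x)"
      unfolding R_Suc[OF 0] by (simp add: R_def time_chains_0)
    then show ?case unfolding R_def[of 0] V_def time_chains_0
      using duhamel[OF P Q \<delta> 0(1) g(2) 0(2) f, of x] by (simp add: D_def)
  next
    case (Suc i)
    have "R (Suc i) s x = (\<Sum>t\<in>steps \<delta> s u. Q s (t - \<delta>) (D (t - \<delta>) (R i t)) x)"
      by (rule R_Suc[OF Suc.prems])
    also have "\<dots> = (\<Sum>t\<in>steps \<delta> s u. Q s (t - \<delta>) (D (t - \<delta>) (V i t)) x
        + Q s (t - \<delta>) (D (t - \<delta>) (R (Suc i) t)) x)"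
    proof (intro sum.cong refl)
      fix t assume "t \<in> steps \<delta> s u"
      then have t: "t \<in> grid \<delta>" "s < t" "t \<le> u" by (auto simp: steps_def)
      note p = grid_pred[OF Suc.prems(1) t(1,2) \<delta>]
      obtain b1 b2 where "mb_operator b1 (Q s (t - \<delta>))" "mb_operator b2 (D (t - \<delta>))"
        using Qm[OF Suc.prems(1) p] Dm[OF p(1)] by blast
      from mb_operator_lincomb_apply[OF mb_operator_comp[OF this] VM[OF t(1,3), of i] RM[OF t(1,3), of "Suc i"], of 1 1]
      have "Q s (t - \<delta>) (D (t - \<delta>) (\<lambda>x. V i t x + R (Suc i) t x))
          = (\<lambda>x. Q s (t - \<delta>) (D (t - \<delta>) (V i t)) x + Q s (t - \<delta>) (D (t - \<delta>) (R (Suc i) t)) x)" by simp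
      moreover have "R i t = (\<lambda>x. V i t x + R (Suc i) t x)" using Suc.IH[OF t(1,3)] by blast
      ultimately show "Q s (t - \<delta>) (D (t - \<delta>) (R i t)) x
          = Q s (t - \<delta>) (D (t - \<delta>) (V i t)) x + Q s (t - \<delta>) (D (t - \<delta>) (R (Suc i) t)) x" by simp
    qed
    also have "\<dots> = V (Suc i) s x + R (Suc (Suc i)) s x"
      unfolding R_Suc[OF Suc.prems, of "Suc i"] V_Suc[OF Suc.prems, of i] by (rule sum.distrib)
    finally show ?case .
  qed
  have "P s u f x = (\<Sum>i<m. V i s x) + R m s x"
  proof (induction m)
    case 0
    show ?case by (simp add: R_def time_chains_0)
  next
    case (Suc m)
    then show ?case using step[OF g(1,3), of m x] by simp
  qed
  then show ?thesis by (simp add: V_def R_def)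
qed

subsection \<open>Bounds for chains\<close>

text \<open>Orders add up along a chain, constants multiply.\<close>

lemma order_bounded_gchain:
  fixes Q :: "real \<Rightarrow> real \<Rightarrow> 'd::finite operator"
  assumes \<delta>: "\<delta> > 0" and s: "s \<in> grid \<delta>" "s \<le> u" and ts: "ts \<in> time_chains \<delta> s u i"
    and Q: "\<And>s t. s \<in> grid \<delta> \<Longrightarrow> t \<in> grid \<delta> \<Longrightarrow> s \<le> t \<Longrightarrow> order_bounded q 0 k k (Q s t)"
    and D: "\<And>s. s \<in> grid \<delta> \<Longrightarrow> order_bounded q \<kappa> e b (D s)"
    and Z: "\<And>s. s \<in> grid \<delta> \<Longrightarrow> s \<le> u \<Longrightarrow> order_bounded q 0 k k (Z s)"
  shows "order_bounded q (i * \<kappa>) ((k * e) ^ i * k) ((k * b) ^ i * k) (gchain \<delta> Q D Z s ts)"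
  using s ts
proof (induction ts arbitrary: s i)
  case Nil
  then have "i = 0" by (simp add: time_chains_def)
  then show ?case using Z[OF Nil(1,2)] by simp
next
  case (Cons t ts)
  then obtain j where j: "i = Suc j" by (auto simp: time_chains_def)
  have t: "t \<in> grid \<delta>" "s < t" "t \<le> u" "ts \<in> time_chains \<delta> t u j"
    using Cons.prems(3) unfolding j time_chains_Cons by (auto simp: steps_def)
  note p = grid_pred[OF Cons.prems(1) t(1,2) \<delta>]
  from order_bounded_comp[OF Q[OF Cons.prems(1) p] order_bounded_comp[OF D[OF p(1)] Cons.IH[OF t(1,3,4)]]]
  show ?case by (simp add: j ac_simps)
qed

lemma mb_operator_diff:
  "mb_operator b1 A \<Longrightarrow> mb_operator b2 B \<Longrightarrow> mb_operator (b1 + b2) (\<lambda>f x. A f x - B f x)"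
  using mb_operator_lincomb[of b1 A b2 B 1 "-1"] by simp

lemma order_bounded_replace_bound:
  "order_bounded q \<kappa> e b A \<Longrightarrow> mb_operator b' A \<Longrightarrow> order_bounded q \<kappa> e b' A"
  unfolding order_bounded_def by blast

text \<open>Exchanging the one-step differences \<open>D\<close> for \<open>D'\<close> one after the other: every term of the telescoping sum
  contains one factor \<open>D - D'\<close>.\<close>

lemma order_bounded_gchain_diff:
  fixes Q :: "real \<Rightarrow> real \<Rightarrow> 'd::finite operator"
  assumes \<delta>: "\<delta> > 0" and s: "s \<in> grid \<delta>" "s \<le> u" and ts: "ts \<in> time_chains \<delta> s u i" and i: "i \<ge> 1"
    and Q: "\<And>s t. s \<in> grid \<delta> \<Longrightarrow> t \<in> grid \<delta> \<Longrightarrow> s \<le> t \<Longrightarrow> order_bounded q 0 k k (Q s t)"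
    and D: "\<And>s. s \<in> grid \<delta> \<Longrightarrow> order_bounded q \<kappa> e b (D s)"
    and D': "\<And>s. s \<in> grid \<delta> \<Longrightarrow> order_bounded q \<kappa> e b (D' s)"
    and DD': "\<And>s. s \<in> grid \<delta> \<Longrightarrow> order_bounded q \<kappa> e' (2 * b) (\<lambda>f x. D s f x - D' s f x)"
    and Z: "\<And>s. s \<in> grid \<delta> \<Longrightarrow> s \<le> u \<Longrightarrow> order_bounded q 0 k k (Z s)"
  shows "order_bounded q (i * \<kappa>) (real i * ((k * e) ^ (i - 1) * (k * e') * k)) (2 * ((k * b) ^ i * k))
    (\<lambda>f x. gchain \<delta> Q D Z s ts f x - gchain \<delta> Q D' Z s ts f x)"
  using s ts i
proof (induction ts arbitrary: s i)
  case Nil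
  then show ?case by (simp add: time_chains_def)
next
  case (Cons t ts)
  then obtain j where j: "i = Suc j" by (auto simp: time_chains_def)
  have t: "t \<in> grid \<delta>" "s < t" "t \<le> u" "ts \<in> time_chains \<delta> t u j"
    using Cons.prems(3) unfolding j time_chains_Cons by (auto simp: steps_def)
  note p = grid_pred[OF Cons.prems(1) t(1,2) \<delta>]
  have k: "0 \<le> k" and e: "0 \<le> e" "0 \<le> e'"
    using order_boundedD(2)[OF Z[OF Cons.prems(1,2)]] order_boundedD(2)[OF D[OF p(1)]]
      order_boundedD(2)[OF DD'[OF p(1)]] by auto
  let ?G = "gchain \<delta> Q D Z t ts" and ?G' = "gchain \<delta> Q D' Z t ts"
  have G: "order_bounded q (j * \<kappa>) ((k * e) ^ j * k) ((k * b) ^ j * k) ?G"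
    and G': "order_bounded q (j * \<kappa>) ((k * e) ^ j * k) ((k * b) ^ j * k) ?G'"
    using order_bounded_gchain[OF \<delta> t(1,3,4) Q D Z] order_bounded_gchain[OF \<delta> t(1,3,4) Q D' Z] by auto
  have Qs: "order_bounded q 0 k k (Q s (t - \<delta>))" by (rule Q[OF Cons.prems(1) p])
  let ?T1 = "\<lambda>f. Q s (t - \<delta>) (\<lambda>x. D (t - \<delta>) (?G f) x - D' (t - \<delta>) (?G f) x)"
  have T1: "order_bounded q (i * \<kappa>) ((k * e) ^ (i - 1) * (k * e') * k) (2 * ((k * b) ^ i * k)) ?T1"
  proof -
    have "0 + (\<kappa> + j * \<kappa>) = i * \<kappa>" "k * (e' * ((k * e) ^ j * k)) = (k * e) ^ (i - 1) * (k * e') * k"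
      "k * (2 * b * ((k * b) ^ j * k)) = 2 * ((k * b) ^ i * k)" by (simp_all add: j)
    with order_bounded_comp[OF Qs order_bounded_comp[OF DD'[OF p(1)] G]] show ?thesis by (simp only:)
  qed
  let ?T2 = "\<lambda>f. Q s (t - \<delta>) (D' (t - \<delta>) (\<lambda>x. ?G f x - ?G' f x))"
  \<comment> \<open>The bound \<open>c\<close> on \<open>M_b\<close> that comes out of this step is useless; in the end it is replaced by the sum of the bounds of
    the two chains.\<close>
  have T2: "\<exists>c. order_bounded q (i * \<kappa>) (real j * ((k * e) ^ (i - 1) * (k * e') * k)) c ?T2"
  proof (cases "j = 0")
    case True
    then have "?G = Z t" "?G' = Z t" using t(4) by (simp_all add: time_chains_0)
    then have z: "(\<lambda>x. ?G f x - ?G' f x) = (\<lambda>x. 0)" for f by simp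
    have eq: "0 + (\<kappa> + 0) = i * \<kappa>" "k * (e * 0) = real j * ((k * e) ^ (i - 1) * (k * e') * k)"
      using True by (simp_all add: j)
    from order_bounded_comp[OF Qs order_bounded_comp[OF D'[OF p(1)] order_bounded_zero[where q = q and \<kappa> = 0]]]
    show ?thesis unfolding z eq by blast
  next
    case False
    then obtain j' where j': "j = Suc j'" by (cases j) auto
    have IH: "order_bounded q (j * \<kappa>) (real j * ((k * e) ^ (j - 1) * (k * e') * k)) (2 * ((k * b) ^ j * k))
        (\<lambda>f x. ?G f x - ?G' f x)"
      using Cons.IH[OF t(1,3,4)] False by simp
    have eq: "0 + (\<kappa> + j * \<kappa>) = i * \<kappa>" "k * (e * (real j * ((k * e) ^ (j - 1) * (k * e') * k)))
        = real j * ((k * e) ^ (i - 1) * (k * e') * k)"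
      by (simp_all add: j j')
    from order_bounded_comp[OF Qs order_bounded_comp[OF D'[OF p(1)] IH]]
    show ?thesis unfolding eq by blast
  qed
  then obtain c where T2: "order_bounded q (i * \<kappa>) (real j * ((k * e) ^ (i - 1) * (k * e') * k)) c ?T2" by blast
  have split: "(\<lambda>x. gchain \<delta> Q D Z s (t # ts) f x - gchain \<delta> Q D' Z s (t # ts) f x) = (\<lambda>x. ?T1 f x + ?T2 f x)"
    if f: "f \<in> M_b" for f
  proof -
    have GM: "?G f \<in> M_b" "?G' f \<in> M_b"
      using mb_operatorD(1)[OF order_boundedD(1)[OF G] f] mb_operatorD(1)[OF order_boundedD(1)[OF G'] f] by auto
    note mD = order_boundedD(1)[OF D[OF p(1)]] and mD' = order_boundedD(1)[OF D'[OF p(1)]]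
      and mQ = order_boundedD(1)[OF Qs]
    have "?T1 f = (\<lambda>x. Q s (t - \<delta>) (D (t - \<delta>) (?G f)) x - Q s (t - \<delta>) (D' (t - \<delta>) (?G f)) x)"
      by (rule mb_operator_diff_apply[OF mQ mb_operatorD(1)[OF mD GM(1)] mb_operatorD(1)[OF mD' GM(1)]])
    moreover have "?T2 f = (\<lambda>x. Q s (t - \<delta>) (D' (t - \<delta>) (?G f)) x - Q s (t - \<delta>) (D' (t - \<delta>) (?G' f)) x)"
      unfolding mb_operator_diff_apply[OF mD' GM]
      by (rule mb_operator_diff_apply[OF mQ mb_operatorD(1)[OF mD' GM(1)] mb_operatorD(1)[OF mD' GM(2)]])
    ultimately show ?thesis by simp
  qed
  have "order_bounded q (i * \<kappa>) (real i * ((k * e) ^ (i - 1) * (k * e') * k)) (2 * ((k * b) ^ i * k) + c)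
    (\<lambda>f x. gchain \<delta> Q D Z s (t # ts) f x - gchain \<delta> Q D' Z s (t # ts) f x)"
  proof -
    have "(k * e) ^ (i - 1) * (k * e') * k + real j * ((k * e) ^ (i - 1) * (k * e') * k)
        = real i * ((k * e) ^ (i - 1) * (k * e') * k)" by (simp add: j algebra_simps)
    with order_bounded_cong[OF order_bounded_add[OF T1 T2] split] show ?thesis by (simp only:)
  qed
  moreover have "mb_operator (2 * ((k * b) ^ i * k))
    (\<lambda>f x. gchain \<delta> Q D Z s (t # ts) f x - gchain \<delta> Q D' Z s (t # ts) f x)"
  proof -
    have "mb_operator ((k * b) ^ i * k) (gchain \<delta> Q D Z s (t # ts))"
      by (rule order_boundedD(1)[OF order_bounded_gchain[OF \<delta> Cons.prems(1-3) Q D Z]])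
    moreover have "mb_operator ((k * b) ^ i * k) (gchain \<delta> Q D' Z s (t # ts))"
      by (rule order_boundedD(1)[OF order_bounded_gchain[OF \<delta> Cons.prems(1-3) Q D' Z]])
    ultimately have "mb_operator ((k * b) ^ i * k + (k * b) ^ i * k)
      (\<lambda>f x. gchain \<delta> Q D Z s (t # ts) f x - gchain \<delta> Q D' Z s (t # ts) f x)"
      by (rule mb_operator_diff)
    then show ?thesis by (simp only: mult_2)
  qed
  ultimately show ?case by (rule order_bounded_replace_bound)
qed

text \<open>A chain with few factors on a long interval has a long gap. Everything to the left of it is absorbed into the
  functional, everything to the right into the function to which the regularising operator of the gap is
  applied. The arithmetic condition on \<open>u - s\<close> passes from a chain whose first gap is short to its tail.\<close>

lemma gchain_regularised:
  fixes Q :: "real \<Rightarrow> real \<Rightarrow> 'd::finite operator"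
  assumes \<delta>: "\<delta> > 0" and s: "s \<in> grid \<delta>" "s \<le> u" and ts: "ts \<in> time_chains \<delta> s u i"
    and Q: "\<And>s t. s \<in> grid \<delta> \<Longrightarrow> t \<in> grid \<delta> \<Longrightarrow> s \<le> t \<Longrightarrow> order_bounded q 0 k k (Q s t)"
    and D: "\<And>s. s \<in> grid \<delta> \<Longrightarrow> order_bounded q \<kappa> e b (D s)"
    and Z: "\<And>s. s \<in> grid \<delta> \<Longrightarrow> s \<le> u \<Longrightarrow> order_bounded q 0 k k (Z s)"
    and QR: "\<And>s t r \<kappa> a A \<Lambda> v g. s \<in> grid \<delta> \<Longrightarrow> t \<in> grid \<delta> \<Longrightarrow> \<tau> \<le> t - s \<Longrightarrow> r + \<kappa> \<le> q \<Longrightarrow>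
      order_functional r a A \<Lambda> \<Longrightarrow> weak_bounded \<kappa> v g \<Longrightarrow> g \<in> C_b 0 \<Longrightarrow>
      \<bar>\<Lambda> (Q s t g)\<bar> \<le> M * a * v + E * A * sup_norm g"
    and ZR: "\<And>s r a A \<Lambda>. s \<in> grid \<delta> \<Longrightarrow> \<tau> \<le> u - s \<Longrightarrow> r \<le> q \<Longrightarrow> order_functional r a A \<Lambda> \<Longrightarrow>
      \<bar>\<Lambda> (Z s f)\<bar> \<le> (M * a + E * A) * sup_norm f"
    and f: "f \<in> C_c_inf" and k: "k \<ge> 1" and M: "M \<ge> 0" and E: "E \<ge> 0"
    and \<Lambda>: "order_functional r a A \<Lambda>" and r: "r + i * \<kappa> \<le> q"
    and long: "real (i + 1) * \<tau> + real i * \<delta> \<le> u - s"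
  shows "\<bar>\<Lambda> (gchain \<delta> Q D Z s ts f)\<bar> \<le> (M * a * ((k * e) ^ i * k) + E * A * ((k * b) ^ i * k)) * sup_norm f"
  using s ts \<Lambda> r long
proof (induction ts arbitrary: s i r a A \<Lambda>)
  case Nil
  then have i: "i = 0" by (simp add: time_chains_def)
  have a: "0 \<le> M * a" "0 \<le> E * A" using order_functionalD(2,3)[OF Nil.prems(4)] M E by auto
  have "\<bar>\<Lambda> (Z s f)\<bar> \<le> (M * a + E * A) * sup_norm f"
    using ZR[OF Nil.prems(1) _ _ Nil.prems(4)] Nil.prems(5,6) i by simp
  also have "\<dots> \<le> (M * a * k + E * A * k) * sup_norm f"
    using mult_left_mono[OF k a(1)] mult_left_mono[OF k a(2)] M_b_sup_norm_nonneg[OF C_c_inf_subset_M_b[OF f]]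
    by (intro mult_right_mono) auto
  finally show ?case by (simp add: i)
next
  case (Cons t ts)
  then obtain j where j: "i = Suc j" by (auto simp: time_chains_def)
  have t: "t \<in> grid \<delta>" "s < t" "t \<le> u" "ts \<in> time_chains \<delta> t u j"
    using Cons.prems(3) unfolding j time_chains_Cons by (auto simp: steps_def)
  note p = grid_pred[OF Cons.prems(1) t(1,2) \<delta>]
  note \<Lambda> = Cons.prems(4)
  have fM: "f \<in> M_b" by (rule C_c_inf_subset_M_b[OF f])
  let ?g = "D (t - \<delta>) (gchain \<delta> Q D Z t ts f)"
  have X: "order_bounded q (\<kappa> + j * \<kappa>) (e * ((k * e) ^ j * k)) (b * ((k * b) ^ j * k))
      (\<lambda>f. D (t - \<delta>) (gchain \<delta> Q D Z t ts f))"
    by (rule order_bounded_comp[OF D[OF p(1)] order_bounded_gchain[OF \<delta> t(1,3,4) Q D Z]])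
  have nn: "0 \<le> e * ((k * e) ^ j * k)" "0 \<le> b * ((k * b) ^ j * k)" "0 \<le> a" "0 \<le> A" "0 \<le> sup_norm f"
    using order_boundedD(2)[OF X] mb_operatorD(4)[OF order_boundedD(1)[OF X]] order_functionalD(2,3)[OF \<Lambda>]
      M_b_sup_norm_nonneg[OF fM] by auto
  show ?case
  \<comment> \<open>Either the first gap is long, or it is handed over to the functional and the tail has a long gap.\<close>
  proof (cases "\<tau> \<le> (t - \<delta>) - s")
    case True
    have q: "\<kappa> + j * \<kappa> \<le> q" using Cons.prems(5) by (simp add: j)
    have g: "?g \<in> C_b 0"
      using order_boundedD(3)[OF X, of 0 f] q C_c_inf_subset_C_b[OF f] by simp
    have w: "weak_bounded (\<kappa> + j * \<kappa>) (e * ((k * e) ^ j * k) * sup_norm f) ?g"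
      using weak_bounded_apply[OF weak_bounded_sup_norm[OF fM M_b_abs_le[OF fM]] X] q by simp
    have "\<bar>\<Lambda> (Q s (t - \<delta>) ?g)\<bar> \<le> M * a * (e * ((k * e) ^ j * k) * sup_norm f) + E * A * sup_norm ?g"
      using QR[OF Cons.prems(1) p(1) True _ \<Lambda> w g] Cons.prems(5) by (simp add: j)
    also have "\<dots> \<le> M * a * (k * (e * ((k * e) ^ j * k)) * sup_norm f)
        + E * A * (k * (b * ((k * b) ^ j * k)) * sup_norm f)"
    proof (intro add_mono mult_left_mono mult_right_mono)
      show "e * ((k * e) ^ j * k) \<le> k * (e * ((k * e) ^ j * k))" using mult_right_mono[OF k nn(1)] by simp
      have "sup_norm ?g \<le> b * ((k * b) ^ j * k) * sup_norm f" by (rule mb_operatorD(2)[OF order_boundedD(1)[OF X] fM])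
      also have "\<dots> \<le> k * (b * ((k * b) ^ j * k)) * sup_norm f"
        using mult_right_mono[OF k nn(2)] nn(5) by (intro mult_right_mono) auto
      finally show "sup_norm ?g \<le> k * (b * ((k * b) ^ j * k)) * sup_norm f" .
    qed (use nn M E in auto)
    finally show ?thesis by (simp add: j algebra_simps)
  next
    case False
    have X': "order_bounded q (0 + \<kappa>) (k * e) (k * b) (\<lambda>f. Q s (t - \<delta>) (D (t - \<delta>) f))"
      by (rule order_bounded_comp[OF Q[OF Cons.prems(1) p] D[OF p(1)]])
    have r: "r + (0 + \<kappa>) \<le> q" using Cons.prems(5) by (simp add: j)
    have "\<bar>\<Lambda> (Q s (t - \<delta>) (D (t - \<delta>) (gchain \<delta> Q D Z t ts f)))\<bar>
        \<le> (M * (a * (k * e)) * ((k * e) ^ j * k) + E * (A * (k * b)) * ((k * b) ^ j * k)) * sup_norm f"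
    proof (rule Cons.IH[OF t(1,3,4) order_functional_comp[OF \<Lambda> X' r]])
      show "0 + \<kappa> + r + j * \<kappa> \<le> q" using Cons.prems(5) by (simp add: j)
      have "real (i + 1) * \<tau> + real i * \<delta> = (real (j + 1) * \<tau> + real j * \<delta>) + \<tau> + \<delta>"
        by (simp add: j algebra_simps)
      then show "real (j + 1) * \<tau> + real j * \<delta> \<le> u - t" using Cons.prems(6) False by linarith
    qed
    then show ?thesis by (simp add: j algebra_simps)
  qed
qed

text \<open>As in \<open>gchain_regularised\<close>, for the two parts of the telescoping sum: in \<open>T1\<close> the exchanged factor is the first one,
  in \<open>T2\<close> it lies in the tail. The bound \<open>e'\<close> of the exchanged factor enters through the first term only; in
  the second term the difference is estimated like its two parts.\<close>

lemma gchain_diff_regularised: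
  fixes Q :: "real \<Rightarrow> real \<Rightarrow> 'd::finite operator"
  assumes \<delta>: "\<delta> > 0" and s: "s \<in> grid \<delta>" "s \<le> u" and ts: "ts \<in> time_chains \<delta> s u i" and i: "i \<ge> 1"
    and Q: "\<And>s t. s \<in> grid \<delta> \<Longrightarrow> t \<in> grid \<delta> \<Longrightarrow> s \<le> t \<Longrightarrow> order_bounded q 0 k k (Q s t)"
    and D: "\<And>s. s \<in> grid \<delta> \<Longrightarrow> order_bounded q \<kappa> e b (D s)"
    and D': "\<And>s. s \<in> grid \<delta> \<Longrightarrow> order_bounded q \<kappa> e b (D' s)"
    and DD': "\<And>s. s \<in> grid \<delta> \<Longrightarrow> order_bounded q \<kappa> e' (2 * b) (\<lambda>f x. D s f x - D' s f x)"
    and Z: "\<And>s. s \<in> grid \<delta> \<Longrightarrow> s \<le> u \<Longrightarrow> order_bounded q 0 k k (Z s)"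
    and QR: "\<And>s t r \<kappa> a A \<Lambda> v g. s \<in> grid \<delta> \<Longrightarrow> t \<in> grid \<delta> \<Longrightarrow> \<tau> \<le> t - s \<Longrightarrow> r + \<kappa> \<le> q \<Longrightarrow>
      order_functional r a A \<Lambda> \<Longrightarrow> weak_bounded \<kappa> v g \<Longrightarrow> g \<in> C_b 0 \<Longrightarrow>
      \<bar>\<Lambda> (Q s t g)\<bar> \<le> M * a * v + E * A * sup_norm g"
    and ZR: "\<And>s r a A \<Lambda>. s \<in> grid \<delta> \<Longrightarrow> \<tau> \<le> u - s \<Longrightarrow> r \<le> q \<Longrightarrow> order_functional r a A \<Lambda> \<Longrightarrow>
      \<bar>\<Lambda> (Z s f)\<bar> \<le> (M * a + E * A) * sup_norm f"
    and f: "f \<in> C_c_inf" and k: "k \<ge> 1" and M: "M \<ge> 0" and E: "E \<ge> 0"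
    and \<Lambda>: "order_functional r a A \<Lambda>" and r: "r + i * \<kappa> \<le> q"
    and long: "real (i + 1) * \<tau> + real i * \<delta> \<le> u - s"
  shows "\<bar>\<Lambda> (\<lambda>x. gchain \<delta> Q D Z s ts f x - gchain \<delta> Q D' Z s ts f x)\<bar>
    \<le> real i * (M * a * ((k * e) ^ (i - 1) * (k * e') * k) + E * A * (2 * ((k * b) ^ i * k))) * sup_norm f"
  using s ts i \<Lambda> r long
proof (induction ts arbitrary: s i r a A \<Lambda>)
  case Nil
  then show ?case by (simp add: time_chains_def)
next
  case (Cons t ts)
  then obtain j where j: "i = Suc j" by (auto simp: time_chains_def)
  have t: "t \<in> grid \<delta>" "s < t" "t \<le> u" "ts \<in> time_chains \<delta> t u j"
    using Cons.prems(3) unfolding j time_chains_Cons by (auto simp: steps_def)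
  note p = grid_pred[OF Cons.prems(1) t(1,2) \<delta>]
  note \<Lambda> = Cons.prems(5)
  let ?G = "gchain \<delta> Q D Z t ts" and ?G' = "gchain \<delta> Q D' Z t ts"
  note G = order_bounded_gchain[OF \<delta> t(1,3,4) Q D Z] and G' = order_bounded_gchain[OF \<delta> t(1,3,4) Q D' Z]
  note mG = order_boundedD(1)[OF G] and mG' = order_boundedD(1)[OF G']
  have Qs: "order_bounded q 0 k k (Q s (t - \<delta>))" by (rule Q[OF Cons.prems(1) p])
  note mD = order_boundedD(1)[OF D[OF p(1)]] and mD' = order_boundedD(1)[OF D'[OF p(1)]]
    and mQ = order_boundedD(1)[OF Qs]
  have fM: "f \<in> M_b" by (rule C_c_inf_subset_M_b[OF f])
  have GM: "?G f \<in> M_b" "?G' f \<in> M_b" using mb_operatorD(1)[OF mG fM] mb_operatorD(1)[OF mG' fM] by auto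
  have nk: "0 \<le> k" using k by simp
  have nn: "0 \<le> a" "0 \<le> A" "0 \<le> sup_norm f" "0 \<le> e" "0 \<le> e'" "0 \<le> b"
    using order_functionalD(2,3)[OF \<Lambda>] M_b_sup_norm_nonneg[OF fM] order_boundedD(2)[OF D[OF p(1)]]
      order_boundedD(2)[OF DD'[OF p(1)]] mb_operatorD(4)[OF mD] by auto
  define B where "B = M * a * ((k * e) ^ j * (k * e') * k) + E * A * (2 * ((k * b) ^ i * k))"
  have long': "real (j + 1) * \<tau> + real j * \<delta> \<le> u - t" if "\<not> \<tau> \<le> (t - \<delta>) - s"
  proof -
    have "real (i + 1) * \<tau> + real i * \<delta> = (real (j + 1) * \<tau> + real j * \<delta>) + \<tau> + \<delta>"
      by (simp add: j algebra_simps)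
    then show ?thesis using Cons.prems(7) that by linarith
  qed
  let ?DD = "\<lambda>h x. D (t - \<delta>) h x - D' (t - \<delta>) h x"
  have gap: "\<bar>\<Lambda> (Q s (t - \<delta>) (Y f))\<bar> \<le> (M * a * (k * y) + E * A * (k * z)) * sup_norm f"
    if long_gap: "\<tau> \<le> (t - \<delta>) - s" and Y: "order_bounded q (\<kappa> + j * \<kappa>) y z Y" for Y y z
  proof -
    have q: "\<kappa> + j * \<kappa> \<le> q" using Cons.prems(6) by (simp add: j)
    have yz: "0 \<le> y" "0 \<le> z" using order_boundedD(2)[OF Y] mb_operatorD(4)[OF order_boundedD(1)[OF Y]] by auto
    have g: "Y f \<in> C_b 0" using order_boundedD(3)[OF Y, of 0 f] q C_c_inf_subset_C_b[OF f] by simp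
    have w: "weak_bounded (\<kappa> + j * \<kappa>) (y * sup_norm f) (Y f)"
      using weak_bounded_apply[OF weak_bounded_sup_norm[OF fM M_b_abs_le[OF fM]] Y] q by simp
    have "\<bar>\<Lambda> (Q s (t - \<delta>) (Y f))\<bar> \<le> M * a * (y * sup_norm f) + E * A * sup_norm (Y f)"
      using QR[OF Cons.prems(1) p(1) long_gap _ \<Lambda> w g] Cons.prems(6) by (simp add: j)
    also have "\<dots> \<le> M * a * (k * y * sup_norm f) + E * A * (k * z * sup_norm f)"
    proof (intro add_mono mult_left_mono mult_right_mono)
      show "y \<le> k * y" using mult_right_mono[OF k yz(1)] by simp
      have "sup_norm (Y f) \<le> z * sup_norm f" by (rule mb_operatorD(2)[OF order_boundedD(1)[OF Y] fM])
      also have "\<dots> \<le> k * z * sup_norm f" using mult_right_mono[OF k yz(2)] nn(3) by (intro mult_right_mono) auto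
      finally show "sup_norm (Y f) \<le> k * z * sup_norm f" .
    qed (use nn M E in auto)
    finally show ?thesis by (simp add: algebra_simps)
  qed
  have T1: "\<bar>\<Lambda> (Q s (t - \<delta>) (?DD (?G f)))\<bar> \<le> B * sup_norm f"
  proof (cases "\<tau> \<le> (t - \<delta>) - s")
    case True
    from gap[OF True order_bounded_comp[OF DD'[OF p(1)] G]]
    show ?thesis unfolding B_def by (simp add: j algebra_simps)
  next
    case False
    have X': "order_bounded q (0 + \<kappa>) (k * e') (k * (2 * b)) (\<lambda>h. Q s (t - \<delta>) (?DD h))"
      by (rule order_bounded_comp[OF Qs DD'[OF p(1)]])
    have r: "r + (0 + \<kappa>) \<le> q" using Cons.prems(6) by (simp add: j)
    have "\<bar>\<Lambda> (Q s (t - \<delta>) (?DD (?G f)))\<bar>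
        \<le> (M * (a * (k * e')) * ((k * e) ^ j * k) + E * (A * (k * (2 * b))) * ((k * b) ^ j * k)) * sup_norm f"
    proof (rule gchain_regularised[where q = q and \<tau> = \<tau> and \<kappa> = \<kappa> and Q = Q and D = D and Z = Z,
          OF \<delta> t(1,3,4) _ _ _ _ _ f k M E order_functional_comp[OF \<Lambda> X' r] _ long'[OF False]])
      show "0 + \<kappa> + r + j * \<kappa> \<le> q" using Cons.prems(6) by (simp add: j)
      show "order_bounded q 0 k k (Q s t)" if "s \<in> grid \<delta>" "t \<in> grid \<delta>" "s \<le> t" for s t by (rule Q[OF that])
      show "order_bounded q \<kappa> e b (D s)" if "s \<in> grid \<delta>" for s by (rule D[OF that])
      show "order_bounded q 0 k k (Z s)" if "s \<in> grid \<delta>" "s \<le> u" for s by (rule Z[OF that])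
      show "\<bar>\<Lambda> (Q s t g)\<bar> \<le> M * a * v + E * A * sup_norm g"
        if "s \<in> grid \<delta>" "t \<in> grid \<delta>" "\<tau> \<le> t - s" "r + \<kappa> \<le> q" "order_functional r a A \<Lambda>"
          "weak_bounded \<kappa> v g" "g \<in> C_b 0" for s t r \<kappa> a A \<Lambda> v g by (rule QR[OF that])
      show "\<bar>\<Lambda> (Z s f)\<bar> \<le> (M * a + E * A) * sup_norm f"
        if "s \<in> grid \<delta>" "\<tau> \<le> u - s" "r \<le> q" "order_functional r a A \<Lambda>" for s r a A \<Lambda> by (rule ZR[OF that])
    qed
    then show ?thesis unfolding B_def by (simp add: j algebra_simps)
  qed
  have T2: "\<bar>\<Lambda> (Q s (t - \<delta>) (D' (t - \<delta>) (\<lambda>x. ?G f x - ?G' f x)))\<bar> \<le> real j * B * sup_norm f"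
  proof (cases "j = 0")
    case True
    then have "?G f = ?G' f" using t(4) by (simp add: time_chains_0)
    moreover have "D' (t - \<delta>) (\<lambda>x. 0) = (\<lambda>x. 0)" "Q s (t - \<delta>) (\<lambda>x. 0) = (\<lambda>x. 0)"
      using mb_operator_lincomb_apply[OF mD' M_b_zero M_b_zero, of 0 0]
        mb_operator_lincomb_apply[OF mQ M_b_zero M_b_zero, of 0 0] by simp_all
    moreover have "\<Lambda> (\<lambda>x. 0) = 0"
      using mb_functional_lincomb[OF order_functionalD(1)[OF \<Lambda>] M_b_zero M_b_zero, of 0 0] by simp
    ultimately show ?thesis using True by simp
  next
    case False
    then obtain l where l: "j = Suc l" by (cases j) auto
    have j1: "1 \<le> j" using False by simp
    show ?thesis
    proof (cases "\<tau> \<le> (t - \<delta>) - s")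
      case True
      from gap[OF True order_bounded_comp[OF D'[OF p(1)] order_bounded_gchain_diff[OF \<delta> t(1,3,4) j1 Q D D' DD' Z]]]
      have "\<bar>\<Lambda> (Q s (t - \<delta>) (D' (t - \<delta>) (\<lambda>x. ?G f x - ?G' f x)))\<bar>
        \<le> (M * a * (k * (e * (real j * ((k * e) ^ (j - 1) * (k * e') * k))))
          + E * A * (k * (b * (2 * ((k * b) ^ j * k))))) * sup_norm f" .
      also have "\<dots> \<le> (real j * (M * a * ((k * e) ^ j * (k * e') * k)) + real j * (E * A * (2 * ((k * b) ^ i * k)))) * sup_norm f"
      proof (intro mult_right_mono add_mono)
        show "M * a * (k * (e * (real j * ((k * e) ^ (j - 1) * (k * e') * k)))) \<le> real j * (M * a * ((k * e) ^ j * (k * e') * k))"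
          by (simp add: l algebra_simps)
        have "0 \<le> E * A * (2 * ((k * b) ^ i * k))" using nn nk E by simp
        then have "1 * (E * A * (2 * ((k * b) ^ i * k))) \<le> real j * (E * A * (2 * ((k * b) ^ i * k)))"
          using j1 by (intro mult_right_mono) auto
        then show "E * A * (k * (b * (2 * ((k * b) ^ j * k)))) \<le> real j * (E * A * (2 * ((k * b) ^ i * k)))"
          by (simp add: j algebra_simps)
      qed (use nn in auto)
      finally show ?thesis by (simp add: B_def algebra_simps)
    next
      case False
      have X': "order_bounded q (0 + \<kappa>) (k * e) (k * b) (\<lambda>h. Q s (t - \<delta>) (D' (t - \<delta>) h))"
        by (rule order_bounded_comp[OF Qs D'[OF p(1)]])
      have r: "r + (0 + \<kappa>) \<le> q" using Cons.prems(6) by (simp add: j)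
      have "\<bar>\<Lambda> (Q s (t - \<delta>) (D' (t - \<delta>) (\<lambda>x. ?G f x - ?G' f x)))\<bar>
          \<le> real j * (M * (a * (k * e)) * ((k * e) ^ (j - 1) * (k * e') * k) + E * (A * (k * b)) * (2 * ((k * b) ^ j * k))) * sup_norm f"
      proof (rule Cons.IH[OF t(1,3,4) j1 order_functional_comp[OF \<Lambda> X' r] _ long'[OF False]])
        show "0 + \<kappa> + r + j * \<kappa> \<le> q" using Cons.prems(6) by (simp add: j)
      qed
      then show ?thesis by (simp add: B_def j l algebra_simps)
    qed
  qed
  have "(\<lambda>x. gchain \<delta> Q D Z s (t # ts) f x - gchain \<delta> Q D' Z s (t # ts) f x)
      = (\<lambda>x. Q s (t - \<delta>) (?DD (?G f)) x + Q s (t - \<delta>) (D' (t - \<delta>) (\<lambda>x. ?G f x - ?G' f x)) x)"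
    unfolding mb_operator_diff_apply[OF mD' GM]
      mb_operator_diff_apply[OF mQ mb_operatorD(1)[OF mD' GM(1)] mb_operatorD(1)[OF mD' GM(2)]]
      mb_operator_diff_apply[OF mQ mb_operatorD(1)[OF mD GM(1)] mb_operatorD(1)[OF mD' GM(1)]] by simp
  moreover have "?DD (?G f) \<in> M_b" by (rule M_b_diff[OF mb_operatorD(1)[OF mD GM(1)] mb_operatorD(1)[OF mD' GM(1)]])
  moreover have "D' (t - \<delta>) (\<lambda>x. ?G f x - ?G' f x) \<in> M_b" by (rule mb_operatorD(1)[OF mD' M_b_diff[OF GM]])
  ultimately have "\<Lambda> (\<lambda>x. gchain \<delta> Q D Z s (t # ts) f x - gchain \<delta> Q D' Z s (t # ts) f x)
      = \<Lambda> (Q s (t - \<delta>) (?DD (?G f))) + \<Lambda> (Q s (t - \<delta>) (D' (t - \<delta>) (\<lambda>x. ?G f x - ?G' f x)))"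
    using mb_functional_add[OF order_functionalD(1)[OF \<Lambda>]] mb_operatorD(1)[OF mQ] by simp
  with T1 T2 have "\<bar>\<Lambda> (\<lambda>x. gchain \<delta> Q D Z s (t # ts) f x - gchain \<delta> Q D' Z s (t # ts) f x)\<bar>
      \<le> B * sup_norm f + real j * B * sup_norm f" by linarith
  then show ?case by (simp add: B_def j algebra_simps)
qed

section \<open>The parameters\<close>

lemma m_par_bounds:
  fixes \<alpha> :: real and l \<nu> :: nat
  assumes \<alpha>: "\<alpha> > 0" and \<nu>: "\<nu> \<ge> 1"
  defines "a \<equiv> (1 + \<alpha>) * real l + \<alpha>"
  shows "1 \<le> m_par \<alpha> l \<nu>" "real \<nu> \<le> real (m_par \<alpha> l \<nu>) * a" "(real (m_par \<alpha> l \<nu>) - 1) * a < real \<nu>"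
proof -
  have a: "a > 0" unfolding a_def using \<alpha> by (simp add: add_nonneg_pos)
  have pos: "real \<nu> / a > 0" using a \<nu> by simp
  then have c: "\<lceil>real \<nu> / a\<rceil> \<ge> 1" by linarith
  then have m: "real (m_par \<alpha> l \<nu>) = of_int \<lceil>real \<nu> / a\<rceil>" unfolding m_par_def a_def by simp
  show "1 \<le> m_par \<alpha> l \<nu>" using c unfolding m_par_def a_def by linarith
  have "real \<nu> / a \<le> real (m_par \<alpha> l \<nu>)" "real (m_par \<alpha> l \<nu>) - 1 < real \<nu> / a" unfolding m by linarith+
  then show "real \<nu> \<le> real (m_par \<alpha> l \<nu>) * a" "(real (m_par \<alpha> l \<nu>) - 1) * a < real \<nu>"
    using a by (simp_all add: field_simps)
qed

text \<open>The bounds express the role of \<open>q\<^sub>i\<close>: by the first, \<open>n\<^sup>i\<close> chains with one factor of order \<open>q\<^sub>i\<close> and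
  \<open>i - 1\<close> factors of order \<open>L\<close> are of order \<open>\<nu>\<close>; by the second, the inner approximation is at least as good
  as a single step of \<open>Q\<close>. The second one is where \<open>i < m\<close> enters.\<close>

lemma q_par_bounds:
  fixes \<alpha> :: real and l \<nu> i :: nat
  assumes \<alpha>: "\<alpha> > 0" and \<nu>: "\<nu> \<ge> 1" and i: "1 \<le> i" "i \<le> m_par \<alpha> l \<nu> - 1"
  defines "L \<equiv> (1 + \<alpha>) * real (Suc l)"
  shows "real \<nu> + real i - L * (real i - 1) \<le> real (q_par \<alpha> i l \<nu>)" "L \<le> real (q_par \<alpha> i l \<nu>)"
    "1 \<le> q_par \<alpha> i l \<nu>"
proof -
  let ?a = "(1 + \<alpha>) * real l + \<alpha>"
  have a: "?a > 0" "L = ?a + 1" using \<alpha> by (simp add: add_nonneg_pos, simp add: L_def algebra_simps)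
  have "real i \<le> real (m_par \<alpha> l \<nu>) - 1" using i by linarith
  then have "real i * ?a \<le> (real (m_par \<alpha> l \<nu>) - 1) * ?a" using a by (intro mult_right_mono) auto
  also have "\<dots> < real \<nu>" by (rule m_par_bounds(3)[OF \<alpha> \<nu>])
  finally have "real i * ?a < real \<nu>" .
  then have big: "L < real \<nu> + real i - L * (real i - 1)" unfolding a(2) by (simp add: algebra_simps)
  have L1: "L > 1" using a by simp
  let ?c = "\<lceil>real i - (1 + \<alpha>) * (real l + 1) * (real i - 1)\<rceil>"
  have "L = (1 + \<alpha>) * (real l + 1)" by (simp add: L_def algebra_simps)
  then have c: "real i - L * (real i - 1) \<le> of_int ?c" by simp
  then have "0 < real_of_int (int \<nu> + ?c)" using big L1 by simp
  then have "real (q_par \<alpha> i l \<nu>) = real_of_int (int \<nu> + ?c)" unfolding q_par_def by simp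
  then show *: "real \<nu> + real i - L * (real i - 1) \<le> real (q_par \<alpha> i l \<nu>)" using c by simp
  then show "L \<le> real (q_par \<alpha> i l \<nu>)" using big by linarith
  then show "1 \<le> q_par \<alpha> i l \<nu>" using L1 by linarith
qed

lemma kappa_bounds:
  assumes \<alpha>: "\<alpha> > 0"
  shows "\<beta> * m_par \<alpha> l \<nu> \<le> kappa \<alpha> \<beta> l \<nu>"
    "1 \<le> i \<Longrightarrow> i \<le> m_par \<alpha> l \<nu> - 1 \<Longrightarrow> i * kappa \<alpha> \<beta> (Suc l) (q_par \<alpha> i l \<nu>) \<le> kappa \<alpha> \<beta> l \<nu>"
proof -
  show "\<beta> * m_par \<alpha> l \<nu> \<le> kappa \<alpha> \<beta> l \<nu>" by (subst kappa.simps) auto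
  assume i: "1 \<le> i" "i \<le> m_par \<alpha> l \<nu> - 1"
  then have "kappa \<alpha> \<beta> l \<nu> = max (\<beta> * m_par \<alpha> l \<nu>)
      (Max ((\<lambda>i. i * kappa \<alpha> \<beta> (Suc l) (q_par \<alpha> i l \<nu>)) ` {1..m_par \<alpha> l \<nu> - 1}))"
    using \<alpha> by (subst kappa.simps) auto
  moreover have "i * kappa \<alpha> \<beta> (Suc l) (q_par \<alpha> i l \<nu>)
      \<le> Max ((\<lambda>i. i * kappa \<alpha> \<beta> (Suc l) (q_par \<alpha> i l \<nu>)) ` {1..m_par \<alpha> l \<nu> - 1})"
    using i by (intro Max_ge) auto
  ultimately show "i * kappa \<alpha> \<beta> (Suc l) (q_par \<alpha> i l \<nu>) \<le> kappa \<alpha> \<beta> l \<nu>" by simp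
qed

lemma kappa_ge_beta:
  assumes "\<alpha> > 0" "\<nu> \<ge> 1"
  shows "\<beta> \<le> kappa \<alpha> \<beta> l \<nu>"
proof -
  have "\<beta> * 1 \<le> \<beta> * m_par \<alpha> l \<nu>" by (rule mult_le_mono2[OF m_par_bounds(1)[OF assms]])
  also have "\<dots> \<le> kappa \<alpha> \<beta> l \<nu>" by (rule kappa_bounds(1)[OF assms(1)])
  finally show ?thesis by simp
qed

lemma q_nu_bounds:
  assumes \<alpha>: "\<alpha> > 0" and \<nu>: "\<nu> \<ge> 1"
  shows "1 \<le> i \<Longrightarrow> i \<le> m_par \<alpha> 0 \<nu> \<Longrightarrow> i * kappa \<alpha> \<beta> 1 (q_par \<alpha> i 0 \<nu>) \<le> q_nu \<alpha> \<beta> \<nu>"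
    "m_par \<alpha> 0 \<nu> * \<beta> \<le> q_nu \<alpha> \<beta> \<nu>"
proof -
  have ge: "i * max \<beta> (kappa \<alpha> \<beta> 1 (q_par \<alpha> i 0 \<nu>)) \<le> q_nu \<alpha> \<beta> \<nu>" if "1 \<le> i" "i \<le> m_par \<alpha> 0 \<nu>" for i
    unfolding q_nu_def using that by (intro Max_ge) auto
  show "i * kappa \<alpha> \<beta> 1 (q_par \<alpha> i 0 \<nu>) \<le> q_nu \<alpha> \<beta> \<nu>" if "1 \<le> i" "i \<le> m_par \<alpha> 0 \<nu>"
    by (rule order_trans[OF _ ge[OF that]]) simp
  show "m_par \<alpha> 0 \<nu> * \<beta> \<le> q_nu \<alpha> \<beta> \<nu>"
    by (rule order_trans[OF _ ge[OF m_par_bounds(1)[OF assms] order_refl]]) simp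
qed

section \<open>Consequences of the hypotheses\<close>

text \<open>The regularity bound of order zero concerns continuous functions; continuity under bounded pointwise
  convergence extends it to \<open>M_b\<close>, and so gives a bound there that is independent of the grid.\<close>

lemma order_bounded_regular:
  fixes A :: "'d::finite operator"
  assumes A: "mb_operator b A" and k: "0 \<le> k"
    and S: "\<And>r f. r \<le> q \<Longrightarrow> f \<in> C_b r \<Longrightarrow> A f \<in> C_b r \<and> norm_inf r (A f) \<le> k * norm_inf r f"
    and D: "\<And>r f. r \<le> q \<Longrightarrow> f \<in> C_1 r \<Longrightarrow> \<exists>h\<in>C_1 r. is_dual A f h \<and> norm_1 r h \<le> k * norm_1 r f"
  shows "order_bounded q 0 k k A"
proof -
  have "\<bar>A f x\<bar> \<le> k * sup_norm f" if "f \<in> M_b" for f x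
  proof (rule mb_functional_bound_extend[OF mb_operatorD(3)[OF A] _ that k])
    fix g :: "'d func" assume g: "g \<in> C_b 0"
    have "\<bar>A g x\<bar> \<le> sup_norm (A g)" by (rule M_b_abs_le[OF mb_operatorD(1)[OF A C_b_subset_M_b[OF g]]])
    also have "\<dots> \<le> k * sup_norm g" using S[OF _ g] by (simp add: norm_inf_0)
    finally show "\<bar>A g x\<bar> \<le> k * sup_norm g" .
  qed
  then have "mb_operator k A"
    using mb_operatorD(3)[OF A] M_b_D(1)[OF mb_operatorD(1)[OF A]] by (intro mb_operatorI[OF k]) auto
  then show ?thesis unfolding order_bounded_def using S D k by simp
qed

text \<open>The locale fixes exactly what constants may depend on. The grid parameter \<open>n\<close> and the semigroups are
  arguments of the predicate \<open>admissible\<close> instead, so that uniformity in them can be expressed by the order of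
  quantifiers.\<close>

locale approximation_setting =
  fixes T \<alpha> c :: real and \<nu> \<beta> :: nat and \<eta> :: "real \<Rightarrow> real" and K :: "nat \<Rightarrow> real"
  assumes T: "T > 0" and \<nu>: "\<nu> \<ge> 1" and \<alpha>: "\<alpha> > 0" and \<eta>: "\<And>x. x \<ge> 0 \<Longrightarrow> \<eta> x \<ge> 0"
begin

definition q :: nat where "q = q_nu \<alpha> \<beta> \<nu>"

text \<open>A common bound for the constants \<open>K r\<close> with \<open>r \<le> q\<close>. At least \<open>1\<close>, so that more factors only increase a
  product.\<close>

definition k0 :: real where "k0 = 1 + (\<Sum>r\<le>q. \<bar>K r\<bar>)"

definition admissible :: "nat \<Rightarrow> (real \<Rightarrow> real \<Rightarrow> real \<Rightarrow> 'd::finite operator) \<Rightarrow>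
    (nat \<Rightarrow> real \<Rightarrow> real \<Rightarrow> 'd operator) \<Rightarrow> bool" where
  "admissible n P Q \<longleftrightarrow> 1 \<le> n \<and> (\<forall>\<delta>>0. discrete_semigroup \<delta> (P \<delta>)) \<and> grid_independent P \<and>
    (\<forall>l. discrete_semigroup (step T n l) (Q l)) \<and> propagates_regularity K P \<and>
    dually_propagates_regularity K P \<and> R_bar K c T n \<nu> \<eta> \<alpha> \<beta> Q \<and>
    (\<forall>k\<ge>1. short_time_estimate K (step T n k) \<alpha> \<beta> (P (step T n k)) (Q k) \<and>
            dual_short_time_estimate K (step T n k) \<alpha> \<beta> (P (step T n k)) (Q k))"

lemma k0: "1 \<le> k0" "0 \<le> k0" "r \<le> q \<Longrightarrow> K r \<le> k0"
proof -
  show "1 \<le> k0" "0 \<le> k0" by (auto simp: k0_def intro!: sum_nonneg add_nonneg_nonneg)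
  assume "r \<le> q"
  then have "\<bar>K r\<bar> \<le> (\<Sum>r\<le>q. \<bar>K r\<bar>)" by (intro member_le_sum) auto
  then show "K r \<le> k0" by (simp add: k0_def)
qed

lemma step_pos: "1 \<le> n \<Longrightarrow> step T n l > 0"
  using T by (simp add: step_def)

lemma step_Suc: "1 \<le> n \<Longrightarrow> step T n l = real n * step T n (Suc l)"
  by (simp add: step_def)

lemma grid_step_mono:
  assumes n: "1 \<le> n" and "l \<le> l'" and "t \<in> grid (step T n l)"
  shows "t \<in> grid (step T n l')"
proof -
  obtain j :: nat where "t = real j * step T n l" using assms(3) unfolding grid_def by blast
  moreover have "step T n l = real (n ^ (l' - l)) * step T n l'"
  proof -
    have "real n ^ l' = real n ^ l * real n ^ (l' - l)" using assms(2) by (simp flip: power_add)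
    then show ?thesis using n by (simp add: step_def)
  qed
  ultimately have "t = real (j * n ^ (l' - l)) * step T n l'" by simp
  then show ?thesis unfolding grid_def by blast
qed

lemma step_powr:
  assumes "1 \<le> n"
  shows "step T n l powr (\<alpha> + 1) = T powr (\<alpha> + 1) * real n powr (- ((1 + \<alpha>) * real l))"
proof -
  have "step T n l = T * real n powr (- real l)"
    using assms by (simp add: step_def powr_minus powr_realpow divide_inverse)
  then show ?thesis using T assms by (simp add: powr_mult powr_powr algebra_simps)
qed

lemma P_order_bounded:
  fixes P :: "real \<Rightarrow> real \<Rightarrow> real \<Rightarrow> 'd::finite operator"
  assumes a: "admissible n P Q" and \<delta>: "\<delta> > 0" and g: "s \<in> grid \<delta>" "t \<in> grid \<delta>" "s \<le> t"
  shows "order_bounded q 0 k0 k0 (P \<delta> s t)"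
proof -
  have P: "discrete_semigroup \<delta> (P \<delta>)" using a \<delta> unfolding admissible_def by blast
  obtain b where b: "mb_operator b (P \<delta> s t)" using discrete_semigroup_mb_operator[OF P g \<delta>] by blast
  show ?thesis
  proof (rule order_bounded_regular[OF b k0(2)])
    fix r and f :: "'d func" assume r: "r \<le> q"
    show "P \<delta> s t f \<in> C_b r \<and> norm_inf r (P \<delta> s t f) \<le> k0 * norm_inf r f" if f: "f \<in> C_b r"
    proof -
      have "P \<delta> s t f \<in> C_b r" "norm_inf r (P \<delta> s t f) \<le> K r * norm_inf r f"
        using a f \<delta> g unfolding admissible_def propagates_regularity_def by blast+
      then show ?thesis using mult_right_mono[OF k0(3)[OF r] norm_inf_nonneg[OF f]] by auto
    qed
    show "\<exists>h\<in>C_1 r. is_dual (P \<delta> s t) f h \<and> norm_1 r h \<le> k0 * norm_1 r f" if f: "f \<in> C_1 r"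
    proof -
      obtain h where "h \<in> C_1 r" "is_dual (P \<delta> s t) f h" "norm_1 r h \<le> K r * norm_1 r f"
        using a f \<delta> g unfolding admissible_def dually_propagates_regularity_def by blast
      then show ?thesis using mult_right_mono[OF k0(3)[OF r] norm_1_nonneg[of r f]] by force
    qed
  qed
qed

lemma R_barD:
  assumes a: "admissible n P Q" and l: "1 \<le> l" and g: "s \<in> grid (step T n l)" "t \<in> grid (step T n l)"
  shows "s \<le> t \<Longrightarrow> f \<in> C_b r \<Longrightarrow> Q l s t f \<in> C_b r \<and> norm_inf r (Q l s t f) \<le> K r * norm_inf r f"
    and "s \<le> t \<Longrightarrow> f \<in> C_1 r \<Longrightarrow> \<exists>h\<in>C_1 r. is_dual (Q l s t) f h \<and> norm_1 r h \<le> K r * norm_1 r f"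
    and "\<exists>Qbar. (s < t \<longrightarrow> linear_on_M_b (Qbar s t)) \<and> regularization K (step T n l) q \<eta> Qbar \<and>
      (s < t \<longrightarrow> (\<forall>f\<in>M_b. sup_norm (\<lambda>x. Q l s t f x - Qbar s t f x)
         \<le> c * (t - s) powr (- \<eta> (real q)) * (sup_norm f / real n ^ (\<nu> + m_par \<alpha> 0 \<nu>))))"
proof -
  have R: "R_bar K c T n \<nu> \<eta> \<alpha> \<beta> Q" using a unfolding admissible_def by blast
  note R' = R[unfolded R_bar_def Let_def, rule_format, OF l]
  show "s \<le> t \<Longrightarrow> f \<in> C_b r \<Longrightarrow> Q l s t f \<in> C_b r \<and> norm_inf r (Q l s t f) \<le> K r * norm_inf r f"
    using conjunct1[OF R'] g by blast
  show "s \<le> t \<Longrightarrow> f \<in> C_1 r \<Longrightarrow> \<exists>h\<in>C_1 r. is_dual (Q l s t) f h \<and> norm_1 r h \<le> K r * norm_1 r f"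
    using conjunct1[OF R'] g by blast
  show "\<exists>Qbar. (s < t \<longrightarrow> linear_on_M_b (Qbar s t)) \<and> regularization K (step T n l) q \<eta> Qbar \<and>
      (s < t \<longrightarrow> (\<forall>f\<in>M_b. sup_norm (\<lambda>x. Q l s t f x - Qbar s t f x)
         \<le> c * (t - s) powr (- \<eta> (real q)) * (sup_norm f / real n ^ (\<nu> + m_par \<alpha> 0 \<nu>))))"
    using conjunct2[OF R'] g unfolding q_def by blast
qed

lemma admissibleD:
  assumes "admissible n P Q"
  shows "1 \<le> n" "discrete_semigroup (step T n l) (Q l)" "\<delta> > 0 \<Longrightarrow> discrete_semigroup \<delta> (P \<delta>)"
  using assms unfolding admissible_def by blast+

lemma Q_order_bounded:
  fixes P :: "real \<Rightarrow> real \<Rightarrow> real \<Rightarrow> 'd::finite operator"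
  assumes a: "admissible n P Q" and l: "1 \<le> l"
    and g: "s \<in> grid (step T n l)" "t \<in> grid (step T n l)" "s \<le> t"
  shows "order_bounded q 0 k0 k0 (Q l s t)"
proof -
  obtain b where b: "mb_operator b (Q l s t)"
    using discrete_semigroup_mb_operator[OF admissibleD(2)[OF a] g step_pos[OF admissibleD(1)[OF a]]] by blast
  show ?thesis
  proof (rule order_bounded_regular[OF b k0(2)])
    fix r and f :: "'d func" assume r: "r \<le> q"
    show "Q l s t f \<in> C_b r \<and> norm_inf r (Q l s t f) \<le> k0 * norm_inf r f" if f: "f \<in> C_b r"
      using R_barD(1)[OF a l g f] mult_right_mono[OF k0(3)[OF r] norm_inf_nonneg[OF f]] by auto
    show "\<exists>h\<in>C_1 r. is_dual (Q l s t) f h \<and> norm_1 r h \<le> k0 * norm_1 r f" if f: "f \<in> C_1 r"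
      using R_barD(2)[OF a l g f] mult_right_mono[OF k0(3)[OF r] norm_1_nonneg[of r f]] by force
  qed
qed

definition \<epsilon>\<^sub>0 :: real where "\<epsilon>\<^sub>0 = k0 * T powr (\<alpha> + 1)"

lemma \<epsilon>\<^sub>0_nonneg: "0 \<le> \<epsilon>\<^sub>0"
  using k0(2) by (simp add: \<epsilon>\<^sub>0_def)

text \<open>The short time estimates in the form used for chains. The step to the power \<open>\<alpha> + 1\<close> becomes a power of \<open>n\<close>, and
  the powers of \<open>T\<close> are put into the constant.\<close>

lemma one_step_diff_order_bounded:
  fixes P :: "real \<Rightarrow> real \<Rightarrow> real \<Rightarrow> 'd::finite operator"
  assumes a: "admissible n P Q" and l: "1 \<le> l" and s: "s \<in> grid (step T n l)"
  shows "order_bounded q \<beta> (\<epsilon>\<^sub>0 * real n powr (- ((1 + \<alpha>) * real l))) (2 * k0)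
    (one_step_diff (step T n l) (P (step T n l)) (Q l) s)"
proof -
  let ?\<delta> = "step T n l"
  have n: "1 \<le> n" by (rule admissibleD(1)[OF a])
  have \<delta>: "?\<delta> > 0" by (rule step_pos[OF n])
  have g: "s \<in> grid ?\<delta>" "s + ?\<delta> \<in> grid ?\<delta>" "s \<le> s + ?\<delta>" using s grid_Suc \<delta> by auto
  note Pb = P_order_bounded[OF a \<delta> g] and Qb = Q_order_bounded[OF a l g]
  let ?A = "\<lambda>f x. P ?\<delta> s (s + ?\<delta>) f x - Q l s (s + ?\<delta>) f x"
  have st: "short_time_estimate K ?\<delta> \<alpha> \<beta> (P ?\<delta>) (Q l)" "dual_short_time_estimate K ?\<delta> \<alpha> \<beta> (P ?\<delta>) (Q l)"
    using a l unfolding admissible_def by blast+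
  have le: "K r * X * ?\<delta> powr (\<alpha> + 1) \<le> \<epsilon>\<^sub>0 * real n powr (- ((1 + \<alpha>) * real l)) * X" if "r \<le> q" "0 \<le> X" for r X
  proof -
    have "K r * (X * ?\<delta> powr (\<alpha> + 1)) \<le> k0 * (X * ?\<delta> powr (\<alpha> + 1))"
      using k0(3)[OF that(1)] that(2) by (intro mult_right_mono) auto
    then show ?thesis unfolding step_powr[OF n] \<epsilon>\<^sub>0_def by (simp add: ac_simps)
  qed
  have "order_bounded q \<beta> (\<epsilon>\<^sub>0 * real n powr (- ((1 + \<alpha>) * real l))) (2 * k0) ?A"
    unfolding order_bounded_def
  proof (intro conjI allI impI ballI)
    show "mb_operator (2 * k0) ?A"
      using mb_operator_diff[OF order_boundedD(1)[OF Pb] order_boundedD(1)[OF Qb]] by simp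
    show "0 \<le> \<epsilon>\<^sub>0 * real n powr (- ((1 + \<alpha>) * real l))" using \<epsilon>\<^sub>0_nonneg by simp
    fix r assume r: "r + \<beta> \<le> q"
    fix f :: "'d func"
    {
      assume f: "f \<in> C_b (\<beta> + r)"
      have fr: "f \<in> C_b r" by (rule C_b_mono[OF f]) simp
      have "P ?\<delta> s (s + ?\<delta>) f \<in> C_b r" "Q l s (s + ?\<delta>) f \<in> C_b r"
        using order_boundedD(3)[OF Pb, of r f] order_boundedD(3)[OF Qb, of r f] fr r by simp_all
      from C_b_lincomb[OF this, of 1 "-1"] show "?A f \<in> C_b r" by simp
      have "norm_inf r (?A f) \<le> K r * norm_inf (\<beta> + r) f * ?\<delta> powr (\<alpha> + 1)"
        using st(1) f s unfolding short_time_estimate_def by blast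
      also have "\<dots> \<le> \<epsilon>\<^sub>0 * real n powr (- ((1 + \<alpha>) * real l)) * norm_inf (\<beta> + r) f"
        using r norm_inf_nonneg[OF f] by (intro le) auto
      finally show "norm_inf r (?A f) \<le> \<epsilon>\<^sub>0 * real n powr (- ((1 + \<alpha>) * real l)) * norm_inf (\<beta> + r) f" .
    }
    assume f: "f \<in> C_1 (\<beta> + r)"
    obtain h h' where h: "h \<in> C_1 r" "h' \<in> C_1 r" "is_dual (P ?\<delta> s (s + ?\<delta>)) f h" "is_dual (Q l s (s + ?\<delta>)) f h'"
      "norm_1 r (\<lambda>x. h x - h' x) \<le> K r * norm_1 (\<beta> + r) f * ?\<delta> powr (\<alpha> + 1)"
      using st(2) f s unfolding dual_short_time_estimate_def by blast
    have "(\<lambda>x. h x - h' x) \<in> C_1 r" using C_1_lincomb[OF h(1,2), of 1 "-1"] by simp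
    moreover have "is_dual ?A f (\<lambda>x. h x - h' x)"
      using is_dual_lincomb[OF h(3) order_boundedD(1)[OF Pb] h(4) order_boundedD(1)[OF Qb] C_1_integrable[OF f],
        where a = 1 and c = "-1"] by simp
    moreover have "norm_1 r (\<lambda>x. h x - h' x) \<le> \<epsilon>\<^sub>0 * real n powr (- ((1 + \<alpha>) * real l)) * norm_1 (\<beta> + r) f"
      using h(5) le[of r "norm_1 (\<beta> + r) f"] r norm_1_nonneg[of "\<beta> + r" f] by simp
    ultimately show "\<exists>h\<in>C_1 r. is_dual ?A f h \<and>
        norm_1 r h \<le> \<epsilon>\<^sub>0 * real n powr (- ((1 + \<alpha>) * real l)) * norm_1 (\<beta> + r) f" by blast
  qed
  then show ?thesis by (simp add: one_step_diff_def)
qed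

lemma P_grid_independent:
  assumes a: "admissible n P Q" and "l \<le> l'" and "s \<in> grid (step T n l)" "t \<in> grid (step T n l)" "s \<le> t" "f \<in> M_b"
  shows "P (step T n l) s t f = P (step T n l') s t f"
proof -
  have "grid_independent P" using a unfolding admissible_def by blast
  moreover have "s \<in> grid (step T n l')" "t \<in> grid (step T n l')"
    using grid_step_mono[OF admissibleD(1)[OF a] assms(2)] assms(3,4) by auto
  ultimately show ?thesis
    using step_pos[OF admissibleD(1)[OF a]] assms(3-6) unfolding grid_independent_def by simp
qed

section \<open>The approximation at one level\<close>

definition Qhat_diff :: "nat \<Rightarrow> (nat \<Rightarrow> real \<Rightarrow> real \<Rightarrow> 'd::finite operator) \<Rightarrow> nat \<Rightarrow> nat \<Rightarrow> real \<Rightarrow> 'd operator" where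
  "Qhat_diff n Q l p s = (\<lambda>g y. Qhat T n \<alpha> Q l p s g y - Q l s (s + step T n l) g y)"

text \<open>Both \<open>P\<close> and its approximation are sums over chains; the sums differ in the one-step differences, and in
  that only the expansion of \<open>P\<close> has a remainder.\<close>

lemma Qhat_error_expansion:
  fixes P :: "real \<Rightarrow> real \<Rightarrow> real \<Rightarrow> 'd::finite operator" and n l p :: nat and t :: real
  assumes a: "admissible n P Q" and t: "t \<in> grid (step T n l)" and p: "p \<ge> 1" and f: "f \<in> M_b"
  defines "\<delta> \<equiv> step T n (Suc l)" and "u \<equiv> t + step T n l" and "m \<equiv> m_par \<alpha> l p"
  defines "D \<equiv> one_step_diff \<delta> (P \<delta>) (Q (Suc l))"
  shows "P (step T n l) t u f x - Qhat T n \<alpha> Q l p t f x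
    = (\<Sum>i=1..m - 1. \<Sum>ts\<in>time_chains \<delta> t u i. gchain \<delta> (Q (Suc l)) D (\<lambda>s. Q (Suc l) s u) t ts f x
        - gchain \<delta> (Q (Suc l)) (Qhat_diff n Q (Suc l) (q_par \<alpha> i l p)) (\<lambda>s. Q (Suc l) s u) t ts f x)
      + (\<Sum>ts\<in>time_chains \<delta> t u m. gchain \<delta> (Q (Suc l)) D (\<lambda>s. P \<delta> s u) t ts f x)"
proof -
  have n: "1 \<le> n" by (rule admissibleD(1)[OF a])
  have \<delta>: "\<delta> > 0" unfolding \<delta>_def by (rule step_pos[OF n])
  have tu: "t \<in> grid (step T n l)" "u \<in> grid (step T n l)" "t \<le> u"
    using t grid_Suc step_pos[OF n, of l] by (auto simp: u_def)
  have g: "t \<in> grid \<delta>" "u \<in> grid \<delta>" "t \<le> u"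
    using tu grid_step_mono[OF n, of l "Suc l"] by (auto simp: \<delta>_def)
  have m: "1 \<le> m" unfolding m_def by (rule m_par_bounds(1)[OF \<alpha> p])
  let ?V = "\<lambda>D i. \<Sum>ts\<in>time_chains \<delta> t u i. gchain \<delta> (Q (Suc l)) D (\<lambda>s. Q (Suc l) s u) t ts f x"
  have "P (step T n l) t u f x = P \<delta> t u f x"
    using P_grid_independent[OF a, of l "Suc l" t u f] tu f by (simp add: \<delta>_def)
  also have "\<dots> = (\<Sum>i<m. ?V D i) + (\<Sum>ts\<in>time_chains \<delta> t u m. gchain \<delta> (Q (Suc l)) D (\<lambda>s. P \<delta> s u) t ts f x)"
    unfolding D_def
    using duhamel_expansion[OF admissibleD(3)[OF a \<delta>] admissibleD(2)[OF a, of "Suc l", folded \<delta>_def] \<delta> g f] .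
  also have "(\<Sum>i<m. ?V D i) = Q (Suc l) t u f x + (\<Sum>i=1..m - 1. ?V D i)"
  proof -
    have "{..<m} = insert 0 {1..m - 1}" using m by auto
    then show ?thesis by (simp add: time_chains_0)
  qed
  finally have P: "P (step T n l) t u f x = Q (Suc l) t u f x + (\<Sum>i=1..m - 1. ?V D i)
    + (\<Sum>ts\<in>time_chains \<delta> t u m. gchain \<delta> (Q (Suc l)) D (\<lambda>s. P \<delta> s u) t ts f x)" .
  have Qhat: "Qhat T n \<alpha> Q l p t f x = Q (Suc l) t u f x
      + (\<Sum>i=1..m - 1. ?V (Qhat_diff n Q (Suc l) (q_par \<alpha> i l p)) i)"
  proof (cases "m \<le> 1")
    case True
    then show ?thesis unfolding m_def u_def by (subst Qhat.simps) simp
  next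
    case False
    then show ?thesis using \<alpha> unfolding m_def u_def \<delta>_def
      by (subst Qhat.simps) (simp add: op_chain_eq_gchain Qhat_diff_def[abs_def])
  qed
  show ?thesis unfolding P Qhat by (simp add: sum_subtractf)
qed

text \<open>Besides the error of order \<open>p\<close> on smooth functions a bound on \<open>M_b\<close> has to be carried along. It only grows
  polynomially in \<open>n\<close>, and the exponent \<open>N\<close> depends on the parameters alone.\<close>

definition level_bound :: "('d::finite) itself \<Rightarrow> nat \<Rightarrow> nat \<Rightarrow> real \<Rightarrow> nat \<Rightarrow> bool" where
  "level_bound _ l p C N \<longleftrightarrow> 0 \<le> C \<and>
    (\<forall>n (P :: real \<Rightarrow> real \<Rightarrow> real \<Rightarrow> 'd operator) Q t. admissible n P Q \<longrightarrow> t \<in> grid (step T n l) \<longrightarrow>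
      order_bounded q (kappa \<alpha> \<beta> l p) (C * real n powr (- real p)) (C * real n ^ N)
        (\<lambda>f x. P (step T n l) t (t + step T n l) f x - Qhat T n \<alpha> Q l p t f x))"

text \<open>The exact and the approximate one-step differences at the next level obey the same bound, of the order of the short
  time estimate. This uses that \<open>q\<^sub>i\<close> is at least that order.\<close>

lemma next_level_diff_bounds:
  fixes P :: "real \<Rightarrow> real \<Rightarrow> real \<Rightarrow> 'd::finite operator" and n l p i :: nat and C :: real
  assumes a: "admissible n P Q" and p: "p \<ge> 1" and i: "1 \<le> i" "i \<le> m_par \<alpha> l p - 1"
    and lb: "level_bound TYPE('d) (Suc l) (q_par \<alpha> i l p) C N"
  defines "\<delta> \<equiv> step T n (Suc l)" and "L \<equiv> (1 + \<alpha>) * real (Suc l)" and "C' \<equiv> 2 * k0 + \<epsilon>\<^sub>0 + C"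
    and "\<kappa> \<equiv> kappa \<alpha> \<beta> (Suc l) (q_par \<alpha> i l p)"
  defines "D \<equiv> one_step_diff \<delta> (P \<delta>) (Q (Suc l))" and "D' \<equiv> Qhat_diff n Q (Suc l) (q_par \<alpha> i l p)"
  assumes s: "s \<in> grid \<delta>"
  shows "order_bounded q \<kappa> (C' * real n powr (- L)) (C' * real n ^ N) (D s)"
    "order_bounded q \<kappa> (C' * real n powr (- L)) (C' * real n ^ N) (D' s)"
    "order_bounded q \<kappa> (C' * real n powr (- real (q_par \<alpha> i l p))) (2 * (C' * real n ^ N)) (\<lambda>f x. D s f x - D' s f x)"
proof -
  have n: "1 \<le> n" by (rule admissibleD(1)[OF a])
  have C: "0 \<le> C" using lb by (simp add: level_bound_def)
  note qp = q_par_bounds[OF \<alpha> p i]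
  have \<beta>: "\<beta> \<le> \<kappa>" unfolding \<kappa>_def by (rule kappa_ge_beta[OF \<alpha> qp(3)])
  have nN: "1 \<le> real n ^ N" using n by simp
  have E: "order_bounded q \<kappa> (C * real n powr (- real (q_par \<alpha> i l p))) (C * real n ^ N)
      (\<lambda>f x. P \<delta> s (s + \<delta>) f x - Qhat T n \<alpha> Q (Suc l) (q_par \<alpha> i l p) s f x)"
    using lb a s unfolding level_bound_def \<kappa>_def \<delta>_def by blast
  have D: "order_bounded q \<beta> (\<epsilon>\<^sub>0 * real n powr (- L)) (2 * k0) (D s)"
    using one_step_diff_order_bounded[OF a _ s[unfolded \<delta>_def]] unfolding D_def \<delta>_def L_def by simp
  have pw: "real n powr (- real (q_par \<alpha> i l p)) \<le> real n powr (- L)"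
    using n qp(2) by (intro powr_mono) (auto simp: L_def)
  have b: "2 * k0 \<le> 2 * k0 * real n ^ N" using mult_left_mono[OF nN, of "2 * k0"] k0(2) by simp
  have C'_split: "C' * x = \<epsilon>\<^sub>0 * x + C * x + 2 * k0 * x" for x by (simp add: C'_def algebra_simps)
  have e0: "0 \<le> \<epsilon>\<^sub>0" by (rule \<epsilon>\<^sub>0_nonneg)
  have e1: "0 \<le> \<epsilon>\<^sub>0 * x" "0 \<le> C * x" "0 \<le> 2 * k0 * x" if "0 \<le> x" for x
    using C k0(2) e0 that by auto
  note eL = e1[of "real n powr (- L)", OF powr_ge_zero]
    and eq = e1[of "real n powr (- real (q_par \<alpha> i l p))", OF powr_ge_zero]
    and eN = e1[of "real n ^ N", OF order_trans[OF zero_le_one nN]]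
  have e2: "C * real n powr (- real (q_par \<alpha> i l p)) \<le> C * real n powr (- L)"
    using pw C by (rule mult_left_mono)
  show "order_bounded q \<kappa> (C' * real n powr (- L)) (C' * real n ^ N) (D s)"
    by (rule order_bounded_mono[OF D \<beta>]; unfold C'_split; use eL eN b in linarith)
  have DE: "order_bounded q \<kappa> (\<epsilon>\<^sub>0 * real n powr (- L) + C * real n powr (- real (q_par \<alpha> i l p)))
      (2 * k0 + C * real n ^ N)
      (\<lambda>f x. D s f x - (P \<delta> s (s + \<delta>) f x - Qhat T n \<alpha> Q (Suc l) (q_par \<alpha> i l p) s f x))"
    by (rule order_bounded_diff[OF order_bounded_mono[OF D \<beta> order_refl order_refl] E])
  have "D' s = (\<lambda>f x. D s f x - (P \<delta> s (s + \<delta>) f x - Qhat T n \<alpha> Q (Suc l) (q_par \<alpha> i l p) s f x))"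
    by (simp add: D'_def Qhat_diff_def D_def one_step_diff_def \<delta>_def)
  with DE have "order_bounded q \<kappa> (\<epsilon>\<^sub>0 * real n powr (- L) + C * real n powr (- real (q_par \<alpha> i l p)))
      (2 * k0 + C * real n ^ N) (D' s)" by simp
  then show "order_bounded q \<kappa> (C' * real n powr (- L)) (C' * real n ^ N) (D' s)"
    by (rule order_bounded_mono[OF _ order_refl]; unfold C'_split; use eL eN e2 b in linarith)
  have "(\<lambda>f x. D s f x - D' s f x) = (\<lambda>f x. P \<delta> s (s + \<delta>) f x - Qhat T n \<alpha> Q (Suc l) (q_par \<alpha> i l p) s f x)"
    by (simp add: D'_def Qhat_diff_def D_def one_step_diff_def \<delta>_def)
  with E have "order_bounded q \<kappa> (C * real n powr (- real (q_par \<alpha> i l p))) (C * real n ^ N) (\<lambda>f x. D s f x - D' s f x)" by simp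
  then show "order_bounded q \<kappa> (C' * real n powr (- real (q_par \<alpha> i l p))) (2 * (C' * real n ^ N)) (\<lambda>f x. D s f x - D' s f x)"
  proof (rule order_bounded_mono[OF _ order_refl])
    show "C * real n powr (- real (q_par \<alpha> i l p)) \<le> C' * real n powr (- real (q_par \<alpha> i l p))"
      unfolding C'_split using eq by linarith
    have "C * real n ^ N \<le> C' * real n ^ N" unfolding C'_split using eN by linarith
    moreover have "0 \<le> C' * real n ^ N" unfolding C'_split using eN by linarith
    ultimately show "C * real n ^ N \<le> 2 * (C' * real n ^ N)" by linarith
  qed
qed

lemma powr_nat_power: "1 \<le> n \<Longrightarrow> (real n powr x) ^ j = real n powr (x * real j)"
  using powr_realpow[of "real n powr x" j] by (simp add: powr_powr)

text \<open>The power of \<open>n\<close> for the chains in which one factor has been exchanged for an inner error.\<close>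

lemma powr_chain_exponent:
  assumes n: "1 \<le> n" and i: "1 \<le> i" and ex: "p + real i - L * (real i - 1) \<le> r"
  shows "real n ^ i * ((real n powr (- L)) ^ (i - 1) * real n powr (- r)) \<le> real n powr (- p)"
proof -
  have "real n ^ i = real n powr real i" using n by (simp add: powr_realpow)
  then have "real n ^ i * ((real n powr (- L)) ^ (i - 1) * real n powr (- r))
      = real n powr (real i + ((- L) * real (i - 1) + (- r)))"
    unfolding powr_nat_power[OF n] by (simp only: powr_add)
  also have "\<dots> \<le> real n powr (- p)"
    using n i ex by (intro powr_mono) (auto simp: of_nat_diff algebra_simps)
  finally show ?thesis .
qed

text \<open>The power of \<open>n\<close> for the remainder, where \<open>m\<close> has been chosen such that \<open>m (L - 1) \<ge> p\<close>.\<close>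

lemma powr_remainder_exponent:
  assumes n: "1 \<le> n" and ex: "p \<le> real m * (L - 1)"
  shows "real n ^ m * (real n powr (- L)) ^ m \<le> real n powr (- p)"
proof -
  have "real n ^ m = real n powr real m" using n by (simp add: powr_realpow)
  then have "real n ^ m * (real n powr (- L)) ^ m = real n powr (real m + (- L) * real m)"
    unfolding powr_nat_power[OF n] by (simp only: powr_add)
  also have "\<dots> \<le> real n powr (- p)"
    using n ex by (intro powr_mono) (auto simp: algebra_simps)
  finally show ?thesis .
qed

lemma chain_sum_order_bounded:
  fixes P :: "real \<Rightarrow> real \<Rightarrow> real \<Rightarrow> 'd::finite operator" and n l p i :: nat and t C :: real
  assumes a: "admissible n P Q" and t: "t \<in> grid (step T n l)" and p: "p \<ge> 1" and i: "1 \<le> i" "i \<le> m_par \<alpha> l p - 1"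
    and lb: "level_bound TYPE('d) (Suc l) (q_par \<alpha> i l p) C N"
  defines "\<delta> \<equiv> step T n (Suc l)" and "u \<equiv> t + step T n l" and "C' \<equiv> 2 * k0 + \<epsilon>\<^sub>0 + C"
  defines "D \<equiv> one_step_diff \<delta> (P \<delta>) (Q (Suc l))" and "D' \<equiv> Qhat_diff n Q (Suc l) (q_par \<alpha> i l p)"
    and "Z \<equiv> \<lambda>s. Q (Suc l) s u"
  shows "order_bounded q (kappa \<alpha> \<beta> l p) (real i * ((k0 * C') ^ i * k0) * real n powr (- real p))
    (2 * ((k0 * C') ^ i * k0) * real n ^ (i + N * i))
    (\<lambda>f x. \<Sum>ts\<in>time_chains \<delta> t u i. gchain \<delta> (Q (Suc l)) D Z t ts f x - gchain \<delta> (Q (Suc l)) D' Z t ts f x)"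
proof -
  have n: "1 \<le> n" by (rule admissibleD(1)[OF a])
  have \<delta>: "\<delta> > 0" unfolding \<delta>_def by (rule step_pos[OF n])
  have tu: "t \<in> grid (step T n l)" "u \<in> grid (step T n l)" "t \<le> u"
    using t grid_Suc step_pos[OF n, of l] by (auto simp: u_def)
  have g: "t \<in> grid \<delta>" "u \<in> grid \<delta>" "t \<le> u"
    using tu grid_step_mono[OF n, of l "Suc l"] by (auto simp: \<delta>_def)
  have u: "u \<le> t + real n * \<delta>" unfolding u_def \<delta>_def using step_Suc[OF n, of l] by simp
  let ?\<kappa> = "kappa \<alpha> \<beta> (Suc l) (q_par \<alpha> i l p)" and ?L = "(1 + \<alpha>) * real (Suc l)"
  let ?nL = "real n powr (- ?L)" and ?nq = "real n powr (- real (q_par \<alpha> i l p))" and ?nN = "real n ^ N"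
  have C: "0 \<le> C" using lb by (simp add: level_bound_def)
  have C': "0 \<le> C'" using C k0(2) \<epsilon>\<^sub>0_nonneg by (simp add: C'_def)
  note fb = next_level_diff_bounds[OF a p i lb, folded \<delta>_def C'_def, folded D_def D'_def]
  have Qb: "order_bounded q 0 k0 k0 (Q (Suc l) s t)" if "s \<in> grid \<delta>" "t \<in> grid \<delta>" "s \<le> t" for s t
    using Q_order_bounded[OF a, of "Suc l" s t] that by (simp add: \<delta>_def)
  have Zb: "order_bounded q 0 k0 k0 (Z s)" if "s \<in> grid \<delta>" "s \<le> u" for s
    unfolding Z_def using Qb[OF that(1) g(2) that(2)] .
  let ?e = "real i * ((k0 * (C' * ?nL)) ^ (i - 1) * (k0 * (C' * ?nq)) * k0)"
  let ?b = "2 * ((k0 * (C' * ?nN)) ^ i * k0)"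
  have G: "order_bounded q (i * ?\<kappa>) ?e ?b
      (\<lambda>f x. gchain \<delta> (Q (Suc l)) D Z t ts f x - gchain \<delta> (Q (Suc l)) D' Z t ts f x)"
    if "ts \<in> time_chains \<delta> t u i" for ts
    by (rule order_bounded_gchain_diff[OF \<delta> g(1,3) that i(1) Qb fb(1) fb(2) fb(3) Zb])
  have card: "real (card (time_chains \<delta> t u i)) \<le> real n ^ i"
    using card_time_chains[OF g \<delta> u, of i] by (metis of_nat_le_iff of_nat_power)
  have e0: "0 \<le> ?e" "0 \<le> ?b" using C' k0(2) by auto
  show ?thesis
  proof (rule order_bounded_mono[OF order_bounded_sum[OF finite_time_chains[OF g \<delta>] G]])
    show "i * ?\<kappa> \<le> kappa \<alpha> \<beta> l p" by (rule kappa_bounds(2)[OF \<alpha> i])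
    have "real (card (time_chains \<delta> t u i)) * ?e \<le> real n ^ i * ?e" using card e0 by (intro mult_right_mono)
    also have "\<dots> = real i * ((k0 * C') ^ i * k0) * (real n ^ i * (?nL ^ (i - 1) * ?nq))"
      using i(1) by (cases i) (simp_all add: power_mult_distrib algebra_simps)
    also have "\<dots> \<le> real i * ((k0 * C') ^ i * k0) * real n powr (- real p)"
      using C' k0(2) q_par_bounds(1)[OF \<alpha> p i]
      by (intro mult_left_mono powr_chain_exponent[OF n i(1)]) auto
    finally show "real (card (time_chains \<delta> t u i)) * ?e \<le> real i * ((k0 * C') ^ i * k0) * real n powr (- real p)" .
    have "real (card (time_chains \<delta> t u i)) * ?b \<le> real n ^ i * ?b" using card e0 by (intro mult_right_mono)
    also have "\<dots> = 2 * ((k0 * C') ^ i * k0) * real n ^ (i + N * i)"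
      by (simp add: power_mult_distrib power_add power_mult algebra_simps)
    finally show "real (card (time_chains \<delta> t u i)) * ?b \<le> 2 * ((k0 * C') ^ i * k0) * real n ^ (i + N * i)" .
  qed
qed

lemma remainder_order_bounded:
  fixes P :: "real \<Rightarrow> real \<Rightarrow> real \<Rightarrow> 'd::finite operator" and n l p :: nat and t :: real
  assumes a: "admissible n P Q" and t: "t \<in> grid (step T n l)" and p: "p \<ge> 1"
  defines "\<delta> \<equiv> step T n (Suc l)" and "u \<equiv> t + step T n l" and "m \<equiv> m_par \<alpha> l p"
  defines "D \<equiv> one_step_diff \<delta> (P \<delta>) (Q (Suc l))"
  shows "order_bounded q (kappa \<alpha> \<beta> l p) ((k0 * \<epsilon>\<^sub>0) ^ m * k0 * real n powr (- real p))
    ((k0 * (2 * k0)) ^ m * k0 * real n ^ m)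
    (\<lambda>f x. \<Sum>ts\<in>time_chains \<delta> t u m. gchain \<delta> (Q (Suc l)) D (\<lambda>s. P \<delta> s u) t ts f x)"
proof -
  have n: "1 \<le> n" by (rule admissibleD(1)[OF a])
  have \<delta>: "\<delta> > 0" unfolding \<delta>_def by (rule step_pos[OF n])
  have tu: "t \<in> grid (step T n l)" "u \<in> grid (step T n l)" "t \<le> u"
    using t grid_Suc step_pos[OF n, of l] by (auto simp: u_def)
  have g: "t \<in> grid \<delta>" "u \<in> grid \<delta>" "t \<le> u"
    using tu grid_step_mono[OF n, of l "Suc l"] by (auto simp: \<delta>_def)
  have u: "u \<le> t + real n * \<delta>" unfolding u_def \<delta>_def using step_Suc[OF n, of l] by simp
  let ?L = "(1 + \<alpha>) * real (Suc l)"
  let ?nL = "real n powr (- ?L)"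
  have Qb: "order_bounded q 0 k0 k0 (Q (Suc l) s t)" if "s \<in> grid \<delta>" "t \<in> grid \<delta>" "s \<le> t" for s t
    using Q_order_bounded[OF a, of "Suc l" s t] that by (simp add: \<delta>_def)
  have Pb: "order_bounded q 0 k0 k0 (P \<delta> s u)" if "s \<in> grid \<delta>" "s \<le> u" for s
    by (rule P_order_bounded[OF a \<delta> that(1) g(2) that(2)])
  have Db: "order_bounded q \<beta> (\<epsilon>\<^sub>0 * ?nL) (2 * k0) (D s)" if "s \<in> grid \<delta>" for s
    using one_step_diff_order_bounded[OF a, of "Suc l" s] that unfolding D_def \<delta>_def by simp
  let ?e = "(k0 * (\<epsilon>\<^sub>0 * ?nL)) ^ m * k0" and ?b = "(k0 * (2 * k0)) ^ m * k0"
  have G: "order_bounded q (m * \<beta>) ?e ?b (gchain \<delta> (Q (Suc l)) D (\<lambda>s. P \<delta> s u) t ts)"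
    if "ts \<in> time_chains \<delta> t u m" for ts
    by (rule order_bounded_gchain[OF \<delta> g(1,3) that Qb Db Pb])
  have card: "real (card (time_chains \<delta> t u m)) \<le> real n ^ m"
    using card_time_chains[OF g \<delta> u, of m] by (metis of_nat_le_iff of_nat_power)
  have e0: "0 \<le> ?e" "0 \<le> ?b" using \<epsilon>\<^sub>0_nonneg k0(2) by auto
  show ?thesis
  proof (rule order_bounded_mono[OF order_bounded_sum[OF finite_time_chains[OF g \<delta>] G]])
    show "m * \<beta> \<le> kappa \<alpha> \<beta> l p" unfolding m_def using kappa_bounds(1)[OF \<alpha>, of \<beta> l p] by (simp add: mult.commute)
    have "real (card (time_chains \<delta> t u m)) * ?e \<le> real n ^ m * ?e" using card e0 by (intro mult_right_mono)
    also have "\<dots> = (k0 * \<epsilon>\<^sub>0) ^ m * k0 * (real n ^ m * ?nL ^ m)" by (simp add: power_mult_distrib algebra_simps)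
    also have "\<dots> \<le> (k0 * \<epsilon>\<^sub>0) ^ m * k0 * real n powr (- real p)"
    proof (intro mult_left_mono powr_remainder_exponent[OF n])
      have "?L - 1 = (1 + \<alpha>) * real l + \<alpha>" by (simp add: algebra_simps)
      then show "real p \<le> real m * (?L - 1)" unfolding m_def using m_par_bounds(2)[OF \<alpha> p, of l] by simp
    qed (use \<epsilon>\<^sub>0_nonneg k0(2) in auto)
    finally show "real (card (time_chains \<delta> t u m)) * ?e \<le> (k0 * \<epsilon>\<^sub>0) ^ m * k0 * real n powr (- real p)" .
    have "real (card (time_chains \<delta> t u m)) * ?b \<le> real n ^ m * ?b" using card e0 by (intro mult_right_mono)
    then show "real (card (time_chains \<delta> t u m)) * ?b \<le> (k0 * (2 * k0)) ^ m * k0 * real n ^ m" by (simp add: mult.commute)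
  qed
qed

text \<open>Induction along the recursion that defines the approximation. The inner approximations have the orders
  \<open>q\<^sub>i\<close>, and the chains of each length \<open>i\<close> as well as the remainder contribute one term of order \<open>p\<close>.\<close>

lemma level_bound_exists:
  assumes "p \<ge> 1"
  shows "\<exists>C N. level_bound TYPE('d::finite) l p C N"
  using assms
proof (induction "rec_measure \<alpha> l p" arbitrary: l p rule: less_induct)
  case less
  define m where "m = m_par \<alpha> l p"
  have "\<exists>C N. level_bound TYPE('d) (Suc l) (q_par \<alpha> i l p) C N" if "i \<in> {1..m - 1}" for i
  proof (rule less.hyps)
    have i: "1 \<le> i" "i \<le> m_par \<alpha> l p - 1" using that by (auto simp: m_def)
    then show "rec_measure \<alpha> (Suc l) (q_par \<alpha> i l p) < rec_measure \<alpha> l p"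
      by (intro rec_measure_decreases[OF \<alpha>]) auto
    show "1 \<le> q_par \<alpha> i l p" by (rule q_par_bounds(3)[OF \<alpha> less.prems i])
  qed
  then obtain C N where CN: "\<And>i. i \<in> {1..m - 1} \<Longrightarrow> level_bound TYPE('d) (Suc l) (q_par \<alpha> i l p) (C i) (N i)"
    by metis
  define C' where "C' i = 2 * k0 + \<epsilon>\<^sub>0 + C i" for i
  define A where "A i = real i * ((k0 * C' i) ^ i * k0) + 2 * ((k0 * C' i) ^ i * k0)" for i
  define R where "R = (k0 * \<epsilon>\<^sub>0) ^ m * k0 + (k0 * (2 * k0)) ^ m * k0"
  define Cmax where "Cmax = (\<Sum>i=1..m - 1. A i) + R"
  define Nmax where "Nmax = (\<Sum>i=1..m - 1. i + N i * i) + m"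
  have C'0: "0 \<le> C' i" if "i \<in> {1..m - 1}" for i
    using CN[OF that] k0(2) \<epsilon>\<^sub>0_nonneg by (simp add: C'_def level_bound_def)
  have parts: "0 \<le> real i * ((k0 * C' i) ^ i * k0)" "0 \<le> 2 * ((k0 * C' i) ^ i * k0)" if "i \<in> {1..m - 1}" for i
    using C'0[OF that] k0(2) by auto
  have Rparts: "0 \<le> (k0 * \<epsilon>\<^sub>0) ^ m * k0" "0 \<le> (k0 * (2 * k0)) ^ m * k0" using \<epsilon>\<^sub>0_nonneg k0(2) by auto
  have A0: "0 \<le> A i" if "i \<in> {1..m - 1}" for i unfolding A_def
    by (rule add_nonneg_nonneg[OF parts(1)[OF that] parts(2)[OF that]])
  have A_le: "A i \<le> Cmax" if "i \<in> {1..m - 1}" for i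
    using member_le_sum[OF that A0, of id] Rparts that A0 unfolding Cmax_def R_def
    by (smt (verit) member_le_sum finite_atLeastAtMost Diff_iff)
  have R_le: "R \<le> Cmax" unfolding Cmax_def using sum_nonneg[of "{1..m - 1}" A, OF A0] by linarith
  have N_le: "i + N i * i \<le> Nmax" if "i \<in> {1..m - 1}" for i
    unfolding Nmax_def using member_le_sum[OF that, of "\<lambda>i. i + N i * i"] by simp
  have Cmax0: "0 \<le> Cmax" using R_le Rparts by (simp add: R_def)
  have "level_bound TYPE('d) l p (real m * Cmax) Nmax"
    unfolding level_bound_def
  proof (intro conjI allI impI)
    show "0 \<le> real m * Cmax" using Cmax0 by simp
    fix n and P :: "real \<Rightarrow> real \<Rightarrow> real \<Rightarrow> 'd operator" and Q t
    assume a: "admissible n P Q" and t: "t \<in> grid (step T n l)"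
    have n: "1 \<le> n" by (rule admissibleD(1)[OF a])
    let ?\<delta> = "step T n (Suc l)" and ?u = "t + step T n l"
    let ?D = "one_step_diff ?\<delta> (P ?\<delta>) (Q (Suc l))"
    let ?S = "\<lambda>i f x. \<Sum>ts\<in>time_chains ?\<delta> t ?u i.
      gchain ?\<delta> (Q (Suc l)) ?D (\<lambda>s. Q (Suc l) s ?u) t ts f x
        - gchain ?\<delta> (Q (Suc l)) (Qhat_diff n Q (Suc l) (q_par \<alpha> i l p)) (\<lambda>s. Q (Suc l) s ?u) t ts f x"
    let ?R = "\<lambda>f x. \<Sum>ts\<in>time_chains ?\<delta> t ?u m. gchain ?\<delta> (Q (Suc l)) ?D (\<lambda>s. P ?\<delta> s ?u) t ts f x"
    have pw: "(X * real n ^ j) \<le> Cmax * real n ^ Nmax" if "X \<le> Cmax" "j \<le> Nmax" for X j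
    proof -
      have "X * real n ^ j \<le> Cmax * real n ^ j" using that(1) by (intro mult_right_mono) auto
      also have "\<dots> \<le> Cmax * real n ^ Nmax"
        using that(2) n Cmax0 by (intro mult_left_mono power_increasing) auto
      finally show ?thesis .
    qed
    have S: "order_bounded q (kappa \<alpha> \<beta> l p) (Cmax * real n powr (- real p)) (Cmax * real n ^ Nmax) (?S i)"
      if i: "i \<in> {1..m - 1}" for i
    proof (rule order_bounded_mono[OF chain_sum_order_bounded[OF a t less.prems _ _ CN[OF i]] order_refl])
      show "1 \<le> i" "i \<le> m_par \<alpha> l p - 1" using i by (auto simp: m_def)
      have le: "real i * ((k0 * C' i) ^ i * k0) \<le> Cmax" "2 * ((k0 * C' i) ^ i * k0) \<le> Cmax"
        using A_le[OF i, unfolded A_def] parts(1)[OF i] parts(2)[OF i] by linarith+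
      show "real i * ((k0 * (2 * k0 + \<epsilon>\<^sub>0 + C i)) ^ i * k0) * real n powr (- real p) \<le> Cmax * real n powr (- real p)"
        using le(1) by (intro mult_right_mono) (auto simp: C'_def)
      show "2 * ((k0 * (2 * k0 + \<epsilon>\<^sub>0 + C i)) ^ i * k0) * real n ^ (i + N i * i) \<le> Cmax * real n ^ Nmax"
        using pw[OF le(2) N_le[OF i]] by (simp add: C'_def)
    qed
    have Rb: "order_bounded q (kappa \<alpha> \<beta> l p) (Cmax * real n powr (- real p)) (Cmax * real n ^ Nmax) ?R"
      unfolding m_def
    proof (rule order_bounded_mono[OF remainder_order_bounded[OF a t less.prems] order_refl])
      have le: "(k0 * \<epsilon>\<^sub>0) ^ m * k0 \<le> Cmax" "(k0 * (2 * k0)) ^ m * k0 \<le> Cmax"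
        using R_le[unfolded R_def] Rparts by linarith+
      show "(k0 * \<epsilon>\<^sub>0) ^ m_par \<alpha> l p * k0 * real n powr (- real p) \<le> Cmax * real n powr (- real p)"
        using le(1) by (intro mult_right_mono) (auto simp: m_def)
      have "m \<le> Nmax" by (simp add: Nmax_def)
      from pw[OF le(2) this] show "(k0 * (2 * k0)) ^ m_par \<alpha> l p * k0 * real n ^ m_par \<alpha> l p \<le> Cmax * real n ^ Nmax"
        by (simp add: m_def)
    qed
    have "1 \<le> m" unfolding m_def by (rule m_par_bounds(1)[OF \<alpha> less.prems])
    then have m: "real (card {1..m - 1}) * X + X = real m * X" for X by (simp add: of_nat_diff algebra_simps)
    have "order_bounded q (kappa \<alpha> \<beta> l p) (real m * (Cmax * real n powr (- real p))) (real m * (Cmax * real n ^ Nmax))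
        (\<lambda>f x. (\<Sum>i=1..m - 1. ?S i f x) + ?R f x)"
      unfolding m[symmetric] by (rule order_bounded_add[OF order_bounded_sum[OF finite_atLeastAtMost] Rb]) (rule S)
    then have "order_bounded q (kappa \<alpha> \<beta> l p) (real m * Cmax * real n powr (- real p)) (real m * Cmax * real n ^ Nmax)
        (\<lambda>f x. (\<Sum>i=1..m - 1. ?S i f x) + ?R f x)" by (simp only: mult.assoc)
    then show "order_bounded q (kappa \<alpha> \<beta> l p) (real m * Cmax * real n powr (- real p)) (real m * Cmax * real n ^ Nmax)
        (\<lambda>f x. P (step T n l) t ?u f x - Qhat T n \<alpha> Q l p t f x)"
      by (rule order_bounded_cong) (simp add: Qhat_error_expansion[OF a t less.prems] m_def)
  qed
  then show ?case by blast
qed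

end

section \<open>Long gaps\<close>

text \<open>Pieces of length \<open>w\<close> are cut off from the left, the last piece is what remains; all are at least \<open>\<tau>\<close>
  long.\<close>

lemma discrete_semigroup_split:
  fixes Q :: "real \<Rightarrow> real \<Rightarrow> 'd::finite operator"
  assumes Q: "discrete_semigroup \<delta> Q" and \<delta>: "\<delta> > 0" and s: "s \<in> grid \<delta>" and t: "t \<in> grid \<delta>"
    and w: "0 \<le> w" "w = real j * \<delta>" "\<tau> \<le> w" and gap: "real (Suc p) * w \<le> t - s"
  shows "\<exists>Qs. length Qs = Suc p \<and> (\<forall>A\<in>set Qs. \<exists>s'\<in>grid \<delta>. \<exists>t'\<in>grid \<delta>. \<tau> \<le> t' - s' \<and> A = Q s' t') \<and>
    (\<forall>f\<in>M_b. comp_list Qs f = Q s t f)"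
  using s gap
proof (induction p arbitrary: s)
  case 0
  have "comp_list [Q s t] f = Q s t f" for f by (simp add: comp_list_simps)
  moreover have "\<tau> \<le> t - s" using 0 w by simp
  ultimately show ?case using 0 t by (intro exI[of _ "[Q s t]"]) auto
next
  case (Suc p)
  let ?s = "s + w"
  have s': "?s \<in> grid \<delta>" using grid_add[OF Suc.prems(1)] w(2) by simp
  have gap': "real (Suc p) * w \<le> t - ?s" using Suc.prems(2) by (simp add: algebra_simps)
  obtain Qs where Qs: "length Qs = Suc p" "\<forall>A\<in>set Qs. \<exists>s'\<in>grid \<delta>. \<exists>t'\<in>grid \<delta>. \<tau> \<le> t' - s' \<and> A = Q s' t'"
    "\<forall>f\<in>M_b. comp_list Qs f = Q ?s t f"
    using Suc.IH[OF s' gap'] by blast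
  have "0 \<le> real (Suc p) * w" using w(1) by simp
  then have le: "s \<le> ?s" "?s \<le> t" using gap' w(1) by linarith+
  have "comp_list (Q s ?s # Qs) f = Q s t f" if "f \<in> M_b" for f
    using Qs(3) that discrete_semigroup_comp[OF Q Suc.prems(1) s' t le \<delta> that] by (simp add: comp_list_simps)
  moreover have "\<exists>s'\<in>grid \<delta>. \<exists>t'\<in>grid \<delta>. \<tau> \<le> t' - s' \<and> A = Q s' t'" if "A \<in> set (Q s ?s # Qs)" for A
    using that Qs(2) Suc.prems(1) s' w(3) by (cases "A = Q s ?s") force+
  ultimately show ?case using Qs(1) by (intro exI[of _ "Q s ?s # Qs"]) auto
qed

context approximation_setting
begin

lemma Q_approx_smoothing:
  fixes P :: "real \<Rightarrow> real \<Rightarrow> real \<Rightarrow> 'd::finite operator"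
  assumes a: "admissible n P Q" and l: "1 \<le> l" and \<tau>: "\<tau> > 0"
    and g: "s \<in> grid (step T n l)" "t \<in> grid (step T n l)" "\<tau> \<le> t - s" and \<rho>: "mollifier \<delta> \<rho>"
  defines "X \<equiv> \<tau> powr (- \<eta> (real q))"
  shows "approx_smoothing q (real (card {\<gamma> :: 'd \<Rightarrow> nat. msize \<gamma> \<le> q}) * (k0 * X)) (\<bar>c\<bar> * X / real n)
    (\<lambda>f. Q l s t (conv \<rho> f))"
proof -
  have n: "1 \<le> n" by (rule admissibleD(1)[OF a])
  have st: "s < t" "s \<le> t" using g(3) \<tau> by auto
  obtain Qbar where lin: "linear_on_M_b (Qbar s t)" and reg: "regularization K (step T n l) q \<eta> Qbar"
    and close: "\<And>f. f \<in> M_b \<Longrightarrow> sup_norm (\<lambda>x. Q l s t f x - Qbar s t f x)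
       \<le> c * (t - s) powr (- \<eta> (real q)) * (sup_norm f / real n ^ (\<nu> + m_par \<alpha> 0 \<nu>))"
    using R_barD(3)[OF a l g(1,2)] st(1) by blast
  have \<eta>0: "0 \<le> \<eta> (real q)" by (rule \<eta>) simp
  have pw: "(t - s) powr (- \<eta> (real q)) \<le> X"
    unfolding X_def using \<tau> g(3) \<eta>0 by (intro powr_mono2') auto
  show ?thesis
  proof (rule regularisation_approx_smoothing[OF order_boundedD(1)[OF Q_order_bounded[OF a l g(1,2) st(2)]] lin _ _ _ _ _ \<rho>])
    show "Qbar s t f \<in> C_b_inf" if "f \<in> M_b" for f
      using reg that g(1,2) st(1) unfolding regularization_def by blast
    show "norm_inf r (Qbar s t (mpartial \<gamma> f)) \<le> k0 * X * sup_norm f"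
      if r: "msize \<gamma> + r \<le> q" and f: "f \<in> C_c_inf" for r \<gamma> f
    proof -
      have "norm_inf r (Qbar s t (mpartial \<gamma> f)) \<le> K r / (t - s) powr \<eta> (real q) * sup_norm f"
        using reg r f g(1,2) st(1) unfolding regularization_def by blast
      also have "\<dots> = K r * (t - s) powr (- \<eta> (real q)) * sup_norm f"
        by (simp add: powr_minus divide_inverse)
      also have "\<dots> \<le> k0 * X * sup_norm f"
        using k0(3)[of r] r pw k0(2) M_b_sup_norm_nonneg[OF C_c_inf_subset_M_b[OF f]]
        by (intro mult_right_mono mult_mono) auto
      finally show ?thesis .
    qed
    show "sup_norm (\<lambda>x. Q l s t f x - Qbar s t f x) \<le> \<bar>c\<bar> * X / real n * sup_norm f" if f: "f \<in> M_b" for f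
    proof -
      have "real n ^ 1 \<le> real n ^ (\<nu> + m_par \<alpha> 0 \<nu>)" using n \<nu> by (intro power_increasing) auto
      then have "sup_norm f / real n ^ (\<nu> + m_par \<alpha> 0 \<nu>) \<le> sup_norm f / real n"
        using n M_b_sup_norm_nonneg[OF f] by (intro divide_left_mono) auto
      moreover have "c * (t - s) powr (- \<eta> (real q)) \<le> \<bar>c\<bar> * X" using pw by (intro mult_mono) auto
      ultimately have "c * (t - s) powr (- \<eta> (real q)) * (sup_norm f / real n ^ (\<nu> + m_par \<alpha> 0 \<nu>))
          \<le> \<bar>c\<bar> * X * (sup_norm f / real n)"
        using M_b_sup_norm_nonneg[OF f] by (intro mult_mono[of _ "\<bar>c\<bar> * X"]) (auto simp: X_def)
      with close[OF f] show ?thesis by simp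
    qed
  qed (use k0(2) in \<open>auto simp: X_def\<close>)
qed

text \<open>A gap of length at least \<open>2 (p + 1) \<tau>\<close> is cut into \<open>p + 1\<close> pieces with lengths between \<open>\<tau>\<close> and \<open>2 \<tau>\<close>, apart from the
  last one. The cuts have to be on the grid, which is possible once its step is at most \<open>\<tau>\<close>. Every piece
  contributes a factor \<open>1 / n\<close> to the error, through the distance of \<open>Q\<close> to a regularising operator.\<close>

lemma gap_regularised:
  assumes \<tau>: "\<tau> > 0"
  shows "\<exists>M\<ge>0. \<exists>E\<ge>0. \<forall>n (P :: real \<Rightarrow> real \<Rightarrow> real \<Rightarrow> 'd::finite operator) Q l s t r \<kappa> a A \<Lambda> v g.
    admissible n P Q \<longrightarrow> T / real n \<le> \<tau> \<longrightarrow> 1 \<le> l \<longrightarrow> s \<in> grid (step T n l) \<longrightarrow> t \<in> grid (step T n l) \<longrightarrow>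
    2 * real (Suc p) * \<tau> \<le> t - s \<longrightarrow> r + \<kappa> \<le> q \<longrightarrow> order_functional r a A \<Lambda> \<longrightarrow> weak_bounded \<kappa> v g \<longrightarrow> g \<in> C_b 0 \<longrightarrow>
    \<bar>\<Lambda> (Q l s t g)\<bar> \<le> M * a * v + (E / real n) ^ Suc p * A * sup_norm g"
proof -
  define X where "X = \<tau> powr (- \<eta> (real q))"
  define M0 where "M0 = real (card {\<gamma> :: 'd \<Rightarrow> nat. msize \<gamma> \<le> q}) * (k0 * X)"
  have M0: "0 \<le> M0" using k0(2) by (simp add: M0_def X_def)
  show ?thesis
  proof (rule exI[of _ "smoothing_const M0 k0 (Suc p)"], rule conjI[OF smoothing_const_nonneg[OF M0 k0(2)]],
      rule exI[of _ "\<bar>c\<bar> * X"], intro conjI allI impI)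
    show "0 \<le> \<bar>c\<bar> * X" by (simp add: X_def)
    fix n l r \<kappa> :: nat and P :: "real \<Rightarrow> real \<Rightarrow> real \<Rightarrow> 'd operator" and Q and s t a A v :: real and \<Lambda> :: "'d func \<Rightarrow> real" and g :: "'d func"
    assume ad: "admissible n P Q" and small: "T / real n \<le> \<tau>" and l: "1 \<le> l"
      and g: "s \<in> grid (step T n l)" "t \<in> grid (step T n l)" and gap: "2 * real (Suc p) * \<tau> \<le> t - s"
      and r: "r + \<kappa> \<le> q" and \<Lambda>: "order_functional r a A \<Lambda>" and wb: "weak_bounded \<kappa> v g" "g \<in> C_b 0"
    let ?\<delta> = "step T n l"
    have n: "1 \<le> n" by (rule admissibleD(1)[OF ad])
    have \<delta>: "?\<delta> > 0" by (rule step_pos[OF n])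
    have "real n ^ 1 \<le> real n ^ l" using n l by (intro power_increasing) auto
    then have "?\<delta> \<le> T / real n" unfolding step_def using n T by (intro divide_left_mono) auto
    then have \<delta>\<tau>: "?\<delta> \<le> \<tau>" using small by simp
    \<comment> \<open>The length \<open>w\<close> of a piece is \<open>\<tau>\<close> rounded up to the grid.\<close>
    define j where "j = nat \<lceil>\<tau> / ?\<delta>\<rceil>"
    define w where "w = real j * ?\<delta>"
    have "0 \<le> \<tau> / ?\<delta>" using \<tau> \<delta> by simp
    then have "\<tau> / ?\<delta> \<le> real j" "real j \<le> \<tau> / ?\<delta> + 1" unfolding j_def by linarith+
    then have w: "\<tau> \<le> w" "w \<le> 2 * \<tau>" "0 \<le> w"
      using \<delta> \<delta>\<tau> \<tau> unfolding w_def by (simp_all add: field_simps)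
    have "real (Suc p) * w \<le> real (Suc p) * (2 * \<tau>)" using w(2) by (intro mult_left_mono) auto
    also have "\<dots> = 2 * real (Suc p) * \<tau>" by simp
    also note gap
    finally have "real (Suc p) * w \<le> t - s" .
    from discrete_semigroup_split[OF admissibleD(2)[OF ad] \<delta> g w(3) w_def w(1) this]
    obtain Qs where Qs: "length Qs = Suc p"
      "\<And>A. A \<in> set Qs \<Longrightarrow> \<exists>s'\<in>grid ?\<delta>. \<exists>t'\<in>grid ?\<delta>. \<tau> \<le> t' - s' \<and> A = Q l s' t'"
      "\<And>f. f \<in> M_b \<Longrightarrow> comp_list Qs f = Q l s t f" by blast
    have "\<bar>\<Lambda> (comp_list Qs g)\<bar> \<le> smoothing_const M0 k0 (length Qs) * a * v
        + (\<bar>c\<bar> * X / real n) ^ length Qs * A * sup_norm g"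
    proof (rule comp_list_regularises[OF _ _ r \<Lambda> wb])
      fix A assume "A \<in> set Qs"
      then obtain s' t' where A: "s' \<in> grid ?\<delta>" "t' \<in> grid ?\<delta>" "\<tau> \<le> t' - s'" "A = Q l s' t'" using Qs(2) by blast
      show "order_bounded q 0 k0 k0 A" unfolding A(4) using Q_order_bounded[OF ad l A(1,2)] A(3) \<tau> by simp
      show "approx_smoothing q M0 (\<bar>c\<bar> * X / real n) (\<lambda>f. A (conv \<rho> f))" if "mollifier \<delta> \<rho>" for \<delta> \<rho>
        unfolding A(4) M0_def X_def by (rule Q_approx_smoothing[OF ad l \<tau> A(1-3) that])
    qed
    then show "\<bar>\<Lambda> (Q l s t g)\<bar> \<le> smoothing_const M0 k0 (Suc p) * a * v + (\<bar>c\<bar> * X / real n) ^ Suc p * A * sup_norm g"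
      unfolding Qs(1) Qs(3)[OF weak_boundedD(1)[OF wb(1)]] .
  qed
qed

lemma q_ge_beta: "\<beta> \<le> q"
proof -
  have "1 * \<beta> \<le> m_par \<alpha> 0 \<nu> * \<beta>" by (rule mult_le_mono1[OF m_par_bounds(1)[OF \<alpha> \<nu>]])
  also have "\<dots> \<le> q" unfolding q_def by (rule q_nu_bounds(2)[OF \<alpha> \<nu>])
  finally show ?thesis by simp
qed

text \<open>On functions with \<open>\<beta>\<close> derivatives the first order error on the grid of level \<open>l\<close> consists of a multiple of \<open>n\<^sup>l\<close> terms of
  order \<open>n\<close> to the power \<open>-(1 + \<alpha>) l\<close>, and so tends to zero.\<close>

lemma Q_tendsto_P:
  fixes P :: "real \<Rightarrow> real \<Rightarrow> real \<Rightarrow> 'd::finite operator"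
  assumes a: "admissible n P Q" and n2: "2 \<le> n" and g: "s \<in> grid (step T n 1)" "u \<in> grid (step T n 1)" "s \<le> u"
    and f: "f \<in> C_b \<beta>"
  shows "(\<lambda>l. Q (Suc l) s u f x) \<longlonglongrightarrow> P (step T n 1) s u f x"
proof -
  have n: "1 \<le> n" by (rule admissibleD(1)[OF a])
  have fM: "f \<in> M_b" by (rule C_b_subset_M_b[OF f])
  obtain J :: nat where J: "u = s + real J * step T n 1" using grid_obtain[OF g step_pos[OF n]] .
  define B where "B = real J * (k0 * \<epsilon>\<^sub>0 * k0 * norm_inf \<beta> f)"
  have B0: "0 \<le> B" using k0(2) \<epsilon>\<^sub>0_nonneg norm_inf_nonneg[OF f] by (simp add: B_def)
  have le: "\<bar>Q (Suc l) s u f x - P (step T n 1) s u f x\<bar> \<le> B * (real n powr (- \<alpha>)) ^ Suc l" for l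
  proof -
    let ?l = "Suc l"
    let ?\<delta> = "step T n ?l"
    let ?e = "\<epsilon>\<^sub>0 * real n powr (- ((1 + \<alpha>) * real ?l))"
    let ?D = "one_step_diff ?\<delta> (P ?\<delta>) (Q ?l)" and ?Z = "\<lambda>s. P ?\<delta> s u"
    have \<delta>: "?\<delta> > 0" by (rule step_pos[OF n])
    have g': "s \<in> grid ?\<delta>" "u \<in> grid ?\<delta>" using grid_step_mono[OF n, of 1 ?l] g by auto
    have "step T n 1 = real (n ^ l) * ?\<delta>" using n by (simp add: step_def)
    then have u: "u \<le> s + real (J * n ^ l) * ?\<delta>" using J by simp
    have "P (step T n 1) s u f x = P ?\<delta> s u f x" using P_grid_independent[OF a, of 1 ?l] g fM by simp
    also have "\<dots> = Q ?l s u f x + (\<Sum>ts\<in>time_chains ?\<delta> s u 1. gchain ?\<delta> (Q ?l) ?D ?Z s ts f x)"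
      using duhamel_expansion[OF admissibleD(3)[OF a \<delta>] admissibleD(2)[OF a, of ?l] \<delta> g' g(3) fM, where m = 1]
      by (simp add: time_chains_0)
    finally have "\<bar>Q ?l s u f x - P (step T n 1) s u f x\<bar>
        = \<bar>\<Sum>ts\<in>time_chains ?\<delta> s u 1. gchain ?\<delta> (Q ?l) ?D ?Z s ts f x\<bar>" by simp
    also have "\<dots> \<le> (\<Sum>ts\<in>time_chains ?\<delta> s u 1. \<bar>gchain ?\<delta> (Q ?l) ?D ?Z s ts f x\<bar>)" by (rule sum_abs)
    also have "\<dots> \<le> real (card (time_chains ?\<delta> s u 1)) * (k0 * ?e * k0 * norm_inf \<beta> f)"
    proof (rule sum_bounded_above)
      fix ts assume ts: "ts \<in> time_chains ?\<delta> s u 1"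
      have G: "order_bounded q (1 * \<beta>) ((k0 * ?e) ^ 1 * k0) ((k0 * (2 * k0)) ^ 1 * k0) (gchain ?\<delta> (Q ?l) ?D ?Z s ts)"
      proof (rule order_bounded_gchain[OF \<delta> g'(1) g(3) ts])
        show "order_bounded q 0 k0 k0 (Q ?l s t)" if "s \<in> grid ?\<delta>" "t \<in> grid ?\<delta>" "s \<le> t" for s t
          using Q_order_bounded[OF a _ that] by simp
        show "order_bounded q \<beta> ?e (2 * k0) (?D s)" if "s \<in> grid ?\<delta>" for s
          using one_step_diff_order_bounded[OF a _ that] by simp
        show "order_bounded q 0 k0 k0 (P ?\<delta> s u)" if "s \<in> grid ?\<delta>" "s \<le> u" for s
          by (rule P_order_bounded[OF a \<delta> that(1) g'(2) that(2)])
      qed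
      have "\<bar>gchain ?\<delta> (Q ?l) ?D ?Z s ts f x\<bar> \<le> norm_inf 0 (gchain ?\<delta> (Q ?l) ?D ?Z s ts f)"
        unfolding norm_inf_0 by (rule M_b_abs_le[OF mb_operatorD(1)[OF order_boundedD(1)[OF G] fM]])
      also have "\<dots> \<le> k0 * ?e * k0 * norm_inf \<beta> f"
        using order_boundedD(4)[OF G, of 0 f] q_ge_beta f by simp
      finally show "\<bar>gchain ?\<delta> (Q ?l) ?D ?Z s ts f x\<bar> \<le> k0 * ?e * k0 * norm_inf \<beta> f" .
    qed
    also have "\<dots> \<le> real (J * n ^ ?l) * (k0 * ?e * k0 * norm_inf \<beta> f)"
    proof (rule mult_right_mono)
      have "card (time_chains ?\<delta> s u 1) \<le> (J * n ^ l) ^ 1" by (rule card_time_chains[OF g' g(3) \<delta> u])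
      also have "\<dots> \<le> J * n ^ ?l" using n by simp
      finally show "real (card (time_chains ?\<delta> s u 1)) \<le> real (J * n ^ ?l)" by (simp only: of_nat_le_iff)
      show "0 \<le> k0 * ?e * k0 * norm_inf \<beta> f" using k0(2) \<epsilon>\<^sub>0_nonneg norm_inf_nonneg[OF f] by simp
    qed
    also have "\<dots> = B * (real n ^ ?l * real n powr (- ((1 + \<alpha>) * real ?l)))"
      by (simp add: B_def)
    also have "real n ^ ?l * real n powr (- ((1 + \<alpha>) * real ?l)) = (real n powr (- \<alpha>)) ^ ?l"
    proof -
      have "real n ^ ?l = real n powr real ?l" using n by (intro powr_realpow[symmetric]) simp
      moreover have "real ?l + - ((1 + \<alpha>) * real ?l) = - \<alpha> * real ?l" by (simp add: algebra_simps)
      ultimately show ?thesis unfolding powr_nat_power[OF n] by (simp only: powr_add[symmetric])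
    qed
    finally show ?thesis .
  qed
  have "real n powr (- \<alpha>) < 1" using n2 \<alpha> by (intro powr_less_one) auto
  then have "(\<lambda>l. (real n powr (- \<alpha>)) ^ Suc l) \<longlonglongrightarrow> 0" by (intro LIMSEQ_Suc LIMSEQ_power_zero) simp
  then have "(\<lambda>l. B * (real n powr (- \<alpha>)) ^ Suc l) \<longlonglongrightarrow> B * 0" by (intro tendsto_mult_left)
  then have lim: "(\<lambda>l. B * (real n powr (- \<alpha>)) ^ Suc l) \<longlonglongrightarrow> 0" by simp
  have "(\<lambda>l. Q (Suc l) s u f x - P (step T n 1) s u f x) \<longlonglongrightarrow> 0"
    by (rule Lim_null_comparison[OF _ lim]) (use le in simp)
  then show ?thesis by (rule LIM_zero_cancel)
qed

text \<open>The hypotheses \<open>QR\<close> and \<open>ZR\<close> of \<open>gchain_regularised\<close> on the grid of level one, for the gaps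
  inside a chain and for a last gap that carries \<open>P\<close>.\<close>

definition regularising_gaps :: "real \<Rightarrow> real \<Rightarrow> real \<Rightarrow> nat \<Rightarrow> (real \<Rightarrow> real \<Rightarrow> real \<Rightarrow> 'd::finite operator) \<Rightarrow>
    (nat \<Rightarrow> real \<Rightarrow> real \<Rightarrow> 'd operator) \<Rightarrow> bool" where
  "regularising_gaps \<tau> M E n P Q \<longleftrightarrow> 0 \<le> M \<and> 0 \<le> E \<and>
    (\<forall>s\<in>grid (step T n 1). \<forall>t\<in>grid (step T n 1). \<tau> \<le> t - s \<longrightarrow> (\<forall>r \<kappa> a A \<Lambda> v g. r + \<kappa> \<le> q \<longrightarrow>
      order_functional r a A \<Lambda> \<longrightarrow> weak_bounded \<kappa> v g \<longrightarrow> g \<in> C_b 0 \<longrightarrow>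
      \<bar>\<Lambda> (Q 1 s t g)\<bar> \<le> M * a * v + E * A * sup_norm g)) \<and>
    (\<forall>f\<in>C_c_inf. \<forall>s\<in>grid (step T n 1). \<tau> \<le> T - s \<longrightarrow> (\<forall>r a A \<Lambda>. r \<le> q \<longrightarrow> order_functional r a A \<Lambda> \<longrightarrow>
      \<bar>\<Lambda> (P (step T n 1) s T f)\<bar> \<le> (M * a + E * A) * sup_norm f))"

lemma regularising_gaps_exist:
  assumes \<tau>: "\<tau> > 0"
  shows "\<exists>M\<ge>0. \<exists>E\<ge>0. \<forall>n (P :: real \<Rightarrow> real \<Rightarrow> real \<Rightarrow> 'd::finite operator) Q. admissible n P Q \<longrightarrow> 2 \<le> n \<longrightarrow>
    T / real n \<le> \<tau> / (2 * real (Suc p)) \<longrightarrow> regularising_gaps \<tau> M ((E / real n) ^ Suc p) n P Q"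
proof -
  let ?\<tau> = "\<tau> / (2 * real (Suc p))"
  have "?\<tau> > 0" using \<tau> by simp
  from gap_regularised[OF this, where p = p and 'd = 'd] obtain M E where M: "0 \<le> M" and E: "0 \<le> E"
    and gap: "\<forall>n (P :: real \<Rightarrow> real \<Rightarrow> real \<Rightarrow> 'd operator) Q l s t r \<kappa> a A \<Lambda> v g.
    admissible n P Q \<longrightarrow> T / real n \<le> ?\<tau> \<longrightarrow> 1 \<le> l \<longrightarrow> s \<in> grid (step T n l) \<longrightarrow> t \<in> grid (step T n l) \<longrightarrow>
    2 * real (Suc p) * ?\<tau> \<le> t - s \<longrightarrow> r + \<kappa> \<le> q \<longrightarrow> order_functional r a A \<Lambda> \<longrightarrow> weak_bounded \<kappa> v g \<longrightarrow> g \<in> C_b 0 \<longrightarrow>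
    \<bar>\<Lambda> (Q l s t g)\<bar> \<le> M * a * v + (E / real n) ^ Suc p * A * sup_norm g" by blast
  note gap = gap[rule_format]
  have \<tau>_eq: "2 * real (Suc p) * ?\<tau> = \<tau>" by simp
  have "regularising_gaps \<tau> M ((E / real n) ^ Suc p) n P Q"
    if a: "admissible n P Q" and n2: "2 \<le> n" and small: "T / real n \<le> ?\<tau>"
    for n and P :: "real \<Rightarrow> real \<Rightarrow> real \<Rightarrow> 'd operator" and Q
    unfolding regularising_gaps_def
  proof (intro conjI ballI allI impI)
    let ?\<delta> = "step T n 1"
    have n: "1 \<le> n" using n2 by simp
    show "\<bar>\<Lambda> (Q 1 s t g)\<bar> \<le> M * b * v + (E / real n) ^ Suc p * A * sup_norm g"
      if "s \<in> grid ?\<delta>" "t \<in> grid ?\<delta>" "\<tau> \<le> t - s" "r + \<kappa> \<le> q" "order_functional r b A \<Lambda>" "weak_bounded \<kappa> v g" "g \<in> C_b 0"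
      for s t r \<kappa> b A \<Lambda> v g
      using gap[OF a small order_refl that(1,2) _ that(4-7)] that(3) unfolding \<tau>_eq by simp
    fix f :: "'d func" and s r b A and \<Lambda> :: "'d func \<Rightarrow> real"
    assume f: "f \<in> C_c_inf" and s: "s \<in> grid ?\<delta>" "\<tau> \<le> T - s" and r: "r \<le> q" and \<Lambda>: "order_functional r b A \<Lambda>"
    have fM: "f \<in> M_b" by (rule C_c_inf_subset_M_b[OF f])
    have "T = real n * ?\<delta>" using n by (simp add: step_def)
    then have Tg: "T \<in> grid ?\<delta>" unfolding grid_def by blast
    have sT: "s \<le> T" using s(2) \<tau> by simp
    have gl: "s \<in> grid (step T n (Suc l))" "T \<in> grid (step T n (Suc l))" for l
      using grid_step_mono[OF n, of 1 "Suc l"] s(1) Tg by auto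
    note Qb = order_boundedD(1)[OF Q_order_bounded[OF a _ gl sT], simplified]
    have "(\<lambda>l. \<Lambda> (Q (Suc l) s T f)) \<longlonglongrightarrow> \<Lambda> (P ?\<delta> s T f)"
    proof (rule mb_functional_tendsto[OF order_functionalD(1)[OF \<Lambda>]])
      show "Q (Suc l) s T f \<in> M_b" for l by (rule mb_operatorD(1)[OF Qb fM])
      show "\<bar>Q (Suc l) s T f x\<bar> \<le> k0 * sup_norm f" for l x by (rule mb_operator_abs_le[OF Qb fM])
      show "(\<lambda>l. Q (Suc l) s T f x) \<longlonglongrightarrow> P ?\<delta> s T f x" for x
        by (rule Q_tendsto_P[OF a n2 s(1) Tg sT C_c_inf_subset_C_b[OF f]])
    qed
    moreover have "\<bar>\<Lambda> (Q (Suc l) s T f)\<bar> \<le> M * b * sup_norm f + (E / real n) ^ Suc p * A * sup_norm f" for l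
      using gap[OF a small _ gl _ _ \<Lambda> weak_bounded_sup_norm[OF fM M_b_abs_le[OF fM]] C_c_inf_subset_C_b[OF f]]
        r s(2) unfolding \<tau>_eq by simp
    ultimately have "\<bar>\<Lambda> (P ?\<delta> s T f)\<bar> \<le> M * b * sup_norm f + (E / real n) ^ Suc p * A * sup_norm f"
      by (intro tendsto_upperbound[OF tendsto_rabs]) auto
    then show "\<bar>\<Lambda> (P ?\<delta> s T f)\<bar> \<le> (M * b + (E / real n) ^ Suc p * A) * sup_norm f" by (simp add: algebra_simps)
  qed (use M E in auto)
  then show ?thesis using M E by blast
qed

section \<open>The error bound for smooth functions\<close>

text \<open>The two terms of \<open>gchain_diff_regularised\<close>: the first one has the order \<open>\<nu>\<close> as on smooth functions, and in the
  second one \<open>E\<close> is assumed to compensate for the crude bounds of all factors and the number of chains.\<close>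

lemma chain_sum_gap_bound:
  fixes P :: "real \<Rightarrow> real \<Rightarrow> real \<Rightarrow> 'd::finite operator" and n i :: nat and C :: real
  assumes a: "admissible n P Q" and i: "1 \<le> i" "i \<le> m_par \<alpha> 0 \<nu> - 1"
    and lb: "level_bound TYPE('d) 1 (q_par \<alpha> i 0 \<nu>) C N"
    and gaps: "regularising_gaps \<tau> M E n P Q" and long: "real (i + 1) * \<tau> + real i * (T / real n) \<le> T"
    and F: "E * real n ^ (i + N * i) \<le> F * real n powr (- real \<nu>)" and f: "f \<in> C_c_inf"
  defines "\<delta> \<equiv> step T n 1" and "C' \<equiv> 2 * k0 + \<epsilon>\<^sub>0 + C"
  defines "D \<equiv> one_step_diff \<delta> (P \<delta>) (Q 1)" and "D' \<equiv> Qhat_diff n Q 1 (q_par \<alpha> i 0 \<nu>)"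
    and "Z \<equiv> \<lambda>s. Q 1 s T"
  shows "\<bar>\<Sum>ts\<in>time_chains \<delta> 0 T i. gchain \<delta> (Q 1) D Z 0 ts f x - gchain \<delta> (Q 1) D' Z 0 ts f x\<bar>
    \<le> real i * ((k0 * C') ^ i * k0) * (M + 2 * F) * (sup_norm f * real n powr (- real \<nu>))"
proof -
  have n: "1 \<le> n" by (rule admissibleD(1)[OF a])
  have \<delta>: "\<delta> > 0" "\<delta> = T / real n" unfolding \<delta>_def by (rule step_pos[OF n], simp add: step_def)
  have u: "T = 0 + real n * \<delta>" using n by (simp add: \<delta>)
  have g: "0 \<in> grid \<delta>" "T \<in> grid \<delta>" "0 \<le> T"
    using grid_add[of 0 \<delta> n] zero_mem_grid[of \<delta>] u T by auto
  let ?\<kappa> = "kappa \<alpha> \<beta> 1 (q_par \<alpha> i 0 \<nu>)" and ?L = "(1 + \<alpha>) * real 1"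
  let ?nL = "real n powr (- ?L)" and ?nq = "real n powr (- real (q_par \<alpha> i 0 \<nu>))" and ?nN = "real n ^ N"
  let ?n\<nu> = "real n powr (- real \<nu>)"
  have C: "0 \<le> C" using lb by (simp add: level_bound_def)
  have C': "0 \<le> C'" using C k0(2) \<epsilon>\<^sub>0_nonneg by (simp add: C'_def)
  have ME: "0 \<le> M" "0 \<le> E" using gaps by (simp_all add: regularising_gaps_def)
  have fM: "f \<in> M_b" by (rule C_c_inf_subset_M_b[OF f])
  have f0: "0 \<le> sup_norm f" by (rule M_b_sup_norm_nonneg[OF fM])
  note fb = next_level_diff_bounds[OF a \<nu> i, folded One_nat_def, OF lb, folded \<delta>_def C'_def, folded D_def D'_def]
  have QR: "\<bar>\<Lambda> (Q 1 s t g)\<bar> \<le> M * a * v + E * A * sup_norm g"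
    if "s \<in> grid \<delta>" "t \<in> grid \<delta>" "\<tau> \<le> t - s" "r + \<kappa> \<le> q" "order_functional r a A \<Lambda>" "weak_bounded \<kappa> v g" "g \<in> C_b 0"
    for s t r \<kappa> a A \<Lambda> v g
    using gaps that unfolding regularising_gaps_def \<delta>_def by blast
  have Qb: "order_bounded q 0 k0 k0 (Q 1 s t)" if "s \<in> grid \<delta>" "t \<in> grid \<delta>" "s \<le> t" for s t
    using Q_order_bounded[OF a order_refl, of s t] that by (simp add: \<delta>_def)
  let ?B = "real i * (M * 1 * ((k0 * (C' * ?nL)) ^ (i - 1) * (k0 * (C' * ?nq)) * k0)
    + E * 1 * (2 * ((k0 * (C' * ?nN)) ^ i * k0))) * sup_norm f"
  have G: "\<bar>gchain \<delta> (Q 1) D Z 0 ts f x - gchain \<delta> (Q 1) D' Z 0 ts f x\<bar> \<le> ?B"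
    if ts: "ts \<in> time_chains \<delta> 0 T i" for ts
  proof (rule gchain_diff_regularised[where q = q and \<tau> = \<tau> and \<kappa> = ?\<kappa> and D = D and D' = D' and Z = Z and Q = "Q 1"
        and \<Lambda> = "\<lambda>f. f x" and r = 0, OF \<delta>(1) g(1,3) ts i(1) Qb fb(1) fb(2) fb(3) _ _ _ f k0(1) ME order_functional_eval])
    show "order_bounded q 0 k0 k0 (Z s)" if "s \<in> grid \<delta>" "s \<le> T" for s
      unfolding Z_def by (rule Qb[OF that(1) g(2) that(2)])
    show "\<bar>\<Lambda> (Q 1 s t g)\<bar> \<le> M * a * v + E * A * sup_norm g"
      if "s \<in> grid \<delta>" "t \<in> grid \<delta>" "\<tau> \<le> t - s" "r + \<kappa> \<le> q" "order_functional r a A \<Lambda>" "weak_bounded \<kappa> v g" "g \<in> C_b 0"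
      for s t r \<kappa> a A \<Lambda> v g by (rule QR[OF that])
    show "\<bar>\<Lambda> (Z s f)\<bar> \<le> (M * a + E * A) * sup_norm f"
      if "s \<in> grid \<delta>" "\<tau> \<le> T - s" "r \<le> q" "order_functional r a A \<Lambda>" for s r a A \<Lambda>
      using QR[OF that(1) g(2) that(2) _ that(4) weak_bounded_sup_norm[OF fM M_b_abs_le[OF fM]] C_c_inf_subset_C_b[OF f]]
        that(3) unfolding Z_def by (simp add: algebra_simps)
    show "0 + i * ?\<kappa> \<le> q" using q_nu_bounds(1)[OF \<alpha> \<nu> i(1), of \<beta>] i(2) by (simp add: q_def)
    show "real (i + 1) * \<tau> + real i * \<delta> \<le> T - 0" using long by (simp add: \<delta>)
  qed
  have B0: "0 \<le> ?B" using ME C' k0(2) f0 by simp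
  have card: "real (card (time_chains \<delta> 0 T i)) \<le> real n ^ i"
    using card_time_chains[OF g \<delta>(1), of n i] u by (metis of_nat_le_iff of_nat_power order_refl)
  have "\<bar>\<Sum>ts\<in>time_chains \<delta> 0 T i. gchain \<delta> (Q 1) D Z 0 ts f x - gchain \<delta> (Q 1) D' Z 0 ts f x\<bar>
      \<le> (\<Sum>ts\<in>time_chains \<delta> 0 T i. \<bar>gchain \<delta> (Q 1) D Z 0 ts f x - gchain \<delta> (Q 1) D' Z 0 ts f x\<bar>)" by (rule sum_abs)
  also have "\<dots> \<le> real (card (time_chains \<delta> 0 T i)) * ?B" by (rule sum_bounded_above[OF G])
  also have "\<dots> \<le> real n ^ i * ?B" using card B0 by (rule mult_right_mono)
  also have "\<dots> = real i * ((k0 * C') ^ i * k0) * (M * (real n ^ i * (?nL ^ (i - 1) * ?nq)) + 2 * (E * real n ^ (i + N * i))) * sup_norm f"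
  proof -
    have pw: "real n ^ (i + N * i) = real n ^ i * ?nN ^ i" by (simp add: power_add power_mult)
    show ?thesis unfolding pw using i(1) by (cases i) (simp_all add: power_mult_distrib algebra_simps)
  qed
  also have "\<dots> \<le> real i * ((k0 * C') ^ i * k0) * (M * ?n\<nu> + 2 * (F * ?n\<nu>)) * sup_norm f"
    using C' k0(2) f0 F ME q_par_bounds(1)[OF \<alpha> \<nu> i]
    by (intro mult_right_mono mult_left_mono add_mono powr_chain_exponent[OF n i(1)]) auto
  finally show ?thesis by (simp add: algebra_simps)
qed

lemma remainder_gap_bound:
  fixes P :: "real \<Rightarrow> real \<Rightarrow> real \<Rightarrow> 'd::finite operator" and n :: nat
  defines "m \<equiv> m_par \<alpha> 0 \<nu>"
  assumes a: "admissible n P Q"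
    and gaps: "regularising_gaps \<tau> M E n P Q" and long: "real (m + 1) * \<tau> + real m * (T / real n) \<le> T"
    and F: "E * real n ^ m \<le> F * real n powr (- real \<nu>)" and f: "f \<in> C_c_inf"
  defines "\<delta> \<equiv> step T n 1"
  defines "D \<equiv> one_step_diff \<delta> (P \<delta>) (Q 1)" and "Z \<equiv> \<lambda>s. P \<delta> s T"
  shows "\<bar>\<Sum>ts\<in>time_chains \<delta> 0 T m. gchain \<delta> (Q 1) D Z 0 ts f x\<bar>
    \<le> (M * ((k0 * \<epsilon>\<^sub>0) ^ m * k0) + F * ((k0 * (2 * k0)) ^ m * k0)) * (sup_norm f * real n powr (- real \<nu>))"
proof -
  have n: "1 \<le> n" by (rule admissibleD(1)[OF a])
  have \<delta>: "\<delta> > 0" "\<delta> = T / real n" unfolding \<delta>_def by (rule step_pos[OF n], simp add: step_def)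
  have u: "T = 0 + real n * \<delta>" using n by (simp add: \<delta>)
  have g: "0 \<in> grid \<delta>" "T \<in> grid \<delta>" "0 \<le> T"
    using grid_add[of 0 \<delta> n] zero_mem_grid[of \<delta>] u T by auto
  let ?L = "(1 + \<alpha>) * real 1"
  let ?nL = "real n powr (- ?L)" and ?n\<nu> = "real n powr (- real \<nu>)"
  have ME: "0 \<le> M" "0 \<le> E" using gaps by (simp_all add: regularising_gaps_def)
  have fM: "f \<in> M_b" by (rule C_c_inf_subset_M_b[OF f])
  have f0: "0 \<le> sup_norm f" by (rule M_b_sup_norm_nonneg[OF fM])
  let ?B = "(M * 1 * ((k0 * (\<epsilon>\<^sub>0 * ?nL)) ^ m * k0) + E * 1 * ((k0 * (2 * k0)) ^ m * k0)) * sup_norm f"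
  have G: "\<bar>gchain \<delta> (Q 1) D Z 0 ts f x\<bar> \<le> ?B"
    if ts: "ts \<in> time_chains \<delta> 0 T m" for ts
  proof (rule gchain_regularised[where q = q and \<tau> = \<tau> and \<kappa> = \<beta> and D = D and Z = Z and Q = "Q 1"
        and \<Lambda> = "\<lambda>f. f x" and r = 0, OF \<delta>(1) g(1,3) ts _ _ _ _ _ f k0(1) ME order_functional_eval])
    show "order_bounded q 0 k0 k0 (Q 1 s t)" if "s \<in> grid \<delta>" "t \<in> grid \<delta>" "s \<le> t" for s t
      using Q_order_bounded[OF a order_refl, of s t] that by (simp add: \<delta>_def)
    show "order_bounded q \<beta> (\<epsilon>\<^sub>0 * ?nL) (2 * k0) (D s)" if "s \<in> grid \<delta>" for s
      using one_step_diff_order_bounded[OF a order_refl, of s] that unfolding D_def \<delta>_def by simp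
    show "order_bounded q 0 k0 k0 (Z s)" if "s \<in> grid \<delta>" "s \<le> T" for s
      unfolding Z_def by (rule P_order_bounded[OF a \<delta>(1) that(1) g(2) that(2)])
    show "\<bar>\<Lambda> (Q 1 s t g)\<bar> \<le> M * a * v + E * A * sup_norm g"
      if "s \<in> grid \<delta>" "t \<in> grid \<delta>" "\<tau> \<le> t - s" "r + \<kappa> \<le> q" "order_functional r a A \<Lambda>" "weak_bounded \<kappa> v g" "g \<in> C_b 0"
      for s t r \<kappa> a A \<Lambda> v g
      using gaps that unfolding regularising_gaps_def \<delta>_def by blast
    show "\<bar>\<Lambda> (Z s f)\<bar> \<le> (M * a + E * A) * sup_norm f"
      if "s \<in> grid \<delta>" "\<tau> \<le> T - s" "r \<le> q" "order_functional r a A \<Lambda>" for s r a A \<Lambda>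
      using gaps that f unfolding regularising_gaps_def \<delta>_def Z_def by blast
    show "0 + m * \<beta> \<le> q" using q_nu_bounds(2)[OF \<alpha> \<nu>, of \<beta>] by (simp add: q_def m_def)
    show "real (m + 1) * \<tau> + real m * \<delta> \<le> T - 0" using long by (simp add: \<delta>)
  qed
  have B0: "0 \<le> ?B" using ME \<epsilon>\<^sub>0_nonneg k0(2) f0 by simp
  have card: "real (card (time_chains \<delta> 0 T m)) \<le> real n ^ m"
    using card_time_chains[OF g \<delta>(1), of n m] u by (metis of_nat_le_iff of_nat_power order_refl)
  have "\<bar>\<Sum>ts\<in>time_chains \<delta> 0 T m. gchain \<delta> (Q 1) D Z 0 ts f x\<bar>
      \<le> (\<Sum>ts\<in>time_chains \<delta> 0 T m. \<bar>gchain \<delta> (Q 1) D Z 0 ts f x\<bar>)" by (rule sum_abs)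
  also have "\<dots> \<le> real (card (time_chains \<delta> 0 T m)) * ?B" by (rule sum_bounded_above[OF G])
  also have "\<dots> \<le> real n ^ m * ?B" using card B0 by (rule mult_right_mono)
  also have "\<dots> = (M * ((k0 * \<epsilon>\<^sub>0) ^ m * k0) * (real n ^ m * ?nL ^ m)
      + (k0 * (2 * k0)) ^ m * k0 * (E * real n ^ m)) * sup_norm f"
    by (simp add: power_mult_distrib algebra_simps)
  also have "\<dots> \<le> (M * ((k0 * \<epsilon>\<^sub>0) ^ m * k0) * ?n\<nu> + (k0 * (2 * k0)) ^ m * k0 * (F * ?n\<nu>)) * sup_norm f"
  proof (intro mult_right_mono add_mono mult_left_mono powr_remainder_exponent[OF n] F)
    show "real \<nu> \<le> real m * (?L - 1)" using m_par_bounds(2)[OF \<alpha> \<nu>, of 0] by (simp add: m_def)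
  qed (use ME k0(2) \<epsilon>\<^sub>0_nonneg f0 in auto)
  finally show ?thesis by (simp add: algebra_simps)
qed

end

context approximation_setting
begin

text \<open>Here \<open>n\<close> is so large that the steps of the grid fit into the pieces of the gaps. The number of pieces is chosen
  after the exponents \<open>N\<close>.\<close>

lemma smooth_error_bound_large_n:
  fixes C :: "nat \<Rightarrow> real" and N :: "nat \<Rightarrow> nat"
  defines "m \<equiv> m_par \<alpha> 0 \<nu>"
  assumes lb: "\<And>i. i \<in> {1..m - 1} \<Longrightarrow> level_bound TYPE('d::finite) 1 (q_par \<alpha> i 0 \<nu>) (C i) (N i)"
  shows "\<exists>B\<ge>0. \<exists>n0. \<forall>n (P :: real \<Rightarrow> real \<Rightarrow> real \<Rightarrow> 'd operator) Q f x.
    admissible n P Q \<longrightarrow> n0 \<le> n \<longrightarrow> f \<in> C_c_inf \<longrightarrow>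
    \<bar>P T 0 T f x - Qhat T n \<alpha> Q 0 \<nu> 0 f x\<bar> \<le> B * (sup_norm f * real n powr (- real \<nu>))"
proof -
  have m: "1 \<le> m" unfolding m_def by (rule m_par_bounds(1)[OF \<alpha> \<nu>])
  \<comment> \<open>The \<open>m + 1\<close> gaps take up half of \<open>[0, T]\<close>; the other half is left for at most \<open>m\<close> steps of length \<open>T / n\<close>.\<close>
  define \<tau> where "\<tau> = T / (2 * real (m + 1))"
  \<comment> \<open>Large enough for each of the crude bounds \<open>n\<close> to the power \<open>i + N i * i\<close>, and for that of the remainder, which is \<open>n\<^sup>m\<close>.\<close>
  define p where "p = \<nu> + m + (\<Sum>i=1..m - 1. i + N i * i)"
  have \<tau>: "\<tau> > 0" using T by (simp add: \<tau>_def)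
  obtain M E where M: "0 \<le> M" and E: "0 \<le> E"
    and gaps: "\<forall>n (P :: real \<Rightarrow> real \<Rightarrow> real \<Rightarrow> 'd operator) Q. admissible n P Q \<longrightarrow> 2 \<le> n \<longrightarrow>
      T / real n \<le> \<tau> / (2 * real (Suc p)) \<longrightarrow> regularising_gaps \<tau> M ((E / real n) ^ Suc p) n P Q"
    using regularising_gaps_exist[OF \<tau>, of p, where 'd = 'd] by blast
  define F where "F = E ^ Suc p"
  define B where "B = (\<Sum>i=1..m - 1. real i * ((k0 * (2 * k0 + \<epsilon>\<^sub>0 + C i)) ^ i * k0) * (M + 2 * F))
    + (M * ((k0 * \<epsilon>\<^sub>0) ^ m * k0) + F * ((k0 * (2 * k0)) ^ m * k0))"
  define n0 where "n0 = max 2 (max (2 * m) (nat \<lceil>2 * real (Suc p) * T / \<tau>\<rceil>))"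
  have F0: "0 \<le> F" using E by (simp add: F_def)
  have "0 \<le> real i * ((k0 * (2 * k0 + \<epsilon>\<^sub>0 + C i)) ^ i * k0) * (M + 2 * F)" if "i \<in> {1..m - 1}" for i
    using lb[OF that] M F0 k0(2) \<epsilon>\<^sub>0_nonneg by (simp add: level_bound_def)
  then have B0: "0 \<le> B" unfolding B_def using M F0 k0(2) \<epsilon>\<^sub>0_nonneg by (intro add_nonneg_nonneg sum_nonneg) auto
  have "\<bar>P T 0 T f x - Qhat T n \<alpha> Q 0 \<nu> 0 f x\<bar> \<le> B * (sup_norm f * real n powr (- real \<nu>))"
    if a: "admissible n P Q" and nn: "n0 \<le> n" and f: "f \<in> C_c_inf"
    for n and P :: "real \<Rightarrow> real \<Rightarrow> real \<Rightarrow> 'd operator" and Q f x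
  proof -
    have n: "1 \<le> n" "2 \<le> n" "2 * m \<le> n" "nat \<lceil>2 * real (Suc p) * T / \<tau>\<rceil> \<le> n"
      using nn by (auto simp: n0_def)
    have "2 * real (Suc p) * T / \<tau> \<le> real n" using n(4) by linarith
    then have "T / real n \<le> \<tau> / (2 * real (Suc p))" using n(1) \<tau> by (simp add: field_simps)
    then have gap: "regularising_gaps \<tau> M ((E / real n) ^ Suc p) n P Q" using gaps a n(2) by blast
    have half: "real (m + 1) * \<tau> = T / 2" by (simp add: \<tau>_def field_simps)
    have long: "real (i + 1) * \<tau> + real i * (T / real n) \<le> T" if "i \<le> m" for i
    proof -
      have "real (i + 1) * \<tau> \<le> real (m + 1) * \<tau>" using that \<tau> by (intro mult_right_mono) auto
      moreover have "real i * (T / real n) \<le> real m * (T / real n)"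
        using that T n(1) by (intro mult_right_mono) auto
      moreover have "real m * (T / real n) \<le> T / 2"
      proof -
        have "2 * real m \<le> real n" using n(3) by linarith
        then have "2 * real m * T \<le> real n * T" using T by (intro mult_right_mono) auto
        then show ?thesis using n(1) by (simp add: field_simps)
      qed
      ultimately show ?thesis using half by linarith
    qed
    have small: "(E / real n) ^ Suc p * real n ^ j \<le> F * real n powr (- real \<nu>)" if "\<nu> + j \<le> Suc p" for j
    proof -
      have "real n ^ j * real n ^ \<nu> \<le> real n ^ Suc p"
        unfolding power_add[symmetric] using that n(1) by (intro power_increasing) auto
      then have "real n ^ j / real n ^ Suc p \<le> 1 / real n ^ \<nu>" using n(1) by (simp add: field_simps)
      then have "F * (real n ^ j / real n ^ Suc p) \<le> F * (1 / real n ^ \<nu>)" using F0 by (rule mult_left_mono)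
      moreover have "(E / real n) ^ Suc p * real n ^ j = F * (real n ^ j / real n ^ Suc p)"
        unfolding F_def power_divide by (simp only: times_divide_eq_left times_divide_eq_right)
      moreover have "1 / real n ^ \<nu> = real n powr (- real \<nu>)"
        using n(1) by (simp add: powr_minus powr_realpow divide_inverse)
      ultimately show ?thesis by simp
    qed
    let ?\<delta> = "step T n 1" and ?X = "sup_norm f * real n powr (- real \<nu>)"
    let ?D = "one_step_diff ?\<delta> (P ?\<delta>) (Q 1)"
    define S where "S i = (\<Sum>ts\<in>time_chains ?\<delta> 0 T i. gchain ?\<delta> (Q 1) ?D (\<lambda>s. Q 1 s T) 0 ts f x
        - gchain ?\<delta> (Q 1) (Qhat_diff n Q 1 (q_par \<alpha> i 0 \<nu>)) (\<lambda>s. Q 1 s T) 0 ts f x)" for i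
    define R where "R = (\<Sum>ts\<in>time_chains ?\<delta> 0 T m. gchain ?\<delta> (Q 1) ?D (\<lambda>s. P ?\<delta> s T) 0 ts f x)"
    let ?c = "\<lambda>i. real i * ((k0 * (2 * k0 + \<epsilon>\<^sub>0 + C i)) ^ i * k0) * (M + 2 * F)"
    let ?d = "M * ((k0 * \<epsilon>\<^sub>0) ^ m * k0) + F * ((k0 * (2 * k0)) ^ m * k0)"
    have S: "\<bar>S i\<bar> \<le> ?c i * ?X" if i: "i \<in> {1..m - 1}" for i
      unfolding S_def
    proof (rule chain_sum_gap_bound[OF a _ _ lb[OF i] gap _ _ f])
      show "1 \<le> i" "i \<le> m_par \<alpha> 0 \<nu> - 1" using i by (auto simp: m_def)
      show "real (i + 1) * \<tau> + real i * (T / real n) \<le> T" using i by (intro long) auto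
      have "i + N i * i \<le> (\<Sum>i=1..m - 1. i + N i * i)" using member_le_sum[OF i, of "\<lambda>i. i + N i * i"] by simp
      then show "(E / real n) ^ Suc p * real n ^ (i + N i * i) \<le> F * real n powr (- real \<nu>)"
        by (intro small) (simp add: p_def)
    qed
    have R: "\<bar>R\<bar> \<le> ?d * ?X"
      unfolding R_def m_def
      by (rule remainder_gap_bound[OF a gap _ _ f]) (rule long small, simp add: m_def p_def)+
    from Qhat_error_expansion[OF a zero_mem_grid[of "step T n 0"] \<nu> C_c_inf_subset_M_b[OF f], of x]
    have "P T 0 T f x - Qhat T n \<alpha> Q 0 \<nu> 0 f x = (\<Sum>i=1..m - 1. S i) + R"
      unfolding S_def R_def by (simp add: step_def m_def)
    moreover have "\<bar>\<Sum>i=1..m - 1. S i\<bar> \<le> (\<Sum>i=1..m - 1. \<bar>S i\<bar>)" by (rule sum_abs)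
    moreover have "(\<Sum>i=1..m - 1. \<bar>S i\<bar>) \<le> (\<Sum>i=1..m - 1. ?c i * ?X)" by (rule sum_mono[OF S])
    moreover have "B * ?X = (\<Sum>i=1..m - 1. ?c i * ?X) + ?d * ?X"
      unfolding B_def by (simp only: sum_distrib_right distrib_right)
    ultimately show ?thesis using R by linarith
  qed
  then show ?thesis using B0 by blast
qed

lemma error_bound:
  "\<exists>B\<ge>0. \<forall>n (P :: real \<Rightarrow> real \<Rightarrow> real \<Rightarrow> 'd::finite operator) Q f x. admissible n P Q \<longrightarrow> f \<in> M_b \<longrightarrow>
    \<bar>P T 0 T f x - Qhat T n \<alpha> Q 0 \<nu> 0 f x\<bar> \<le> B * real n powr (- real \<nu>) * sup_norm f"
proof -
  have "\<forall>i. \<exists>C N. i \<in> {1..m_par \<alpha> 0 \<nu> - 1} \<longrightarrow> level_bound TYPE('d) 1 (q_par \<alpha> i 0 \<nu>) C N"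
  proof
    fix i
    show "\<exists>C N. i \<in> {1..m_par \<alpha> 0 \<nu> - 1} \<longrightarrow> level_bound TYPE('d) 1 (q_par \<alpha> i 0 \<nu>) C N"
      using level_bound_exists[OF q_par_bounds(3)[OF \<alpha> \<nu>, of i 0], of 1, where 'd = 'd] by auto
  qed
  then obtain C N where "\<And>i. i \<in> {1..m_par \<alpha> 0 \<nu> - 1} \<Longrightarrow> level_bound TYPE('d) 1 (q_par \<alpha> i 0 \<nu>) (C i) (N i)" by metis
  from smooth_error_bound_large_n[of C N, OF this] obtain B n0 where B: "0 \<le> B"
    and large: "\<forall>n (P :: real \<Rightarrow> real \<Rightarrow> real \<Rightarrow> 'd operator) Q f x. admissible n P Q \<longrightarrow> n0 \<le> n \<longrightarrow> f \<in> C_c_inf \<longrightarrow>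
      \<bar>P T 0 T f x - Qhat T n \<alpha> Q 0 \<nu> 0 f x\<bar> \<le> B * (sup_norm f * real n powr (- real \<nu>))" by blast
  obtain C0 N0 where crude: "level_bound TYPE('d) 0 \<nu> C0 N0" using level_bound_exists[OF \<nu>] by blast
  have C0: "0 \<le> C0" using crude by (simp add: level_bound_def)
  \<comment> \<open>For \<open>n < n0\<close> the crude bound \<open>C0 n\<^sup>N\<^sup>0\<close> is at most a constant times \<open>1 / n\<^sup>\<nu>\<close>.\<close>
  define B' where "B' = B + C0 * real n0 ^ (N0 + \<nu>)"
  have B': "0 \<le> B'" "B \<le> B'" "C0 * real n0 ^ (N0 + \<nu>) \<le> B'" using B C0 by (auto simp: B'_def)
  have "\<bar>P T 0 T f x - Qhat T n \<alpha> Q 0 \<nu> 0 f x\<bar> \<le> B' * real n powr (- real \<nu>) * sup_norm f"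
    if a: "admissible n P Q" and f: "f \<in> M_b" for n and P :: "real \<Rightarrow> real \<Rightarrow> real \<Rightarrow> 'd operator" and Q f x
  proof -
    have n: "1 \<le> n" by (rule admissibleD(1)[OF a])
    let ?A = "\<lambda>f x. P T 0 T f x - Qhat T n \<alpha> Q 0 \<nu> 0 f x"
    have T0: "step T n 0 = T" by (simp add: step_def)
    have "order_bounded q (kappa \<alpha> \<beta> 0 \<nu>) (C0 * real n powr (- real \<nu>)) (C0 * real n ^ N0)
        (\<lambda>f x. P (step T n 0) 0 (0 + step T n 0) f x - Qhat T n \<alpha> Q 0 \<nu> 0 f x)"
      using crude a zero_mem_grid unfolding level_bound_def by blast
    then have "order_bounded q (kappa \<alpha> \<beta> 0 \<nu>) (C0 * real n powr (- real \<nu>)) (C0 * real n ^ N0) ?A" by (simp add: T0)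
    note A = order_boundedD(1)[OF this]
    show ?thesis
    proof (rule mb_functional_bound_extend_smooth[OF mb_operatorD(3)[OF A] _ f])
      fix g :: "'d func" assume g: "g \<in> C_c_inf"
      have g0: "0 \<le> sup_norm g" by (rule M_b_sup_norm_nonneg[OF C_c_inf_subset_M_b[OF g]])
      show "\<bar>?A g x\<bar> \<le> B' * real n powr (- real \<nu>) * sup_norm g"
      proof (cases "n0 \<le> n")
        case True
        then have "\<bar>?A g x\<bar> \<le> B * (sup_norm g * real n powr (- real \<nu>))" using large a g by blast
        also have "\<dots> \<le> B' * (sup_norm g * real n powr (- real \<nu>))" using B'(2) g0 by (intro mult_right_mono) auto
        finally show ?thesis by (simp add: ac_simps)
      next
        case False
        have "real n ^ N0 = real n ^ (N0 + \<nu>) * real n powr (- real \<nu>)"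
          using n by (simp add: powr_minus powr_realpow power_add)
        also have "\<dots> \<le> real n0 ^ (N0 + \<nu>) * real n powr (- real \<nu>)"
          using False by (intro mult_right_mono power_mono) auto
        finally have "C0 * real n ^ N0 \<le> C0 * (real n0 ^ (N0 + \<nu>) * real n powr (- real \<nu>))"
          using C0 by (rule mult_left_mono)
        also have "\<dots> \<le> B' * real n powr (- real \<nu>)"
          using mult_right_mono[OF B'(3), of "real n powr (- real \<nu>)"] by (simp add: mult.assoc)
        finally have le: "C0 * real n ^ N0 \<le> B' * real n powr (- real \<nu>)" .
        show ?thesis by (rule order_trans[OF mb_operator_abs_le[OF A C_c_inf_subset_M_b[OF g]] mult_right_mono[OF le g0]])
      qed
    qed (use B' in simp)
  qed
  then show ?thesis using B' by blast
qed

end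

text \<open>The horizon \<open>T\<close> itself is one of the times over which the infimum is taken, so that the powers of
  \<open>T(\<nu>)\<close> in the conclusion can be bounded by powers of \<open>T\<close>.\<close>

lemma T_nu_bounds:
  assumes T: "T > 0" and n: "n \<ge> 1" and nz: "T_nu T n \<alpha> \<nu> \<noteq> 0"
  shows "0 < T_nu T n \<alpha> \<nu>" "T_nu T n \<alpha> \<nu> \<le> T"
proof -
  let ?m = "real (m_par \<alpha> 0 \<nu>)"
  let ?S = "{t \<in> grid (step T n 1). t \<ge> T * (real n - ?m) / (real n * (?m + 1))}"
  have "T = real n * step T n 1" using n by (simp add: step_def)
  then have "T \<in> grid (step T n 1)" unfolding grid_def by blast
  moreover have "T * (real n - ?m) / (real n * (?m + 1)) \<le> T"
  proof -
    have "real n - ?m \<le> real n * (?m + 1)" using n by (simp add: algebra_simps)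
    then have "T * (real n - ?m) \<le> T * (real n * (?m + 1))" using T by (intro mult_left_mono) auto
    then show ?thesis using n by (subst pos_divide_le_eq) auto
  qed
  ultimately have mem: "T \<in> ?S" by simp
  have pos: "0 \<le> t" if "t \<in> ?S" for t using that T n by (auto simp: grid_def step_def)
  then have "bdd_below ?S" by (rule bdd_belowI)
  with mem show "T_nu T n \<alpha> \<nu> \<le> T" unfolding T_nu_def by (rule cInf_lower)
  have "0 \<le> T_nu T n \<alpha> \<nu>" unfolding T_nu_def using mem pos by (intro cInf_greatest) auto
  then show "0 < T_nu T n \<alpha> \<nu>" using nz by simp
qed

theorem theorem1p2:
  fixes T \<alpha> c :: real and \<nu> \<beta> :: nat and \<eta> :: "real \<Rightarrow> real" and K :: "nat \<Rightarrow> real"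
  assumes "T > 0" and "\<nu> \<ge> 1" and "\<alpha> > 0"
    and "mono_on {0..} \<eta>" and "\<forall>x\<ge>0. \<eta> x \<ge> 0"
  shows "\<exists>C. \<forall>n\<ge>1. \<forall>(P :: real \<Rightarrow> real \<Rightarrow> real \<Rightarrow> 'd::finite operator)
      (Q :: nat \<Rightarrow> real \<Rightarrow> real \<Rightarrow> 'd operator).
    (\<forall>\<delta>>0. discrete_semigroup \<delta> (P \<delta>)) \<longrightarrow>
    grid_independent P \<longrightarrow>
    (\<forall>l. discrete_semigroup (step T n l) (Q l)) \<longrightarrow>
    propagates_regularity K P \<longrightarrow>
    dually_propagates_regularity K P \<longrightarrow>
    R_bar K c T n \<nu> \<eta> \<alpha> \<beta> Q \<longrightarrow>
    (\<forall>k\<ge>1. short_time_estimate K (step T n k) \<alpha> \<beta> (P (step T n k)) (Q k) \<and>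
            dual_short_time_estimate K (step T n k) \<alpha> \<beta> (P (step T n k)) (Q k)) \<longrightarrow>
    (\<forall>f\<in>M_b. T_nu T n \<alpha> \<nu> \<noteq> 0 \<longrightarrow>
       sup_norm (\<lambda>x. P T 0 T f x - Qhat T n \<alpha> Q 0 \<nu> 0 f x)
         \<le> C / T_nu T n \<alpha> \<nu> powr \<eta> (real (q_nu \<alpha> \<beta> \<nu>)) * sup_norm f * (1 / real n ^ \<nu>))"
proof -
  interpret approximation_setting T \<alpha> c \<nu> \<beta> \<eta> K by unfold_locales (use assms in auto)
  obtain B where B: "0 \<le> B" and err: "\<forall>n (P :: real \<Rightarrow> real \<Rightarrow> real \<Rightarrow> 'd operator) Q f x. admissible n P Q \<longrightarrow> f \<in> M_b \<longrightarrow>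
    \<bar>P T 0 T f x - Qhat T n \<alpha> Q 0 \<nu> 0 f x\<bar> \<le> B * real n powr (- real \<nu>) * sup_norm f"
    using error_bound[where 'd = 'd] by blast
  let ?h = "\<eta> (real (q_nu \<alpha> \<beta> \<nu>))"
  show ?thesis
  proof (rule exI[of _ "B * T powr ?h"], intro allI impI ballI)
    fix n and P :: "real \<Rightarrow> real \<Rightarrow> real \<Rightarrow> 'd operator" and Q and f :: "'d func"
    assume "1 \<le> n" "\<forall>\<delta>>0. discrete_semigroup \<delta> (P \<delta>)" "grid_independent P"
      "\<forall>l. discrete_semigroup (step T n l) (Q l)" "propagates_regularity K P" "dually_propagates_regularity K P"
      "R_bar K c T n \<nu> \<eta> \<alpha> \<beta> Q"
      "\<forall>k\<ge>1. short_time_estimate K (step T n k) \<alpha> \<beta> (P (step T n k)) (Q k) \<and>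
            dual_short_time_estimate K (step T n k) \<alpha> \<beta> (P (step T n k)) (Q k)"
    then have a: "admissible n P Q" and n: "1 \<le> n" unfolding admissible_def by auto
    assume f: "f \<in> M_b" and nz: "T_nu T n \<alpha> \<nu> \<noteq> 0"
    note Tn = T_nu_bounds[OF assms(1) n nz]
    have f0: "0 \<le> sup_norm f" by (rule M_b_sup_norm_nonneg[OF f])
    have "T_nu T n \<alpha> \<nu> powr ?h \<le> T powr ?h" using Tn assms(5) by (intro powr_mono2) auto
    then have one: "1 \<le> T powr ?h / T_nu T n \<alpha> \<nu> powr ?h" using Tn by (simp add: le_divide_eq)
    have "sup_norm (\<lambda>x. P T 0 T f x - Qhat T n \<alpha> Q 0 \<nu> 0 f x) \<le> B * real n powr (- real \<nu>) * sup_norm f"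
      using err a f by (intro sup_norm_le) blast
    also have "\<dots> = B * sup_norm f * (1 / real n ^ \<nu>) * 1" using n by (simp add: powr_minus powr_realpow divide_inverse)
    also have "\<dots> \<le> B * sup_norm f * (1 / real n ^ \<nu>) * (T powr ?h / T_nu T n \<alpha> \<nu> powr ?h)"
      using one B f0 by (intro mult_left_mono) auto
    finally show "sup_norm (\<lambda>x. P T 0 T f x - Qhat T n \<alpha> Q 0 \<nu> 0 f x)
         \<le> B * T powr ?h / T_nu T n \<alpha> \<nu> powr ?h * sup_norm f * (1 / real n ^ \<nu>)" by (simp add: ac_simps)
  qed
qed

end
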